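(* Let $(X,d)$ be a geodesic metric space with basepoint $o$, let $G$ be a countable group of isometries of $X$, and let $g\in G$ be a WPD contracting isometry. Let $\mu$ be a probability measure on $G$ such that $\mu^{*n}(g^m)>0$ for some $n,m>0$, and let $\{\mu_i\}_{i>0}$ be a sequence of probability measures on $G$ that converges simply to $\mu$ (i.e. $\mu_i(x)\to\mu(x)$ for every $x\in G$) with $H(\mu_i)\to H(\mu)$. Then $h(\mu_i)\to h(\mu)$.
   Context: A $K$-quasigeodesic $\gamma$ is a $K$-contracting axis if the closest-point projection onto $\gamma$ of every geodesic not entering the $K$-neighborhood of $\gamma$ has diameter $<K$; an isometry $g$ is contracting if $\{g^io\}_{i\in\mathbb Z}$ is a $K$-contracting axis for some $K$. A contracting isometry $g\in G$ is WPD if for each $K\ge0$ there exists $N>0$ such that $\{h\in G: d(o,ho)\le K,\ d(g^No,hg^No)\le K\}$ is finite. The time-one entropy is $H(\mu)=-\sum_{x\in G}\mu(x)\log\mu(x)$ and the asymptotic entropy is $h(\mu)=\lim_{n\to\infty}H(\mu^{*n})/n$. *)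

theory Defs
  imports "HOL-Analysis.Analysis"
begin

definition geodesic_space :: "'x::metric_space itself \<Rightarrow> bool" where
  "geodesic_space _ \<longleftrightarrow> (\<forall>x y::'x. \<exists>c::real \<Rightarrow> 'x. c 0 = x \<and> c (dist x y) = y \<and>
      (\<forall>s\<in>{0..dist x y}. \<forall>t\<in>{0..dist x y}. dist (c s) (c t) = \<bar>s - t\<bar>))"

definition isometry :: "('x::metric_space \<Rightarrow> 'x) \<Rightarrow> bool" where
  "isometry f \<longleftrightarrow> bij f \<and> (\<forall>x y. dist (f x) (f y) = dist x y)"

definition isometry_group :: "('x::metric_space \<Rightarrow> 'x) set \<Rightarrow> bool" where
  "isometry_group G \<longleftrightarrow> (\<forall>f\<in>G. isometry f) \<and> id \<in> G \<and>
      (\<forall>f\<in>G. \<forall>h\<in>G. f \<circ> h \<in> G) \<and> (\<forall>f\<in>G. inv f \<in> G)"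

definition ipow :: "('x \<Rightarrow> 'x) \<Rightarrow> int \<Rightarrow> ('x \<Rightarrow> 'x)" where
  "ipow g i = (if 0 \<le> i then g ^^ nat i else (inv g) ^^ nat (- i))"

definition quasigeodesic :: "real \<Rightarrow> (int \<Rightarrow> 'x::metric_space) \<Rightarrow> bool" where
  "quasigeodesic K \<gamma> \<longleftrightarrow> (\<forall>i j. \<bar>real_of_int (i - j)\<bar> / K - K \<le> dist (\<gamma> i) (\<gamma> j)
      \<and> dist (\<gamma> i) (\<gamma> j) \<le> K * \<bar>real_of_int (i - j)\<bar> + K)"

definition proj :: "'x::metric_space set \<Rightarrow> 'x \<Rightarrow> 'x set" where
  "proj A x = {p \<in> A. dist x p = infdist x A}"

definition geodesic_segment :: "'x::metric_space set \<Rightarrow> bool" where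
  "geodesic_segment S \<longleftrightarrow> (\<exists>(c::real \<Rightarrow> 'x) a b. a \<le> b \<and> S = c ` {a..b} \<and>
      (\<forall>s\<in>{a..b}. \<forall>t\<in>{a..b}. dist (c s) (c t) = \<bar>s - t\<bar>))"

definition contracting_axis :: "real \<Rightarrow> (int \<Rightarrow> 'x::metric_space) \<Rightarrow> bool" where
  "contracting_axis K \<gamma> \<longleftrightarrow> quasigeodesic K \<gamma> \<and>
     (\<forall>S. geodesic_segment S \<and> (\<forall>x\<in>S. infdist x (range \<gamma>) > K) \<longrightarrow>
        (let P = (\<Union>x\<in>S. proj (range \<gamma>) x) in bounded P \<and> diameter P < K))"

definition contracting :: "'x::metric_space \<Rightarrow> ('x \<Rightarrow> 'x) \<Rightarrow> bool" where
  "contracting b g \<longleftrightarrow> (\<exists>K. contracting_axis K (\<lambda>i. ipow g i b))"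

definition WPD :: "('x::metric_space \<Rightarrow> 'x) set \<Rightarrow> 'x \<Rightarrow> ('x \<Rightarrow> 'x) \<Rightarrow> bool" where
  "WPD G b g \<longleftrightarrow> (\<forall>K\<ge>0. \<exists>N>0. finite {h\<in>G. dist b (h b) \<le> K \<and>
       dist ((g ^^ N) b) (h ((g ^^ N) b)) \<le> K})"

definition prob_on :: "('x \<Rightarrow> 'x) set \<Rightarrow> (('x \<Rightarrow> 'x) \<Rightarrow> real) \<Rightarrow> bool" where
  "prob_on G \<mu> \<longleftrightarrow> (\<forall>x\<in>G. 0 \<le> \<mu> x) \<and> (\<mu> has_sum 1) G"

definition conv :: "('x \<Rightarrow> 'x) set \<Rightarrow> (('x \<Rightarrow> 'x) \<Rightarrow> real) \<Rightarrow> (('x \<Rightarrow> 'x) \<Rightarrow> real)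
     \<Rightarrow> (('x \<Rightarrow> 'x) \<Rightarrow> real)" where
  "conv G \<mu> \<nu> = (\<lambda>x. \<Sum>\<^sub>\<infinity>y\<in>G. \<mu> y * \<nu> (inv y \<circ> x))"

fun conv_pow :: "('x \<Rightarrow> 'x) set \<Rightarrow> (('x \<Rightarrow> 'x) \<Rightarrow> real) \<Rightarrow> nat \<Rightarrow> (('x \<Rightarrow> 'x) \<Rightarrow> real)" where
  "conv_pow G \<mu> 0 = (\<lambda>x. if x = id then 1 else 0)"
| "conv_pow G \<mu> (Suc n) = conv G (conv_pow G \<mu> n) \<mu>"

definition finite_entropy :: "('x \<Rightarrow> 'x) set \<Rightarrow> (('x \<Rightarrow> 'x) \<Rightarrow> real) \<Rightarrow> bool" where
  "finite_entropy G \<mu> \<longleftrightarrow> (\<lambda>x. - \<mu> x * ln (\<mu> x)) summable_on G"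

definition entropy :: "('x \<Rightarrow> 'x) set \<Rightarrow> (('x \<Rightarrow> 'x) \<Rightarrow> real) \<Rightarrow> real" where
  "entropy G \<mu> = (\<Sum>\<^sub>\<infinity>x\<in>G. - \<mu> x * ln (\<mu> x))"

definition asymp_entropy :: "('x \<Rightarrow> 'x) set \<Rightarrow> (('x \<Rightarrow> 'x) \<Rightarrow> real) \<Rightarrow> real" where
  "asymp_entropy G \<mu> = lim (\<lambda>n. entropy G (conv_pow G \<mu> n) / real n)"

end

theory Submission
  imports Defs "HOL-Probability.Probability"
begin

text \<open>
Upper semicontinuity of $h$ is automatic, since $h(\mu) = \inf_n H(\mu^{*n})/n$ and each
$H(\mu^{*n})$ is continuous along the given sequence. For the lower bound let $E$ be the set of
elements of $G$ that commensurate $\langle g \rangle$.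

If $\mu$ is supported on $E$, then, as $\langle g \rangle$ has finite index in $E$ by WPD, the position
of the walk is determined by an integer of at most linear size, up to an error of small entropy rate, so
$h(\mu) = 0$.

Otherwise pick $x \notin E$ in the support of $\mu$. After passing to a convolution power, $\mu$ charges
Schottky elements $s_j = g^{l_j} x g^{r_j} x g^{e_j}$, whose orbit segments align with each other except
for few values of $j$. Splitting off from every $\mu_i$ the same multiple $\alpha$ of the uniform law on
$\{s_j\}$ and pivoting at these steps, one sees that with probability close to one, uniformly in $i$ and
$n$, the trajectory has a persistent pivot near time $N$. Given the endpoint at time $n$,
such a pivot together with few extra data of entropy $\le \epsilon N$ determines the position at time $N$:
by WPD only boundedly many group elements are compatible with its location on a geodesic to the endpoint. Hence
$H(\mu_i^{*N}) + H(\mu_i^{*(n-N)}) \le H(\mu_i^{*n}) + \epsilon N$, so that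
$h(\mu_i) \ge H(\mu_i^{*N})/N - \epsilon$ with $N$ independent of $i$, and the right-hand side
converges.
\<close>

section \<open>Isometries and geodesic segments\<close>

text \<open>No moment is assumed: under finite entropy alone the displacement of a step may have
  infinite mean, so the distance from the basepoint to a pivot cannot be treated as an integer of
  linear size. The remedy is to record in full only the letters in gaps between pivots that are long
  or contain an atypical letter. Such gaps are rare, and a rare event costs little entropy as soon
  as the tail of the entropy is small, which holds uniformly along the sequence because the
  entropies converge. The remaining gaps add a length linear in the time, hence an integer of
  logarithmic entropy. The space need not be hyperbolic. The geometric inputs are contraction along
  translates of one axis and its consequence, Behrstock's inequality, so alignment is tested by
  projections to such translates. A test excludes at most three indices; with 102 Schottky elements
  at least 96 indices are available at each test, so it succeeds with probability at least 31/32,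
  enough for a potential on the stack to contract. The contraction rate depends on
  \<open>\<alpha>\<close> only, hence on the limit law and not on the member of the
  sequence.\<close>

definition geod :: "(real \<Rightarrow> 'x::metric_space) \<Rightarrow> real \<Rightarrow> bool" where
  "geod c D \<longleftrightarrow> 0 \<le> D \<and> (\<forall>s\<in>{0..D}. \<forall>t\<in>{0..D}. dist (c s) (c t) = \<bar>s - t\<bar>)"

lemma geod_dist: "geod c D \<Longrightarrow> 0 \<le> s \<Longrightarrow> s \<le> D \<Longrightarrow> 0 \<le> t \<Longrightarrow> t \<le> D \<Longrightarrow> dist (c s) (c t) = \<bar>s - t\<bar>"
  by (auto simp: geod_def)

lemma geod_reverse: "geod c D \<Longrightarrow> geod (\<lambda>t. c (D - t)) D"
  by (auto simp: geod_def)

lemma geod_exists: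
  assumes "geodesic_space TYPE('x::metric_space)"
  obtains c where "c 0 = (x::'x)" "c (dist x y) = y" "geod c (dist x y)"
  using assms unfolding geodesic_space_def geod_def by (metis zero_le_dist)

lemma geod_isometry: "isometry f \<Longrightarrow> geod c D \<Longrightarrow> geod (\<lambda>t. f (c t)) D"
  by (auto simp: geod_def isometry_def)

lemma geod_continuous: "geod c D \<Longrightarrow> continuous_on {0..D} c"
  unfolding continuous_on_iff geod_def by (metis dist_real_def)

lemma isometry_dist: "isometry f \<Longrightarrow> dist (f x) (f y) = dist x y"
  by (simp add: isometry_def)

lemma isometry_bij: "isometry f \<Longrightarrow> bij f"
  by (simp add: isometry_def)

lemma isometry_inv_dist: "isometry f \<Longrightarrow> dist (inv f x) y = dist x (f y)"
  by (metis bij_is_surj isometry_def surj_f_inv_f)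

lemma isometry_inv: "isometry f \<Longrightarrow> isometry (inv f)"
  unfolding isometry_def[of "inv f"]
  by (simp add: isometry_inv_dist isometry_bij bij_imp_bij_inv bij_is_surj surj_f_inv_f)

lemma isometry_comp: "isometry f \<Longrightarrow> isometry h \<Longrightarrow> isometry (f \<circ> h)"
  by (auto simp: isometry_def bij_comp)

subsection \<open>Integer powers\<close>

lemma ipow_0 [simp]: "ipow g 0 = id"
  by (simp add: ipow_def)

lemma ipow_1 [simp]: "ipow g 1 = g"
  by (simp add: ipow_def)

lemma ipow_of_nat: "ipow g (int n) = g ^^ n"
  by (simp add: ipow_def)

lemma ipow_Suc:
  assumes "bij g" shows "ipow g (i + 1) = g \<circ> ipow g i"
proof -
  have c: "g \<circ> inv g = id" using surj_iff[of g] bij_is_surj[OF assms] by simp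
  consider "0 \<le> i" | "i = -1" | "i < -1" by linarith
  then show ?thesis
  proof cases
    case 1 then show ?thesis by (simp add: ipow_def nat_add_distrib)
  next
    case 2 then show ?thesis using c by (simp add: ipow_def)
  next
    case 3
    then have e: "nat (- i) = Suc (nat (- (i + 1)))" by simp
    have "ipow g i = inv g \<circ> (inv g ^^ nat (- (i + 1)))"
      using 3 by (simp only: ipow_def e funpow.simps) simp
    then have "g \<circ> ipow g i = (g \<circ> inv g) \<circ> (inv g ^^ nat (- (i + 1)))" by (simp add: comp_assoc)
    then show ?thesis using 3 c by (simp add: ipow_def)
  qed
qed

lemma ipow_diff1:
  assumes "bij g" shows "ipow g (i - 1) = inv g \<circ> ipow g i"
proof -
  have "ipow g i = g \<circ> ipow g (i - 1)" using ipow_Suc[OF assms, of "i - 1"] by simp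
  then have "inv g \<circ> ipow g i = (inv g \<circ> g) \<circ> ipow g (i - 1)" by (simp add: comp_assoc)
  moreover have "inv g \<circ> g = id" using inj_iff[of g] bij_is_inj[OF assms] by simp
  ultimately show ?thesis by simp
qed

lemma ipow_add:
  assumes "bij g" shows "ipow g (i + j) = ipow g i \<circ> ipow g j"
proof (induct i rule: int_induct[where k=0])
  case base then show ?case by simp
next
  case (step1 i)
  have "ipow g (i + 1 + j) = g \<circ> ipow g (i + j)" using ipow_Suc[OF assms, of "i + j"] by (simp add: algebra_simps)
  then show ?case using step1 by (simp add: ipow_Suc[OF assms] comp_assoc)
next
  case (step2 i)
  have "ipow g (i - 1 + j) = inv g \<circ> ipow g (i + j)" using ipow_diff1[OF assms, of "i + j"] by (simp add: algebra_simps)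
  then show ?case using step2 by (simp add: ipow_diff1[OF assms] comp_assoc)
qed

lemma ipow_minus_cancel: "bij g \<Longrightarrow> ipow g (- i) \<circ> ipow g i = id"
  using ipow_add[of g "-i" i] by simp

lemma ipow_bij: "bij g \<Longrightarrow> bij (ipow g i)"
  by (metis add.right_inverse add.left_inverse ipow_0 ipow_add o_bij)

lemma ipow_inv: "bij g \<Longrightarrow> inv (ipow g i) = ipow g (- i)"
  by (rule inv_unique_comp) (use ipow_add[of g "-i" i] ipow_add[of g i "-i"] in auto)

lemma ipow_isometry: "isometry g \<Longrightarrow> isometry (ipow g i)"
proof (induct i rule: int_induct[where k=0])
  case base show ?case unfolding ipow_0 isometry_def using bij_id by auto
next
  case (step1 i) then show ?case using ipow_Suc[OF isometry_bij] isometry_comp by metis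
next
  case (step2 i) then show ?case using ipow_diff1[OF isometry_bij] isometry_comp isometry_inv by metis
qed

lemma ipow_mult: assumes "bij g" shows "ipow (ipow g i) j = ipow g (i * j)"
proof (induct j rule: int_induct[where k=0])
  case base then show ?case by simp
next
  case (step1 j)
  have "i * (j + 1) = i + i * j" by (simp add: algebra_simps)
  then show ?case using step1 ipow_add[OF assms, of i "i * j"] ipow_Suc[OF ipow_bij[OF assms], of i j] by simp
next
  case (step2 j)
  have "i * (j - 1) = - i + i * j" by (simp add: algebra_simps)
  then show ?case using step2 ipow_add[OF assms, of "-i" "i * j"] ipow_diff1[OF ipow_bij[OF assms], of i j]
    by (simp add: ipow_inv[OF assms])
qed

text \<open>Index projections jump, so they have the intermediate value property only up to the jump
  size \<open>J\<close>: the first \<open>k\<close> with \<open>f k \<ge> l\<close> overshoots by at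
  most one jump.\<close>

lemma discrete_ivt:
  fixes f :: "nat \<Rightarrow> real"
  assumes "\<And>k. k < n \<Longrightarrow> \<bar>f (Suc k) - f k\<bar> \<le> J" "f 0 \<le> l" "l \<le> f n" "0 \<le> J"
  obtains k where "k \<le> n" "\<bar>f k - l\<bar> \<le> J"
proof -
  define k where "k = (LEAST k. f k \<ge> l)"
  have k: "f k \<ge> l" "k \<le> n" using assms(3) unfolding k_def by (auto intro: LeastI Least_le)
  show ?thesis
  proof (cases k)
    case 0 then show ?thesis using that[of 0] k assms(2,4) by simp
  next
    case (Suc m)
    have "f m < l" using not_less_Least[of m "\<lambda>k. f k \<ge> l"] Suc unfolding k_def by simp
    then show ?thesis using that[of k] k assms(1)[of m] Suc by auto
  qed
qed

section \<open>Contracting axes\<close>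

locale contracting_orbit =
  fixes b :: "'x::metric_space" and g :: "'x \<Rightarrow> 'x" and K :: real
  assumes geo: "geodesic_space TYPE('x)" and ig: "isometry g" and K1: "1 \<le> K"
    and ax: "contracting_axis K (\<lambda>i. ipow g i b)"
begin

definition gm :: "int \<Rightarrow> 'x" where "gm i = ipow g i b"

abbreviation \<Gamma> :: "'x set" where "\<Gamma> \<equiv> range gm"

lemma gm_0 [simp]: "gm 0 = b" by (simp add: gm_def)

lemma gm_shift: "ipow g i (gm j) = gm (i + j)"
  using ipow_add[OF isometry_bij[OF ig], of i j] by (simp add: gm_def)

lemma gm_eta: "(\<lambda>i. ipow g i b) = gm" by (auto simp: gm_def)

lemma gm_upper: "dist (gm i) (gm j) \<le> K * \<bar>real_of_int i - real_of_int j\<bar> + K"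
  using ax by (auto simp: contracting_axis_def quasigeodesic_def gm_eta)

lemma gm_lower: "\<bar>real_of_int i - real_of_int j\<bar> \<le> K * (dist (gm i) (gm j) + K)"
proof -
  have "\<bar>real_of_int i - real_of_int j\<bar> / K - K \<le> dist (gm i) (gm j)"
    using ax by (auto simp: contracting_axis_def quasigeodesic_def gm_eta)
  then show ?thesis using K1 by (simp add: field_simps)
qed

text \<open>Projections are recorded by the exponent of the closest point rather than by the point,
  so that translation along the axis becomes addition of integers.\<close>

definition near :: "'x \<Rightarrow> int \<Rightarrow> bool" where "near x i \<longleftrightarrow> dist x (gm i) = infdist x \<Gamma>"

lemma infdist_le_gm: "infdist x \<Gamma> \<le> dist x (gm i)"
  by (simp add: infdist_le)

lemma nearI: "(\<And>j. dist x (gm i) \<le> dist x (gm j)) \<Longrightarrow> near x i"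
  unfolding near_def
  by (intro antisym infdist_le_gm) (auto simp: infdist_notempty intro!: cINF_greatest)

text \<open>An index closer to \<open>x\<close> than index 0 gives an orbit point within
  \<open>2 * dist x (gm 0)\<close> of \<open>gm 0\<close>; the lower quasigeodesic inequality leaves
  finitely many such indices, so the infimum is attained.\<close>

lemma near_exists: "\<exists>i. near x i"
proof -
  define A where "A = {i. dist x (gm i) \<le> dist x (gm 0)}"
  define R where "R = K * (2 * dist x (gm 0) + K)"
  have "A \<subseteq> {-\<lceil>R\<rceil>..\<lceil>R\<rceil>}"
  proof
    fix i assume "i \<in> A"
    then have "dist (gm i) (gm 0) \<le> 2 * dist x (gm 0)"
      using dist_triangle3[of "gm i" "gm 0" x] by (simp add: A_def)
    then have "\<bar>real_of_int i\<bar> \<le> R"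
      using gm_lower[of i 0] K1 by (smt (verit) R_def mult_left_mono of_int_0)
    then show "i \<in> {-\<lceil>R\<rceil>..\<lceil>R\<rceil>}" by simp linarith
  qed
  then have f: "finite A" by (rule finite_subset) simp
  have "0 \<in> A" by (simp add: A_def)
  then have ne: "A \<noteq> {}" by auto
  obtain i where i: "i \<in> A" "\<And>j. j \<in> A \<Longrightarrow> dist x (gm i) \<le> dist x (gm j)"
    using ex_min_if_finite[of "(\<lambda>i. dist x (gm i)) ` A"] f ne by (fastforce simp: not_less)
  have "near x i"
    by (rule nearI) (use i in \<open>auto simp: A_def not_le\<close>, smt (verit))
  then show ?thesis ..
qed

definition pr :: "'x \<Rightarrow> int" where "pr x = (SOME i. near x i)"

lemma near_pr: "near x (pr x)"
  unfolding pr_def by (rule someI_ex) (rule near_exists)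

lemma contraction:
  assumes c: "geod c D" and st: "0 \<le> s" "s \<le> t" "t \<le> D"
    and far: "\<And>u. s \<le> u \<Longrightarrow> u \<le> t \<Longrightarrow> infdist (c u) \<Gamma> > K"
    and n: "near (c s) i" "near (c t) j"
  shows "\<bar>real_of_int i - real_of_int j\<bar> \<le> 2 * K\<^sup>2"
proof -
  have "geodesic_segment (c ` {s..t})"
    unfolding geodesic_segment_def using c st
    by (intro exI[of _ c] exI[of _ s] exI[of _ t]) (auto simp: geod_def)
  moreover have "\<forall>x\<in>c ` {s..t}. infdist x \<Gamma> > K" using far by auto
  ultimately have *: "bounded (\<Union>x\<in>c ` {s..t}. proj \<Gamma> x)" "diameter (\<Union>x\<in>c ` {s..t}. proj \<Gamma> x) < K"
    using ax unfolding contracting_axis_def gm_eta Let_def by blast+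
  have "gm i \<in> (\<Union>x\<in>c ` {s..t}. proj \<Gamma> x)" "gm j \<in> (\<Union>x\<in>c ` {s..t}. proj \<Gamma> x)"
  proof -
    have "gm i \<in> proj \<Gamma> (c s)" "gm j \<in> proj \<Gamma> (c t)" using n by (auto simp: Defs.proj_def near_def)
    then show "gm i \<in> (\<Union>x\<in>c ` {s..t}. proj \<Gamma> x)" "gm j \<in> (\<Union>x\<in>c ` {s..t}. proj \<Gamma> x)"
      using st by auto
  qed
  from diameter_bounded_bound[OF *(1) this] *(2) have "dist (gm i) (gm j) \<le> K" by simp
  then have "K * (dist (gm i) (gm j) + K) \<le> K * (K + K)" using K1 by (intro mult_left_mono) auto
  then show ?thesis using gm_lower[of i j] by (simp add: power2_eq_square algebra_simps)
qed

text \<open>Join \<open>x\<close> to \<open>y\<close>. If the geodesic avoids the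
  \<open>K\<close>-neighborhood, contraction applies; if it meets it, both points are within
  \<open>K + dist x y\<close> of the axis and the triangle inequality suffices.\<close>

lemma coarse_lipschitz_near:
  assumes "near x i" "near y j"
  shows "\<bar>real_of_int i - real_of_int j\<bar> \<le> 3 * K * (dist x y + K)"
proof -
  obtain c where c: "c 0 = x" "c (dist x y) = y" "geod c (dist x y)" using geod_exists[OF geo] .
  have KK: "K * K \<ge> 0" "K * dist x y \<ge> 0" using K1 by auto
  show ?thesis
  proof (cases "\<forall>u. 0 \<le> u \<and> u \<le> dist x y \<longrightarrow> infdist (c u) \<Gamma> > K")
    case True
    then have "\<bar>real_of_int i - real_of_int j\<bar> \<le> 2 * K\<^sup>2"
      using contraction[OF c(3), of 0 "dist x y" i j] assms c by auto
    also have "\<dots> \<le> 3 * K * (dist x y + K)" using KK by (simp add: power2_eq_square algebra_simps)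
    finally show ?thesis .
  next
    case False
    then obtain u where u: "0 \<le> u" "u \<le> dist x y" "infdist (c u) \<Gamma> \<le> K" by (auto simp: not_less)
    have d: "dist x (c u) \<le> dist x y" "dist y (c u) \<le> dist x y"
      using geod_dist[OF c(3), of 0 u] geod_dist[OF c(3), of "dist x y" u] c u by auto
    have "infdist x \<Gamma> \<le> K + dist x y" "infdist y \<Gamma> \<le> K + dist x y"
      using infdist_triangle[of x \<Gamma> "c u"] infdist_triangle[of y \<Gamma> "c u"] d u by auto
    then have "dist (gm i) (gm j) \<le> 3 * dist x y + 2 * K"
      using assms dist_triangle3[of "gm i" y x] dist_triangle2[of "gm i" "gm j" y]
      by (simp add: near_def dist_commute)
    then have "K * (dist (gm i) (gm j) + K) \<le> K * (3 * dist x y + 2 * K + K)"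
      using K1 by (intro mult_left_mono) auto
    then show ?thesis using gm_lower[of i j] by (simp add: algebra_simps)
  qed
qed

text \<open>The bound of \<open>coarse_lipschitz_near\<close> for points at distance
  \<open>C\<close>. In particular \<open>JJ 0\<close> is the ambiguity in the choice of a nearest
  index, which appears whenever \<open>pr\<close> is compared with another nearest index, for
  instance after a shift.\<close>

definition JJ :: "real \<Rightarrow> real" where "JJ C = 3 * K * (C + K)"

lemma JJ_mono: "C \<le> C' \<Longrightarrow> JJ C \<le> JJ C'"
  using K1 by (simp add: JJ_def mult_left_mono)

lemma JJ_pos: "0 \<le> C \<Longrightarrow> 0 \<le> JJ C"
  using K1 by (simp add: JJ_def)

lemma near_pr_diff:
  assumes "near x i" "dist x y \<le> C"
  shows "\<bar>real_of_int i - real_of_int (pr y)\<bar> \<le> JJ C"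
  using coarse_lipschitz_near[OF assms(1) near_pr[of y]] JJ_mono[OF assms(2)] by (simp add: JJ_def)

lemma pr_lipschitz:
  assumes "dist x y \<le> C"
  shows "\<bar>real_of_int (pr x) - real_of_int (pr y)\<bar> \<le> JJ C"
  by (rule near_pr_diff[OF near_pr assms])

lemma near_shift: "near (ipow g k x) (k + i) \<longleftrightarrow> near x i"
proof -
  have *: "dist (ipow g k x) (gm (k + j)) = dist x (gm j)" for j
    using gm_shift[of k j] isometry_dist[OF ipow_isometry[OF ig]] by metis
  have "infdist (ipow g k x) \<Gamma> = infdist x \<Gamma>"
  proof (rule antisym)
    have "infdist (ipow g k x) \<Gamma> \<le> dist x (gm j)" for j
      using infdist_le_gm[of "ipow g k x" "k + j"] * by simp
    then show "infdist (ipow g k x) \<Gamma> \<le> infdist x \<Gamma>"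
      by (subst (2) infdist_notempty) (auto intro!: cINF_greatest)
    have "infdist x \<Gamma> \<le> dist (ipow g k x) (gm j)" for j
      using infdist_le_gm[of x "j - k"] *[of "j - k"] by simp
    then show "infdist x \<Gamma> \<le> infdist (ipow g k x) \<Gamma>"
      by (subst (2) infdist_notempty) (auto intro!: cINF_greatest)
  qed
  then show ?thesis using * by (simp add: near_def)
qed

lemma pr_shift: "\<bar>real_of_int (pr (ipow g k x)) - (real_of_int k + real_of_int (pr x))\<bar> \<le> JJ 0"
  using near_pr_diff[of "ipow g k x" "k + pr x" "ipow g k x" 0] near_shift near_pr by (simp add: abs_minus_commute)

lemma near_gm: "near (gm i) i"
  by (rule nearI) simp

lemma pr_gm: "\<bar>real_of_int (pr (gm i)) - real_of_int i\<bar> \<le> JJ 0"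
  using near_pr_diff[OF near_gm, of i "gm i" 0] by (simp add: abs_minus_commute)

section \<open>The Morse property: geodesics between points with distant projections follow the
  axis\<close>

lemma infdist_geod_continuous: "geod c D \<Longrightarrow> continuous_on {0..D} (\<lambda>t. infdist (c t) \<Gamma>)"
  by (intro continuous_on_infdist geod_continuous)

text \<open>Contraction needs a segment strictly outside the neighborhood, so it is applied up to a
  time at most 1 before the first entry time \<open>t1\<close>; the last unit is bridged by
  \<open>pr_lipschitz\<close>, whence the summand \<open>JJ 1\<close>.\<close>

lemma enter_forward:
  assumes c: "geod c D" and t: "0 \<le> t" "t \<le> t0" "t0 \<le> D"
    and f: "infdist (c t) \<Gamma> > K" and n: "infdist (c t0) \<Gamma> \<le> K"
  shows "\<exists>t1. 0 \<le> t1 \<and> t1 \<le> D \<and> infdist (c t1) \<Gamma> \<le> K \<and>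
     \<bar>real_of_int (pr (c t1)) - real_of_int (pr (c t))\<bar> \<le> 2 * K\<^sup>2 + JJ 1"
proof -
  define A where "A = {u\<in>{t..t0}. infdist (c u) \<Gamma> \<le> K}"
  have con: "continuous_on {t..t0} (\<lambda>t. infdist (c t) \<Gamma>)"
    using infdist_geod_continuous[OF c] t by (auto elim: continuous_on_subset)
  have "closed A" unfolding A_def by (intro continuous_on_closed_Collect_le con continuous_on_const closed_atLeastAtMost)
  moreover have "A \<subseteq> {t..t0}" by (auto simp: A_def)
  ultimately have "compact A" by (meson bounded_closed_interval bounded_subset compact_eq_bounded_closed)
  moreover have "A \<noteq> {}" using n t by (auto simp: A_def)
  ultimately obtain t1 where t1: "t1 \<in> A" "\<And>u. u \<in> A \<Longrightarrow> t1 \<le> u" using compact_attains_inf[of A] by metis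
  have "t \<le> t1" "t \<noteq> t1" using t1(1) f by (auto simp: A_def)
  then have "t < t1" by simp
  define s where "s = max t (t1 - 1)"
  have s: "t \<le> s" "s < t1" "t1 - s \<le> 1" using \<open>t < t1\<close> by (auto simp: s_def)
  have "infdist (c u) \<Gamma> > K" if "t \<le> u" "u \<le> s" for u
  proof (rule ccontr)
    assume "\<not> ?thesis"
    then have "u \<in> A" using that s t1(1) by (auto simp: A_def)
    then show False using t1(2) that s by fastforce
  qed
  then have 1: "\<bar>real_of_int (pr (c t)) - real_of_int (pr (c s))\<bar> \<le> 2 * K\<^sup>2"
    using s t t1 by (intro contraction[OF c, of t s]) (auto simp: A_def intro: near_pr)
  have "dist (c s) (c t1) \<le> 1"
    using geod_dist[OF c, of s t1] s t t1(1) by (auto simp: A_def)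
  from pr_lipschitz[OF this] 1 have "\<bar>real_of_int (pr (c t1)) - real_of_int (pr (c t))\<bar> \<le> 2 * K\<^sup>2 + JJ 1" by linarith
  then show ?thesis using t1(1) t by (intro exI[of _ t1]) (auto simp: A_def)
qed

lemma enter:
  assumes c: "geod c D" and t: "0 \<le> t" "t \<le> D" "0 \<le> t0" "t0 \<le> D"
    and f: "infdist (c t) \<Gamma> > K" and n: "infdist (c t0) \<Gamma> \<le> K"
  shows "\<exists>t1. 0 \<le> t1 \<and> t1 \<le> D \<and> infdist (c t1) \<Gamma> \<le> K \<and>
     \<bar>real_of_int (pr (c t1)) - real_of_int (pr (c t))\<bar> \<le> 2 * K\<^sup>2 + JJ 1"
proof (cases "t \<le> t0")
  case True then show ?thesis using enter_forward[OF c, of t t0] assms by auto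
next
  case False
  from enter_forward[OF geod_reverse[OF c], of "D - t" "D - t0"] False assms
  obtain t1 where "0 \<le> t1 \<and> t1 \<le> D \<and> infdist (c (D - t1)) \<Gamma> \<le> K \<and>
     \<bar>real_of_int (pr (c (D - t1))) - real_of_int (pr (c t))\<bar> \<le> 2 * K\<^sup>2 + JJ 1" by auto
  then show ?thesis by (intro exI[of _ "D - t1"]) auto
qed

lemma pass:
  assumes "geod c D" "\<bar>real_of_int (pr (c 0)) - real_of_int (pr (c D))\<bar> > 2 * K\<^sup>2"
  shows "\<exists>t. 0 \<le> t \<and> t \<le> D \<and> infdist (c t) \<Gamma> \<le> K"
proof (rule ccontr)
  assume "\<not> ?thesis"
  then have "\<bar>real_of_int (pr (c 0)) - real_of_int (pr (c D))\<bar> \<le> 2 * K\<^sup>2"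
    using assms(1) by (intro contraction[OF assms(1), of 0 D]) (fastforce simp: geod_def not_le intro: near_pr)+
  then show False using assms(2) by simp
qed

lemma pr_geod_ivt:
  assumes c: "geod c D" and l: "real_of_int (pr (c 0)) \<le> l" "l \<le> real_of_int (pr (c D))"
  shows "\<exists>t. 0 \<le> t \<and> t \<le> D \<and> \<bar>real_of_int (pr (c t)) - l\<bar> \<le> JJ 1"
proof -
  define n where "n = Suc (nat \<lceil>D\<rceil>)"
  define h where "h = D / real n"
  have D: "0 \<le> D" using c by (simp add: geod_def)
  have n: "real n > 0" "real n \<ge> D" by (simp_all add: n_def) linarith
  have h: "0 \<le> h" "h \<le> 1" using D n by (auto simp: h_def field_simps)
  have kh: "0 \<le> real k * h \<and> real k * h \<le> D" if "k \<le> n" for k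
  proof -
    have "real k * h \<le> real n * h" using that h by (intro mult_right_mono) auto
    moreover have "real n * h = D" using n by (simp add: h_def)
    ultimately show ?thesis using h by simp
  qed
  obtain k where "k \<le> n" "\<bar>real_of_int (pr (c (real k * h))) - l\<bar> \<le> JJ 1"
  proof (rule discrete_ivt[of n "\<lambda>k. real_of_int (pr (c (real k * h)))" "JJ 1" l])
    fix k assume "k < n"
    then have "dist (c (real (Suc k) * h)) (c (real k * h)) \<le> 1"
      using geod_dist[OF c] kh[of k] kh[of "Suc k"] h by (auto simp: algebra_simps)
    then show "\<bar>real_of_int (pr (c (real (Suc k) * h))) - real_of_int (pr (c (real k * h)))\<bar> \<le> JJ 1"
      by (rule pr_lipschitz)
  qed (use l n JJ_pos[of 1] in \<open>auto simp: h_def\<close>)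
  then show ?thesis using kh by blast
qed

definition C1 :: real where "C1 = 2 * K + K * (2 * K\<^sup>2 + 2 * JJ 1)"

lemma C1_pos: "0 \<le> C1"
  using K1 JJ_pos[of 1] by (auto simp: C1_def intro!: add_nonneg_nonneg mult_nonneg_nonneg)

text \<open>A point of the geodesic with projection near \<open>l\<close> exists by the discrete
  intermediate value property but may be far from the axis. The geodesic meets the neighborhood
  because its ends project far apart, and sliding the point into the neighborhood changes its
  projection by a bounded amount.\<close>

lemma morse_increasing:
  assumes c: "geod c D" and big: "\<bar>real_of_int (pr (c 0)) - real_of_int (pr (c D))\<bar> > 2 * K\<^sup>2"
    and l: "pr (c 0) \<le> l" "l \<le> pr (c D)"
  shows "\<exists>t. 0 \<le> t \<and> t \<le> D \<and> dist (c t) (gm l) \<le> C1"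
proof -
  obtain t where t: "0 \<le> t" "t \<le> D" "\<bar>real_of_int (pr (c t)) - real_of_int l\<bar> \<le> JJ 1"
    using pr_geod_ivt[OF c, of "real_of_int l"] l by auto
  obtain t0 where t0: "0 \<le> t0" "t0 \<le> D" "infdist (c t0) \<Gamma> \<le> K" using pass[OF c big] by blast
  obtain t1 where t1: "0 \<le> t1" "t1 \<le> D" "infdist (c t1) \<Gamma> \<le> K"
    "\<bar>real_of_int (pr (c t1)) - real_of_int (pr (c t))\<bar> \<le> 2 * K\<^sup>2 + JJ 1"
  proof (cases "infdist (c t) \<Gamma> \<le> K")
    case True then show ?thesis using that[of t] t JJ_pos[of 1] by auto
  next
    case False then show ?thesis using enter[OF c t(1,2) t0(1,2)] t0 that by force
  qed
  have "\<bar>real_of_int (pr (c t1)) - real_of_int l\<bar> \<le> 2 * K\<^sup>2 + 2 * JJ 1" using t1(4) t(3) by linarith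
  then have "K * \<bar>real_of_int (pr (c t1)) - real_of_int l\<bar> \<le> K * (2 * K\<^sup>2 + 2 * JJ 1)"
    using K1 by (intro mult_left_mono) auto
  then have "dist (gm (pr (c t1))) (gm l) \<le> K * (2 * K\<^sup>2 + 2 * JJ 1) + K"
    using gm_upper[of "pr (c t1)" l] by linarith
  moreover have "dist (c t1) (gm (pr (c t1))) \<le> K" using near_pr[of "c t1"] t1 by (simp add: near_def)
  ultimately have "dist (c t1) (gm l) \<le> C1"
    using dist_triangle[of "c t1" "gm l" "gm (pr (c t1))"] by (simp add: C1_def)
  then show ?thesis using t1 by blast
qed

lemma morse:
  assumes c: "geod c D" and big: "\<bar>real_of_int (pr (c 0)) - real_of_int (pr (c D))\<bar> > 2 * K\<^sup>2"
    and l: "min (pr (c 0)) (pr (c D)) \<le> l" "l \<le> max (pr (c 0)) (pr (c D))"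
  shows "\<exists>t. 0 \<le> t \<and> t \<le> D \<and> dist (c t) (gm l) \<le> C1"
proof (cases "pr (c 0) \<le> pr (c D)")
  case True then show ?thesis using morse_increasing[OF c big] l by auto
next
  case False
  have "\<exists>t. 0 \<le> t \<and> t \<le> D \<and> dist (c (D - t)) (gm l) \<le> C1"
    using morse_increasing[OF geod_reverse[OF c], of l] big l False by (simp add: abs_minus_commute)
  then obtain t where "0 \<le> t \<and> t \<le> D \<and> dist (c (D - t)) (gm l) \<le> C1" ..
  then show ?thesis by (intro exI[of _ "D - t"]) auto
qed

end

section \<open>Bounded projections and the elementary closure\<close>

context contracting_orbit
begin

lemma morse_translate:
  assumes y: "isometry y" and c: "geod c D"
    and big: "\<bar>real_of_int (pr (inv y (c 0))) - real_of_int (pr (inv y (c D)))\<bar> > 2 * K\<^sup>2"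
    and l: "min (pr (inv y (c 0))) (pr (inv y (c D))) \<le> l" "l \<le> max (pr (inv y (c 0))) (pr (inv y (c D)))"
  shows "\<exists>t. 0 \<le> t \<and> t \<le> D \<and> dist (c t) (y (gm l)) \<le> C1"
  using morse[OF geod_isometry[OF isometry_inv[OF y] c] big l] by (simp add: isometry_inv_dist[OF y])

lemma inv_translate [simp]: "isometry y \<Longrightarrow> inv y (y x) = x"
  by (simp add: bij_is_inj isometry_bij)

definition CE :: real where "CE = C1 + K * JJ 0 + K"
definition CD :: real where "CD = 3 * C1 + 2 * K + CE"

lemma CE_pos: "0 \<le> CE"
  using C1_pos K1 JJ_pos[of 0] by (simp add: CE_def)

text \<open>The converse of the Morse property, by coarse connectivity: the times \<open>T j\<close>
  at which the geodesic is close to \<open>y (gm j)\<close> advance in bounded jumps and come within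
  \<open>CE\<close> of both ends, so every time is close to some \<open>T j\<close>. The indices run
  between \<open>pr (gm a)\<close> and \<open>pr (gm a')\<close>, which agree with \<open>a\<close>
  and \<open>a'\<close> only up to \<open>JJ 0\<close>.\<close>

lemma translate_dense:
  assumes y: "isometry y" and c: "geod c D" "c 0 = y (gm a)" "c D = y (gm a')"
    and big: "\<bar>real_of_int (pr (gm a)) - real_of_int (pr (gm a'))\<bar> > 2 * K\<^sup>2"
    and t: "0 \<le> t" "t \<le> D"
  shows "\<exists>j. min (pr (gm a)) (pr (gm a')) \<le> j \<and> j \<le> max (pr (gm a)) (pr (gm a')) \<and> dist (c t) (y (gm j)) \<le> CD"
proof -
  define A A' where "A = pr (gm a)" and "A' = pr (gm a')"
  have "\<exists>t. 0 \<le> t \<and> t \<le> D \<and> dist (c t) (y (gm j)) \<le> C1" if "min A A' \<le> j" "j \<le> max A A'" for j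
    using morse_translate[OF y c(1), of j] c(2,3) big that y by (simp add: A_def A'_def)
  then obtain T where T: "\<And>j. min A A' \<le> j \<Longrightarrow> j \<le> max A A' \<Longrightarrow> 0 \<le> T j \<and> T j \<le> D \<and> dist (c (T j)) (y (gm j)) \<le> C1"
    by metis
  have D: "0 \<le> D" using c(1) by (simp add: geod_def)
  have end_close: "dist (y (gm (pr (gm i)))) (y (gm i)) \<le> K * JJ 0 + K" for i
  proof -
    have "K * \<bar>real_of_int (pr (gm i)) - real_of_int i\<bar> \<le> K * JJ 0" using pr_gm K1 by (intro mult_left_mono) auto
    then show ?thesis using gm_upper[of "pr (gm i)" i] by (simp add: isometry_dist[OF y])
  qed
  have TA: "T A \<le> CE"
  proof -
    have "dist (c (T A)) (c 0) \<le> CE"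
      using T[of A] end_close[of a] dist_triangle[of "c (T A)" "c 0" "y (gm A)"] c(2) by (simp add: CE_def A_def)
    then show ?thesis using T[of A] geod_dist[OF c(1), of "T A" 0] D by simp
  qed
  have TA': "T A' \<ge> D - CE"
  proof -
    have "dist (c (T A')) (c D) \<le> CE"
      using T[of A'] end_close[of a'] dist_triangle[of "c (T A')" "c D" "y (gm A')"] c(3) by (simp add: CE_def A'_def)
    then show ?thesis using T[of A'] geod_dist[OF c(1), of "T A'" D] D by simp
  qed
  have "\<exists>j. min A A' \<le> j \<and> j \<le> max A A' \<and> \<bar>T j - t\<bar> \<le> 2 * C1 + 2 * K + CE"
  proof -
    consider "t \<le> T A" | "t \<ge> T A'" | "T A \<le> t" "t \<le> T A'" by linarith
    then show ?thesis
    proof cases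
      case 1 then show ?thesis using TA t C1_pos K1 T[of A] by (intro exI[of _ A]) auto
    next
      case 2 then show ?thesis using TA' t C1_pos K1 T[of A'] by (intro exI[of _ A']) auto
    next
      case 3
      define q where "q k = (if A \<le> A' then A + int k else A - int k)" for k
      have q: "min A A' \<le> q k \<and> q k \<le> max A A'" if "k \<le> nat \<bar>A' - A\<bar>" for k using that by (auto simp: q_def)
      obtain k where "k \<le> nat \<bar>A' - A\<bar>" "\<bar>T (q k) - t\<bar> \<le> 2 * C1 + 2 * K"
      proof (rule discrete_ivt[of "nat \<bar>A' - A\<bar>" "\<lambda>k. T (q k)" "2 * C1 + 2 * K" t])
        fix k assume k: "k < nat \<bar>A' - A\<bar>"
        have i: "min A A' \<le> q k \<and> q k \<le> max A A'" "min A A' \<le> q (Suc k) \<and> q (Suc k) \<le> max A A'"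
          using q[of k] q[of "Suc k"] k by auto
        have "dist (gm (q (Suc k))) (gm (q k)) \<le> 2 * K"
          using gm_upper[of "q (Suc k)" "q k"] by (auto simp: q_def split: if_splits)
        then have "dist (c (T (q (Suc k)))) (c (T (q k))) \<le> 2 * C1 + 2 * K"
          using T[of "q k"] T[of "q (Suc k)"] i isometry_dist[OF y, of "gm (q (Suc k))" "gm (q k)"]
            dist_triangle[of "c (T (q (Suc k)))" "c (T (q k))" "y (gm (q (Suc k)))"]
            dist_triangle2[of "y (gm (q (Suc k)))" "c (T (q k))" "y (gm (q k))"] by linarith
        then show "\<bar>T (q (Suc k)) - T (q k)\<bar> \<le> 2 * C1 + 2 * K"
          using geod_dist[OF c(1)] T[of "q k"] T[of "q (Suc k)"] i by simp
      qed (use 3 C1_pos K1 in \<open>auto simp: q_def\<close>)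
      then show ?thesis using q[of k] CE_pos by (intro exI[of _ "q k"]) auto
    qed
  qed
  then obtain j where j: "min A A' \<le> j" "j \<le> max A A'" "\<bar>T j - t\<bar> \<le> 2 * C1 + 2 * K + CE" by blast
  have "dist (c t) (c (T j)) \<le> 2 * C1 + 2 * K + CE" using geod_dist[OF c(1), of t "T j"] T[of j] j t by auto
  then have "dist (c t) (y (gm j)) \<le> CD"
    using T[of j] j dist_triangle[of "c t" "y (gm j)" "c (T j)"] by (simp add: CD_def)
  then show ?thesis using j unfolding A_def A'_def by blast
qed

definition C2 :: real where "C2 = CD + C1"
definition T0 :: real where "T0 = K * (K * (6 * C1 + 2 * C2 + K)) + K"
definition C3 :: real where "C3 = 6 * C1 + C2 + 2 * T0"

lemma C2_pos: "0 \<le> C2" using C1_pos CE_pos K1 by (simp add: C2_def CD_def)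
lemma T0_pos: "0 \<le> T0" using C1_pos C2_pos K1 by (auto simp: T0_def intro!: add_nonneg_nonneg mult_nonneg_nonneg)
lemma C3_pos: "0 \<le> C3" using C1_pos C2_pos T0_pos by (simp add: C3_def)

text \<open>The times \<open>t'\<close>, \<open>s\<close> and \<open>s'\<close> are all at distance
  about \<open>\<tau>\<close> from \<open>t\<close>, so two of them lie on the same side of
  \<open>t\<close> and nearly coincide. If these are \<open>s\<close> and \<open>s'\<close>, then
  \<open>gm (j + N)\<close> and \<open>gm (j - N)\<close> are close, which bounds \<open>N\<close>
  and gives \<open>\<tau> \<le> T0\<close>.\<close>

lemma same_direction:
  assumes y: "isometry y" and c: "geod c D" and N: "0 \<le> N"
    and t: "0 \<le> t" "t \<le> D" "dist (c t) (gm l) \<le> C1"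
    and t': "0 \<le> t'" "t' \<le> D" "dist (c t') (gm (l + N)) \<le> C1"
    and s: "0 \<le> s" "s \<le> D" "dist (c s) (y (gm (j + N))) \<le> C1"
    and s': "0 \<le> s'" "s' \<le> D" "dist (c s') (y (gm (j - N))) \<le> C1"
    and j: "dist (gm l) (y (gm j)) \<le> C2"
  shows "dist (gm (l + N)) (y (gm (j + N))) \<le> C3 \<or> dist (gm (l + N)) (y (gm (j - N))) \<le> C3"
proof -
  define \<tau> where "\<tau> = dist b (gm N)"
  have tr: "dist (gm i) (gm (i + N)) = \<tau>" for i
    using isometry_dist[OF ipow_isometry[OF ig], of i b "gm N"] gm_shift[of i N] gm_shift[of i 0] by (simp add: \<tau>_def)
  have \<tau>0: "0 \<le> \<tau>" by (simp add: \<tau>_def)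
  have y1: "dist (y (gm j)) (y (gm (j + N))) = \<tau>" "dist (y (gm j)) (y (gm (j - N))) = \<tau>"
    using tr[of j] tr[of "j - N"] by (simp_all add: isometry_dist[OF y] dist_commute)
  note gd = geod_dist[OF c]
  have e1: "\<bar>\<bar>t' - t\<bar> - \<tau>\<bar> \<le> 2 * C1"
    using gd[of t' t] t t' tr[of l] dist_triangle[of "c t'" "c t" "gm (l+N)"] dist_triangle2[of "gm (l+N)" "c t" "gm l"]
      dist_triangle[of "gm l" "gm (l+N)" "c t"] dist_triangle2[of "c t" "gm (l+N)" "c t'"]
    by (simp add: dist_commute abs_le_iff) linarith
  have e2: "\<bar>\<bar>s - t\<bar> - \<tau>\<bar> \<le> 2 * C1 + C2"
    using gd[of s t] t s y1(1) j dist_triangle[of "c s" "c t" "y (gm (j+N))"] dist_triangle[of "y (gm (j+N))" "c t" "y (gm j)"]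
      dist_triangle[of "y (gm j)" "c t" "gm l"] dist_triangle[of "y (gm j)" "y (gm (j+N))" "gm l"]
      dist_triangle[of "gm l" "y (gm (j+N))" "c t"] dist_triangle[of "c t" "y (gm (j+N))" "c s"]
    by (simp add: dist_commute abs_le_iff) linarith
  have e3: "\<bar>\<bar>s' - t\<bar> - \<tau>\<bar> \<le> 2 * C1 + C2"
    using gd[of s' t] t s' y1(2) j dist_triangle[of "c s'" "c t" "y (gm (j-N))"] dist_triangle[of "y (gm (j-N))" "c t" "y (gm j)"]
      dist_triangle[of "y (gm j)" "c t" "gm l"] dist_triangle[of "y (gm j)" "y (gm (j-N))" "gm l"]
      dist_triangle[of "gm l" "y (gm (j-N))" "c t"] dist_triangle[of "c t" "y (gm (j-N))" "c s'"]
    by (simp add: dist_commute abs_le_iff) linarith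
  have fin1: ?thesis if "\<bar>s - t'\<bar> \<le> 4 * C1 + C2"
  proof -
    have "dist (gm (l + N)) (y (gm (j + N))) \<le> 6 * C1 + C2"
      using that gd[of s t'] s t' dist_triangle[of "gm (l+N)" "y (gm (j+N))" "c t'"] dist_triangle[of "c t'" "y (gm (j+N))" "c s"]
      by (simp add: dist_commute)
    then show ?thesis using T0_pos by (simp add: C3_def)
  qed
  have fin2: ?thesis if "\<bar>s' - t'\<bar> \<le> 4 * C1 + C2"
  proof -
    have "dist (gm (l + N)) (y (gm (j - N))) \<le> 6 * C1 + C2"
      using that gd[of s' t'] s' t' dist_triangle[of "gm (l+N)" "y (gm (j-N))" "c t'"] dist_triangle[of "c t'" "y (gm (j-N))" "c s'"]
      by (simp add: dist_commute)
    then show ?thesis using T0_pos by (simp add: C3_def)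
  qed
  have fin3: ?thesis if "\<bar>s - s'\<bar> \<le> 2 * (2 * C1 + C2)"
  proof -
    have "dist (y (gm (j+N))) (y (gm (j-N))) \<le> 6 * C1 + 2 * C2"
      using that gd[of s s'] s s' dist_triangle[of "y (gm (j+N))" "y (gm (j-N))" "c s"] dist_triangle[of "c s" "y (gm (j-N))" "c s'"]
      by (simp add: dist_commute)
    then have "K * (dist (gm (j+N)) (gm (j-N)) + K) \<le> K * (6 * C1 + 2 * C2 + K)"
      using K1 by (intro mult_left_mono) (auto simp: isometry_dist[OF y])
    then have "real_of_int N \<le> K * (6 * C1 + 2 * C2 + K)"
      using gm_lower[of "j+N" "j-N"] N by simp
    then have "K * real_of_int N \<le> K * (K * (6 * C1 + 2 * C2 + K))" using K1 by (intro mult_left_mono) auto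
    then have "\<tau> \<le> T0" using gm_upper[of 0 N] N by (simp add: T0_def \<tau>_def)
    then have "dist (gm (l + N)) (y (gm (j + N))) \<le> C2 + 2 * T0"
      using j tr[of l] y1 dist_triangle[of "gm (l+N)" "y (gm (j+N))" "gm l"] dist_triangle[of "gm l" "y (gm (j+N))" "y (gm j)"]
      by (simp add: dist_commute)
    then show ?thesis using C1_pos by (simp add: C3_def)
  qed
  show ?thesis
  proof -
    have "\<bar>s - t'\<bar> \<le> 4 * C1 + C2 \<or> \<bar>s' - t'\<bar> \<le> 4 * C1 + C2 \<or> \<bar>s - s'\<bar> \<le> 2 * (2 * C1 + C2)"
      using e1 e2 e3 C2_pos C1_pos by (simp add: abs_if split: if_splits)
    then show ?thesis using fin1 fin2 fin3 by blast
  qed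
qed

end

section \<open>WPD: finitely many ways for a translate to follow the axis\<close>

locale wpd_orbit = contracting_orbit b g K for b :: "'x::metric_space" and g K +
  fixes G :: "('x \<Rightarrow> 'x) set"
  assumes Ggrp: "isometry_group G" and gG: "g \<in> G" and wpd: "WPD G b g"
begin

lemma G_iso: "f \<in> G \<Longrightarrow> isometry f" using Ggrp by (simp add: isometry_group_def)
lemma G_bij: "f \<in> G \<Longrightarrow> bij f" using G_iso isometry_bij by blast
lemma G_comp: "f \<in> G \<Longrightarrow> h \<in> G \<Longrightarrow> f \<circ> h \<in> G" using Ggrp by (simp add: isometry_group_def)
lemma G_inv: "f \<in> G \<Longrightarrow> inv f \<in> G" using Ggrp by (simp add: isometry_group_def)
lemma G_id: "id \<in> G" using Ggrp by (simp add: isometry_group_def)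
lemma bij_g: "bij g" using G_bij[OF gG] .

lemma G_ipow: "ipow g i \<in> G"
proof (induct i rule: int_induct[where k=0])
  case base show ?case unfolding ipow_0 by (rule G_id)
next
  case (step1 i) then show ?case using ipow_Suc[OF bij_g] G_comp gG by metis
next
  case (step2 i) then show ?case using ipow_diff1[OF bij_g] G_comp gG G_inv by metis
qed

text \<open>The constant \<open>2 * (C2 + C3)\<close> allows WPD to be applied to a quotient of two
  elements of \<open>\<Psi>\<close>, and later to a quotient of two candidates for the position of a
  pivot.\<close>

definition Nw :: nat where
  "Nw = (SOME N. 0 < N \<and> finite {h\<in>G. dist b (h b) \<le> 2 * (C2 + C3) \<and> dist ((g ^^ N) b) (h ((g ^^ N) b)) \<le> 2 * (C2 + C3)})"

lemma Nw: "0 < Nw" "finite {h\<in>G. dist b (h b) \<le> 2 * (C2 + C3) \<and> dist (gm (int Nw)) (h (gm (int Nw))) \<le> 2 * (C2 + C3)}"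
proof -
  have "\<exists>N. 0 < N \<and> finite {h\<in>G. dist b (h b) \<le> 2 * (C2 + C3) \<and> dist ((g ^^ N) b) (h ((g ^^ N) b)) \<le> 2 * (C2 + C3)}"
    using wpd C2_pos C3_pos unfolding WPD_def by simp
  from someI_ex[OF this, folded Nw_def]
  show "0 < Nw" "finite {h\<in>G. dist b (h b) \<le> 2 * (C2 + C3) \<and> dist (gm (int Nw)) (h (gm (int Nw))) \<le> 2 * (C2 + C3)}"
    by (simp_all add: gm_def ipow_of_nat)
qed

definition \<Psi> :: "('x \<Rightarrow> 'x) set" where
  "\<Psi> = {h\<in>G. dist b (h b) \<le> C2 \<and> (dist (gm (int Nw)) (h (gm (int Nw))) \<le> C3 \<or> dist (gm (int Nw)) (h (gm (- int Nw))) \<le> C3)}"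

text \<open>WPD concerns elements that keep the direction of the axis. Elements reversing it are
  compared with a fixed one, \<open>f\<close>: the quotient \<open>inv f \<circ> h\<close> almost
  fixes \<open>gm (- Nw)\<close> and \<open>b\<close>, and conjugation by
  \<open>ipow g (int Nw)\<close> carries this pair to \<open>b\<close> and
  \<open>gm Nw\<close>.\<close>

lemma finite_\<Psi>: "finite \<Psi>"
proof -
  let ?F = "{h\<in>G. dist b (h b) \<le> 2 * (C2 + C3) \<and> dist (gm (int Nw)) (h (gm (int Nw))) \<le> 2 * (C2 + C3)}"
  let ?P = "{h\<in>G. dist b (h b) \<le> C2 \<and> dist (gm (int Nw)) (h (gm (- int Nw))) \<le> C3}"
  have P: "finite ?P"
  proof (cases "?P = {}")
    case True then show ?thesis by (metis finite.emptyI)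
  next
    case False
    then obtain f where f: "f \<in> G" "dist b (f b) \<le> C2" "dist (gm (int Nw)) (f (gm (- int Nw))) \<le> C3" by blast
    let ?m = "\<lambda>h. ipow g (int Nw) \<circ> inv f \<circ> h \<circ> ipow g (- int Nw)"
    have "inj_on ?m ?P"
    proof (rule inj_onI)
      fix h h' assume "?m h = ?m h'"
      then have "(f \<circ> ipow g (- int Nw)) \<circ> ?m h \<circ> ipow g (int Nw) = (f \<circ> ipow g (- int Nw)) \<circ> ?m h' \<circ> ipow g (int Nw)" by simp
      moreover have "(f \<circ> ipow g (- int Nw)) \<circ> ?m k \<circ> ipow g (int Nw) = k" for k
      proof
        fix x
        have 1: "ipow g (- int Nw) (ipow g (int Nw) z) = z" for z
          using ipow_minus_cancel[OF bij_g, of "int Nw"] by (metis comp_apply id_apply)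
        show "((f \<circ> ipow g (- int Nw)) \<circ> ?m k \<circ> ipow g (int Nw)) x = k x"
          using 1 surj_f_inv_f[OF bij_is_surj[OF G_bij[OF f(1)]]] by simp
      qed
      ultimately show "h = h'" by metis
    qed
    moreover have "?m ` ?P \<subseteq> ?F"
    proof safe
      fix h assume h: "h \<in> G" "dist b (h b) \<le> C2" "dist (gm (int Nw)) (h (gm (- int Nw))) \<le> C3"
      show "?m h \<in> G" using G_comp G_inv G_ipow f h by simp
      have "dist b (?m h b) = dist (ipow g (int Nw) (gm (- int Nw))) (ipow g (int Nw) (inv f (h (gm (- int Nw)))))"
        using gm_shift[of "int Nw" "- int Nw"] by (simp add: gm_def)
      also have "\<dots> = dist (f (gm (- int Nw))) (h (gm (- int Nw)))"
        using isometry_inv_dist[OF G_iso[OF f(1)]] by (simp add: isometry_dist[OF G_iso[OF G_ipow]] dist_commute)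
      also have "\<dots> \<le> 2 * (C2 + C3)" using f h dist_triangle3[of "f (gm (- int Nw))" "h (gm (- int Nw))" "gm (int Nw)"] C2_pos by simp
      finally show "dist b (?m h b) \<le> 2 * (C2 + C3)" .
      have "dist (gm (int Nw)) (?m h (gm (int Nw))) = dist (ipow g (int Nw) b) (ipow g (int Nw) (inv f (h b)))"
        using gm_shift[of "- int Nw" "int Nw"] by (simp add: gm_def)
      also have "\<dots> = dist (f b) (h b)"
        using isometry_inv_dist[OF G_iso[OF f(1)]] by (simp add: isometry_dist[OF G_iso[OF G_ipow]] dist_commute)
      also have "\<dots> \<le> 2 * (C2 + C3)" using f h dist_triangle3[of "f b" "h b" b] C3_pos by simp
      finally show "dist (gm (int Nw)) (?m h (gm (int Nw))) \<le> 2 * (C2 + C3)" .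
    qed
    ultimately show ?thesis using Nw(2) finite_imageD finite_subset by blast
  qed
  have "\<Psi> \<subseteq> ?F \<union> ?P" using C2_pos C3_pos by (auto simp: \<Psi>_def)
  then show ?thesis using P Nw(2) by (meson finite_UnI finite_subset)
qed

text \<open>A geodesic between two points of the translated axis is close to the axis by
  \<open>morse\<close> and to the translate by \<open>translate_dense\<close>, so every index
  \<open>l\<close> has a partner \<open>j\<close>. Away from the ends of its range the partner has
  room for \<open>Nw\<close> steps in both directions, and \<open>same_direction\<close> puts the
  comparison element into \<open>\<Psi>\<close>.\<close>

lemma fellow_travel:
  assumes y: "y \<in> G"
    and P: "P = pr (y (gm a))" "P' = pr (y (gm a'))" and A: "A = pr (gm a)" "A' = pr (gm a')"
    and bigP: "\<bar>real_of_int P - real_of_int P'\<bar> > 2 * K\<^sup>2" and bigA: "\<bar>real_of_int A - real_of_int A'\<bar> > 2 * K\<^sup>2"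
    and l: "min P P' \<le> l" "l + int Nw \<le> max P P'"
  shows "\<exists>j. min A A' \<le> j \<and> j \<le> max A A' \<and> dist (gm l) (y (gm j)) \<le> C2 \<and>
     (min A A' + int Nw \<le> j \<and> j + int Nw \<le> max A A' \<longrightarrow> ipow g (- l) \<circ> y \<circ> ipow g j \<in> \<Psi>)"
proof -
  have iy: "isometry y" using G_iso[OF y] .
  obtain c where c: "c 0 = y (gm a)" "c (dist (y (gm a)) (y (gm a'))) = y (gm a')" "geod c (dist (y (gm a)) (y (gm a')))"
    using geod_exists[OF geo] .
  define D where "D = dist (y (gm a)) (y (gm a'))"
  note c = c[folded D_def]
  have m1: "\<exists>t. 0 \<le> t \<and> t \<le> D \<and> dist (c t) (gm i) \<le> C1" if "min P P' \<le> i" "i \<le> max P P'" for i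
    using morse[OF c(3)] bigP that c(1,2) by (simp add: P)
  have m2: "\<exists>t. 0 \<le> t \<and> t \<le> D \<and> dist (c t) (y (gm i)) \<le> C1" if "min A A' \<le> i" "i \<le> max A A'" for i
    using morse_translate[OF iy c(3)] bigA that c(1,2) iy by (simp add: A)
  obtain t where t: "0 \<le> t" "t \<le> D" "dist (c t) (gm l) \<le> C1" using m1[of l] l by auto
  obtain t' where t': "0 \<le> t'" "t' \<le> D" "dist (c t') (gm (l + int Nw)) \<le> C1" using m1[of "l + int Nw"] l by auto
  obtain j where j: "min A A' \<le> j" "j \<le> max A A'" "dist (c t) (y (gm j)) \<le> CD"
    using translate_dense[OF iy c(3,1,2), of t] bigA t unfolding A by blast
  have d: "dist (gm l) (y (gm j)) \<le> C2"
    using dist_triangle[of "gm l" "y (gm j)" "c t"] t j by (simp add: C2_def dist_commute)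
  have "ipow g (- l) \<circ> y \<circ> ipow g j \<in> \<Psi>" if q: "min A A' + int Nw \<le> j" "j + int Nw \<le> max A A'"
  proof -
    obtain s where s: "0 \<le> s" "s \<le> D" "dist (c s) (y (gm (j + int Nw))) \<le> C1" using m2[of "j + int Nw"] j q by auto
    obtain s' where s': "0 \<le> s'" "s' \<le> D" "dist (c s') (y (gm (j - int Nw))) \<le> C1" using m2[of "j - int Nw"] j q by auto
    have *: "dist (gm k) ((ipow g (- l) \<circ> y \<circ> ipow g j) (gm m)) = dist (gm (l + k)) (y (gm (j + m)))" for k m
      using isometry_inv_dist[OF ipow_isometry[OF ig], of l "y (gm (j + m))" "gm k"]
      by (simp add: gm_shift ipow_inv[OF bij_g] dist_commute)
    show ?thesis
      using same_direction[OF iy c(3) _ t t' s s' d] d *[of 0 0] *[of "int Nw" "int Nw"] *[of "int Nw" "- int Nw"]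
      by (simp add: \<Psi>_def G_comp G_ipow y)
  qed
  then show ?thesis using j d by blast
qed

text \<open>A relation with \<open>q \<noteq> 0\<close> forces \<open>a \<noteq> 0\<close>, because
  \<open>g\<close> has infinite order; the relation therefore says that conjugation by
  \<open>y\<close> maps one nontrivial power of \<open>g\<close> to another.\<close>

definition E :: "('x \<Rightarrow> 'x) set" where
  "E = {y\<in>G. \<exists>a q. q \<noteq> 0 \<and> y \<circ> ipow g a = ipow g q \<circ> y}"

definition d0 :: real where "d0 = K * (2 * K\<^sup>2 + 2 * JJ 0) + K"
definition Wd :: nat where "Wd = nat (2 * \<lceil>K * (2 * C2 + K)\<rceil> + 1)"
text \<open>The threshold of a counting argument: \<open>card \<Psi>\<close> indices whose partner
  is in the middle, and at most \<open>Wd\<close> indices for each of the at most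
  \<open>2 * Nw\<close> partners near the ends. The summand \<open>JJ d0\<close> ensures that a long
  projection comes from a long piece of the translate.\<close>

definition \<theta> :: real where "\<theta> = JJ d0 + 2 * K\<^sup>2 + real Nw + real (card \<Psi>) + 2 * real Nw * real Wd + 1"

lemma d0_pos: "0 \<le> d0"
  using K1 JJ_pos[of 0] by (auto simp: d0_def intro!: add_nonneg_nonneg mult_nonneg_nonneg)

lemma \<theta>_pos: "0 \<le> \<theta>"
  using JJ_pos[OF d0_pos] by (simp add: \<theta>_def)

lemma \<theta>_ge: "2 * K\<^sup>2 \<le> \<theta>" "JJ d0 \<le> \<theta>"
proof -
  have "0 \<le> 2 * real Nw * real Wd" by simp
  then show "2 * K\<^sup>2 \<le> \<theta>" "JJ d0 \<le> \<theta>" using JJ_pos[OF d0_pos] zero_le_power2[of K] unfolding \<theta>_def by linarith+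
qed

lemma far_translate_far:
  assumes y: "isometry y" and "\<bar>real_of_int (pr (y (gm a))) - real_of_int (pr (y (gm a')))\<bar> > JJ d0"
  shows "\<bar>real_of_int (pr (gm a)) - real_of_int (pr (gm a'))\<bar> > 2 * K\<^sup>2"
proof (rule ccontr)
  assume "\<not> ?thesis"
  then have "\<bar>real_of_int a - real_of_int a'\<bar> \<le> 2 * K\<^sup>2 + 2 * JJ 0" using pr_gm[of a] pr_gm[of a'] by linarith
  then have "K * \<bar>real_of_int a - real_of_int a'\<bar> \<le> K * (2 * K\<^sup>2 + 2 * JJ 0)" using K1 by (intro mult_left_mono) auto
  then have "dist (y (gm a)) (y (gm a')) \<le> d0" using gm_upper[of a a'] by (simp add: d0_def isometry_dist[OF y])
  from pr_lipschitz[OF this] assms(2) show False by simp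
qed

lemma card_fibre:
  assumes "\<And>l l'. l \<in> L \<Longrightarrow> l' \<in> L \<Longrightarrow> dist (gm l) (gm l') \<le> 2 * C2"
  shows "card L \<le> Wd"
proof (cases "L = {}")
  case False
  then obtain l0 where l0: "l0 \<in> L" by blast
  define r where "r = \<lceil>K * (2 * C2 + K)\<rceil>"
  have "L \<subseteq> {l0 - r..l0 + r}"
  proof
    fix l assume "l \<in> L"
    from assms[OF this l0] have "K * (dist (gm l) (gm l0) + K) \<le> K * (2 * C2 + K)" using K1 by (intro mult_left_mono) auto
    then have "\<bar>real_of_int l - real_of_int l0\<bar> \<le> K * (2 * C2 + K)" using gm_lower[of l l0] by linarith
    then have "\<bar>real_of_int l - real_of_int l0\<bar> \<le> real_of_int r" unfolding r_def by linarith
    then show "l \<in> {l0 - r..l0 + r}" by auto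
  qed
  then have "card L \<le> card {l0 - r..l0 + r}" by (intro card_mono) auto
  also have "\<dots> = Wd" by (simp add: Wd_def r_def)
  finally show ?thesis .
qed simp

text \<open>Pigeonhole. A projection longer than \<open>\<theta>\<close> offers more indices
  \<open>l\<close> than there are values of
  \<open>ipow g (- l) \<circ> y \<circ> ipow g (\<phi> l)\<close>, and a coincidence at
  \<open>l\<close> and \<open>l'\<close> reads \<open>y \<circ> ipow g (\<phi> l - \<phi> l') = ipow
  g (l - l') \<circ> y\<close>, which would put \<open>y\<close> into \<open>E\<close>. The proof
  phrases this as injectivity on \<open>\<Lambda>'\<close>.\<close>

lemma bounded_projection:
  assumes y: "y \<in> G" "y \<notin> E"
  shows "\<bar>real_of_int (pr (y (gm a))) - real_of_int (pr (y (gm a')))\<bar> \<le> \<theta>"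
proof (rule ccontr)
  assume neg: "\<not> ?thesis"
  define P P' A A' where d: "P = pr (y (gm a))" "P' = pr (y (gm a'))" "A = pr (gm a)" "A' = pr (gm a')"
  have big: "\<bar>real_of_int P - real_of_int P'\<bar> > \<theta>" using neg d by simp
  have bigP: "\<bar>real_of_int P - real_of_int P'\<bar> > 2 * K\<^sup>2" using big \<theta>_ge by linarith
  have bigA: "\<bar>real_of_int A - real_of_int A'\<bar> > 2 * K\<^sup>2"
    unfolding d by (rule far_translate_far[OF G_iso[OF y(1)]]) (use big \<theta>_ge in \<open>simp add: d\<close>)
  define \<Lambda> where "\<Lambda> = {min P P'..max P P' - int Nw}"
  have "\<forall>l\<in>\<Lambda>. \<exists>j. min A A' \<le> j \<and> j \<le> max A A' \<and> dist (gm l) (y (gm j)) \<le> C2 \<and>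
     (min A A' + int Nw \<le> j \<and> j + int Nw \<le> max A A' \<longrightarrow> ipow g (- l) \<circ> y \<circ> ipow g j \<in> \<Psi>)"
    using fellow_travel[OF y(1) d bigP bigA] by (auto simp: \<Lambda>_def)
  then obtain \<phi> where \<phi>: "\<And>l. l \<in> \<Lambda> \<Longrightarrow> min A A' \<le> \<phi> l \<and> \<phi> l \<le> max A A' \<and> dist (gm l) (y (gm (\<phi> l))) \<le> C2 \<and>
     (min A A' + int Nw \<le> \<phi> l \<and> \<phi> l + int Nw \<le> max A A' \<longrightarrow> ipow g (- l) \<circ> y \<circ> ipow g (\<phi> l) \<in> \<Psi>)"
    by metis
  define Q where "Q = {min A A'..<min A A' + int Nw} \<union> {max A A' - int Nw<..max A A'}"
  define \<Lambda>' where "\<Lambda>' = {l\<in>\<Lambda>. \<phi> l \<notin> Q}"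
  have fin: "finite \<Lambda>" by (simp add: \<Lambda>_def)
  have "inj_on (\<lambda>l. ipow g (- l) \<circ> y \<circ> ipow g (\<phi> l)) \<Lambda>'"
  proof (rule inj_onI, rule ccontr)
    fix l l' assume "l \<noteq> l'" and e: "ipow g (- l) \<circ> y \<circ> ipow g (\<phi> l) = ipow g (- l') \<circ> y \<circ> ipow g (\<phi> l')"
    have "y \<circ> ipow g (\<phi> l - \<phi> l') = ipow g l \<circ> (ipow g (- l) \<circ> y \<circ> ipow g (\<phi> l)) \<circ> ipow g (- \<phi> l')"
      using ipow_add[OF bij_g, of "l" "-l"] ipow_add[OF bij_g, of "\<phi> l" "- \<phi> l'"] by (simp add: fun_eq_iff)
    also have "\<dots> = ipow g (l - l') \<circ> y"
      unfolding e using ipow_add[OF bij_g, of "l" "-l'"] ipow_add[OF bij_g, of "\<phi> l'" "- \<phi> l'"] by (simp add: fun_eq_iff)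
    finally have "y \<circ> ipow g (\<phi> l - \<phi> l') = ipow g (l - l') \<circ> y" .
    moreover have "l - l' \<noteq> 0" using \<open>l \<noteq> l'\<close> by simp
    ultimately have "y \<in> E" using y(1) unfolding E_def by blast
    then show False using y(2) by simp
  qed
  moreover have "(\<lambda>l. ipow g (- l) \<circ> y \<circ> ipow g (\<phi> l)) ` \<Lambda>' \<subseteq> \<Psi>"
  proof safe
    fix l assume "l \<in> \<Lambda>'"
    then show "ipow g (- l) \<circ> y \<circ> ipow g (\<phi> l) \<in> \<Psi>" using \<phi>[of l] by (auto simp: \<Lambda>'_def Q_def)
  qed
  ultimately have c1: "card \<Lambda>' \<le> card \<Psi>" using finite_\<Psi> by (rule card_inj_on_le)
  have "\<Lambda> - \<Lambda>' \<subseteq> (\<Union>q\<in>Q. {l\<in>\<Lambda>. \<phi> l = q})" by (auto simp: \<Lambda>'_def)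
  then have "card (\<Lambda> - \<Lambda>') \<le> card (\<Union>q\<in>Q. {l\<in>\<Lambda>. \<phi> l = q})" using fin by (intro card_mono) (auto simp: Q_def)
  also have "\<dots> \<le> (\<Sum>q\<in>Q. card {l\<in>\<Lambda>. \<phi> l = q})" by (rule card_UN_le) (simp add: Q_def)
  also have "\<dots> \<le> (\<Sum>q\<in>Q. Wd)"
  proof (intro sum_mono card_fibre)
    fix q l l' assume "l \<in> {l \<in> \<Lambda>. \<phi> l = q}" "l' \<in> {l \<in> \<Lambda>. \<phi> l = q}"
    then show "dist (gm l) (gm l') \<le> 2 * C2"
      using \<phi>[of l] \<phi>[of l'] dist_triangle2[of "gm l" "gm l'" "y (gm q)"] by auto
  qed
  also have "\<dots> = card Q * Wd" by simp
  also have "\<dots> \<le> (2 * Nw) * Wd"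
  proof (rule mult_right_mono)
    have "card Q \<le> card {min A A'..<min A A' + int Nw} + card {max A A' - int Nw<..max A A'}" unfolding Q_def by (rule card_Un_le)
    then show "card Q \<le> 2 * Nw" by simp
  qed simp
  finally have c2: "card (\<Lambda> - \<Lambda>') \<le> 2 * Nw * Wd" .
  have "card \<Lambda> \<le> card \<Lambda>' + card (\<Lambda> - \<Lambda>')"
    using fin card_Un_le[of \<Lambda>' "\<Lambda> - \<Lambda>'"] by (simp add: \<Lambda>'_def Un_absorb1)
  then have "real (card \<Lambda>) \<le> real (card \<Psi>) + real (2 * Nw * Wd)" using c1 c2 by linarith
  moreover have "real (card \<Lambda>) \<ge> \<bar>real_of_int P - real_of_int P'\<bar> - real Nw"
    by (simp add: \<Lambda>_def)
  ultimately show False using big JJ_pos[OF d0_pos] zero_le_power2[of K] by (simp add: \<theta>_def)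
qed

section \<open>Algebra of the elementary closure\<close>

lemma ipow_eq_id: assumes "ipow g q = id" shows "q = 0"
proof (rule ccontr)
  assume "q \<noteq> 0"
  define n where "n = \<lceil>K * (0 + K)\<rceil> + 1"
  have "(id ^^ m) = (id :: 'x \<Rightarrow> 'x)" for m by (induct m) (auto simp: fun_eq_iff)
  then have "ipow (ipow g q) n = id" unfolding assms unfolding ipow_def inv_id by presburger
  then have "gm (q * n) = b" using ipow_mult[OF bij_g, of q n] by (simp add: gm_def)
  then have "\<bar>real_of_int (q * n)\<bar> \<le> K * (0 + K)" using gm_lower[of "q * n" 0] by simp
  moreover have n: "real_of_int n > K * (0 + K)" unfolding n_def by linarith
  moreover have "real_of_int n \<le> \<bar>real_of_int (q * n)\<bar>"
  proof -
    have "1 \<le> \<bar>real_of_int q\<bar>" using \<open>q \<noteq> 0\<close> by linarith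
    then show ?thesis using n K1 mult_right_mono[of 1 "\<bar>real_of_int q\<bar>" "\<bar>real_of_int n\<bar>"] by (simp add: abs_mult)
  qed
  ultimately show False by linarith
qed

lemma commute_power:
  assumes "y \<circ> ipow g a = ipow g q \<circ> y" shows "y \<circ> ipow g (a * n) = ipow g (q * n) \<circ> y"
proof (induct n rule: int_induct[where k=0])
  case base then show ?case by simp
next
  case (step1 n)
  have "y \<circ> ipow g (a * (n + 1)) = (y \<circ> ipow g (a * n)) \<circ> ipow g a"
    using ipow_add[OF bij_g, of "a * n" a] by (simp add: algebra_simps comp_assoc)
  also have "\<dots> = ipow g (q * n) \<circ> (y \<circ> ipow g a)" by (simp only: step1 comp_assoc)
  also have "\<dots> = ipow g (q * (n + 1)) \<circ> y"
    using ipow_add[OF bij_g, of "q * n" q] by (simp only: assms) (simp add: algebra_simps comp_assoc)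
  finally show ?case .
next
  case (step2 n)
  have m: "y \<circ> ipow g (- a) = ipow g (- q) \<circ> y"
  proof -
    have "y \<circ> ipow g (- a) = ipow g (-q) \<circ> (ipow g q \<circ> y) \<circ> ipow g (-a)"
      using ipow_add[OF bij_g, of "-q" q] by (simp add: fun_eq_iff)
    also have "\<dots> = ipow g (-q) \<circ> y"
      using ipow_add[OF bij_g, of "a" "-a"] by (simp only: assms[symmetric]) (simp add: fun_eq_iff)
    finally show ?thesis .
  qed
  have "y \<circ> ipow g (a * (n - 1)) = (y \<circ> ipow g (a * n)) \<circ> ipow g (-a)"
    using ipow_add[OF bij_g, of "a * n" "-a"] by (simp add: algebra_simps comp_assoc)
  also have "\<dots> = ipow g (q * n) \<circ> (y \<circ> ipow g (-a))" by (simp only: step2 comp_assoc)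
  also have "\<dots> = ipow g (q * (n - 1)) \<circ> y"
    using ipow_add[OF bij_g, of "q * n" "-q"] by (simp only: m) (simp add: algebra_simps comp_assoc)
  finally show ?case .
qed

lemma E_exponent_nonzero:
  assumes "y \<in> G" "y \<circ> ipow g a = ipow g q \<circ> y" "q \<noteq> 0" shows "a \<noteq> 0"
proof
  assume "a = 0"
  then have "ipow g q \<circ> y = y" using assms by simp
  then have "ipow g q \<circ> y \<circ> inv y = y \<circ> inv y" by simp
  moreover have "y \<circ> inv y = id" using G_bij[OF assms(1)] surj_iff[of y] bij_is_surj by blast
  ultimately have "ipow g q = id" by (simp add: comp_assoc)
  then show False using ipow_eq_id assms by blast
qed

text \<open>The commutation relation persists for all multiples, so the translate by
  \<open>y\<close> has arbitrarily long projections around index 0 and \<open>fellow_travel\<close>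
  applies at \<open>l = 0\<close>. Thus \<open>\<Psi>\<close> meets every coset of the powers of
  \<open>g\<close> in \<open>E\<close>. The size of \<open>n\<close> keeps the partner
  \<open>j\<close>, bounded by \<open>c0\<close>, at least \<open>Nw\<close> away from the
  ends.\<close>

lemma E_coset:
  assumes "y \<in> E" shows "\<exists>j. y \<circ> ipow g j \<in> \<Psi>"
proof -
  obtain a q where y: "y \<in> G" and q: "q \<noteq> 0" and aq: "y \<circ> ipow g a = ipow g q \<circ> y" using assms by (auto simp: E_def)
  have a: "a \<noteq> 0" using E_exponent_nonzero[OF y aq q] .
  define p0 where "p0 = real_of_int (pr (y b))"
  define c0 where "c0 = K * (C2 + dist b (y b) + K)"
  define n where "n = nat \<lceil>JJ d0 + 2 * K\<^sup>2 + \<bar>p0\<bar> + c0 + JJ 0 + real Nw + 1\<rceil>"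
  have c0: "0 \<le> c0" using C2_pos K1 by (simp add: c0_def)
  have n: "real n \<ge> JJ d0 + 2 * K\<^sup>2 + \<bar>p0\<bar> + c0 + JJ 0 + real Nw + 1" unfolding n_def by linarith
  have Jp: "0 \<le> JJ d0" "0 \<le> JJ 0" "0 \<le> K\<^sup>2" using JJ_pos[OF d0_pos] JJ_pos[of 0] by auto
  have big: "real n \<le> \<bar>real_of_int z * real n\<bar>" if "z \<noteq> 0" for z
  proof -
    have "1 \<le> \<bar>real_of_int z\<bar>" using that by linarith
    then show ?thesis using mult_right_mono[of 1 "\<bar>real_of_int z\<bar>" "real n"] by (simp add: abs_mult)
  qed
  define a1 a2 where "a1 = a * (- int n)" and "a2 = a * int n"
  define P P' A A' where d: "P = pr (y (gm a1))" "P' = pr (y (gm a2))" "A = pr (gm a1)" "A' = pr (gm a2)"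
  have yg: "y (gm (a * m)) = ipow g (q * m) (y b)" for m
    using fun_cong[OF commute_power[OF aq, of m], of b] by (simp add: gm_def)
  have P: "\<bar>real_of_int P - (- (real_of_int q * real n) + p0)\<bar> \<le> JJ 0" "\<bar>real_of_int P' - (real_of_int q * real n + p0)\<bar> \<le> JJ 0"
    using pr_shift[of "q * (- int n)" "y b"] pr_shift[of "q * int n" "y b"]
    unfolding d a1_def a2_def yg p0_def by simp_all
  have A: "\<bar>real_of_int A + real_of_int a * real n\<bar> \<le> JJ 0" "\<bar>real_of_int A' - real_of_int a * real n\<bar> \<le> JJ 0"
    using pr_gm[of a1] pr_gm[of a2] unfolding d a1_def a2_def by simp_all
  have bq: "real n \<le> \<bar>real_of_int q * real n\<bar>" and ba: "real n \<le> \<bar>real_of_int a * real n\<bar>" using big q a by auto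
  have bigP: "\<bar>real_of_int P - real_of_int P'\<bar> > JJ d0"
    using P bq n Jp c0 by linarith
  have bigP2: "\<bar>real_of_int P - real_of_int P'\<bar> > 2 * K\<^sup>2" using P bq n Jp c0 by linarith
  have bigA: "\<bar>real_of_int A - real_of_int A'\<bar> > 2 * K\<^sup>2"
    unfolding d by (rule far_translate_far[OF G_iso[OF y]]) (use bigP in \<open>simp add: d\<close>)
  have l: "min P P' \<le> 0" "0 + int Nw \<le> max P P'"
  proof -
    have "min (real_of_int P) (real_of_int P') \<le> 0" using P bq n Jp c0 by linarith
    then show "min P P' \<le> 0" by auto
    have "real Nw \<le> max (real_of_int P) (real_of_int P')" using P bq n Jp c0 by linarith
    then show "0 + int Nw \<le> max P P'" by auto
  qed
  obtain j where j: "dist (gm 0) (y (gm j)) \<le> C2"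
     "min A A' + int Nw \<le> j \<and> j + int Nw \<le> max A A' \<longrightarrow> ipow g (- 0) \<circ> y \<circ> ipow g j \<in> \<Psi>"
    using fellow_travel[OF y d bigP2 bigA l] by blast
  have "dist (gm j) (gm 0) \<le> C2 + dist b (y b)"
    using j(1) isometry_dist[OF G_iso[OF y], of "gm j" "gm 0"] dist_triangle[of "y (gm j)" "y b" b] by (simp add: dist_commute)
  then have "K * (dist (gm j) (gm 0) + K) \<le> c0" unfolding c0_def using K1 by (intro mult_left_mono) auto
  then have jc: "\<bar>real_of_int j\<bar> \<le> c0" using gm_lower[of j 0] by simp
  have "min (real_of_int A) (real_of_int A') + real Nw \<le> real_of_int j" "real_of_int j + real Nw \<le> max (real_of_int A) (real_of_int A')"
    using A ba n Jp jc by linarith+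
  then have "min A A' + int Nw \<le> j \<and> j + int Nw \<le> max A A'" by linarith
  then show ?thesis using j(2) by auto
qed

text \<open>Passing from exponent \<open>a * k\<close> to \<open>q * k\<close> changes the distance
  to the basepoint by at most \<open>2 * Dy\<close>. Iterating from \<open>a ^ m\<close> to
  \<open>q ^ m\<close> and using the quasigeodesic inequalities,
  \<open>\<bar>q\<bar> > \<bar>a\<bar>\<close> would make the exponential \<open>r ^ m\<close> grow
  at most linearly.\<close>

lemma exponent_le:
  assumes y: "isometry y" and aq: "y \<circ> ipow g a = ipow g q \<circ> y" and a: "a \<noteq> 0"
  shows "\<bar>q\<bar> \<le> \<bar>a\<bar>"
proof (rule ccontr)
  assume "\<not> ?thesis"
  then have qa: "\<bar>q\<bar> \<ge> \<bar>a\<bar> + 1" by simp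
  define f where "f k = dist b (gm k)" for k
  define Dy where "Dy = dist b (y b)"
  have step: "f (q * k) \<le> f (a * k) + 2 * Dy" for k
  proof -
    have e: "y (gm (a * k)) = ipow g (q * k) (y b)"
      using fun_cong[OF commute_power[OF aq, of k], of b] by (simp add: gm_def)
    have "dist (y (gm (a * k))) (gm (q * k)) = Dy"
      unfolding e using isometry_dist[OF ipow_isometry[OF ig], of "q * k" "y b" b] by (simp add: gm_def Dy_def dist_commute)
    moreover have "dist (y b) (y (gm (a * k))) = f (a * k)" by (simp add: isometry_dist[OF y] f_def)
    ultimately show ?thesis
      using dist_triangle[of b "gm (q * k)" "y b"] dist_triangle[of "y b" "gm (q * k)" "y (gm (a * k))"]
      by (simp add: f_def Dy_def)
  qed
  have it: "f (q ^ m * k) \<le> f (a ^ m * k) + 2 * real m * Dy" for m k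
  proof (induct m arbitrary: k)
    case (Suc m)
    have "f (q ^ Suc m * k) \<le> f (a * (q ^ m * k)) + 2 * Dy" using step[of "q ^ m * k"] by (simp add: mult.assoc)
    also have "a * (q ^ m * k) = q ^ m * (a * k)" by simp
    also have "f (q ^ m * (a * k)) \<le> f (a ^ m * (a * k)) + 2 * real m * Dy" by (rule Suc)
    finally show ?case by (simp add: algebra_simps)
  qed simp
  define r where "r = \<bar>real_of_int q\<bar> / \<bar>real_of_int a\<bar>"
  define \<delta> where "\<delta> = r - 1"
  have a1: "\<bar>real_of_int a\<bar> \<ge> 1" using a by linarith
  have qa': "\<bar>real_of_int q\<bar> > \<bar>real_of_int a\<bar>" using qa by linarith
  have \<delta>: "\<delta> > 0" using a1 qa' by (simp add: \<delta>_def r_def field_simps)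
  define C where "C = K * (3 * K)"
  define B where "B = K * (2 * Dy)"
  have CB: "0 \<le> C" "0 \<le> B" using K1 by (auto simp: C_def B_def Dy_def)
  have bound: "r ^ m \<le> C + B * real m" for m
  proof -
    have "\<bar>real_of_int (q ^ m)\<bar> \<le> K * (f (q ^ m) + K)" using gm_lower[of "q ^ m" 0] by (simp add: f_def dist_commute)
    also have "\<dots> \<le> K * (K * \<bar>real_of_int (a ^ m)\<bar> + K + 2 * real m * Dy + K)"
      using it[of m 1] gm_upper[of 0 "a ^ m"] K1 by (intro mult_left_mono) (auto simp: f_def)
    also have "\<dots> \<le> K * (\<bar>real_of_int a\<bar> ^ m * (3 * K + 2 * real m * Dy))"
    proof (rule mult_left_mono)
      have p: "1 \<le> \<bar>real_of_int a\<bar> ^ m" using a1 by (rule one_le_power)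
      have "2 * K + 2 * real m * Dy \<le> \<bar>real_of_int a\<bar> ^ m * (2 * K + 2 * real m * Dy)"
        using mult_right_mono[OF p, of "2 * K + 2 * real m * Dy"] K1 by (simp add: Dy_def)
      then show "K * \<bar>real_of_int (a ^ m)\<bar> + K + 2 * real m * Dy + K \<le> \<bar>real_of_int a\<bar> ^ m * (3 * K + 2 * real m * Dy)"
        by (simp add: algebra_simps power_abs)
    qed (use K1 in simp)
    finally have "\<bar>real_of_int q\<bar> ^ m \<le> \<bar>real_of_int a\<bar> ^ m * (C + B * real m)"
      by (simp add: C_def B_def power_abs algebra_simps)
    moreover have "\<bar>real_of_int a\<bar> ^ m > 0" using a1 by simp
    ultimately show ?thesis by (simp add: r_def power_divide field_simps)
  qed
  define m where "m = nat \<lceil>(C + 2 * B) / \<delta>\<^sup>2\<rceil> + 1"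
  have m: "real m > (C + 2 * B) / \<delta>\<^sup>2" "real m \<ge> 1" unfolding m_def by linarith+
  \<comment> \<open>Bernoulli's inequality is only linear in \<open>m\<close>; squaring turns it
    into a quadratic lower bound for \<open>r ^ (2 * m)\<close>, which beats the linear upper
    bound.\<close>
  have "real m * \<delta> \<le> r ^ m" using Bernoulli_inequality[of \<delta> m] \<delta> by (simp add: \<delta>_def)
  then have "(real m * \<delta>)\<^sup>2 \<le> (r ^ m)\<^sup>2" using \<delta> by (intro power_mono) auto
  also have "\<dots> = r ^ (2 * m)" by (simp add: power_mult mult.commute[of 2 m])
  also have "\<dots> \<le> C + B * real (2 * m)" by (rule bound)
  also have "\<dots> \<le> real m * (C + 2 * B)" using m(2) CB mult_right_mono[of 1 "real m" C] by (simp add: algebra_simps)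
  also have "\<dots> < real m * (real m * \<delta>\<^sup>2)"
    using m \<delta> by (intro mult_strict_left_mono) (auto simp: field_simps)
  finally show False by (simp add: power2_eq_square algebra_simps)
qed

lemma E_exponents:
  assumes "y \<in> E" shows "\<exists>a \<sigma>. 0 < a \<and> (\<sigma> = 1 \<or> \<sigma> = -1) \<and> y \<circ> ipow g a = ipow g (\<sigma> * a) \<circ> y"
proof -
  obtain a q where y: "y \<in> G" and q: "q \<noteq> 0" and aq: "y \<circ> ipow g a = ipow g q \<circ> y" using assms by (auto simp: E_def)
  have a: "a \<noteq> 0" using E_exponent_nonzero[OF y aq q] .
  have "\<bar>q\<bar> \<le> \<bar>a\<bar>" using exponent_le[OF G_iso[OF y] aq a] .
  moreover have "\<bar>a\<bar> \<le> \<bar>q\<bar>"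
  proof (rule exponent_le[OF G_iso[OF G_inv[OF y]] _ q])
    have i: "inv y \<circ> y = id" "y \<circ> inv y = id"
      using G_bij[OF y] inj_iff[of y] surj_iff[of y] bij_is_inj bij_is_surj by blast+
    have "inv y \<circ> ipow g q = inv y \<circ> (ipow g q \<circ> y) \<circ> inv y" using i by (simp only: comp_assoc comp_id)
    also have "\<dots> = ipow g a \<circ> inv y" by (simp only: aq[symmetric] comp_assoc[symmetric] i id_comp)
    finally show "inv y \<circ> ipow g q = ipow g a \<circ> inv y" .
  qed
  ultimately have abs: "\<bar>q\<bar> = \<bar>a\<bar>" by simp
  show ?thesis
  proof (cases "a > 0")
    case True
    then show ?thesis using abs aq by (intro exI[of _ a] exI[of _ "if q > 0 then 1 else -1"]) (auto split: if_splits)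
  next
    case False
    have "y \<circ> ipow g (- a) = ipow g (- q) \<circ> y" using commute_power[OF aq, of "-1"] by simp
    then show ?thesis using False a abs by (intro exI[of _ "-a"] exI[of _ "if q > 0 then -1 else 1"]) (auto split: if_splits)
  qed
qed

definition commutes_upto_sign :: "int \<Rightarrow> ('x \<Rightarrow> 'x) \<Rightarrow> bool" where
  "commutes_upto_sign p y \<longleftrightarrow> (\<exists>\<sigma>. (\<sigma> = 1 \<or> \<sigma> = -1) \<and> (\<forall>k. y \<circ> ipow g (p * k) = ipow g (\<sigma> * p * k) \<circ> y))"

lemma E_G: "y \<in> E \<Longrightarrow> y \<in> G" by (simp add: E_def)

text \<open>Composing with a power of \<open>g\<close> on the right does not affect the commutation
  relation, so it suffices to treat the finitely many representatives in \<open>\<Psi>\<close>; the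
  product of their exponents serves all of them.\<close>

lemma uniform_exponent: "\<exists>p>0. \<forall>y\<in>E. commutes_upto_sign p y"
proof -
  have "\<forall>y\<in>\<Psi> \<inter> E. \<exists>a. 0 < a \<and> (\<exists>\<sigma>. (\<sigma> = 1 \<or> \<sigma> = -1) \<and> y \<circ> ipow g a = ipow g (\<sigma> * a) \<circ> y)"
    using E_exponents by blast
  then obtain ex where ex: "\<And>y. y \<in> \<Psi> \<inter> E \<Longrightarrow> 0 < ex y \<and> (\<exists>\<sigma>. (\<sigma> = 1 \<or> \<sigma> = -1) \<and> y \<circ> ipow g (ex y) = ipow g (\<sigma> * ex y) \<circ> y)"
    by metis
  define p where "p = (\<Prod>y\<in>\<Psi> \<inter> E. ex y)"
  have fin: "finite (\<Psi> \<inter> E)" using finite_\<Psi> by blast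
  have "p > 0" unfolding p_def using ex by (intro prod_pos) blast
  moreover have "commutes_upto_sign p y" if yE: "y \<in> E" for y
  proof -
    obtain j where j: "y \<circ> ipow g j \<in> \<Psi>" using E_coset[OF yE] by blast
    obtain a q where q: "q \<noteq> 0" and aq: "y \<circ> ipow g a = ipow g q \<circ> y" using yE by (auto simp: E_def)
    have "(y \<circ> ipow g j) \<circ> ipow g a = ipow g q \<circ> (y \<circ> ipow g j)"
    proof -
      have "(y \<circ> ipow g j) \<circ> ipow g a = (y \<circ> ipow g a) \<circ> ipow g j"
        by (simp only: comp_assoc ipow_add[OF bij_g, symmetric] add.commute)
      then show ?thesis by (simp only: aq comp_assoc)
    qed
    then have "y \<circ> ipow g j \<in> \<Psi> \<inter> E" using j q yE E_G G_comp G_ipow unfolding E_def by blast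
    from ex[OF this] obtain \<sigma> where s: "\<sigma> = 1 \<or> \<sigma> = -1"
      "(y \<circ> ipow g j) \<circ> ipow g (ex (y \<circ> ipow g j)) = ipow g (\<sigma> * ex (y \<circ> ipow g j)) \<circ> (y \<circ> ipow g j)" by blast
    have "ex (y \<circ> ipow g j) dvd p" unfolding p_def
      using fin \<open>y \<circ> ipow g j \<in> \<Psi> \<inter> E\<close> by (rule dvd_prodI)
    then obtain m where m: "p = ex (y \<circ> ipow g j) * m" by (auto simp: dvd_def)
    have "y \<circ> ipow g (p * k) = ipow g (\<sigma> * p * k) \<circ> y" for k
    proof -
      have 1: "(y \<circ> ipow g j) \<circ> ipow g (p * k) = ipow g (\<sigma> * p * k) \<circ> (y \<circ> ipow g j)"
        using commute_power[OF s(2), of "m * k"] by (simp only: m mult.assoc)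
      have "y \<circ> ipow g (p * k) = (y \<circ> ipow g j) \<circ> ipow g (p * k) \<circ> ipow g (-j)"
        using ipow_add[OF bij_g, of j "p * k + - j"] ipow_add[OF bij_g, of "p * k" "- j"] by (simp add: comp_assoc)
      also have "\<dots> = ipow g (\<sigma> * p * k) \<circ> y"
        unfolding 1 using ipow_add[OF bij_g, of j "-j"] by (simp add: comp_assoc)
      finally show ?thesis .
    qed
    then show ?thesis using s(1) unfolding commutes_upto_sign_def by blast
  qed
  ultimately show ?thesis by blast
qed

lemma commutes_upto_sign_E: "0 < p \<Longrightarrow> y \<in> G \<Longrightarrow> commutes_upto_sign p y \<Longrightarrow> y \<in> E"
proof -
  assume p: "0 < p" "y \<in> G" "commutes_upto_sign p y"
  then obtain \<sigma> where "\<sigma> = 1 \<or> \<sigma> = -1" "y \<circ> ipow g (p * 1) = ipow g (\<sigma> * p * 1) \<circ> y" unfolding commutes_upto_sign_def by blast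
  moreover from this have "\<sigma> * p * 1 \<noteq> 0" using p by auto
  ultimately show ?thesis using p unfolding E_def by blast
qed

lemma commutes_upto_sign_comp: 
  assumes "commutes_upto_sign p y" "commutes_upto_sign p z" shows "commutes_upto_sign p (y \<circ> z)"
proof -
  obtain \<sigma> where s: "\<sigma> = 1 \<or> \<sigma> = -1" "\<And>k. y \<circ> ipow g (p * k) = ipow g (\<sigma> * p * k) \<circ> y"
    using assms(1) unfolding commutes_upto_sign_def by blast
  obtain \<sigma>' where s': "\<sigma>' = 1 \<or> \<sigma>' = -1" "\<And>k. z \<circ> ipow g (p * k) = ipow g (\<sigma>' * p * k) \<circ> z"
    using assms(2) unfolding commutes_upto_sign_def by blast
  have "y \<circ> z \<circ> ipow g (p * k) = ipow g (\<sigma> * \<sigma>' * p * k) \<circ> (y \<circ> z)" for k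
  proof -
    have "y \<circ> z \<circ> ipow g (p * k) = y \<circ> ipow g (p * (\<sigma>' * k)) \<circ> z"
      using s'(2)[of k] by (simp only: comp_assoc) (simp add: mult.commute mult.left_commute)
    also have "\<dots> = ipow g (\<sigma> * p * (\<sigma>' * k)) \<circ> y \<circ> z" by (simp only: s(2))
    finally show ?thesis by (simp add: comp_assoc mult.commute mult.left_commute)
  qed
  then show ?thesis unfolding commutes_upto_sign_def using s(1) s'(1)
    by (intro exI[of _ "\<sigma> * \<sigma>'"]) auto
qed

text \<open>In the definition of \<open>E\<close> the exponents of the two factors need not fit
  together; a common exponent for all of \<open>E\<close> removes this obstacle.\<close>

lemma E_comp: "y \<in> E \<Longrightarrow> z \<in> E \<Longrightarrow> y \<circ> z \<in> E"
  using uniform_exponent commutes_upto_sign_comp commutes_upto_sign_E G_comp E_G by metis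

lemma E_inv: assumes "y \<in> E" shows "inv y \<in> E"
proof -
  obtain a q where y: "y \<in> G" and q: "q \<noteq> 0" and aq: "y \<circ> ipow g a = ipow g q \<circ> y" using assms by (auto simp: E_def)
  have a: "a \<noteq> 0" using E_exponent_nonzero[OF y aq q] .
  have i: "inv y \<circ> y = id" "y \<circ> inv y = id"
    using G_bij[OF y] inj_iff[of y] surj_iff[of y] bij_is_inj bij_is_surj by blast+
  have "inv y \<circ> ipow g q = inv y \<circ> (ipow g q \<circ> y) \<circ> inv y" using i by (simp only: comp_assoc comp_id)
  also have "\<dots> = ipow g a \<circ> inv y" by (simp only: aq[symmetric] comp_assoc[symmetric] i id_comp)
  finally show ?thesis using a G_inv[OF y] unfolding E_def by blast
qed

lemma E_ipow: "ipow g k \<in> E"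
proof -
  have "ipow g k \<circ> ipow g 1 = ipow g 1 \<circ> ipow g k" using ipow_add[OF bij_g, of k 1] ipow_add[OF bij_g, of 1 k] by (simp add: add.commute)
  then show ?thesis unfolding E_def using G_ipow by (metis (mono_tags, lifting) mem_Collect_eq one_neq_zero)
qed

end

context contracting_orbit
begin

text \<open>Move from \<open>u\<close> to its nearest point \<open>w\<close> on the axis. If the two
  projected far apart on the translate, some \<open>c t\<close> in between would be
  \<open>K\<close>-close to the translate and hence project to the axis near \<open>m\<close>. But
  every point between \<open>u\<close> and \<open>w\<close> still has \<open>w\<close> as a nearest
  point, so \<open>u\<close> itself would project near \<open>m\<close>.\<close>

lemma behrstock:
  assumes y: "isometry y"
    and m: "\<And>t. \<bar>real_of_int (pr (y (gm t))) - m\<bar> \<le> \<theta>'"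
    and m': "\<And>t. \<bar>real_of_int (pr (inv y (gm t))) - m'\<bar> \<le> \<theta>'"
    and u: "\<bar>real_of_int (pr u) - m\<bar> > \<theta>' + JJ 0 + JJ K"
  shows "\<bar>real_of_int (pr (inv y u)) - m'\<bar> \<le> \<theta>' + 2 * K\<^sup>2"
proof (rule ccontr)
  assume neg: "\<not> ?thesis"
  define w where "w = gm (pr u)"
  define D where "D = dist u w"
  obtain c where c: "c 0 = u" "c D = w" "geod c D" using geod_exists[OF geo, of u w] unfolding D_def by metis
  have "\<bar>real_of_int (pr (inv y (c 0))) - real_of_int (pr (inv y (c D)))\<bar> > 2 * K\<^sup>2"
    using neg m'[of "pr u"] unfolding c w_def by linarith
  from pass[OF geod_isometry[OF isometry_inv[OF y] c(3)] this]
  obtain t where t: "0 \<le> t" "t \<le> D" "infdist (inv y (c t)) \<Gamma> \<le> K" by blast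
  define i where "i = pr (inv y (c t))"
  have di: "dist (c t) (y (gm i)) \<le> K"
    using near_pr[of "inv y (c t)"] t(3) isometry_inv_dist[OF y] unfolding near_def i_def by metis
  have "near (c t) (pr u)"
  proof (rule nearI)
    fix j
    have "dist u w \<le> dist u (gm j)" using near_pr[of u] infdist_le_gm[of u j] unfolding w_def near_def by simp
    also have "\<dots> \<le> dist u (c t) + dist (c t) (gm j)" by (rule dist_triangle)
    finally have "D \<le> t + dist (c t) (gm j)" using geod_dist[OF c(3), of 0 t] t c(1) by (simp add: D_def)
    moreover have "dist (c t) w = D - t" using geod_dist[OF c(3), of t D] t c(2) by simp
    ultimately show "dist (c t) (gm (pr u)) \<le> dist (c t) (gm j)" by (simp add: w_def)
  qed
  then have "\<bar>real_of_int (pr u) - real_of_int (pr (c t))\<bar> \<le> JJ 0" using near_pr_diff[of "c t" "pr u" "c t" 0] by simp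
  moreover have "\<bar>real_of_int (pr (c t)) - real_of_int (pr (y (gm i)))\<bar> \<le> JJ K" by (rule pr_lipschitz[OF di])
  ultimately show False using m[of i] u by linarith
qed

end

section \<open>Schottky elements\<close>

context wpd_orbit
begin

text \<open>\<open>\<theta>b\<close> is both threshold and bound in Behrstock's inequality outside
  \<open>E\<close>. \<open>\<theta>1\<close> also absorbs the replacement of a projection by its
  nominal index, \<open>\<Theta>\<close> is the precision at which exponents must be separated, and
  \<open>\<theta>2\<close> is an error that reproduces itself from one pivot to the next.\<close>

definition \<theta>b :: real where "\<theta>b = \<theta> + JJ 0 + JJ K + 2 * K\<^sup>2"
definition \<theta>1 :: real where "\<theta>1 = \<theta>b + \<theta> + JJ 0"
definition \<Theta> :: real where "\<Theta> = \<theta>1 + \<theta>b + \<theta> + JJ 0"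
definition \<theta>2 :: real where "\<theta>2 = \<theta>1 + 2 * JJ 0 + JJ K + 2 * K\<^sup>2"

lemma JJ0: "0 \<le> JJ 0" and JJK: "0 \<le> JJ K"
  using JJ_pos[of 0] JJ_pos[of K] K1 by auto

lemma K2: "0 \<le> K\<^sup>2" by simp

lemma behrstock_E:
  assumes y: "y \<in> G" "y \<notin> E" and u: "\<bar>real_of_int (pr u) - real_of_int (pr (y b))\<bar> > \<theta>b"
  shows "\<bar>real_of_int (pr (inv y u)) - real_of_int (pr (inv y b))\<bar> \<le> \<theta>b"
proof -
  have "inv y \<notin> E" using E_inv[of "inv y"] y G_bij[OF y(1)] by (auto simp: inv_inv_eq)
  moreover have "\<bar>real_of_int (pr u) - real_of_int (pr (y b))\<bar> > \<theta> + JJ 0 + JJ K"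
    using u K2 unfolding \<theta>b_def by linarith
  ultimately have "\<bar>real_of_int (pr (inv y u)) - real_of_int (pr (inv y b))\<bar> \<le> \<theta> + 2 * K\<^sup>2"
    using bounded_projection[OF y, of _ 0] bounded_projection[OF G_inv[OF y(1)], of _ 0]
    by (intro behrstock[OF G_iso[OF y(1)], where m = "real_of_int (pr (y b))"]) auto
  then show ?thesis using JJ0 JJK by (simp add: \<theta>b_def)
qed

end

text \<open>The integers \<open>M * i + \<sigma> * j\<close> with \<open>j < M\<close> are distinct,
  as in an expansion in base \<open>M\<close>. Scaled by \<open>U > 2 * \<Theta>\<close> they are so
  far apart that no two of them come within \<open>\<Theta>\<close> of the same point.\<close>

lemma sidon_unique:
  fixes U k \<Theta> :: real and i j i' j' M :: nat
  assumes U: "U > 2 * \<Theta>" "\<Theta> \<ge> 0" and \<sigma>: "\<sigma> = 1 \<or> \<sigma> = -1"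
    and a: "\<bar>U * real M * real i + \<sigma> * (U * real j) + k\<bar> \<le> \<Theta>" "j < M"
    and b: "\<bar>U * real M * real i' + \<sigma> * (U * real j') + k\<bar> \<le> \<Theta>" "j' < M"
  shows "i = i'" "j = j'"
proof -
  define z :: int where "z = int M * (int i - int i') + (if \<sigma> = 1 then 1 else -1) * (int j - int j')"
  have "U * real_of_int z = (U * real M * real i + \<sigma> * (U * real j) + k) - (U * real M * real i' + \<sigma> * (U * real j') + k)"
    using \<sigma> by (auto simp: z_def algebra_simps)
  then have "\<bar>U * real_of_int z\<bar> < U" using a b U by linarith
  then have "\<bar>real_of_int z\<bar> < 1" using U by (simp add: abs_mult)
  then have z: "z = 0" by linarith
  have "i = i'"
  proof (rule ccontr)
    assume "i \<noteq> i'"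
    then have "1 \<le> \<bar>int i - int i'\<bar>" by simp
    then have "int M \<le> \<bar>int M * (int i - int i')\<bar>" using mult_left_mono[of 1 "\<bar>int i - int i'\<bar>" "int M"] by (simp add: abs_mult)
    moreover have "\<bar>int j - int j'\<bar> < int M" using a b by auto
    ultimately show False using z by (auto simp: z_def split: if_splits)
  qed
  then show "i = i'" "j = j'" using z by (auto simp: z_def split: if_splits)
qed

lemma card_le_1I: "(\<And>a b. a \<in> A \<Longrightarrow> b \<in> A \<Longrightarrow> a = b) \<Longrightarrow> card A \<le> 1"
proof -
  assume *: "\<And>a b. a \<in> A \<Longrightarrow> b \<in> A \<Longrightarrow> a = b"
  show ?thesis
  proof (cases "A = {}")
    case False
    then obtain a where "a \<in> A" by blast
    then have "A = {a}" using * by blast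
    then show ?thesis by simp
  qed simp
qed

text \<open>\<open>p dvd U\<close> lets the powers of \<open>g\<close> at the ends of a Schottky
  element pass through elements of \<open>E\<close> up to sign. The bound on \<open>Rt\<close> makes
  the middle power longer than all error terms together.\<close>

locale schottky = wpd_orbit b g K G for b :: "'x::metric_space" and g K G +
  fixes x :: "'x \<Rightarrow> 'x" and p U Rt :: int and M :: nat
  assumes xG: "x \<in> G" and xE: "x \<notin> E" and p0: "0 < p" and pE: "\<And>y. y \<in> E \<Longrightarrow> commutes_upto_sign p y"
    and pU: "p dvd U" and U: "real_of_int U > 2 * \<Theta>" and M0: "0 < M"
    and Rt: "real_of_int Rt \<ge> 2 * real_of_int U * real M * real M + \<bar>real_of_int (pr (x b))\<bar> + \<bar>real_of_int (pr (inv x b))\<bar> + 4 * \<theta>2 + real Nw + 2 * K\<^sup>2 + 2"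
begin

text \<open>All \<open>ss j\<close> contain the same total power \<open>Rt\<close> of \<open>g\<close>, so they can lie in the support of one convolution
  power; the exponents at both ends are separated by \<open>U\<close>, so that a given word misaligns with either end
  for few \<open>j\<close> only.\<close>

definition lx :: "nat \<Rightarrow> int" where "lx j = U * int j"
definition ex :: "nat \<Rightarrow> int" where "ex j = U * int M * int j"
definition Rx :: "nat \<Rightarrow> int" where "Rx j = Rt - lx j - ex j"
definition sa :: "nat \<Rightarrow> 'x \<Rightarrow> 'x" where "sa j = ipow g (lx j) \<circ> x"
definition sb :: "nat \<Rightarrow> 'x \<Rightarrow> 'x" where "sb j = x \<circ> ipow g (ex j)"
definition ss :: "nat \<Rightarrow> 'x \<Rightarrow> 'x" where "ss j = sa j \<circ> ipow g (Rx j) \<circ> sb j"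
definition c1 :: real where "c1 = real_of_int (pr (x b))"
definition c2 :: real where "c2 = real_of_int (pr (inv x b))"

lemma csts: "0 \<le> \<theta>" "0 \<le> \<theta>b" "0 \<le> \<theta>1" "0 \<le> \<theta>2" "0 \<le> \<Theta>"
  using \<theta>_pos JJ0 JJK K2 by (simp_all add: \<theta>b_def \<theta>1_def \<theta>2_def \<Theta>_def)

lemma \<theta>2_ge: "\<theta>1 + JJ 0 + JJ 0 + JJ K \<le> \<theta>2" "\<theta>1 + JJ 0 + 2 * K\<^sup>2 \<le> \<theta>2" "\<theta> \<le> \<theta>2" "\<theta>1 + JJ 0 \<le> \<theta>2" "\<theta>1 \<le> \<theta>2"
  using csts JJ0 JJK K2 unfolding \<theta>2_def \<theta>1_def by linarith+

lemma U_pos: "0 < U" using U csts by linarith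

lemma Rx_ge: assumes "j < M" shows "real_of_int (Rx j) \<ge> \<bar>c1\<bar> + \<bar>c2\<bar> + 4 * \<theta>2 + real Nw + 2 * K\<^sup>2 + 2"
proof -
  have "U * int j \<le> U * int M" using assms U_pos by (intro mult_left_mono) auto
  moreover have "U * int M * 1 \<le> U * int M * int M" using M0 U_pos by (intro mult_left_mono) auto
  moreover have "U * int M * int j \<le> U * int M * int M" using assms U_pos by (intro mult_left_mono) auto
  ultimately have "lx j + ex j \<le> 2 * U * int M * int M" by (simp add: lx_def ex_def)
  then have "real_of_int (lx j + ex j) \<le> real_of_int (2 * U * int M * int M)" by linarith
  then show ?thesis using Rt by (simp add: Rx_def c1_def c2_def)
qed

lemma inG [simp]: "sa j \<in> G" "sb j \<in> G" "ss j \<in> G" "x \<in> G" "inv x \<in> G"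
  using xG by (auto simp: sa_def sb_def ss_def intro!: G_comp G_ipow G_inv)

lemma inv_comp: "f \<in> G \<Longrightarrow> h \<in> G \<Longrightarrow> inv (f \<circ> h) = inv h \<circ> inv f"
  using G_bij by (simp add: o_inv_distrib)

lemma inv_app [simp]: "f \<in> G \<Longrightarrow> inv f (f z) = z" "f \<in> G \<Longrightarrow> f (inv f z) = z"
  using G_bij by (simp_all add: bij_is_inj bij_is_surj surj_f_inv_f)

lemma inv_sa: "inv (sa j) = inv x \<circ> ipow g (- lx j)"
  unfolding sa_def using inv_comp[OF G_ipow xG] ipow_inv[OF bij_g] by simp

lemma inv_sb: "inv (sb j) = ipow g (- ex j) \<circ> inv x"
  unfolding sb_def using inv_comp[OF xG G_ipow] ipow_inv[OF bij_g] by simp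

lemma E_cancel_left: assumes "f \<in> E" "h \<in> G" "f \<circ> h \<in> E" shows "h \<in> E"
proof -
  have "inv f \<circ> (f \<circ> h) = h" using E_G[OF assms(1)] by (simp add: fun_eq_iff)
  then show ?thesis using E_comp[OF E_inv[OF assms(1)] assms(3)] by simp
qed

lemma inv_xE: "inv x \<notin> E"
  using E_inv[of "inv x"] xE G_bij[OF xG] by (auto simp: inv_inv_eq)

lemma saE: "sa j \<notin> E" using E_cancel_left[OF E_ipow xG] xE unfolding sa_def by blast
lemma inv_sbE: "inv (sb j) \<notin> E" using E_cancel_left[OF E_ipow G_inv[OF xG]] inv_xE unfolding inv_sb by blast

lemma pr_sa: "\<bar>real_of_int (pr (sa j (gm t))) - (real_of_int (lx j) + c1)\<bar> \<le> \<theta> + JJ 0"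
  using pr_shift[of "lx j" "x (gm t)"] bounded_projection[OF xG xE, of t 0] by (simp add: sa_def c1_def)

lemma pr_inv_sb: "\<bar>real_of_int (pr (inv (sb j) (gm t))) - (- real_of_int (ex j) + c2)\<bar> \<le> \<theta> + JJ 0"
  using pr_shift[of "- ex j" "inv x (gm t)"] bounded_projection[OF G_inv[OF xG] inv_xE, of t 0] by (simp add: inv_sb c2_def)

lemma pr_inv_sa_b: "\<bar>real_of_int (pr (inv (sa j) b)) - c2\<bar> \<le> \<theta>"
  using bounded_projection[OF G_inv[OF xG] inv_xE, of "- lx j" 0] gm_shift[of "- lx j" 0] by (simp add: inv_sa c2_def)

lemma pr_sb_b: "\<bar>real_of_int (pr (sb j b)) - c1\<bar> \<le> \<theta>"
  using bounded_projection[OF xG xE, of "ex j" 0] gm_shift[of "ex j" 0] by (simp add: sb_def c1_def)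

lemma left_single:
  assumes "\<bar>real_of_int (pr u) - (real_of_int (lx j) + c1)\<bar> > \<theta>1"
  shows "\<bar>real_of_int (pr (inv (sa j) u)) - c2\<bar> \<le> \<theta>1"
proof -
  have "\<bar>real_of_int (pr u) - real_of_int (pr (sa j b))\<bar> > \<theta>b"
    using assms pr_sa[of j 0] by (simp add: \<theta>1_def)
  from behrstock_E[OF inG(1) saE this] show ?thesis using pr_inv_sa_b[of j] JJ0 by (simp add: \<theta>1_def)
qed

lemma right_single:
  assumes "\<bar>real_of_int (pr u) - (- real_of_int (ex j) + c2)\<bar> > \<theta>1"
  shows "\<bar>real_of_int (pr (sb j u)) - c1\<bar> \<le> \<theta>1"
proof -
  have "\<bar>real_of_int (pr u) - real_of_int (pr (inv (sb j) b))\<bar> > \<theta>b"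
    using assms pr_inv_sb[of j 0] by (simp add: \<theta>1_def)
  from behrstock_E[OF G_inv[OF inG(2)] inv_sbE this] show ?thesis
    using pr_sb_b[of j] JJ0 G_bij[OF inG(2), of j] by (simp add: \<theta>1_def inv_inv_eq)
qed

text \<open>Inside a Schottky element the middle power of \<open>g\<close> travels along a
  translated axis. \<open>Rend\<close> says that the point reached after the word \<open>v\<close>
  projects near the end of this segment, \<open>Lend\<close> that the point before \<open>v\<close>
  projects near its start, and \<open>aligned\<close> says both for the entire axes of two Schottky
  elements separated by \<open>v\<close>.\<close>

definition Rend :: "('x \<Rightarrow> 'x) \<Rightarrow> nat \<Rightarrow> bool" where
  "Rend v i \<longleftrightarrow> \<bar>real_of_int (pr (sb i (v b))) - c1\<bar> \<le> \<theta>1"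
definition Lend :: "('x \<Rightarrow> 'x) \<Rightarrow> nat \<Rightarrow> bool" where
  "Lend v j \<longleftrightarrow> \<bar>real_of_int (pr (inv (sa j) (inv v b))) - c2\<bar> \<le> \<theta>1"
definition aligned :: "('x \<Rightarrow> 'x) \<Rightarrow> nat \<Rightarrow> nat \<Rightarrow> bool" where
  "aligned v i j \<longleftrightarrow> (\<forall>t. \<bar>real_of_int (pr (sb i (v (sa j (gm t))))) - c1\<bar> \<le> \<theta>1) \<and>
     (\<forall>t. \<bar>real_of_int (pr (inv (sa j) (inv v (inv (sb i) (gm t))))) - c2\<bar> \<le> \<theta>1)"

text \<open>For \<open>v\<close> outside \<open>E\<close>, Behrstock's inequality for
  \<open>v\<close> itself determines where distant axes are sent, and each side loses at most one
  index. For \<open>v\<close> in \<open>E\<close> the end powers move through \<open>v\<close>, so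
  misalignment depends on the pair \<open>(i, j)\<close>; by the separation of exponents it occurs
  for at most one pair, whose coordinates are discarded. The two directions of alignment and the
  condition at the basepoint exclude at most three indices on each side.\<close>

lemma exists_bad_sets:
  assumes v: "v \<in> G"
  shows "\<exists>BR BL. finite BR \<and> finite BL \<and> card BR \<le> 3 \<and> card BL \<le> 3 \<and> (\<forall>i<M. i \<notin> BR \<longrightarrow> Rend v i) \<and> (\<forall>j<M. j \<notin> BL \<longrightarrow> Lend v j) \<and>
     (\<forall>i<M. \<forall>j<M. i \<notin> BR \<longrightarrow> j \<notin> BL \<longrightarrow> aligned v i j)"
proof -
  define k k' where "k = real_of_int (pr (v b))" and "k' = real_of_int (pr (inv v b))"
  define BR0 where "BR0 = {i. i < M \<and> \<bar>k + real_of_int (ex i) - c2\<bar> \<le> \<Theta>}"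
  define BL0 where "BL0 = {j. j < M \<and> \<bar>k' - real_of_int (lx j) - c1\<bar> \<le> \<Theta>}"
  have finBR0: "finite BR0" and finBL0: "finite BL0" by (simp_all add: BR0_def BL0_def)
  have BR0: "card BR0 \<le> 1"
  proof (rule card_le_1I)
    fix i i' assume "i \<in> BR0" "i' \<in> BR0"
    then show "i = i'"
      using sidon_unique(1)[of \<Theta> "real_of_int U" 1 M i 0 "k - c2" i' 0] U csts M0 by (simp add: BR0_def ex_def algebra_simps)
  qed
  have BL0: "card BL0 \<le> 1"
  proof (rule card_le_1I)
    fix i i' assume "i \<in> BL0" "i' \<in> BL0"
    then show "i = i'"
      using sidon_unique(2)[of \<Theta> "real_of_int U" "-1" M 0 i "k' - c1" 0 i'] U csts M0 by (simp add: BL0_def lx_def algebra_simps)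
  qed
  have \<Theta>1: "\<theta>1 \<le> \<Theta>" using csts JJ0 by (simp add: \<Theta>_def)
  have R0: "Rend v i" if "i < M" "i \<notin> BR0" for i
    unfolding Rend_def using that \<Theta>1 by (intro right_single) (auto simp: BR0_def k_def)
  have L0: "Lend v j" if "j < M" "j \<notin> BL0" for j
    unfolding Lend_def using that \<Theta>1 by (intro left_single) (auto simp: BL0_def k'_def)
  show ?thesis
  proof (cases "v \<in> E")
    case False
    have nE: "inv v \<notin> E" using E_inv[of "inv v"] False G_bij[OF v] by (auto simp: inv_inv_eq)
    have "aligned v i j" if "i < M" "j < M" "i \<notin> BR0" "j \<notin> BL0" for i j
    proof -
      have i: "\<bar>k + real_of_int (ex i) - c2\<bar> > \<Theta>" and j: "\<bar>k' - real_of_int (lx j) - c1\<bar> > \<Theta>"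
        using that by (auto simp: BR0_def BL0_def)
      have "\<bar>real_of_int (pr (sb i (v (sa j (gm t))))) - c1\<bar> \<le> \<theta>1" for t
      proof (rule right_single)
        have "\<bar>real_of_int (pr (sa j (gm t))) - real_of_int (pr (inv v b))\<bar> > \<theta>b"
          using pr_sa[of j t] j csts by (simp add: \<Theta>_def k'_def)
        from behrstock_E[OF G_inv[OF v] nE this]
        have "\<bar>real_of_int (pr (v (sa j (gm t)))) - k\<bar> \<le> \<theta>b" by (simp add: inv_inv_eq G_bij[OF v] k_def)
        then show "\<bar>real_of_int (pr (v (sa j (gm t)))) - (- real_of_int (ex i) + c2)\<bar> > \<theta>1"
          using i csts JJ0 by (simp add: \<Theta>_def)
      qed
      moreover have "\<bar>real_of_int (pr (inv (sa j) (inv v (inv (sb i) (gm t))))) - c2\<bar> \<le> \<theta>1" for t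
      proof (rule left_single)
        have "\<bar>real_of_int (pr (inv (sb i) (gm t))) - real_of_int (pr (v b))\<bar> > \<theta>b"
          using pr_inv_sb[of i t] i csts by (simp add: \<Theta>_def k_def)
        from behrstock_E[OF v False this]
        have "\<bar>real_of_int (pr (inv v (inv (sb i) (gm t)))) - k'\<bar> \<le> \<theta>b" by (simp add: k'_def)
        then show "\<bar>real_of_int (pr (inv v (inv (sb i) (gm t)))) - (real_of_int (lx j) + c1)\<bar> > \<theta>1"
          using j csts JJ0 by (simp add: \<Theta>_def)
      qed
      ultimately show ?thesis unfolding aligned_def by blast
    qed
    then show ?thesis using BR0 BL0 R0 L0 finBR0 finBL0 by (intro exI[of _ BR0] exI[of _ BL0]) auto
  next
    case True
    obtain \<sigma> where \<sigma>: "\<sigma> = 1 \<or> \<sigma> = -1" "\<And>k. v \<circ> ipow g (p * k) = ipow g (\<sigma> * p * k) \<circ> v"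
      using pE[OF True] unfolding commutes_upto_sign_def by blast
    obtain \<sigma>' where \<sigma>': "\<sigma>' = 1 \<or> \<sigma>' = -1" "\<And>k. inv v \<circ> ipow g (p * k) = ipow g (\<sigma>' * p * k) \<circ> inv v"
      using pE[OF E_inv[OF True]] unfolding commutes_upto_sign_def by blast
    obtain U' where U': "U = p * U'" using pU by (auto simp: dvd_def)
    have Ul: "p * (U' * int j) = lx j" "p * (- (U' * int M * int j)) = - ex j" for j
      unfolding ex_def lx_def by (simp_all add: U' mult.assoc)
    define r r' where "r = real_of_int \<sigma>" and "r' = real_of_int \<sigma>'"
    have rr: "r = 1 \<or> r = -1" "r' = 1 \<or> r' = -1" using \<sigma>(1) \<sigma>'(1) by (auto simp: r_def r'_def)
    have nE1: "v \<circ> x \<notin> E" using E_cancel_left[OF True xG] xE by blast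
    have nE2: "inv v \<circ> inv x \<notin> E" using E_cancel_left[OF E_inv[OF True] G_inv[OF xG]] inv_xE by blast
    define k1 k2 where "k1 = real_of_int (pr (v (x b)))" and "k2 = real_of_int (pr (inv v (inv x b)))"
    have p1: "\<bar>real_of_int (pr (v (sa j (gm t)))) - (r * real_of_int (lx j) + k1)\<bar> \<le> \<theta> + JJ 0" for j t
    proof -
      have "v (sa j (gm t)) = ipow g (\<sigma> * lx j) (v (x (gm t)))"
        using fun_cong[OF \<sigma>(2)[of "U' * int j"], of "x (gm t)"] Ul[of j] by (simp add: sa_def mult.assoc)
      then show ?thesis
        using pr_shift[of "\<sigma> * lx j" "v (x (gm t))"] bounded_projection[OF G_comp[OF v xG] nE1, of t 0] by (simp add: k1_def r_def)
    qed
    have p2: "\<bar>real_of_int (pr (inv v (inv (sb i) (gm t)))) - (- r' * real_of_int (ex i) + k2)\<bar> \<le> \<theta> + JJ 0" for i t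
    proof -
      have "inv v (inv (sb i) (gm t)) = ipow g (- \<sigma>' * ex i) (inv v (inv x (gm t)))"
        using fun_cong[OF \<sigma>'(2)[of "- (U' * int M * int i)"], of "inv x (gm t)"]
        unfolding mult.assoc[of \<sigma>'] Ul by (simp add: inv_sb)
      then show ?thesis
        using pr_shift[of "- \<sigma>' * ex i" "inv v (inv x (gm t))"] bounded_projection[OF G_comp[OF G_inv[OF v] G_inv[OF xG]] nE2, of t 0]
        by (simp add: k2_def r'_def)
    qed
    define P1 where "P1 i j \<longleftrightarrow> j < M \<and> i < M \<and> \<bar>r * real_of_int (lx j) + k1 + real_of_int (ex i) - c2\<bar> \<le> \<Theta>" for i j
    define P2 where "P2 i j \<longleftrightarrow> j < M \<and> i < M \<and> \<bar>- r' * real_of_int (ex i) + k2 - real_of_int (lx j) - c1\<bar> \<le> \<Theta>" for i j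
    have P1: "i = i' \<and> j = j'" if "P1 i j" "P1 i' j'" for i j i' j'
      using sidon_unique[of \<Theta> "real_of_int U" r M i j "k1 - c2" i' j'] that U csts rr
      by (auto simp: P1_def lx_def ex_def algebra_simps)
    have P2': "P2 i j \<longleftrightarrow> j < M \<and> i < M \<and> \<bar>real_of_int (ex i) + r' * real_of_int (lx j) + (- r' * (k2 - c1))\<bar> \<le> \<Theta>" for i j
    proof -
      have "- r' * (- r' * real_of_int (ex i) + k2 - real_of_int (lx j) - c1) = real_of_int (ex i) + r' * real_of_int (lx j) + (- r' * (k2 - c1))"
        using rr(2) by auto
      moreover have "\<bar>- r' * z\<bar> = \<bar>z\<bar>" for z using rr(2) by auto
      ultimately show ?thesis unfolding P2_def by metis
    qed
    have P2: "i = i' \<and> j = j'" if "P2 i j" "P2 i' j'" for i j i' j'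
      using sidon_unique[of \<Theta> "real_of_int U" r' M i j "- r' * (k2 - c1)" i' j'] that U csts rr
      unfolding P2' by (auto simp: lx_def ex_def mult.assoc)
    define BR where "BR = BR0 \<union> {i. \<exists>j. P1 i j} \<union> {i. \<exists>j. P2 i j}"
    define BL where "BL = BL0 \<union> {j. \<exists>i. P1 i j} \<union> {j. \<exists>i. P2 i j}"
    have "card {i. \<exists>j. P1 i j} \<le> 1" "card {i. \<exists>j. P2 i j} \<le> 1" "card {j. \<exists>i. P1 i j} \<le> 1" "card {j. \<exists>i. P2 i j} \<le> 1"
      by (rule card_le_1I, use P1 P2 in blast)+
    then have cards: "card BR \<le> 3" "card BL \<le> 3" unfolding BR_def BL_def
      using BR0 BL0 card_Un_le[of BR0 "{i. \<exists>j. P1 i j}"] card_Un_le[of "BR0 \<union> {i. \<exists>j. P1 i j}" "{i. \<exists>j. P2 i j}"]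
        card_Un_le[of BL0 "{j. \<exists>i. P1 i j}"] card_Un_le[of "BL0 \<union> {j. \<exists>i. P1 i j}" "{j. \<exists>i. P2 i j}"] by linarith+
    have "aligned v i j" if "i < M" "j < M" "i \<notin> BR" "j \<notin> BL" for i j
    proof -
      have n1: "\<bar>r * real_of_int (lx j) + k1 + real_of_int (ex i) - c2\<bar> > \<Theta>"
        and n2: "\<bar>- r' * real_of_int (ex i) + k2 - real_of_int (lx j) - c1\<bar> > \<Theta>"
        using that unfolding BR_def P1_def P2_def by auto
      have "\<bar>real_of_int (pr (sb i (v (sa j (gm t))))) - c1\<bar> \<le> \<theta>1" for t
        using p1[of j t] n1 csts by (intro right_single) (simp add: \<Theta>_def)
      moreover have "\<bar>real_of_int (pr (inv (sa j) (inv v (inv (sb i) (gm t))))) - c2\<bar> \<le> \<theta>1" for t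
        using p2[of i t] n2 csts by (intro left_single) (simp add: \<Theta>_def)
      ultimately show ?thesis unfolding aligned_def by blast
    qed
    moreover have "BR \<subseteq> {..<M}" "BL \<subseteq> {..<M}" by (auto simp: BR_def BL_def BR0_def BL0_def P1_def P2_def)
    then have "finite BR" "finite BL" using finite_subset by blast+
    ultimately show ?thesis using cards R0 L0 by (intro exI[of _ BR] exI[of _ BL]) (auto simp: BR_def BL_def)
  qed
qed

text \<open>The excluded sets are functions of the word alone, so a test of an index reveals only
  whether it belongs to a set fixed beforehand.\<close>

definition bad :: "('x \<Rightarrow> 'x) \<Rightarrow> nat set \<times> nat set" where
  "bad v = (SOME (BR, BL). finite BR \<and> finite BL \<and> card BR \<le> 3 \<and> card BL \<le> 3 \<and> (\<forall>i<M. i \<notin> BR \<longrightarrow> Rend v i) \<and> (\<forall>j<M. j \<notin> BL \<longrightarrow> Lend v j) \<and>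
     (\<forall>i<M. \<forall>j<M. i \<notin> BR \<longrightarrow> j \<notin> BL \<longrightarrow> aligned v i j))"
definition BR :: "('x \<Rightarrow> 'x) \<Rightarrow> nat set" where "BR v = fst (bad v) \<inter> {..<M}"
definition BL :: "('x \<Rightarrow> 'x) \<Rightarrow> nat set" where "BL v = snd (bad v) \<inter> {..<M}"

lemma bad_sets:
  assumes v: "v \<in> G"
  shows "finite (BR v)" "finite (BL v)" "card (BR v) \<le> 3" "card (BL v) \<le> 3" "\<And>i. i < M \<Longrightarrow> i \<notin> BR v \<Longrightarrow> Rend v i" "\<And>j. j < M \<Longrightarrow> j \<notin> BL v \<Longrightarrow> Lend v j"
    "\<And>i j. i < M \<Longrightarrow> j < M \<Longrightarrow> i \<notin> BR v \<Longrightarrow> j \<notin> BL v \<Longrightarrow> aligned v i j"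
proof -
  have "\<exists>B. case B of (X, Y) \<Rightarrow> finite X \<and> finite Y \<and> card X \<le> 3 \<and> card Y \<le> 3 \<and> (\<forall>i<M. i \<notin> X \<longrightarrow> Rend v i) \<and> (\<forall>j<M. j \<notin> Y \<longrightarrow> Lend v j) \<and>
     (\<forall>i<M. \<forall>j<M. i \<notin> X \<longrightarrow> j \<notin> Y \<longrightarrow> aligned v i j)"
    using exists_bad_sets[OF v] by auto
  from someI_ex[OF this, folded bad_def]
  have *: "finite (fst (bad v))" "finite (snd (bad v))" "card (fst (bad v)) \<le> 3" "card (snd (bad v)) \<le> 3" "\<forall>i<M. i \<notin> fst (bad v) \<longrightarrow> Rend v i" "\<forall>j<M. j \<notin> snd (bad v) \<longrightarrow> Lend v j"
     "\<forall>i<M. \<forall>j<M. i \<notin> fst (bad v) \<longrightarrow> j \<notin> snd (bad v) \<longrightarrow> aligned v i j"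
    by (auto simp: case_prod_beta)
  show "finite (BR v)" "finite (BL v)" by (auto simp: BR_def BL_def)
  show "card (BR v) \<le> 3" using *(1,3) card_mono[of "fst (bad v)" "BR v"] by (auto simp: BR_def)
  show "card (BL v) \<le> 3" using *(2,4) card_mono[of "snd (bad v)" "BL v"] by (auto simp: BL_def)
  show "\<And>i. i < M \<Longrightarrow> i \<notin> BR v \<Longrightarrow> Rend v i" "\<And>j. j < M \<Longrightarrow> j \<notin> BL v \<Longrightarrow> Lend v j"
    "\<And>i j. i < M \<Longrightarrow> j < M \<Longrightarrow> i \<notin> BR v \<Longrightarrow> j \<notin> BL v \<Longrightarrow> aligned v i j"
    using *(5-7) by (auto simp: BR_def BL_def)
qed

text \<open>A list of pairs \<open>(j, v)\<close>, last pair first, encodes the product \<open>v\<^sub>1 s\<^sub>1 v\<^sub>2 s\<^sub>2 \<cdots> v\<^sub>r s\<^sub>r\<close> with \<open>s\<^sub>i\<close> a Schottky element.\<close>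

fun pos :: "(nat \<times> ('x \<Rightarrow> 'x)) list \<Rightarrow> ('x \<Rightarrow> 'x)" where
  "pos [] = id"
| "pos ((j, v) # st) = pos st \<circ> v \<circ> ss j"

fun base :: "(nat \<times> ('x \<Rightarrow> 'x)) list \<Rightarrow> ('x \<Rightarrow> 'x)" where
  "base [] = id"
| "base ((j, v) # st) = pos st \<circ> v"

fun fr :: "(nat \<times> ('x \<Rightarrow> 'x)) list \<Rightarrow> ('x \<Rightarrow> 'x)" where
  "fr [] = id"
| "fr ((j, v) # st) = pos st \<circ> v \<circ> sa j"

fun chain :: "(nat \<times> ('x \<Rightarrow> 'x)) list \<Rightarrow> bool" where
  "chain [] \<longleftrightarrow> True"
| "chain [(j, v)] \<longleftrightarrow> j < M \<and> v \<in> G \<and> j \<notin> BL v"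
| "chain ((j, v) # (i, w) # st) \<longleftrightarrow> j < M \<and> v \<in> G \<and> j \<notin> BL v \<and> i \<notin> BR v \<and> chain ((i, w) # st)"

section \<open>Projections along a chain of aligned Schottky elements\<close>

lemma chain_tl: "chain (e # st) \<Longrightarrow> chain st"
  by (cases e; cases st) auto

lemma chain_hd: "chain ((j, v) # st) \<Longrightarrow> j < M \<and> v \<in> G \<and> j \<notin> BL v"
  by (cases st) auto

lemma chain_append: "chain (st1 @ s2) \<Longrightarrow> chain s2"
  by (induct st1) (auto dest: chain_tl)

lemma pos_G: "chain st \<Longrightarrow> pos st \<in> G"
  by (induct st rule: pos.induct) (auto intro!: G_comp G_id dest: chain_tl chain_hd)

lemma fr_G: "chain st \<Longrightarrow> fr st \<in> G"
  by (cases st rule: fr.cases) (auto intro!: G_comp G_id pos_G dest: chain_tl chain_hd)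

lemma base_G: "chain st \<Longrightarrow> base st \<in> G"
  by (cases st rule: fr.cases) (auto intro!: G_comp G_id pos_G dest: chain_tl chain_hd)

text \<open>The axis belonging to the top entry is the image of the orbit under
  \<open>fr st\<close>, and the word follows it from index about \<open>c2\<close> to index about
  \<open>Rx j + c1\<close>. The predicates express, by projection to this axis, that
  \<open>u\<close> lies before the segment or beyond it.\<close>

definition nearstart :: "(nat \<times> ('x \<Rightarrow> 'x)) list \<Rightarrow> 'x \<Rightarrow> bool" where
  "nearstart st u \<longleftrightarrow> \<bar>real_of_int (pr (inv (fr st) u)) - c2\<bar> \<le> \<theta>2"
definition nearend :: "(nat \<times> ('x \<Rightarrow> 'x)) list \<Rightarrow> 'x \<Rightarrow> bool" where
  "nearend st u \<longleftrightarrow> \<bar>real_of_int (pr (inv (fr st) u)) - (real_of_int (Rx (fst (hd st))) + c1)\<bar> \<le> \<theta>2"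

definition link :: "nat \<Rightarrow> ('x \<Rightarrow> 'x) \<Rightarrow> nat \<Rightarrow> ('x \<Rightarrow> 'x)" where
  "link i v j = ipow g (Rx i) \<circ> sb i \<circ> v \<circ> sa j"

lemma link_G: "v \<in> G \<Longrightarrow> link i v j \<in> G"
  by (simp add: link_def G_comp G_ipow)

lemma fr_link: "fr ((j, v) # (i, w) # st) = fr ((i, w) # st) \<circ> link i v j"
  by (simp add: link_def ss_def comp_assoc)

lemma inv_fr_link:
  assumes "chain ((j, v) # (i, w) # st)"
  shows "inv (fr ((j, v) # (i, w) # st)) u = inv (link i v j) (inv (fr ((i, w) # st)) u)"
proof -
  have "fr ((i, w) # st) \<in> G" "link i v j \<in> G" using assms fr_G chain_tl link_G chain_hd by blast+
  then show ?thesis unfolding fr_link by (simp add: inv_comp)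
qed

lemma link_projections:
  assumes "aligned v i j" "v \<in> G"
  shows "\<bar>real_of_int (pr (link i v j (gm t))) - (real_of_int (Rx i) + c1)\<bar> \<le> \<theta>1 + JJ 0"
    "\<bar>real_of_int (pr (inv (link i v j) (gm t))) - c2\<bar> \<le> \<theta>1 + JJ 0"
proof -
  have "\<bar>real_of_int (pr (sb i (v (sa j (gm t))))) - c1\<bar> \<le> \<theta>1" using assms(1) by (simp add: aligned_def)
  then show "\<bar>real_of_int (pr (link i v j (gm t))) - (real_of_int (Rx i) + c1)\<bar> \<le> \<theta>1 + JJ 0"
    using pr_shift[of "Rx i" "sb i (v (sa j (gm t)))"] by (simp add: link_def)
  have "inv (link i v j) = inv (sa j) \<circ> inv v \<circ> inv (sb i) \<circ> ipow g (- Rx i)"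
    unfolding link_def using assms(2) by (simp add: inv_comp G_comp G_ipow ipow_inv[OF bij_g] comp_assoc)
  then have "inv (link i v j) (gm t) = inv (sa j) (inv v (inv (sb i) (gm (t - Rx i))))" by (simp add: gm_shift)
  then show "\<bar>real_of_int (pr (inv (link i v j) (gm t))) - c2\<bar> \<le> \<theta>1 + JJ 0"
    using assms(1) JJ0 unfolding aligned_def by (metis add_increasing2 order_trans add.commute add_left_mono add_0_right)
qed

text \<open>A point projecting near the start of the lower segment is far from its end, since
  \<open>Rx i\<close> exceeds all errors. The next axis projects near that end, so Behrstock's
  inequality puts the point near the start of the next segment, again with error
  \<open>\<theta>2\<close>; hence the step can be iterated.\<close>

lemma step_up:
  assumes c: "chain ((j, v) # (i, w) # st)" and u: "nearstart ((i, w) # st) u"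
  shows "nearstart ((j, v) # (i, w) # st) u"
proof -
  have h: "v \<in> G" "i < M" "j < M" "i \<notin> BR v" "j \<notin> BL v" using c chain_hd[of i w st] by auto
  have al: "aligned v i j" using bad_sets(7)[OF h(1)] h by blast
  have "\<bar>real_of_int (pr (inv (link i v j) (inv (fr ((i, w) # st)) u))) - c2\<bar> \<le> (\<theta>1 + JJ 0) + 2 * K\<^sup>2"
  proof (rule behrstock[OF G_iso[OF link_G[OF h(1)]] link_projections[OF al h(1)]])
    show "\<theta>1 + JJ 0 + JJ 0 + JJ K < \<bar>real_of_int (pr (inv (fr ((i, w) # st)) u)) - (real_of_int (Rx i) + c1)\<bar>"
      using u Rx_ge[OF h(2)] csts(4) K2 \<theta>2_ge(1) unfolding nearstart_def by linarith
  qed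
  then show ?thesis unfolding nearstart_def inv_fr_link[OF c] using \<theta>2_ge(2) by linarith
qed

lemma step_down:
  assumes c: "chain ((j, v) # (i, w) # st)" and u: "nearend ((j, v) # (i, w) # st) u"
  shows "nearend ((i, w) # st) u"
proof -
  have h: "v \<in> G" "i < M" "j < M" "i \<notin> BR v" "j \<notin> BL v" using c chain_hd[of i w st] by auto
  have al: "aligned v i j" using bad_sets(7)[OF h(1)] h by blast
  let ?y = "link i v j"
  have yG: "?y \<in> G" by (rule link_G[OF h(1)])
  have ii: "inv (inv ?y) = ?y" using G_bij[OF yG] by (rule inv_inv_eq)
  have "\<bar>real_of_int (pr (inv (inv ?y) (inv (fr ((j, v) # (i, w) # st)) u))) - (real_of_int (Rx i) + c1)\<bar> \<le> (\<theta>1 + JJ 0) + 2 * K\<^sup>2"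
  proof (rule behrstock[OF G_iso[OF G_inv[OF yG]], where m = c2])
    show "\<theta>1 + JJ 0 + JJ 0 + JJ K < \<bar>real_of_int (pr (inv (fr ((j, v) # (i, w) # st)) u)) - c2\<bar>"
      using u Rx_ge[OF h(3)] csts(4) K2 \<theta>2_ge(1) unfolding nearend_def list.sel fst_conv by linarith
  qed (use link_projections[OF al h(1)] in \<open>simp_all add: ii\<close>)
  then have "\<bar>real_of_int (pr (inv (fr ((i, w) # st)) u)) - (real_of_int (Rx i) + c1)\<bar> \<le> \<theta>1 + JJ 0 + 2 * K\<^sup>2"
    unfolding ii inv_fr_link[OF c] inv_app(2)[OF yG] .
  then show ?thesis unfolding nearend_def list.sel fst_conv using \<theta>2_ge(2) by linarith
qed

lemma nearstart_append:
  "chain (st1 @ s2) \<Longrightarrow> s2 \<noteq> [] \<Longrightarrow> nearstart s2 u \<Longrightarrow> nearstart (st1 @ s2) u"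
proof (induct st1)
  case (Cons e st1)
  then have IH: "nearstart (st1 @ s2) u" using chain_tl by auto
  obtain i w st where "st1 @ s2 = (i, w) # st" using Cons(3) by (metis append_is_Nil_conv neq_Nil_conv surj_pair)
  then show ?case using step_up[of "fst e" "snd e" i w st u] Cons(2) IH by simp
qed simp

lemma nearend_append:
  "chain (st1 @ s2) \<Longrightarrow> s2 \<noteq> [] \<Longrightarrow> nearend (st1 @ s2) u \<Longrightarrow> nearend s2 u"
proof (induct st1)
  case (Cons e st1)
  obtain i w st where e: "st1 @ s2 = (i, w) # st" using Cons(3) by (metis append_is_Nil_conv neq_Nil_conv surj_pair)
  then have "nearend (st1 @ s2) u" using step_down[of "fst e" "snd e" i w st u] Cons(2,4) by simp
  then show ?case using Cons chain_tl by auto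
qed simp

lemma nearstart_b:
  assumes "chain st" "st \<noteq> []" shows "nearstart st b"
proof -
  obtain st1 j v where st: "st = st1 @ [(j, v)]" using assms(2) by (metis rev_exhaust surj_pair)
  have c: "chain [(j, v)]" using assms(1) chain_append st by blast
  then have v: "v \<in> G" "j < M" "j \<notin> BL v" by auto
  have "inv (fr [(j, v)]) b = inv (sa j) (inv v b)" using v by (simp add: inv_comp)
  then have "nearstart [(j, v)] b" unfolding nearstart_def
    using bad_sets(6)[OF v] \<theta>2_ge(5) unfolding Lend_def by simp
  then show ?thesis using nearstart_append assms(1) unfolding st by blast
qed

lemma nearend_pos:
  assumes c: "chain ((i, w) # st)" and v: "v \<in> G" "i \<notin> BR v"
  shows "nearend ((i, w) # st) (pos ((i, w) # st) (v b))"
proof -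
  have i: "i < M" using chain_hd[OF c] by simp
  have f: "fr ((i, w) # st) \<in> G" using fr_G[OF c] .
  have "pos ((i, w) # st) (v b) = fr ((i, w) # st) (ipow g (Rx i) (sb i (v b)))" by (simp add: ss_def)
  then have "inv (fr ((i, w) # st)) (pos ((i, w) # st) (v b)) = ipow g (Rx i) (sb i (v b))" using inv_app(1)[OF f] by simp
  then show ?thesis unfolding nearend_def
    using pr_shift[of "Rx i" "sb i (v b)"] bad_sets(5)[OF v(1) i v(2)] \<theta>2_ge(4) unfolding Rend_def by simp
qed

lemma nearend_base:
  assumes c: "chain (st1 @ s2)" "s2 \<noteq> []" "st1 \<noteq> []"
  shows "nearend s2 (base (st1 @ s2) b)"
proof -
  obtain j v t where st1: "st1 = (j, v) # t" using assms(3) by (metis neq_Nil_conv surj_pair)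
  obtain i w s where e: "t @ s2 = (i, w) # s" using c(2) by (metis append_is_Nil_conv neq_Nil_conv surj_pair)
  have c': "chain ((j, v) # (i, w) # s)" using c(1) by (simp add: st1 e)
  have "nearend ((i, w) # s) (pos ((i, w) # s) (v b))" using c' by (intro nearend_pos) auto
  then have "nearend (t @ s2) (base (st1 @ s2) b)" by (simp add: st1 e)
  then show ?thesis using nearend_append[of t s2] c chain_tl by (auto simp: st1)
qed

lemma nearend_final:
  assumes c: "chain (st1 @ s2)" "s2 \<noteq> []" and v: "v \<in> G" "fst (hd (st1 @ s2)) \<notin> BR v"
  shows "nearend s2 (pos (st1 @ s2) (v b))"
proof -
  obtain i w s where e: "st1 @ s2 = (i, w) # s" using c(2) by (metis append_is_Nil_conv neq_Nil_conv surj_pair)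
  have "nearend (st1 @ s2) (pos (st1 @ s2) (v b))" unfolding e using c(1) v unfolding e by (intro nearend_pos) auto
  then show ?thesis using nearend_append[OF c] by blast
qed

section \<open>Geodesics past a pivot and the candidates for its position\<close>

definition l0 :: int where "l0 = \<lceil>c2 + \<theta>2\<rceil>"
definition ca :: real where "ca = (\<Sum>j<M. dist b (sa j (gm l0)))"

lemma ca_ge: "j < M \<Longrightarrow> dist b (sa j (gm l0)) \<le> ca"
  unfolding ca_def by (rule member_le_sum) auto

text \<open>Index \<open>l0\<close> lies past the start of the segment, and the size of
  \<open>Rx\<close> puts \<open>l0 + Nw\<close> before its end, so the Morse property reaches both.
  Two points \<open>Nw\<close> steps apart are what WPD requires.\<close>

lemma pivot_pass:
  assumes c: "chain st" "st \<noteq> []" and u: "nearstart st (c 0)" "nearend st (c D)" and g: "geod c D"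
    and l: "l0 \<le> l" "l \<le> l0 + int Nw"
  shows "\<exists>t. 0 \<le> t \<and> t \<le> D \<and> dist (c t) (fr st (gm l)) \<le> C1"
proof -
  obtain j v s where st: "st = (j, v) # s" using c(2) by (metis neq_Nil_conv surj_pair)
  have j: "j < M" using c(1) chain_hd by (simp add: st)
  have hd: "fst (hd st) = j" by (simp add: st)
  have l0: "real_of_int l0 \<ge> c2 + \<theta>2" "real_of_int l0 \<le> c2 + \<theta>2 + 1" unfolding l0_def by linarith+
  have a: "real_of_int (pr (inv (fr st) (c 0))) \<le> real_of_int l0" using u(1) l0 unfolding nearstart_def by linarith
  have bb: "real_of_int (l0 + int Nw) \<le> real_of_int (pr (inv (fr st) (c D)))"
    using u(2) l0 Rx_ge[OF j] csts(4) K2 unfolding nearend_def hd of_int_add of_int_of_nat_eq by linarith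
  show ?thesis
  proof (rule morse_translate[OF G_iso[OF fr_G[OF c(1)]] g])
    show "2 * K\<^sup>2 < \<bar>real_of_int (pr (inv (fr st) (c 0))) - real_of_int (pr (inv (fr st) (c D)))\<bar>"
      using u Rx_ge[OF j] csts unfolding nearstart_def nearend_def hd by linarith
  qed (use a bb l in auto)
qed

definition Cadd :: real where "Cadd = 2 * (C1 + ca)"

text \<open>The geodesic passes within \<open>C1\<close> of the axis point of index
  \<open>l0\<close>, which for every Schottky index is within \<open>ca\<close> of the base of the
  pivot; a detour through the base costs at most \<open>2 * (C1 + ca)\<close>.\<close>

lemma chain_pass_near:
  assumes c: "chain st" "st \<noteq> []" and u: "nearstart st u" "nearend st u'"
  shows "dist u (base st b) + dist (base st b) u' \<le> dist u u' + Cadd"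
proof -
  obtain j v s where st: "st = (j, v) # s" using c(2) by (metis neq_Nil_conv surj_pair)
  have j: "j < M" using c(1) chain_hd by (simp add: st)
  obtain cc where cc: "cc 0 = u" "cc (dist u u') = u'" "geod cc (dist u u')" using geod_exists[OF geo] .
  obtain t where t: "0 \<le> t" "t \<le> dist u u'" "dist (cc t) (fr st (gm l0)) \<le> C1"
    using pivot_pass[OF c, of cc "dist u u'" l0] cc u by auto
  have "dist (base st b) (fr st (gm l0)) = dist b (sa j (gm l0))"
    using isometry_dist[OF G_iso[OF base_G[OF c(1)]], of b "sa j (gm l0)"] by (simp add: st)
  then have "dist (base st b) (cc t) \<le> C1 + ca"
    using ca_ge[OF j] t(3) dist_triangle2[of "base st b" "cc t" "fr st (gm l0)"] by simp
  moreover have "dist u (cc t) = t" "dist (cc t) u' = dist u u' - t"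
    using geod_dist[OF cc(3), of 0 t] geod_dist[OF cc(3), of t "dist u u'"] cc t by auto
  ultimately show ?thesis
    using dist_triangle[of u "base st b" "cc t"] dist_triangle[of "base st b" u' "cc t"] by (simp add: Cadd_def dist_commute)
qed

text \<open>The geodesic is a function of its endpoint, so that it can be reproduced by a decoder
  that knows the endpoint only.\<close>

definition gd :: "'x \<Rightarrow> real \<Rightarrow> 'x" where
  "gd u = (SOME c. c 0 = b \<and> c (dist b u) = u \<and> geod c (dist b u))"

lemma gd: "gd u 0 = b" "gd u (dist b u) = u" "geod (gd u) (dist b u)"
proof -
  have "\<exists>c. c 0 = b \<and> c (dist b u) = u \<and> geod c (dist b u)" using geod_exists[OF geo, of b u] by metis
  from someI_ex[OF this] show "gd u 0 = b" "gd u (dist b u) = u" "geod (gd u) (dist b u)" unfolding gd_def by auto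
qed

definition clamp :: "'x \<Rightarrow> real \<Rightarrow> real" where "clamp u s = max 0 (min s (dist b u))"

text \<open>Group elements that put the two test points of the pivot axis, of indices
  \<open>l0\<close> and \<open>l0 + Nw\<close>, near prescribed points of the geodesic to
  \<open>u\<close>. The sign \<open>e\<close> records which of the two is met first, and clamping
  keeps inexact parameters within the domain of the geodesic.\<close>

definition Cand :: "'x \<Rightarrow> real \<Rightarrow> bool \<Rightarrow> nat \<Rightarrow> ('x \<Rightarrow> 'x) set" where
  "Cand u D e j = {w\<in>G. dist (gd u (clamp u D)) (w (sa j (gm l0))) \<le> 3 * C1 + 1 \<and>
     dist (gd u (clamp u (D + (if e then 1 else -1) * dist b (gm (int Nw))))) (w (sa j (gm (l0 + int Nw)))) \<le> 3 * C1 + 1}"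

definition wpd_set :: "('x \<Rightarrow> 'x) set" where
  "wpd_set = {h\<in>G. dist b (h b) \<le> 2 * (C2 + C3) \<and> dist (gm (int Nw)) (h (gm (int Nw))) \<le> 2 * (C2 + C3)}"

text \<open>Two candidates send the same two test points to nearly the same places; transported back
  to \<open>b\<close> and \<open>gm Nw\<close>, their quotient lies in \<open>wpd_set\<close>. The
  resulting bound depends neither on \<open>u\<close> nor on \<open>D\<close>.\<close>

lemma Cand_card: "finite (Cand u D e j) \<and> card (Cand u D e j) \<le> card wpd_set"
proof (cases "Cand u D e j = {}")
  case False
  then obtain w0 where w0: "w0 \<in> Cand u D e j" by blast
  let ?q = "sa j \<circ> ipow g l0"
  have q: "?q \<in> G" by (simp add: G_comp G_ipow)
  have w0G: "w0 \<in> G" using w0 by (simp add: Cand_def)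
  let ?m = "\<lambda>w. inv (w0 \<circ> ?q) \<circ> (w \<circ> ?q)"
  have K': "2 * (3 * C1 + 1) \<le> 2 * (C2 + C3)"
  proof -
    have "0 \<le> K * (K * (6 * C1 + 2 * C2 + K))" using C1_pos C2_pos K1 by (intro mult_nonneg_nonneg) auto
    from add_mono[OF this K1] have "1 \<le> T0" by (simp add: T0_def)
    then show ?thesis using C1_pos C2_pos unfolding C3_def by argo
  qed
  have d: "dist z (?m w z) = dist (w0 (?q z)) (w (?q z))" if "w \<in> G" for w z
    using isometry_inv_dist[OF G_iso[OF G_comp[OF w0G q]], of "w (?q z)" z] by (simp add: dist_commute)
  have "inj_on ?m (Cand u D e j)"
  proof (rule inj_onI)
    fix w w' assume "?m w = ?m w'"
    then have "(w0 \<circ> ?q) \<circ> ?m w \<circ> inv ?q = (w0 \<circ> ?q) \<circ> ?m w' \<circ> inv ?q" by simp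
    moreover have "(w0 \<circ> ?q) \<circ> ?m k \<circ> inv ?q = k" for k
      using inv_app(2)[OF G_comp[OF w0G q]] inv_app(2)[OF q] by (auto simp: fun_eq_iff)
    ultimately show "w = w'" by metis
  qed
  moreover have "?m ` Cand u D e j \<subseteq> wpd_set"
  proof safe
    fix w assume w: "w \<in> Cand u D e j"
    then have wG: "w \<in> G" by (simp add: Cand_def)
    have q1: "?q b = sa j (gm l0)" "?q (gm (int Nw)) = sa j (gm (l0 + int Nw))" using gm_shift[of l0 0] gm_shift[of l0 "int Nw"] by simp_all
    have "?m w \<in> G" using w0G wG by (intro G_comp G_inv G_ipow inG)
    moreover have "dist (w0 (?q b)) (w (?q b)) \<le> 2 * (3 * C1 + 1)"
      using w w0 dist_triangle3[of "w0 (?q b)" "w (?q b)" "gd u (clamp u D)"] unfolding q1 Cand_def by simp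
    moreover have "dist (w0 (?q (gm (int Nw)))) (w (?q (gm (int Nw)))) \<le> 2 * (3 * C1 + 1)"
      using w w0 dist_triangle3[of "w0 (?q (gm (int Nw)))" "w (?q (gm (int Nw)))" "gd u (clamp u (D + (if e then 1 else -1) * dist b (gm (int Nw))))"]
      unfolding q1 Cand_def by simp
    ultimately show "?m w \<in> wpd_set" using K' d[OF wG, of b] d[OF wG, of "gm (int Nw)"] unfolding wpd_set_def by auto
  qed
  moreover have "finite wpd_set" using Nw(2) unfolding wpd_set_def .
  ultimately show ?thesis using card_inj_on_le inj_on_finite by blast
qed simp

text \<open>The parameter \<open>\<rho>\<close> is needed only up to 1, so its difference from an
  estimate can be stored as an integer; and it equals the distance from \<open>b\<close> to the base
  of the pivot up to \<open>Cadd\<close>, which is the quantity that can be estimated.\<close>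

lemma chain_Cand:
  assumes c: "chain st" "st \<noteq> []" and u: "nearend st u"
  shows "\<exists>\<rho> e. \<bar>\<rho> - dist b (base st b)\<bar> \<le> Cadd \<and> (\<forall>D. \<bar>D - \<rho>\<bar> \<le> 1 \<longrightarrow> base st \<in> Cand u D e (fst (hd st)))"
proof -
  obtain j v s where st: "st = (j, v) # s" using c(2) by (metis neq_Nil_conv surj_pair)
  have j: "j < M" using c(1) chain_hd by (simp add: st)
  have hd: "fst (hd st) = j" by (simp add: st)
  define L where "L = dist b u"
  define \<tau> where "\<tau> = dist b (gm (int Nw))"
  note gd' = gd[of u, folded L_def]
  have ns: "nearstart st (gd u 0)" "nearend st (gd u L)" using nearstart_b[OF c] u gd' by auto
  obtain t where t: "0 \<le> t" "t \<le> L" "dist (gd u t) (fr st (gm l0)) \<le> C1"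
    using pivot_pass[OF c ns gd'(3), of l0] by auto
  obtain t' where t': "0 \<le> t'" "t' \<le> L" "dist (gd u t') (fr st (gm (l0 + int Nw))) \<le> C1"
    using pivot_pass[OF c ns gd'(3), of "l0 + int Nw"] by auto
  have fb: "fr st z = base st (sa j z)" for z by (simp add: st)
  have db: "dist (base st b) (fr st (gm l0)) = dist b (sa j (gm l0))"
    unfolding fb by (rule isometry_dist[OF G_iso[OF base_G[OF c(1)]]])
  have "dist (base st b) (gd u t) \<le> C1 + ca"
    using ca_ge[OF j] t(3) db dist_triangle2[of "base st b" "gd u t" "fr st (gm l0)"] by simp
  moreover have "dist b (gd u t) = t" using geod_dist[OF gd'(3), of 0 t] t gd'(1) by simp
  ultimately have \<rho>: "\<bar>t - dist b (base st b)\<bar> \<le> C1 + ca"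
    using dist_triangle[of b "base st b" "gd u t"] dist_triangle[of b "gd u t" "base st b"] by (simp add: dist_commute abs_le_iff)
  have ca0: "0 \<le> C1 + ca" using \<rho> by linarith
  have "dist (fr st (gm l0)) (fr st (gm (l0 + int Nw))) = \<tau>"
    using isometry_dist[OF G_iso[OF fr_G[OF c(1)]]] isometry_dist[OF ipow_isometry[OF ig], of l0 b "gm (int Nw)"] gm_shift[of l0 0] gm_shift[of l0 "int Nw"]
    by (simp add: \<tau>_def)
  then have tt: "\<bar>\<bar>t' - t\<bar> - \<tau>\<bar> \<le> 2 * C1"
    using geod_dist[OF gd'(3), of t' t] t t' 
      dist_triangle[of "gd u t'" "gd u t" "fr st (gm (l0 + int Nw))"] dist_triangle[of "fr st (gm (l0 + int Nw))" "gd u t" "fr st (gm l0)"]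
      dist_triangle[of "fr st (gm l0)" "fr st (gm (l0 + int Nw))" "gd u t"] dist_triangle[of "gd u t" "fr st (gm (l0 + int Nw))" "gd u t'"]
    by (simp add: dist_commute abs_le_iff) linarith
  define e where "e \<longleftrightarrow> t' \<ge> t"
  have tt2: "\<bar>t' - (t + (if e then 1 else -1) * \<tau>)\<bar> \<le> 2 * C1" using tt by (auto simp: e_def abs_le_iff abs_if split: if_splits)
  have cl: "0 \<le> clamp u s" "clamp u s \<le> L" "0 \<le> r \<Longrightarrow> r \<le> L \<Longrightarrow> \<bar>clamp u s - r\<bar> \<le> \<bar>s - r\<bar>" for s r
    by (auto simp: clamp_def L_def)
  have "base st \<in> Cand u D e j" if D: "\<bar>D - t\<bar> \<le> 1" for D
  proof -
    have "dist (gd u (clamp u D)) (gd u t) \<le> 1"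
      using geod_dist[OF gd'(3), of "clamp u D" t] cl(1,2)[of D] cl(3)[of t D] t D by simp
    then have 1: "dist (gd u (clamp u D)) (fr st (gm l0)) \<le> 3 * C1 + 1"
      using t(3) dist_triangle[of "gd u (clamp u D)" "fr st (gm l0)" "gd u t"] C1_pos by simp
    let ?D = "D + (if e then 1 else -1) * \<tau>"
    have "\<bar>?D - t'\<bar> \<le> 1 + 2 * C1" using tt2 D by linarith
    then have "dist (gd u (clamp u ?D)) (gd u t') \<le> 1 + 2 * C1"
      using geod_dist[OF gd'(3), of "clamp u ?D" t'] cl(1,2)[of ?D] cl(3)[of t' ?D] t' by simp
    then have "dist (gd u (clamp u ?D)) (fr st (gm (l0 + int Nw))) \<le> 3 * C1 + 1"
      using t'(3) dist_triangle[of "gd u (clamp u ?D)" "fr st (gm (l0 + int Nw))" "gd u t'"] by simp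
    then show ?thesis using 1 base_G[OF c(1)] unfolding Cand_def fb \<tau>_def by simp
  qed
  then show ?thesis using \<rho> ca0 unfolding hd Cadd_def by (intro exI[of _ t] exI[of _ e]) auto
qed

end

section \<open>Entropy of probability mass functions\<close>

text \<open>Values in \<open>ennreal\<close> let the entropy inequalities be stated without
  integrability conditions. The integrand is nonnegative on the support because probabilities are at
  most 1.\<close>

definition Hp :: "'a pmf \<Rightarrow> ennreal" where
  "Hp p = (\<integral>\<^sup>+ x. ennreal (- ln (pmf p x)) \<partial>measure_pmf p)"

lemma nn_integral_pmf_cong:
  "(\<And>x. x \<in> set_pmf p \<Longrightarrow> f x = g x) \<Longrightarrow> (\<integral>\<^sup>+ x. f x \<partial>measure_pmf p) = (\<integral>\<^sup>+ x. g x \<partial>measure_pmf p)"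
  by (rule nn_integral_cong_AE) (simp add: AE_measure_pmf_iff)

lemma nn_integral_pmf_mono:
  "(\<And>x. x \<in> set_pmf p \<Longrightarrow> f x \<le> g x) \<Longrightarrow> (\<integral>\<^sup>+ x. f x \<partial>measure_pmf p) \<le> (\<integral>\<^sup>+ x. g x \<partial>measure_pmf p)"
  by (rule nn_integral_mono_AE) (simp add: AE_measure_pmf_iff)

lemma pmf_le_pmf_map: "pmf p x \<le> pmf (map_pmf f p) (f x)"
proof -
  have "pmf p x = measure (measure_pmf p) {x}" by (simp add: measure_pmf_single)
  also have "\<dots> \<le> measure (measure_pmf p) (f -` {f x})" by (intro measure_pmf.finite_measure_mono) auto
  finally show ?thesis by (simp add: pmf_map)
qed

lemma Hp_map_le: "Hp (map_pmf f p) \<le> Hp p"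
  unfolding Hp_def nn_integral_map_pmf
proof (rule nn_integral_pmf_mono)
  fix x assume "x \<in> set_pmf p"
  then have "0 < pmf p x" by (simp add: pmf_positive)
  then show "ennreal (- ln (pmf (map_pmf f p) (f x))) \<le> ennreal (- ln (pmf p x))"
    using pmf_le_pmf_map[of p x f] by (intro ennreal_leI) simp
qed

lemma Hp_function_le:
  assumes "\<And>\<omega>. \<omega> \<in> set_pmf p \<Longrightarrow> Y \<omega> = f (X \<omega>)"
  shows "Hp (map_pmf Y p) \<le> Hp (map_pmf X p)"
proof -
  have "map_pmf Y p = map_pmf f (map_pmf X p)" unfolding map_pmf_comp using assms by (intro map_pmf_cong) auto
  then show ?thesis using Hp_map_le by metis
qed

text \<open>This is \<open>ln t \<le> t - 1\<close> at \<open>t = q x / pmf p x\<close>, integrated.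
  The constant 1 is kept on the left so that every term is nonnegative and the computation stays in
  \<open>ennreal\<close>.\<close>

lemma gibbs:
  fixes q :: "'a \<Rightarrow> real"
  assumes q: "\<And>x. x \<in> set_pmf p \<Longrightarrow> 0 < q x" "\<And>x. x \<in> set_pmf p \<Longrightarrow> q x \<le> 1"
    and s: "(\<integral>\<^sup>+ x. ennreal (q x) \<partial>count_space (set_pmf p)) \<le> 1"
  shows "Hp p \<le> (\<integral>\<^sup>+ x. ennreal (- ln (q x)) \<partial>measure_pmf p)"
proof -
  have 1: "ennreal (- ln (pmf p x)) + 1 \<le> ennreal (- ln (q x)) + ennreal (q x / pmf p x)" if x: "x \<in> set_pmf p" for x
  proof -
    have p: "0 < pmf p x" "pmf p x \<le> 1" using x by (auto simp: pmf_positive pmf_le_1)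
    have "ln (q x / pmf p x) \<le> q x / pmf p x - 1" using p q(1)[OF x] by (intro ln_le_minus_one) auto
    then have "- ln (pmf p x) + 1 \<le> - ln (q x) + q x / pmf p x" using p q(1)[OF x] by (simp add: ln_div)
    then have "ennreal (- ln (pmf p x) + 1) \<le> ennreal (- ln (q x) + q x / pmf p x)" by (rule ennreal_leI)
    moreover have "ennreal (- ln (pmf p x) + 1) = ennreal (- ln (pmf p x)) + ennreal 1" using p by (intro ennreal_plus) auto
    moreover have "ennreal (- ln (q x) + q x / pmf p x) = ennreal (- ln (q x)) + ennreal (q x / pmf p x)"
      using p q[OF x] by (intro ennreal_plus) auto
    ultimately show ?thesis by simp
  qed
  have "Hp p + 1 = (\<integral>\<^sup>+ x. (ennreal (- ln (pmf p x)) + 1) \<partial>measure_pmf p)"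
    by (simp add: Hp_def nn_integral_add measure_pmf.emeasure_space_1)
  also have "\<dots> \<le> (\<integral>\<^sup>+ x. (ennreal (- ln (q x)) + ennreal (q x / pmf p x)) \<partial>measure_pmf p)"
    by (rule nn_integral_pmf_mono) (rule 1)
  also have "\<dots> = (\<integral>\<^sup>+ x. ennreal (- ln (q x)) \<partial>measure_pmf p) + (\<integral>\<^sup>+ x. ennreal (q x / pmf p x) \<partial>measure_pmf p)"
    by (rule nn_integral_add) auto
  also have "(\<integral>\<^sup>+ x. ennreal (q x / pmf p x) \<partial>measure_pmf p) = (\<integral>\<^sup>+ x. ennreal (q x) \<partial>count_space (set_pmf p))"
  proof -
    have "(\<integral>\<^sup>+ x. ennreal (q x / pmf p x) \<partial>measure_pmf p) = (\<integral>\<^sup>+ x. ennreal (pmf p x) * ennreal (q x / pmf p x) \<partial>count_space UNIV)"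
      by (rule nn_integral_measure_pmf)
    also have "\<dots> = (\<integral>\<^sup>+ x. ennreal (q x) * indicator (set_pmf p) x \<partial>count_space UNIV)"
    proof (rule nn_integral_cong)
      fix x
      show "ennreal (pmf p x) * ennreal (q x / pmf p x) = ennreal (q x) * indicator (set_pmf p) x"
      proof (cases "x \<in> set_pmf p")
        case True
        then have "0 < pmf p x" by (simp add: pmf_positive)
        then have "pmf p x * (q x / pmf p x) = q x" by simp
        then have "ennreal (pmf p x) * ennreal (q x / pmf p x) = ennreal (q x)"
          using ennreal_mult'[of "pmf p x" "q x / pmf p x"] by simp
        then show ?thesis using True by simp
      qed (simp add: set_pmf_iff)
    qed
    also have "\<dots> = (\<integral>\<^sup>+ x. ennreal (q x) \<partial>count_space (set_pmf p))"
      by (simp add: nn_integral_count_space_indicator)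
    finally show ?thesis .
  qed
  also have "(\<integral>\<^sup>+ x. ennreal (- ln (q x)) \<partial>measure_pmf p) + (\<integral>\<^sup>+ x. ennreal (q x) \<partial>count_space (set_pmf p)) \<le> (\<integral>\<^sup>+ x. ennreal (- ln (q x)) \<partial>measure_pmf p) + 1"
    using s by (rule add_left_mono)
  finally have "1 + Hp p \<le> 1 + (\<integral>\<^sup>+ x. ennreal (- ln (q x)) \<partial>measure_pmf p)" by (simp only: add.commute)
  then show ?thesis by (simp only: ennreal_add_left_cancel_le) simp
qed

lemma nn_integral_pmf_le_1: "(\<integral>\<^sup>+ x. ennreal (pmf q x) \<partial>count_space A) \<le> 1"
proof -
  have "(\<integral>\<^sup>+ x. ennreal (pmf q x) \<partial>count_space A) = emeasure (measure_pmf q) A"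
    by (rule nn_integral_pmf)
  then show ?thesis by (simp add: measure_pmf.emeasure_eq_measure)
qed

lemma neg_ln_mult: "0 < a \<Longrightarrow> a \<le> 1 \<Longrightarrow> 0 < b \<Longrightarrow> b \<le> 1 \<Longrightarrow> ennreal (- ln (a * b)) = ennreal (- ln a) + ennreal (- ln b)"
  by (simp add: ln_mult ennreal_plus[symmetric] del: ennreal_plus)

lemma Hp_pair_pmf: "Hp (pair_pmf p q) = Hp p + Hp q"
proof -
  have "Hp (pair_pmf p q) = (\<integral>\<^sup>+ z. (ennreal (- ln (pmf p (fst z))) + ennreal (- ln (pmf q (snd z)))) \<partial>pair_pmf p q)"
    unfolding Hp_def
  proof (rule nn_integral_pmf_cong)
    fix z assume "z \<in> set_pmf (pair_pmf p q)"
    then have "0 < pmf p (fst z)" "0 < pmf q (snd z)" by (auto simp: pmf_positive)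
    then show "ennreal (- ln (pmf (pair_pmf p q) z)) = ennreal (- ln (pmf p (fst z))) + ennreal (- ln (pmf q (snd z)))"
      by (cases z) (simp add: pmf_pair neg_ln_mult pmf_le_1)
  qed
  also have "\<dots> = (\<integral>\<^sup>+ z. ennreal (- ln (pmf p (fst z))) \<partial>pair_pmf p q) + (\<integral>\<^sup>+ z. ennreal (- ln (pmf q (snd z))) \<partial>pair_pmf p q)"
    by (rule nn_integral_add) auto
  also have "(\<integral>\<^sup>+ z. ennreal (- ln (pmf p (fst z))) \<partial>pair_pmf p q) = Hp p"
  proof -
    have "Hp p = (\<integral>\<^sup>+ x. ennreal (- ln (pmf p x)) \<partial>map_pmf fst (pair_pmf p q))" by (simp add: map_fst_pair_pmf Hp_def)
    then show ?thesis unfolding nn_integral_map_pmf ..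
  qed
  also have "(\<integral>\<^sup>+ z. ennreal (- ln (pmf q (snd z))) \<partial>pair_pmf p q) = Hp q"
  proof -
    have "Hp q = (\<integral>\<^sup>+ x. ennreal (- ln (pmf q x)) \<partial>map_pmf snd (pair_pmf p q))" by (simp add: map_snd_pair_pmf Hp_def)
    then show ?thesis unfolding nn_integral_map_pmf ..
  qed
  finally show ?thesis .
qed

lemma Hp_subadditive: "Hp p \<le> Hp (map_pmf fst p) + Hp (map_pmf snd p)"
proof -
  let ?q = "pair_pmf (map_pmf fst p) (map_pmf snd p)"
  have pos: "0 < pmf (map_pmf fst p) (fst z)" "0 < pmf (map_pmf snd p) (snd z)" if "z \<in> set_pmf p" for z
    using that by (auto simp: pmf_positive)
  have q: "pmf ?q z = pmf (map_pmf fst p) (fst z) * pmf (map_pmf snd p) (snd z)" for z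
    by (cases z) (simp add: pmf_pair)
  have "Hp p \<le> (\<integral>\<^sup>+ z. ennreal (- ln (pmf ?q z)) \<partial>measure_pmf p)"
  proof (rule gibbs)
    show "0 < pmf ?q z" if "z \<in> set_pmf p" for z unfolding q using pos[OF that] by simp
    show "pmf ?q z \<le> 1" for z by (rule pmf_le_1)
  qed (rule nn_integral_pmf_le_1)
  also have "\<dots> = (\<integral>\<^sup>+ z. (ennreal (- ln (pmf (map_pmf fst p) (fst z))) + ennreal (- ln (pmf (map_pmf snd p) (snd z)))) \<partial>measure_pmf p)"
    by (rule nn_integral_pmf_cong) (simp add: q neg_ln_mult pos pmf_le_1)
  also have "\<dots> = (\<integral>\<^sup>+ z. ennreal (- ln (pmf (map_pmf fst p) (fst z))) \<partial>measure_pmf p) + (\<integral>\<^sup>+ z. ennreal (- ln (pmf (map_pmf snd p) (snd z))) \<partial>measure_pmf p)"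
    by (rule nn_integral_add) auto
  also have "\<dots> = Hp (map_pmf fst p) + Hp (map_pmf snd p)"
    unfolding Hp_def nn_integral_map_pmf ..
  finally show ?thesis .
qed

lemma Hp_Pair_le: "Hp (map_pmf (\<lambda>\<omega>. (X \<omega>, Y \<omega>)) p) \<le> Hp (map_pmf X p) + Hp (map_pmf Y p)"
  using Hp_subadditive[of "map_pmf (\<lambda>\<omega>. (X \<omega>, Y \<omega>)) p"] by (simp add: map_pmf_comp)

lemma Hp_finite_range:
  assumes A: "finite A" and s: "set_pmf p \<subseteq> A"
  shows "Hp p \<le> ennreal (ln (real (card A)))"
proof -
  have ne: "A \<noteq> {}" using s set_pmf_not_empty[of p] by auto
  then have c: "1 \<le> real (card A)" using A by (simp add: Suc_le_eq card_gt_0_iff)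
  have "Hp p \<le> (\<integral>\<^sup>+ x. ennreal (- ln (1 / real (card A))) \<partial>measure_pmf p)"
  proof (rule gibbs)
    have f: "finite (set_pmf p)" using A s finite_subset by blast
    have "(\<integral>\<^sup>+ x. ennreal (1 / real (card A)) \<partial>count_space (set_pmf p)) = ennreal (real (card (set_pmf p)) * (1 / real (card A)))"
      using f c by (simp add: nn_integral_count_space_finite ennreal_of_nat_eq_real_of_nat ennreal_mult[symmetric])
    also have "\<dots> \<le> ennreal 1" using c card_mono[OF A s] by (intro ennreal_leI) (simp add: field_simps)
    finally show "(\<integral>\<^sup>+ x. ennreal (1 / real (card A)) \<partial>count_space (set_pmf p)) \<le> 1" by simp
  qed (use c in auto)
  also have "\<dots> = ennreal (ln (real (card A)))" using c by (simp add: ln_div measure_pmf.emeasure_space_1)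
  finally show ?thesis .
qed

lemma Hp_finite_range_map:
  assumes "finite A" "\<And>\<omega>. \<omega> \<in> set_pmf p \<Longrightarrow> X \<omega> \<in> A" "card A \<le> n"
  shows "Hp (map_pmf X p) \<le> ennreal (ln (real n))"
proof -
  have "set_pmf (map_pmf X p) \<subseteq> A" using assms(2) by auto
  then have *: "Hp (map_pmf X p) \<le> ennreal (ln (real (card A)))" by (rule Hp_finite_range[OF assms(1)])
  have "A \<noteq> {}" using \<open>set_pmf (map_pmf X p) \<subseteq> A\<close> set_pmf_not_empty[of "map_pmf X p"] by auto
  then have "0 < card A" using assms(1) by (simp add: card_gt_0_iff)
  then have "ln (real (card A)) \<le> ln (real n)" using assms(3) by simp
  then show ?thesis using * ennreal_leI order_trans by blast
qed

lemma Hp_list_le: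
  "Hp (map_pmf (\<lambda>\<omega>. map (\<lambda>i. V i \<omega>) xs) p) \<le> (\<Sum>i\<leftarrow>xs. Hp (map_pmf (V i) p))"
proof (induct xs)
  case Nil
  have "Hp (map_pmf (\<lambda>\<omega>. map (\<lambda>i. V i \<omega>) []) p) \<le> ennreal (ln (real (Suc 0)))"
    by (rule Hp_finite_range_map[where A = "{[]}"]) auto
  then show ?case by simp
next
  case (Cons i xs)
  have "Hp (map_pmf (\<lambda>\<omega>. map (\<lambda>i. V i \<omega>) (i # xs)) p) \<le> Hp (map_pmf (\<lambda>\<omega>. (V i \<omega>, map (\<lambda>i. V i \<omega>) xs)) p)"
    by (rule Hp_function_le[where f = "\<lambda>(a, l). a # l"]) simp
  also have "\<dots> \<le> Hp (map_pmf (V i) p) + Hp (map_pmf (\<lambda>\<omega>. map (\<lambda>i. V i \<omega>) xs) p)" by (rule Hp_Pair_le)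
  also have "\<dots> \<le> Hp (map_pmf (V i) p) + (\<Sum>i\<leftarrow>xs. Hp (map_pmf (V i) p))" using Cons by (rule add_left_mono)
  finally show ?case by simp
qed

section \<open>Bounds for - t ln t and the entropy of rare events\<close>

lemma entropy_fun_le_sqrt: "0 \<le> t \<Longrightarrow> t \<le> 1 \<Longrightarrow> - t * ln t \<le> 2 * sqrt (t::real)"
proof (cases "t = 0")
  case False
  assume t: "0 \<le> t" "t \<le> 1"
  then have t0: "0 < t" using False by simp
  define s where "s = sqrt t"
  have s: "0 < s" "t = s\<^sup>2" using t0 by (auto simp: s_def)
  have "ln (1 / s) \<le> 1 / s - 1" using s by (intro ln_le_minus_one) simp
  then have "- ln s \<le> 1 / s" using s by (simp add: ln_div)
  then have "s\<^sup>2 * (- ln s) \<le> s\<^sup>2 * (1 / s)" by (intro mult_left_mono) auto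
  then have "s\<^sup>2 * (- ln s) \<le> s" using s by (simp add: power2_eq_square)
  moreover have "- t * ln t = 2 * (s\<^sup>2 * (- ln s))"
  proof -
    have "ln (s\<^sup>2) = 2 * ln s" using s(1) by (simp add: ln_realpow)
    then show ?thesis by (subst s(2), subst s(2)) simp
  qed
  ultimately have "- t * ln t \<le> 2 * s" by linarith
  then show ?thesis unfolding s_def .
qed simp

lemma entropy_fun_le_compl: "0 < t \<Longrightarrow> - t * ln t \<le> 1 - (t::real)"
proof -
  assume t: "0 < t"
  have "ln (1 / t) \<le> 1 / t - 1" using t by (intro ln_le_minus_one) simp
  then have "t * (- ln t) \<le> t * (1 / t - 1)" using t by (intro mult_left_mono) (auto simp: ln_div)
  then show ?thesis using t by (simp add: algebra_simps)
qed

lemma entropy_fun_mono: assumes "0 \<le> s" "s \<le> t" "t \<le> exp (-1)" shows "- s * ln s \<le> - t * ln (t::real)"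
proof (cases "s = 0")
  case True
  have "exp (-1) \<le> (1::real)" by simp
  then have "t \<le> 1" using assms(3) by linarith
  then have "t * ln t \<le> 0" using assms(1,2) by (cases "t = 0") (auto intro!: mult_nonneg_nonpos)
  then show ?thesis using True by simp
next
  case False
  have "\<exists>y. ((\<lambda>x. - x * ln x) has_real_derivative y) (at x) \<and> y \<ge> 0" if "s \<le> x" "x \<le> t" for x
  proof -
    have x: "0 < x" using False assms that by linarith
    then have d: "((\<lambda>x. - x * ln x) has_real_derivative (- ln x - 1)) (at x)"
      by (auto intro!: derivative_eq_intros simp: field_simps)
    have "x \<le> exp (-1)" using that assms by linarith
    then have "ln x \<le> -1" using x by (metis ln_exp ln_le_cancel_iff exp_gt_zero)
    then show ?thesis using d by (intro exI[of _ "- ln x - 1"]) auto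
  qed
  then show ?thesis using DERIV_nonneg_imp_nondecreasing[of s t "\<lambda>x. - x * ln x"] assms(2) by blast
qed

lemma Hp_count_space: "Hp p = (\<integral>\<^sup>+ x. ennreal (- pmf p x * ln (pmf p x)) \<partial>count_space UNIV)"
  unfolding Hp_def nn_integral_measure_pmf
proof (rule nn_integral_cong)
  fix x
  have "0 \<le> - ln (pmf p x)" if "pmf p x > 0" using that pmf_le_1[of p x] by simp
  then show "ennreal (pmf p x) * ennreal (- ln (pmf p x)) = ennreal (- pmf p x * ln (pmf p x))"
    by (cases "pmf p x = 0") (auto simp: ennreal_mult[symmetric] pmf_nonneg order_le_less)
qed

definition tail :: "'a set \<Rightarrow> 'a pmf \<Rightarrow> ennreal" where
  "tail F p = (\<integral>\<^sup>+ x. ennreal (- pmf p x * ln (pmf p x)) \<partial>count_space (- F))"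

text \<open>Three contributions: \<open>None\<close>, of probability at least
  \<open>1 - \<delta>\<close>; values in \<open>F\<close>, each of probability at most
  \<open>\<delta>\<close>; and values outside \<open>F\<close>, where \<open>- t * ln t\<close> is
  increasing since probabilities are at most \<open>exp (-1)\<close>, so that the tail of
  \<open>X\<close> dominates. For fixed \<open>F\<close> the bound tends to \<open>\<eta>\<close> as
  \<open>\<delta>\<close> tends to 0, for all laws of \<open>X\<close> meeting the hypotheses at
  once.\<close>

lemma Hp_rare:
  fixes X :: "'w \<Rightarrow> 'a" and B :: "'w \<Rightarrow> bool"
  assumes F: "finite F" and \<eta>: "tail F (map_pmf X p) \<le> ennreal \<eta>" "0 \<le> \<eta>"
    and small: "measure_pmf.prob (map_pmf X p) (- F) \<le> exp (-1)"
    and B: "measure_pmf.prob p {\<omega>. B \<omega>} \<le> \<delta>" "\<delta> < 1"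
  shows "Hp (map_pmf (\<lambda>\<omega>. if B \<omega> then Some (X \<omega>) else None) p) \<le> ennreal (\<delta> + 2 * real (card F) * sqrt \<delta> + \<eta>)"
proof -
  let ?V = "\<lambda>\<omega>. if B \<omega> then Some (X \<omega>) else None"
  let ?r = "map_pmf ?V p"
  let ?f = "\<lambda>v. ennreal (- pmf ?r v * ln (pmf ?r v))"
  have \<delta>0: "0 \<le> \<delta>" using B(1) measure_nonneg order_trans by blast
  have Some_le: "pmf ?r (Some x) \<le> \<delta>" "pmf ?r (Some x) \<le> pmf (map_pmf X p) x" for x
  proof -
    have "pmf ?r (Some x) = measure_pmf.prob p {\<omega>. B \<omega> \<and> X \<omega> = x}"
      by (auto simp: pmf_map vimage_def intro!: arg_cong[where f = "measure_pmf.prob p"] split: if_splits)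
    moreover have "measure_pmf.prob p {\<omega>. B \<omega> \<and> X \<omega> = x} \<le> measure_pmf.prob p {\<omega>. B \<omega>}"
      by (intro measure_pmf.finite_measure_mono) auto
    moreover have "measure_pmf.prob p {\<omega>. B \<omega> \<and> X \<omega> = x} \<le> pmf (map_pmf X p) x"
      unfolding pmf_map by (intro measure_pmf.finite_measure_mono) auto
    ultimately show "pmf ?r (Some x) \<le> \<delta>" "pmf ?r (Some x) \<le> pmf (map_pmf X p) x" using B(1) by auto
  qed
  have None: "pmf ?r None \<ge> 1 - \<delta>"
  proof -
    have "pmf ?r None = measure_pmf.prob p (- {\<omega>. B \<omega>})"
      by (auto simp: pmf_map vimage_def intro!: arg_cong[where f = "measure_pmf.prob p"] split: if_splits)
    also have "\<dots> = 1 - measure_pmf.prob p {\<omega>. B \<omega>}" using measure_pmf.prob_compl[of "{\<omega>. B \<omega>}" p] by (simp add: Compl_eq_Diff_UNIV)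
    finally show ?thesis using B(1) by simp
  qed
  have "Hp ?r = (\<integral>\<^sup>+ v. ?f v \<partial>count_space UNIV)" by (rule Hp_count_space)
  also have "\<dots> = (\<integral>\<^sup>+ v. (?f v * indicator {None} v + ?f v * indicator (Some ` F) v + ?f v * indicator (Some ` (- F)) v) \<partial>count_space UNIV)"
  proof (rule nn_integral_cong)
    fix v show "?f v = ?f v * indicator {None} v + ?f v * indicator (Some ` F) v + ?f v * indicator (Some ` (- F)) v"
      by (cases v) (auto simp: indicator_def)
  qed
  also have "\<dots> = (\<integral>\<^sup>+ v. ?f v * indicator {None} v \<partial>count_space UNIV) + (\<integral>\<^sup>+ v. ?f v * indicator (Some ` F) v \<partial>count_space UNIV) + (\<integral>\<^sup>+ v. ?f v * indicator (Some ` (- F)) v \<partial>count_space UNIV)"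
    by (simp add: nn_integral_add)
  also have "\<dots> \<le> ennreal \<delta> + ennreal (2 * real (card F) * sqrt \<delta>) + ennreal \<eta>"
  proof (intro add_mono)
    have "(\<integral>\<^sup>+ v. ?f v * indicator {None} v \<partial>count_space UNIV) = ?f None"
      by (subst nn_integral_count_space'[of "{None}"]) (auto simp: indicator_def)
    also have "\<dots> \<le> ennreal \<delta>"
      using entropy_fun_le_compl[of "pmf ?r None"] None B(2) by (intro ennreal_leI) auto
    finally show "(\<integral>\<^sup>+ v. ?f v * indicator {None} v \<partial>count_space UNIV) \<le> ennreal \<delta>" .
    have "(\<integral>\<^sup>+ v. ?f v * indicator (Some ` F) v \<partial>count_space UNIV) = (\<Sum>v\<in>Some ` F. ?f v * indicator (Some ` F) v)"
      using F by (intro nn_integral_count_space') (auto simp: indicator_def)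
    also have "\<dots> \<le> (\<Sum>v\<in>Some ` F. ennreal (2 * sqrt \<delta>))"
    proof (rule sum_mono)
      fix v assume "v \<in> Some ` F"
      then obtain x where v: "v = Some x" by auto
      have "- pmf ?r v * ln (pmf ?r v) \<le> 2 * sqrt (pmf ?r v)"
        by (rule entropy_fun_le_sqrt) (auto simp: pmf_nonneg pmf_le_1)
      also have "\<dots> \<le> 2 * sqrt \<delta>" using Some_le(1)[of x] v by simp
      finally have "?f v \<le> ennreal (2 * sqrt \<delta>)" by (rule ennreal_leI)
      then show "?f v * indicator (Some ` F) v \<le> ennreal (2 * sqrt \<delta>)" by (auto simp: indicator_def)
    qed
    also have "\<dots> = ennreal (2 * real (card F) * sqrt \<delta>)"
      using \<delta>0 by (simp add: card_image ennreal_of_nat_eq_real_of_nat ennreal_mult'[symmetric] ennreal_mult[symmetric])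
    finally show "(\<integral>\<^sup>+ v. ?f v * indicator (Some ` F) v \<partial>count_space UNIV) \<le> ennreal (2 * real (card F) * sqrt \<delta>)" .
    have "(\<integral>\<^sup>+ v. ?f v * indicator (Some ` (- F)) v \<partial>count_space UNIV) = (\<integral>\<^sup>+ v. ?f v \<partial>count_space (Some ` (- F)))"
      by (simp add: nn_integral_count_space_indicator)
    also have "\<dots> = (\<integral>\<^sup>+ x. ?f (Some x) \<partial>count_space (- F))"
      by (rule nn_integral_bij_count_space[symmetric]) (simp add: inj_on_imp_bij_betw inj_on_def)
    also have "\<dots> \<le> tail F (map_pmf X p)"
      unfolding tail_def
    proof (rule nn_integral_mono)
      fix x assume "x \<in> space (count_space (- F))"
      then have "{x} \<subseteq> - F" by simp
      then have "measure_pmf.prob (map_pmf X p) {x} \<le> measure_pmf.prob (map_pmf X p) (- F)" by (intro measure_pmf.finite_measure_mono) auto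
      then have "pmf (map_pmf X p) x \<le> exp (-1)" using small by (simp add: measure_pmf_single)
      then show "?f (Some x) \<le> ennreal (- pmf (map_pmf X p) x * ln (pmf (map_pmf X p) x))"
        using Some_le(2)[of x] by (intro ennreal_leI entropy_fun_mono) (auto simp: pmf_nonneg)
    qed
    also have "\<dots> \<le> ennreal \<eta>" by (rule \<eta>)
    finally show "(\<integral>\<^sup>+ v. ?f v * indicator (Some ` (- F)) v \<partial>count_space UNIV) \<le> ennreal \<eta>" .
  qed
  also have "\<dots> = ennreal (\<delta> + 2 * real (card F) * sqrt \<delta> + \<eta>)" using \<delta>0 \<eta>(2) by (simp add: ennreal_plus)
  finally show ?thesis .
qed

lemma Hp_rare_bool:
  assumes B: "measure_pmf.prob p {\<omega>. B \<omega>} \<le> \<delta>" "\<delta> < 1"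
  shows "Hp (map_pmf B p) \<le> ennreal (\<delta> + 2 * sqrt \<delta>)"
proof -
  have "Hp (map_pmf B p) \<le> Hp (map_pmf (\<lambda>\<omega>. if B \<omega> then Some () else None) p)"
    by (rule Hp_function_le[where f = "\<lambda>v. v \<noteq> None"]) simp
  also have "\<dots> \<le> ennreal (\<delta> + 2 * real (card {()}) * sqrt \<delta> + 0)"
  proof (rule Hp_rare[OF _ _ _ _ B])
    have e: "- {()} = {}" by auto
    show "tail {()} (map_pmf (\<lambda>\<omega>. ()) p) \<le> ennreal 0" by (simp add: tail_def e nn_integral_count_space_finite)
    show "measure_pmf.prob (map_pmf (\<lambda>\<omega>. ()) p) (- {()}) \<le> exp (- 1)" by (simp add: e)
  qed auto
  finally show ?thesis by simp
qed

section \<open>Random walks\<close>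

lemma replicate_pmf_take: "t \<le> n \<Longrightarrow> map_pmf (take t) (replicate_pmf n q) = replicate_pmf t q"
proof -
  assume "t \<le> n"
  then have "replicate_pmf n q = replicate_pmf (t + (n - t)) q" by simp
  also have "\<dots> = do {xs \<leftarrow> replicate_pmf t q; ys \<leftarrow> replicate_pmf (n - t) q; return_pmf (xs @ ys)}" by (rule replicate_pmf_distrib)
  also have "map_pmf (take t) \<dots> = do {xs \<leftarrow> replicate_pmf t q; ys \<leftarrow> replicate_pmf (n - t) q; return_pmf (take t (xs @ ys))}"
    by (simp add: map_bind_pmf)
  also have "\<dots> = do {xs \<leftarrow> replicate_pmf t q; return_pmf xs}"
  proof (rule bind_pmf_cong)
    fix xs assume "xs \<in> set_pmf (replicate_pmf t q)"
    then have "length xs = t" by (simp add: set_replicate_pmf)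
    then show "do {ys \<leftarrow> replicate_pmf (n - t) q; return_pmf (take t (xs @ ys))} = return_pmf xs" by simp
  qed simp
  finally show ?thesis by (simp add: bind_return_pmf')
qed

lemma replicate_pmf_map: "map_pmf (map f) (replicate_pmf n q) = replicate_pmf n (map_pmf f q)"
proof (induct n)
  case (Suc n) show ?case
    unfolding replicate_pmf.simps Suc[symmetric] by (simp add: map_pmf_def bind_assoc_pmf bind_return_pmf)
qed simp

lemma replicate_pmf_nth: "i < n \<Longrightarrow> map_pmf (\<lambda>l. l ! i) (replicate_pmf n q) = q"
proof (induct n arbitrary: i)
  case (Suc n)
  show ?case
  proof (cases i)
    case 0 then show ?thesis by (simp add: map_bind_pmf bind_return_pmf')
  next
    case (Suc j)
    then have "map_pmf (\<lambda>l. l ! i) (replicate_pmf (Suc n) q) = do {x \<leftarrow> q; map_pmf (\<lambda>l. l ! j) (replicate_pmf n q)}"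
      by (simp add: map_bind_pmf map_pmf_def[of "\<lambda>l. l ! j"])
    then show ?thesis using Suc.hyps[of j] Suc.prems Suc by simp
  qed
qed simp

definition wprod :: "('x \<Rightarrow> 'x) list \<Rightarrow> 'x \<Rightarrow> 'x" where "wprod xs = foldr (\<circ>) xs id"

lemma wprod_Nil [simp]: "wprod [] = id" and wprod_Cons [simp]: "wprod (a # xs) = a \<circ> wprod xs"
  by (simp_all add: wprod_def)

lemma wprod_append: "wprod (xs @ ys) = wprod xs \<circ> wprod ys"
  by (induct xs) (simp_all add: comp_assoc)

definition rw :: "('x \<Rightarrow> 'x) pmf \<Rightarrow> nat \<Rightarrow> ('x \<Rightarrow> 'x) pmf" where
  "rw q n = map_pmf wprod (replicate_pmf n q)"

lemma replicate_pmf_pair: "replicate_pmf (m + n) q = map_pmf (\<lambda>(xs, ys). xs @ ys) (pair_pmf (replicate_pmf m q) (replicate_pmf n q))"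
  by (simp add: replicate_pmf_distrib pair_pmf_def map_bind_pmf)

lemma rw_add: "rw q (m + n) = map_pmf (\<lambda>(x, y). x \<circ> y) (pair_pmf (rw q m) (rw q n))"
  unfolding rw_def replicate_pmf_pair pair_map_pmf1 pair_map_pmf2 map_pmf_comp
  by (intro map_pmf_cong) (auto simp: wprod_append)

lemma rw_0: "rw q 0 = return_pmf id"
  by (simp add: rw_def)

lemma rw_1: "rw q 1 = q"
  by (simp add: rw_def replicate_pmf_1 map_pmf_comp del: replicate_pmf.simps One_nat_def)

lemma rw_Suc: "rw q (Suc n) = map_pmf (\<lambda>(x, y). x \<circ> y) (pair_pmf (rw q n) q)"
  using rw_add[of q n 1] rw_1[of q] by simp

lemma rw_mult: "rw (rw q m) n = rw q (m * n)"
proof (induct n)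
  case 0 then show ?case by (simp add: rw_0)
next
  case (Suc n)
  have "rw q (m * Suc n) = rw q (m * n + m)" by (simp add: add.commute)
  then show ?case unfolding rw_Suc Suc rw_add by simp
qed

lemma Hp_rw_subadditive: "Hp (rw q (m + n)) \<le> Hp (rw q m) + Hp (rw q n)"
  unfolding rw_add using Hp_map_le[of "\<lambda>(x, y). x \<circ> y" "pair_pmf (rw q m) (rw q n)"] by (simp add: Hp_pair_pmf)

lemma Hp_return: "Hp (return_pmf a) = 0"
  using Hp_finite_range[of "{a}" "return_pmf a"] by simp

lemma Hp_rw_le: "Hp (rw q n) \<le> of_nat n * Hp q"
proof (induct n)
  case 0 then show ?case by (simp add: rw_0 Hp_return)
next
  case (Suc n)
  have "Hp (rw q (Suc n)) \<le> Hp (rw q n) + Hp (rw q 1)" using Hp_rw_subadditive[of q n 1] by simp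
  also have "\<dots> \<le> of_nat n * Hp q + Hp q" using Suc by (intro add_mono) (simp_all only: rw_1 order_refl)
  finally show ?case by (simp add: distrib_right add.commute)
qed

section \<open>The pivoting stack\<close>

lemma nn_integral_pmf_swap:
  "(\<integral>\<^sup>+ x. \<integral>\<^sup>+ y. h x y \<partial>measure_pmf q \<partial>measure_pmf p) = (\<integral>\<^sup>+ y. \<integral>\<^sup>+ x. h x y \<partial>measure_pmf p \<partial>measure_pmf q)"
proof -
  have "(\<integral>\<^sup>+ x. \<integral>\<^sup>+ y. h x y \<partial>measure_pmf q \<partial>measure_pmf p) = (\<integral>\<^sup>+ z. h (fst z) (snd z) \<partial>pair_pmf p q)"
    by (simp add: nn_integral_pair_pmf')
  also have "\<dots> = (\<integral>\<^sup>+ z. h (snd z) (fst z) \<partial>pair_pmf q p)"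
    by (subst pair_commute_pmf) (simp add: case_prod_beta)
  also have "\<dots> = (\<integral>\<^sup>+ y. \<integral>\<^sup>+ x. h x y \<partial>measure_pmf p \<partial>measure_pmf q)"
    by (simp add: nn_integral_pair_pmf')
  finally show ?thesis .
qed

text \<open>Conditioning on a test: a passed test leaves the index uniform in \<open>A - B\<close>,
  where only the average is estimated, while a failed test is estimated for each index.\<close>

lemma uniform_split_le:
  fixes h :: "'a \<Rightarrow> ennreal"
  assumes A: "finite A" "A \<noteq> {}" and b: "0 \<le> b1" "0 \<le> b2"
    and good: "A - B \<noteq> {} \<Longrightarrow> (\<integral>\<^sup>+ j. h j \<partial>pmf_of_set (A - B)) \<le> ennreal b1"
    and bad: "\<And>j. j \<in> A \<inter> B \<Longrightarrow> h j \<le> ennreal b2"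
  defines "p \<equiv> real (card (A - B)) / real (card A)"
  shows "(\<integral>\<^sup>+ j. h j \<partial>pmf_of_set A) \<le> ennreal (p * b1 + (1 - p) * b2)"
proof -
  have cA: "0 < real (card A)" using A by (simp add: card_gt_0_iff)
  have 1: "sum h (A - B) \<le> ennreal (real (card (A - B)) * b1)"
  proof (cases "A - B = {}")
    case False
    then have c: "0 < real (card (A - B))" using A by (simp add: card_gt_0_iff)
    have "sum h (A - B) / ennreal (real (card (A - B))) \<le> ennreal b1"
      using good[OF False] nn_integral_pmf_of_set[of "A - B" h] False A by (simp add: ennreal_of_nat_eq_real_of_nat)
    then have "sum h (A - B) / ennreal (real (card (A - B))) * ennreal (real (card (A - B))) \<le> ennreal b1 * ennreal (real (card (A - B)))"
      by (rule mult_right_mono) simp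
    moreover have "sum h (A - B) / ennreal (real (card (A - B))) * ennreal (real (card (A - B))) = sum h (A - B)"
      using c by (simp add: ennreal_divide_times ennreal_divide_self)
    ultimately show ?thesis using b by (simp add: ennreal_mult[symmetric] mult.commute)
  next
    case True then have "sum h (A - B) = 0" by (simp only: sum.empty) then show ?thesis by simp
  qed
  have 2: "sum h (A \<inter> B) \<le> ennreal (real (card (A \<inter> B)) * b2)"
  proof -
    have "sum h (A \<inter> B) \<le> (\<Sum>j\<in>A \<inter> B. ennreal b2)" by (rule sum_mono) (rule bad)
    also have "\<dots> = ennreal (real (card (A \<inter> B)) * b2)" using b by (simp add: ennreal_of_nat_eq_real_of_nat ennreal_mult[symmetric])
    finally show ?thesis .
  qed
  have s: "sum h A = sum h (A - B) + sum h (A \<inter> B)"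
    using A sum.Int_Diff[of A h B] by (simp add: add.commute)
  have c: "card A = card (A - B) + card (A \<inter> B)" using A card_Diff_subset_Int[of A B] card_mono[of A "A \<inter> B"] by (simp add: finite_Int)
  have "(\<integral>\<^sup>+ j. h j \<partial>pmf_of_set A) = sum h A / ennreal (real (card A))"
    using nn_integral_pmf_of_set[OF A(2,1), of h] by (simp add: ennreal_of_nat_eq_real_of_nat)
  also have "\<dots> \<le> ennreal (real (card (A - B)) * b1 + real (card (A \<inter> B)) * b2) / ennreal (real (card A))"
  proof (rule divide_right_mono_ennreal)
    show "sum h A \<le> ennreal (real (card (A - B)) * b1 + real (card (A \<inter> B)) * b2)"
      unfolding s using add_mono[OF 1 2] b by (simp add: ennreal_plus)
  qed
  also have "\<dots> = ennreal ((real (card (A - B)) * b1 + real (card (A \<inter> B)) * b2) / real (card A))"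
    using b cA by (intro divide_ennreal) auto
  also have "(real (card (A - B)) * b1 + real (card (A \<inter> B)) * b2) / real (card A) = p * b1 + (1 - p) * b2"
  proof -
    have "real (card (A \<inter> B)) = real (card A) - real (card (A - B))" using c by simp
    then have "1 - p = real (card (A \<inter> B)) / real (card A)" unfolding p_def using cA by (simp add: field_simps)
    then show ?thesis unfolding p_def by (simp add: add_divide_distrib)
  qed
  finally show ?thesis .
qed

datatype kind = Untested | Fresh | Stale

text \<open>Conditions on the parameters of the potential \<open>\<Phi>\<close> below under which a Schottky step multiplies it on
  average by at most \<open>\<kappa>0\<close>, when every alignment test succeeds with probability at least 31/32.\<close>

definition weights :: "real \<Rightarrow> real \<Rightarrow> real \<Rightarrow> real \<Rightarrow> real \<Rightarrow> real \<Rightarrow> bool" where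
  "weights lam C \<rho> \<rho>U \<kappa>1 \<kappa>0 \<longleftrightarrow> 0 < lam \<and> lam \<le> 1 \<and> 1 \<le> C \<and> 1 \<le> \<rho> \<and> 0 \<le> \<rho>U \<and> 0 \<le> \<kappa>1 \<and> 0 \<le> \<kappa>0 \<and>
     (\<forall>p. 31 / 32 \<le> p \<and> p \<le> 1 \<longrightarrow> p + (1 - p) * \<rho> \<le> \<rho> * lam \<and> p * lam + (1 - p) * \<rho> \<le> \<rho>U * lam \<and> p * lam + (1 - p) * C \<le> \<kappa>1) \<and>
     \<rho>U * \<kappa>1 \<le> \<kappa>0 \<and> \<rho> * \<kappa>1 \<le> \<kappa>0 * C"

text \<open>With all weights 1 the potential is constant, and the run estimate only transports a
  bound valid for all lazy stacks back to the start.\<close>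

lemma weights_trivial: "weights 1 1 1 1 1 1" by (simp add: weights_def)
text \<open>At the worst value \<open>p = 31 / 32\<close> the second and third averages equal 39/64,
  rounded up to 5/8; then \<open>\<kappa>0\<close> is the product of 5/4 and 5/8.\<close>

lemma weights_half: "weights (1 / 2) 4 4 (5 / 4) (5 / 8) (25 / 32)" by (auto simp: weights_def)

locale pivoting = schottky b g K G x p U Rt M
  for b :: "'x::metric_space" and g K G x p U Rt M +
  fixes \<nu> :: "('x \<Rightarrow> 'x) pmf" and \<alpha> :: real
  assumes \<nu>G: "set_pmf \<nu> \<subseteq> G" and \<alpha>: "0 \<le> \<alpha>" "\<alpha> \<le> 1" and M: "102 \<le> M"
begin

type_synonym 'y entry = "kind \<times> nat \<times> nat \<times> ('y \<Rightarrow> 'y)"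

text \<open>The entry \<open>(k, t, j, w)\<close> is a pivot: the Schottky element \<open>ss j\<close> chosen at time \<open>t\<close>, preceded by the
  word \<open>w\<close> accumulated since the entry below it. Settling pops entries until the word on top of the stack is
  aligned with the topmost one. An entry may pass two such tests and is popped at the third: each test
  rules out at most three indices, so the index of a surviving entry is still almost uniform.\<close>

fun settle :: "'x entry list \<Rightarrow> ('x \<Rightarrow> 'x) \<Rightarrow> 'x entry list \<times> ('x \<Rightarrow> 'x)" where
  "settle [] v = ([], v)"
| "settle ((k, t, j, w) # st) v = (if k \<noteq> Stale \<and> j \<notin> BR v then ((if k = Untested then Fresh else Stale, t, j, w) # st, v)
     else settle st (w \<circ> ss j \<circ> v))"

definition push :: "nat \<Rightarrow> nat \<Rightarrow> 'x entry list \<times> ('x \<Rightarrow> 'x) \<Rightarrow> 'x entry list \<times> ('x \<Rightarrow> 'x)" where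
  "push t j c = (if j \<notin> BL (snd c) then ((Untested, t, j, snd c) # fst c, id) else (fst c, snd c \<circ> ss j))"

definition step :: "nat \<Rightarrow> 'x entry list \<times> ('x \<Rightarrow> 'x) \<Rightarrow> nat option \<times> ('x \<Rightarrow> 'x) \<Rightarrow> 'x entry list \<times> ('x \<Rightarrow> 'x)" where
  "step t c a = (case fst a of None \<Rightarrow> (fst c, snd c \<circ> snd a) | Some j \<Rightarrow> push t j (settle (fst c) (snd c)))"

fun run :: "nat \<Rightarrow> 'x entry list \<times> ('x \<Rightarrow> 'x) \<Rightarrow> (nat option \<times> ('x \<Rightarrow> 'x)) list \<Rightarrow> 'x entry list \<times> ('x \<Rightarrow> 'x)" where
  "run t c [] = c"
| "run t c (a # as) = run (Suc t) (step t c a) as"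

definition \<beta> :: "(nat option \<times> ('x \<Rightarrow> 'x)) pmf" where
  "\<beta> = bind_pmf (bernoulli_pmf \<alpha>) (\<lambda>c. if c then map_pmf (\<lambda>j. (Some j, ss j)) (pmf_of_set {..<M}) else map_pmf (Pair None) \<nu>)"

text \<open>The times of the entries that can still pass a test. A stale entry is popped when
  settling reaches it, so it does not count towards the height.\<close>

definition ft :: "'x entry list \<Rightarrow> nat list" where
  "ft st = map (\<lambda>e. fst (snd e)) (filter (\<lambda>e. fst e \<noteq> Stale) st)"

text \<open>A lazy stack replaces the Schottky index of each entry by the set of indices that are still
  possible; conditionally on what the walk has revealed, the true indices are independent and uniform in these sets.\<close>

fun realize :: "(kind \<times> nat \<times> nat set \<times> ('x \<Rightarrow> 'x)) list \<Rightarrow> 'x entry list pmf" where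
  "realize [] = return_pmf []"
| "realize ((k, t, A, w) # ls) = bind_pmf (pmf_of_set A) (\<lambda>j. map_pmf (\<lambda>st. (k, t, j, w) # st) (realize ls))"

abbreviation LE where "LE ls f \<equiv> (\<integral>\<^sup>+ st. f st \<partial>measure_pmf (realize ls))"

text \<open>Every push is preceded by settling, so an untested entry occurs only on top, as
  \<open>valid\<close> expresses. An index set has lost at most three elements at its push and three
  more at its first passed test; a stale entry may have its index fully revealed.\<close>

fun settled :: "(kind \<times> nat \<times> nat set \<times> ('x \<Rightarrow> 'x)) list \<Rightarrow> bool" where
  "settled [] \<longleftrightarrow> True"
| "settled ((k, t, A, w) # ls) \<longleftrightarrow> k \<noteq> Untested \<and> A \<noteq> {} \<and> A \<subseteq> {..<M} \<and> w \<in> G \<and> (k = Fresh \<longrightarrow> M - 6 \<le> card A) \<and> settled ls"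

fun valid :: "(kind \<times> nat \<times> nat set \<times> ('x \<Rightarrow> 'x)) list \<Rightarrow> bool" where
  "valid [] \<longleftrightarrow> True"
| "valid ((k, t, A, w) # ls) \<longleftrightarrow> (if k = Untested then A \<noteq> {} \<and> A \<subseteq> {..<M} \<and> w \<in> G \<and> M - 3 \<le> card A \<and> settled ls else settled ((k, t, A, w) # ls))"

definition nf :: "(kind \<times> nat \<times> nat set \<times> ('x \<Rightarrow> 'x)) list \<Rightarrow> nat" where
  "nf ls = length (filter (\<lambda>e. fst e \<noteq> Stale) ls)"

definition topU :: "(kind \<times> nat \<times> nat set \<times> ('x \<Rightarrow> 'x)) list \<Rightarrow> bool" where
  "topU ls \<longleftrightarrow> ls \<noteq> [] \<and> fst (hd ls) = Untested"

text \<open>The factor \<open>C\<close> charges a stack without an untested top: passing a test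
  leaves the height unchanged for an untested entry but lowers it for a fresh one.\<close>

definition \<Phi> :: "real \<Rightarrow> real \<Rightarrow> (kind \<times> nat \<times> nat set \<times> ('x \<Rightarrow> 'x)) list \<Rightarrow> real" where
  "\<Phi> lam C ls = lam ^ nf ls * (if topU ls then 1 else C)"

section \<open>Average decay of the potential\<close>

lemma settled_valid: "settled ls \<Longrightarrow> valid ls"
  by (cases ls rule: settled.cases) auto

lemma settled_not_topU: "settled ls \<Longrightarrow> \<not> topU ls"
  by (cases ls rule: settled.cases) (auto simp: topU_def)

lemma good_fraction:
  assumes A: "A \<subseteq> {..<M}" "M - 6 \<le> card A" and v: "v \<in> G"
  shows "31 / 32 \<le> real (card (A - BR v)) / real (card A)" "real (card (A - BR v)) / real (card A) \<le> 1"
proof -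
  have f: "finite A" using A finite_subset by blast
  have c: "card A \<ge> 96" using A M by linarith
  have "card (A - BR v) \<ge> card A - card (BR v)" using bad_sets(1)[OF v] by (simp add: diff_card_le_card_Diff)
  then have "real (card (A - BR v)) \<ge> real (card A) - 3" using bad_sets(3)[OF v] by linarith
  then show "31 / 32 \<le> real (card (A - BR v)) / real (card A)" using c by (simp add: field_simps)
  show "real (card (A - BR v)) / real (card A) \<le> 1" using c f card_mono[of A "A - BR v"] by (simp add: field_simps)
qed

text \<open>All realizations of a lazy stack have the same height, so the height can be taken out of
  the expectation over the hidden indices.\<close>

lemma realize_nf: "st \<in> set_pmf (realize ls) \<Longrightarrow> settled ls \<or> valid ls \<Longrightarrow> length (ft st) = nf ls"
proof (induct ls arbitrary: st rule: settled.induct)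
  case 1 then show ?case by (simp add: ft_def nf_def)
next
  case (2 k t A w ls)
  then have "settled ls" by (auto split: if_splits)
  then show ?case using 2 by (fastforce simp: ft_def nf_def)
qed

lemma LE_Cons: "LE ((k, t, A, w) # ls) f = (\<integral>\<^sup>+ j. LE ls (\<lambda>st. f ((k, t, j, w) # st)) \<partial>pmf_of_set A)"
  by simp

lemma LE_const: "LE ls (\<lambda>st. c) = c"
  by (simp add: measure_pmf.emeasure_space_1)

lemma Gword: "w \<in> G \<Longrightarrow> v \<in> G \<Longrightarrow> w \<circ> ss j \<circ> v \<in> G"
  by (simp add: G_comp)

text \<open>Induction down the stack. Testing a fresh entry lowers \<open>nf\<close> by one whether
  it passes and turns stale or fails and is popped; but only failure continues the recursion, with
  probability at most 1/32, so the total loss stays below the factor \<open>\<rho>\<close>.\<close>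

lemma settle_bound:
  assumes W: "weights lam C \<rho> \<rho>U \<kappa>1 \<kappa>0" and c: "0 \<le> c"
    and f: "\<And>ls v. settled ls \<Longrightarrow> v \<in> G \<Longrightarrow> LE ls (\<lambda>st. f (st, v)) \<le> ennreal (c * lam ^ nf ls)"
  shows "settled ls \<Longrightarrow> v \<in> G \<Longrightarrow> LE ls (\<lambda>st. f (settle st v)) \<le> ennreal (\<rho> * c * lam ^ nf ls)"
proof (induct ls arbitrary: v rule: settled.induct)
  case (1 v)
  have "LE [] (\<lambda>st. f (settle st v)) \<le> ennreal (c * lam ^ nf [])" using f[of "[]" v] 1 by simp
  also have "\<dots> \<le> ennreal (\<rho> * c * lam ^ nf [])"
    using W c by (intro ennreal_leI) (auto simp: weights_def mult_le_cancel_right1 nf_def)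
  finally show ?case .
next
  case (2 k t A w ls v)
  have ls: "settled ls" and wG: "w \<in> G" and A: "A \<noteq> {}" "A \<subseteq> {..<M}" "finite A" using 2 finite_subset by auto
  have lam: "0 < lam" "1 \<le> \<rho>" using W by (auto simp: weights_def)
  have IH: "LE ls (\<lambda>st. f (settle st (w \<circ> ss j \<circ> v))) \<le> ennreal (\<rho> * c * lam ^ nf ls)" for j
    using 2(1)[OF ls Gword[OF wG 2(3)]] .
  show ?case
  proof (cases "k = Stale")
    case True
    have "LE ((k, t, A, w) # ls) (\<lambda>st. f (settle st v)) = (\<integral>\<^sup>+ j. LE ls (\<lambda>st. f (settle st (w \<circ> ss j \<circ> v))) \<partial>pmf_of_set A)"
      using True by simp
    also have "\<dots> \<le> (\<integral>\<^sup>+ j. ennreal (\<rho> * c * lam ^ nf ls) \<partial>pmf_of_set A)"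
      using IH by (intro nn_integral_mono) auto
    also have "\<dots> = ennreal (\<rho> * c * lam ^ nf ls)" by (simp add: measure_pmf.emeasure_space_1)
    finally show ?thesis using True by (simp add: nf_def)
  next
    case False
    then have k: "k = Fresh" using 2(2) by (cases k) auto
    let ?h = "\<lambda>j. LE ls (\<lambda>st. f (settle ((k, t, j, w) # st) v))"
    define q where "q = real (card (A - BR v)) / real (card A)"
    have q: "31 / 32 \<le> q" "q \<le> 1" unfolding q_def using good_fraction[OF A(2) _ 2(3)] 2(2) k by auto
    have "(\<integral>\<^sup>+ j. ?h j \<partial>pmf_of_set A) \<le> ennreal (q * (c * lam ^ nf ls) + (1 - q) * (\<rho> * c * lam ^ nf ls))"
      unfolding q_def
    proof (rule uniform_split_le[OF A(3,1)])
      assume ne: "A - BR v \<noteq> {}"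
      have "(\<integral>\<^sup>+ j. ?h j \<partial>pmf_of_set (A - BR v)) \<le> (\<integral>\<^sup>+ j. ennreal (c * lam ^ nf ls) \<partial>pmf_of_set (A - BR v))"
      proof (rule nn_integral_pmf_mono)
        fix j assume "j \<in> set_pmf (pmf_of_set (A - BR v))"
        then have j: "j \<in> A" "j \<notin> BR v" using ne A by auto
        \<comment> \<open>Passing this test may reveal the index completely, hence the singleton; a
          stale entry is never tested with success again.\<close>
        have "?h j = LE ((Stale, t, {j}, w) # ls) (\<lambda>st. f (st, v))" using j k by (simp add: pmf_of_set_singleton)
        also have "\<dots> \<le> ennreal (c * lam ^ nf ((Stale, t, {j}, w) # ls))" using j A wG ls 2(3) by (intro f) auto
        finally show "?h j \<le> ennreal (c * lam ^ nf ls)" by (simp add: nf_def)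
      qed
      then show "(\<integral>\<^sup>+ j. ?h j \<partial>pmf_of_set (A - BR v)) \<le> ennreal (c * lam ^ nf ls)" by (simp add: measure_pmf.emeasure_space_1)
    next
      fix j assume "j \<in> A \<inter> BR v"
      then show "?h j \<le> ennreal (\<rho> * c * lam ^ nf ls)" using IH[of j] by simp
    qed (use c lam in auto)
    also have "\<dots> \<le> ennreal (\<rho> * c * lam ^ nf ((k, t, A, w) # ls))"
    proof (rule ennreal_leI)
      have "q + (1 - q) * \<rho> \<le> \<rho> * lam" using W q by (auto simp: weights_def)
      then have "(q + (1 - q) * \<rho>) * (c * lam ^ nf ls) \<le> (\<rho> * lam) * (c * lam ^ nf ls)" using c lam by (intro mult_right_mono) auto
      then show "q * (c * lam ^ nf ls) + (1 - q) * (\<rho> * c * lam ^ nf ls) \<le> \<rho> * c * lam ^ nf ((k, t, A, w) # ls)"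
        using k by (simp add: nf_def algebra_simps)
    qed
    finally show ?thesis unfolding LE_Cons .
  qed
qed

text \<open>On success the index is only known to avoid \<open>BR v\<close>: it stays uniform in a
  set large enough for one more test, and the height does not drop.\<close>

lemma settle_bound_untested:
  assumes W: "weights lam C \<rho> \<rho>U \<kappa>1 \<kappa>0" and c: "0 \<le> c"
    and f: "\<And>ls v. settled ls \<Longrightarrow> v \<in> G \<Longrightarrow> LE ls (\<lambda>st. f (st, v)) \<le> ennreal (c * lam ^ nf ls)"
    and V: "valid ((Untested, t, A, w) # ls)" "v \<in> G"
  shows "LE ((Untested, t, A, w) # ls) (\<lambda>st. f (settle st v)) \<le> ennreal (\<rho>U * c * lam ^ nf ((Untested, t, A, w) # ls))"
proof -
  have ls: "settled ls" and wG: "w \<in> G" and A: "A \<noteq> {}" "A \<subseteq> {..<M}" "finite A" "M - 3 \<le> card A" using V finite_subset by auto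
  have lam: "0 < lam" "1 \<le> \<rho>" using W by (auto simp: weights_def)
  let ?h = "\<lambda>j. LE ls (\<lambda>st. f (settle ((Untested, t, j, w) # st) v))"
  define q where "q = real (card (A - BR v)) / real (card A)"
  have q: "31 / 32 \<le> q" "q \<le> 1" unfolding q_def using good_fraction[OF A(2) _ V(2)] A(4) by auto
  have "(\<integral>\<^sup>+ j. ?h j \<partial>pmf_of_set A) \<le> ennreal (q * (c * lam ^ Suc (nf ls)) + (1 - q) * (\<rho> * c * lam ^ nf ls))"
    unfolding q_def
  proof (rule uniform_split_le[OF A(3,1)])
    assume ne: "A - BR v \<noteq> {}"
    have "(\<integral>\<^sup>+ j. ?h j \<partial>pmf_of_set (A - BR v)) = (\<integral>\<^sup>+ j. LE ls (\<lambda>st. f ((Fresh, t, j, w) # st, v)) \<partial>pmf_of_set (A - BR v))"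
      by (rule nn_integral_pmf_cong) (use ne A in auto)
    also have "\<dots> = LE ((Fresh, t, A - BR v, w) # ls) (\<lambda>st. f (st, v))" by simp
    also have "\<dots> \<le> ennreal (c * lam ^ nf ((Fresh, t, A - BR v, w) # ls))"
    proof (rule f)
      have "card (A - BR v) \<ge> card A - card (BR v)" using bad_sets(1)[OF V(2)] by (simp add: diff_card_le_card_Diff)
      then have "M - 6 \<le> card (A - BR v)" using bad_sets(3)[OF V(2)] A(4) M by linarith
      then show "settled ((Fresh, t, A - BR v, w) # ls)" using ne A wG ls by auto
    qed (rule V(2))
    finally show "(\<integral>\<^sup>+ j. ?h j \<partial>pmf_of_set (A - BR v)) \<le> ennreal (c * lam ^ Suc (nf ls))" by (simp add: nf_def)
  next
    fix j assume "j \<in> A \<inter> BR v"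
    then show "?h j \<le> ennreal (\<rho> * c * lam ^ nf ls)"
      using settle_bound[OF W c f ls Gword[OF wG V(2), of j]] by simp
  qed (use c lam in auto)
  also have "\<dots> \<le> ennreal (\<rho>U * c * lam ^ nf ((Untested, t, A, w) # ls))"
  proof (rule ennreal_leI)
    have "q * lam + (1 - q) * \<rho> \<le> \<rho>U * lam" using W q by (auto simp: weights_def)
    then have "(q * lam + (1 - q) * \<rho>) * (c * lam ^ nf ls) \<le> (\<rho>U * lam) * (c * lam ^ nf ls)" using c lam by (intro mult_right_mono) auto
    then show "q * (c * lam ^ Suc (nf ls)) + (1 - q) * (\<rho> * c * lam ^ nf ls) \<le> \<rho>U * c * lam ^ nf ((Untested, t, A, w) # ls)"
      by (simp add: nf_def algebra_simps)
  qed
  finally show ?thesis unfolding LE_Cons .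
qed

text \<open>The new index is independent of the stack, so the integrations may be exchanged. Success
  adds an entry, worth a factor \<open>lam\<close>; failure absorbs the Schottky element into the
  word and leaves a settled stack, whence \<open>C\<close>.\<close>

lemma push_bound:
  assumes W: "weights lam C \<rho> \<rho>U \<kappa>1 \<kappa>0" and c: "0 \<le> c"
    and f: "\<And>ls v. valid ls \<Longrightarrow> v \<in> G \<Longrightarrow> LE ls (\<lambda>st. f (st, v)) \<le> ennreal (c * \<Phi> lam C ls)"
    and ls: "settled ls" and v: "v \<in> G"
  shows "LE ls (\<lambda>st. \<integral>\<^sup>+ j. f (push t j (st, v)) \<partial>pmf_of_set {..<M}) \<le> ennreal (\<kappa>1 * c * lam ^ nf ls)"
proof -
  have lam: "0 < lam" "1 \<le> C" using W by (auto simp: weights_def)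
  have "0 \<in> {..<M}" using M by simp
  then have A: "finite {..<M}" "{..<M} \<noteq> {}" by blast+
  let ?h = "\<lambda>j. LE ls (\<lambda>st. f (push t j (st, v)))"
  define q where "q = real (card ({..<M} - BL v)) / real (card {..<M})"
  have cM: "card ({..<M} - BL v) \<ge> M - 3"
    using diff_card_le_card_Diff[OF bad_sets(2)[OF v], of "{..<M}"] bad_sets(4)[OF v] by simp
  have q: "31 / 32 \<le> q" "q \<le> 1"
  proof -
    have "real (card ({..<M} - BL v)) \<ge> real M - 3" using cM M by linarith
    then show "31 / 32 \<le> q" using M by (simp add: q_def field_simps)
    show "q \<le> 1" using M card_mono[of "{..<M}" "{..<M} - BL v"] by (simp add: q_def field_simps)
  qed
  have "LE ls (\<lambda>st. \<integral>\<^sup>+ j. f (push t j (st, v)) \<partial>pmf_of_set {..<M}) = (\<integral>\<^sup>+ j. ?h j \<partial>pmf_of_set {..<M})"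
    by (rule nn_integral_pmf_swap)
  also have "\<dots> \<le> ennreal (q * (c * lam ^ Suc (nf ls)) + (1 - q) * (c * (lam ^ nf ls * C)))"
    unfolding q_def
  proof (rule uniform_split_le[OF A])
    assume ne: "{..<M} - BL v \<noteq> {}"
    have "(\<integral>\<^sup>+ j. ?h j \<partial>pmf_of_set ({..<M} - BL v)) = (\<integral>\<^sup>+ j. LE ls (\<lambda>st. f ((Untested, t, j, v) # st, id)) \<partial>pmf_of_set ({..<M} - BL v))"
      by (rule nn_integral_pmf_cong) (use ne A in \<open>auto simp: push_def\<close>)
    also have "\<dots> = LE ((Untested, t, {..<M} - BL v, v) # ls) (\<lambda>st. f (st, id))" by simp
    also have "\<dots> \<le> ennreal (c * \<Phi> lam C ((Untested, t, {..<M} - BL v, v) # ls))"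
      using ne cM ls v by (intro f G_id) auto
    finally show "(\<integral>\<^sup>+ j. ?h j \<partial>pmf_of_set ({..<M} - BL v)) \<le> ennreal (c * lam ^ Suc (nf ls))" by (simp add: nf_def \<Phi>_def topU_def)
  next
    fix j assume j: "j \<in> {..<M} \<inter> BL v"
    have "?h j = LE ls (\<lambda>st. f (st, v \<circ> ss j))" using j by (simp add: push_def)
    also have "\<dots> \<le> ennreal (c * \<Phi> lam C ls)" using settled_valid[OF ls] v by (intro f G_comp) auto
    finally show "?h j \<le> ennreal (c * (lam ^ nf ls * C))" using settled_not_topU[OF ls] by (simp add: \<Phi>_def)
  qed (use c lam in auto)
  also have "\<dots> \<le> ennreal (\<kappa>1 * c * lam ^ nf ls)"
  proof (rule ennreal_leI)
    have "q * lam + (1 - q) * C \<le> \<kappa>1" using W q by (auto simp: weights_def)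
    then have "(q * lam + (1 - q) * C) * (c * lam ^ nf ls) \<le> \<kappa>1 * (c * lam ^ nf ls)" using c lam by (intro mult_right_mono) auto
    then show "q * (c * lam ^ Suc (nf ls)) + (1 - q) * (c * (lam ^ nf ls * C)) \<le> \<kappa>1 * c * lam ^ nf ls" by (simp add: algebra_simps)
  qed
  finally show ?thesis .
qed

lemma nn_integral_\<beta>:
  "(\<integral>\<^sup>+ a. h a \<partial>\<beta>) = ennreal \<alpha> * (\<integral>\<^sup>+ j. h (Some j, ss j) \<partial>pmf_of_set {..<M}) + ennreal (1 - \<alpha>) * (\<integral>\<^sup>+ z. h (None, z) \<partial>\<nu>)"
  using \<alpha> by (simp add: \<beta>_def mult.commute)

text \<open>An ordinary step only lengthens the word. A Schottky step settles and pushes: with an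
  untested top this costs \<open>\<rho>U * \<kappa>1\<close>, and otherwise
  \<open>\<rho> * \<kappa>1\<close>, which is paid for by the factor \<open>C\<close> already
  contained in the potential.\<close>

lemma step_bound:
  assumes W: "weights lam C \<rho> \<rho>U \<kappa>1 \<kappa>0" and c: "0 \<le> c"
    and f: "\<And>ls v. valid ls \<Longrightarrow> v \<in> G \<Longrightarrow> LE ls (\<lambda>st. f (st, v)) \<le> ennreal (c * \<Phi> lam C ls)"
    and ls: "valid ls" and v: "v \<in> G"
  shows "LE ls (\<lambda>st. \<integral>\<^sup>+ a. f (step t (st, v) a) \<partial>\<beta>) \<le> ennreal ((\<alpha> * \<kappa>0 + (1 - \<alpha>)) * c * \<Phi> lam C ls)"
proof -
  have w: "0 < lam" "1 \<le> C" "0 \<le> \<kappa>1" "0 \<le> \<kappa>0" "\<rho>U * \<kappa>1 \<le> \<kappa>0" "\<rho> * \<kappa>1 \<le> \<kappa>0 * C" using W by (auto simp: weights_def)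
  have \<Phi>0: "0 \<le> \<Phi> lam C ls" using w by (simp add: \<Phi>_def)
  let ?F = "\<lambda>c. \<integral>\<^sup>+ j. f (push t j c) \<partial>pmf_of_set {..<M}"
  have F: "\<And>ls v. settled ls \<Longrightarrow> v \<in> G \<Longrightarrow> LE ls (\<lambda>st. ?F (st, v)) \<le> ennreal ((\<kappa>1 * c) * lam ^ nf ls)"
    using push_bound[OF W c f] by simp
  have c': "0 \<le> \<kappa>1 * c" using w c by simp
  have 1: "LE ls (\<lambda>st. ?F (settle st v)) \<le> ennreal (\<kappa>0 * c * \<Phi> lam C ls)"
  proof (cases "topU ls")
    case True
    then obtain t' A w' ls' where e: "ls = (Untested, t', A, w') # ls'" unfolding topU_def by (cases ls) auto
    have "LE ls (\<lambda>st. ?F (settle st v)) \<le> ennreal (\<rho>U * (\<kappa>1 * c) * lam ^ nf ls)"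
      unfolding e by (rule settle_bound_untested[OF W c' F]) (use ls v e in auto)
    also have "\<dots> \<le> ennreal (\<kappa>0 * c * \<Phi> lam C ls)"
    proof (rule ennreal_leI)
      have "(\<rho>U * \<kappa>1) * (c * lam ^ nf ls) \<le> \<kappa>0 * (c * lam ^ nf ls)" using w c by (intro mult_right_mono) auto
      then show "\<rho>U * (\<kappa>1 * c) * lam ^ nf ls \<le> \<kappa>0 * c * \<Phi> lam C ls" using True by (simp add: \<Phi>_def algebra_simps)
    qed
    finally show ?thesis .
  next
    case False
    then have s: "settled ls" using ls by (cases ls rule: valid.cases) (auto simp: topU_def split: if_splits)
    have "LE ls (\<lambda>st. ?F (settle st v)) \<le> ennreal (\<rho> * (\<kappa>1 * c) * lam ^ nf ls)"
      by (rule settle_bound[OF W c' F s v])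
    also have "\<dots> \<le> ennreal (\<kappa>0 * c * \<Phi> lam C ls)"
    proof (rule ennreal_leI)
      have "(\<rho> * \<kappa>1) * (c * lam ^ nf ls) \<le> (\<kappa>0 * C) * (c * lam ^ nf ls)" using w c by (intro mult_right_mono) auto
      then show "\<rho> * (\<kappa>1 * c) * lam ^ nf ls \<le> \<kappa>0 * c * \<Phi> lam C ls" using False by (simp add: \<Phi>_def algebra_simps)
    qed
    finally show ?thesis .
  qed
  have 2: "LE ls (\<lambda>st. \<integral>\<^sup>+ z. f (st, v \<circ> z) \<partial>\<nu>) \<le> ennreal (c * \<Phi> lam C ls)"
  proof -
    have "LE ls (\<lambda>st. \<integral>\<^sup>+ z. f (st, v \<circ> z) \<partial>\<nu>) = (\<integral>\<^sup>+ z. LE ls (\<lambda>st. f (st, v \<circ> z)) \<partial>\<nu>)" by (rule nn_integral_pmf_swap)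
    also have "\<dots> \<le> (\<integral>\<^sup>+ z. ennreal (c * \<Phi> lam C ls) \<partial>\<nu>)"
      by (rule nn_integral_pmf_mono) (use \<nu>G ls v in \<open>auto intro!: f G_comp\<close>)
    finally show ?thesis by (simp add: measure_pmf.emeasure_space_1)
  qed
  have "LE ls (\<lambda>st. \<integral>\<^sup>+ a. f (step t (st, v) a) \<partial>\<beta>)
      = LE ls (\<lambda>st. ennreal \<alpha> * ?F (settle st v) + ennreal (1 - \<alpha>) * (\<integral>\<^sup>+ z. f (st, v \<circ> z) \<partial>\<nu>))"
    by (simp add: nn_integral_\<beta> step_def)
  also have "\<dots> = ennreal \<alpha> * LE ls (\<lambda>st. ?F (settle st v)) + ennreal (1 - \<alpha>) * LE ls (\<lambda>st. \<integral>\<^sup>+ z. f (st, v \<circ> z) \<partial>\<nu>)"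
    by (simp add: nn_integral_add nn_integral_cmult)
  also have "\<dots> \<le> ennreal \<alpha> * ennreal (\<kappa>0 * c * \<Phi> lam C ls) + ennreal (1 - \<alpha>) * ennreal (c * \<Phi> lam C ls)"
    by (intro add_mono mult_left_mono 1 2) auto
  also have "\<dots> = ennreal (\<alpha> * (\<kappa>0 * c * \<Phi> lam C ls) + (1 - \<alpha>) * (c * \<Phi> lam C ls))"
    using \<alpha> w c \<Phi>0 by (simp add: ennreal_mult[symmetric] ennreal_plus[symmetric] del: ennreal_plus)
  also have "\<alpha> * (\<kappa>0 * c * \<Phi> lam C ls) + (1 - \<alpha>) * (c * \<Phi> lam C ls) = (\<alpha> * \<kappa>0 + (1 - \<alpha>)) * c * \<Phi> lam C ls"
    by (simp add: algebra_simps)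
  finally show ?thesis .
qed

lemma run_bound:
  assumes W: "weights lam C \<rho> \<rho>U \<kappa>1 \<kappa>0" and c: "0 \<le> c"
    and f: "\<And>ls v. valid ls \<Longrightarrow> v \<in> G \<Longrightarrow> LE ls (\<lambda>st. f (st, v)) \<le> ennreal (c * \<Phi> lam C ls)"
  shows "valid ls \<Longrightarrow> v \<in> G \<Longrightarrow>
    LE ls (\<lambda>st. \<integral>\<^sup>+ l. f (run t (st, v) l) \<partial>replicate_pmf n \<beta>) \<le> ennreal ((\<alpha> * \<kappa>0 + (1 - \<alpha>)) ^ n * c * \<Phi> lam C ls)"
proof (induct n arbitrary: t ls v)
  case 0
  then show ?case using f[of ls v] by simp
next
  case (Suc n)
  let ?\<kappa> = "\<alpha> * \<kappa>0 + (1 - \<alpha>)"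
  let ?f = "\<lambda>c. \<integral>\<^sup>+ l. f (run (Suc t) c l) \<partial>replicate_pmf n \<beta>"
  have "0 \<le> ?\<kappa>" using \<alpha> W by (simp add: weights_def)
  then have c': "0 \<le> ?\<kappa> ^ n * c" using c by simp
  have "LE ls (\<lambda>st. \<integral>\<^sup>+ a. ?f (step t (st, v) a) \<partial>\<beta>) \<le> ennreal (?\<kappa> * (?\<kappa> ^ n * c) * \<Phi> lam C ls)"
    by (rule step_bound[OF W c' _ Suc(2,3)]) (rule Suc(1))
  then show ?case by (simp add: mult.assoc)
qed

definition \<kappa> :: real where "\<kappa> = \<alpha> * (25 / 32) + (1 - \<alpha>)"

lemma \<kappa>_bounds: "0 < \<kappa>" "\<kappa> \<le> 1"
  using \<alpha> by (auto simp: \<kappa>_def)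

abbreviation st0 :: "'x entry list \<times> ('x \<Rightarrow> 'x)" where "st0 \<equiv> ([], id)"

text \<open>Up to time \<open>a\<close> the estimate is only transported, with trivial weights. At
  time \<open>a\<close> the factor 2 to the power of the height cancels the initial potential of the
  second phase, so the decay \<open>\<kappa> ^ m\<close> is obtained whatever the height
  reached.\<close>

lemma two_phase_bound:
  assumes c: "0 \<le> c" and f: "\<And>ls v. valid ls \<Longrightarrow> v \<in> G \<Longrightarrow> LE ls (\<lambda>st. f (st, v)) \<le> ennreal (c * \<Phi> (1 / 2) 4 ls)"
  shows "(\<integral>\<^sup>+ l. (\<integral>\<^sup>+ l'. ennreal (2 ^ length (ft (fst (run 0 st0 l)))) * f (run a (run 0 st0 l) l') \<partial>replicate_pmf m \<beta>) \<partial>replicate_pmf a \<beta>)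
     \<le> ennreal (4 * c * \<kappa> ^ m)"
proof -
  let ?F = "\<lambda>s. \<integral>\<^sup>+ l'. ennreal (2 ^ length (ft (fst s))) * f (run a s l') \<partial>replicate_pmf m \<beta>"
  have F: "LE ls (\<lambda>st. ?F (st, v)) \<le> ennreal ((4 * c * \<kappa> ^ m) * \<Phi> 1 1 ls)" if ls: "valid ls" "v \<in> G" for ls v
  proof -
    have "LE ls (\<lambda>st. ?F (st, v)) = LE ls (\<lambda>st. ennreal (2 ^ nf ls) * (\<integral>\<^sup>+ l'. f (run a (st, v) l') \<partial>replicate_pmf m \<beta>))"
    proof (rule nn_integral_pmf_cong)
      fix st assume "st \<in> set_pmf (realize ls)"
      then have "length (ft st) = nf ls" using realize_nf ls by blast
      then show "?F (st, v) = ennreal (2 ^ nf ls) * (\<integral>\<^sup>+ l'. f (run a (st, v) l') \<partial>replicate_pmf m \<beta>)"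
        by (simp add: nn_integral_cmult)
    qed
    also have "\<dots> = ennreal (2 ^ nf ls) * LE ls (\<lambda>st. \<integral>\<^sup>+ l'. f (run a (st, v) l') \<partial>replicate_pmf m \<beta>)"
      by (simp add: nn_integral_cmult)
    also have "\<dots> \<le> ennreal (2 ^ nf ls) * ennreal (\<kappa> ^ m * c * \<Phi> (1 / 2) 4 ls)"
      unfolding \<kappa>_def by (intro mult_left_mono run_bound[OF weights_half c f] ls) auto
    also have "\<dots> = ennreal (2 ^ nf ls * (\<kappa> ^ m * c * \<Phi> (1 / 2) 4 ls))" by (simp add: ennreal_mult')
    also have "\<dots> \<le> ennreal ((4 * c * \<kappa> ^ m) * \<Phi> 1 1 ls)"
    proof (rule ennreal_leI)
      have "2 ^ nf ls * \<Phi> (1 / 2) 4 ls \<le> 4" by (simp add: \<Phi>_def power_divide)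
      then have "(\<kappa> ^ m * c) * (2 ^ nf ls * \<Phi> (1 / 2) 4 ls) \<le> (\<kappa> ^ m * c) * 4" using c \<kappa>_bounds by (intro mult_left_mono) auto
      then show "2 ^ nf ls * (\<kappa> ^ m * c * \<Phi> (1 / 2) 4 ls) \<le> (4 * c * \<kappa> ^ m) * \<Phi> 1 1 ls" by (simp add: \<Phi>_def algebra_simps)
    qed
    finally show ?thesis .
  qed
  have c': "0 \<le> 4 * c * \<kappa> ^ m" using c \<kappa>_bounds by simp
  have "LE [] (\<lambda>st. \<integral>\<^sup>+ l. ?F (run 0 (st, id) l) \<partial>replicate_pmf a \<beta>) \<le> ennreal ((\<alpha> * 1 + (1 - \<alpha>)) ^ a * (4 * c * \<kappa> ^ m) * \<Phi> 1 1 [])"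
    by (rule run_bound[OF weights_trivial c' F]) (auto simp: G_id)
  then show ?thesis by (simp add: \<Phi>_def)
qed

lemma run_append: "run t c (xs @ ys) = run (t + length xs) (run t c xs) ys"
  by (induct xs arbitrary: t c) auto

text \<open>Markov's inequality for a product that is at least 1 on the event. \<open>P\<close> is
  arbitrary so as to cover the height minus 1 at intermediate times and the height after the final
  settling.\<close>

lemma prob_height_le:
  fixes P :: "'x entry list \<times> ('x \<Rightarrow> 'x) \<Rightarrow> nat"
  assumes c: "0 \<le> c" and f: "\<And>ls v. valid ls \<Longrightarrow> v \<in> G \<Longrightarrow> LE ls (\<lambda>st. ennreal ((1 / 2) ^ P (st, v))) \<le> ennreal (c * \<Phi> (1 / 2) 4 ls)"
  shows "measure_pmf.prob (replicate_pmf (a + m) \<beta>) {l. P (run 0 st0 l) \<le> length (ft (fst (run 0 st0 (take a l))))} \<le> 4 * c * \<kappa> ^ m"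
proof -
  let ?E = "{l. P (run 0 st0 l) \<le> length (ft (fst (run 0 st0 (take a l))))}"
  have "emeasure (replicate_pmf (a + m) \<beta>) ?E = (\<integral>\<^sup>+ l. indicator ?E l \<partial>replicate_pmf (a + m) \<beta>)" by simp
  also have "\<dots> = (\<integral>\<^sup>+ l. \<integral>\<^sup>+ l'. indicator ?E (l @ l') \<partial>replicate_pmf m \<beta> \<partial>replicate_pmf a \<beta>)"
    by (simp only: replicate_pmf_distrib nn_integral_bind_pmf) simp
  also have "\<dots> \<le> (\<integral>\<^sup>+ l. (\<integral>\<^sup>+ l'. ennreal (2 ^ length (ft (fst (run 0 st0 l)))) * ennreal ((1 / 2) ^ P (run a (run 0 st0 l) l')) \<partial>replicate_pmf m \<beta>) \<partial>replicate_pmf a \<beta>)"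
  proof (intro nn_integral_pmf_mono)
    fix l l' assume "l \<in> set_pmf (replicate_pmf a \<beta>)"
    then have len: "length l = a" by (simp add: set_replicate_pmf)
    show "indicator ?E (l @ l') \<le> ennreal (2 ^ length (ft (fst (run 0 st0 l)))) * ennreal ((1 / 2) ^ P (run a (run 0 st0 l) l'))"
    proof (cases "l @ l' \<in> ?E")
      case True
      then have le: "P (run a (run 0 st0 l) l') \<le> length (ft (fst (run 0 st0 l)))" using len by (simp add: run_append)
      have "(1::real) \<le> 2 ^ length (ft (fst (run 0 st0 l))) * (1 / 2) ^ P (run a (run 0 st0 l) l')"
        using power_increasing[OF le, of "2::real"] by (simp add: power_divide field_simps)
      then have "ennreal 1 \<le> ennreal (2 ^ length (ft (fst (run 0 st0 l))) * (1 / 2) ^ P (run a (run 0 st0 l) l'))" by (rule ennreal_leI)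
      then show ?thesis using True by (simp add: ennreal_mult')
    qed simp
  qed
  also have "\<dots> \<le> ennreal (4 * c * \<kappa> ^ m)" by (rule two_phase_bound[OF c f])
  finally have "ennreal (measure_pmf.prob (replicate_pmf (a + m) \<beta>) ?E) \<le> ennreal (4 * c * \<kappa> ^ m)"
    by (simp only: measure_pmf.emeasure_eq_measure)
  then show ?thesis using c \<kappa>_bounds by (subst (asm) ennreal_le_iff) auto
qed

lemma LE_half: assumes "valid ls" shows "LE ls (\<lambda>st. ennreal ((1 / 2) ^ length (ft st))) = ennreal ((1 / 2) ^ nf ls)"
proof -
  have "LE ls (\<lambda>st. ennreal ((1 / 2) ^ length (ft st))) = LE ls (\<lambda>st. ennreal ((1 / 2) ^ nf ls))"
    by (rule nn_integral_pmf_cong) (use realize_nf assms in auto)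
  then show ?thesis by (simp only: LE_const)
qed

text \<open>The subtraction of 1 discounts an entry pushed in the current step: the stack must stay
  above its height at time \<open>a\<close> even before that push.\<close>

lemma prob_run_height_le:
  "measure_pmf.prob (replicate_pmf (a + m) \<beta>) {l. length (ft (fst (run 0 st0 l))) - 1 \<le> length (ft (fst (run 0 st0 (take a l))))} \<le> 8 * \<kappa> ^ m"
proof -
  have "measure_pmf.prob (replicate_pmf (a + m) \<beta>) {l. length (ft (fst (run 0 st0 l))) - 1 \<le> length (ft (fst (run 0 st0 (take a l))))} \<le> 4 * 2 * \<kappa> ^ m"
  proof (rule prob_height_le[where P = "\<lambda>s. length (ft (fst s)) - 1"])
    fix ls v assume ls: "valid ls"
    have "(1 / 2 :: real) ^ (n - 1) \<le> 2 * (1 / 2) ^ n" for n by (cases n) auto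
    then have "ennreal ((1 / 2) ^ (n - 1)) \<le> ennreal 2 * ennreal ((1 / 2) ^ n)" for n
      by (subst ennreal_mult'[symmetric]) (auto intro: ennreal_leI)
    then have "LE ls (\<lambda>st. ennreal ((1 / 2) ^ (length (ft (fst (st, v))) - 1))) \<le> LE ls (\<lambda>st. ennreal 2 * ennreal ((1 / 2) ^ length (ft st)))"
      unfolding fst_conv by (intro nn_integral_mono)
    also have "\<dots> = ennreal 2 * ennreal ((1 / 2) ^ nf ls)" using LE_half[OF ls] by (simp add: nn_integral_cmult)
    also have "\<dots> = ennreal (2 * (1 / 2) ^ nf ls)" by (simp add: ennreal_mult')
    also have "\<dots> \<le> ennreal (2 * \<Phi> (1 / 2) 4 ls)" by (intro ennreal_leI) (simp add: \<Phi>_def)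
    finally show "LE ls (\<lambda>st. ennreal ((1 / 2) ^ (length (ft (fst (st, v))) - 1))) \<le> ennreal (2 * \<Phi> (1 / 2) 4 ls)" .
  qed simp
  then show ?thesis by simp
qed

definition final :: "(nat option \<times> ('x \<Rightarrow> 'x)) list \<Rightarrow> 'x entry list \<times> ('x \<Rightarrow> 'x)" where
  "final l = settle (fst (run 0 st0 l)) (snd (run 0 st0 l))"

lemma prob_final_height_le:
  "measure_pmf.prob (replicate_pmf (a + m) \<beta>) {l. length (ft (fst (final l))) \<le> length (ft (fst (run 0 st0 (take a l))))} \<le> 16 * \<kappa> ^ m"
proof -
  let ?f = "\<lambda>s. ennreal ((1 / 2) ^ length (ft (fst s)))"
  have f: "\<And>ls v. settled ls \<Longrightarrow> v \<in> G \<Longrightarrow> LE ls (\<lambda>st. ?f (st, v)) \<le> ennreal (1 * (1 / 2) ^ nf ls)"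
    using LE_half settled_valid by auto
  have "measure_pmf.prob (replicate_pmf (a + m) \<beta>) {l. length (ft (fst (settle (fst (run 0 st0 l)) (snd (run 0 st0 l))))) \<le> length (ft (fst (run 0 st0 (take a l))))} \<le> 4 * 4 * \<kappa> ^ m"
  proof (rule prob_height_le[where P = "\<lambda>s. length (ft (fst (settle (fst s) (snd s))))"])
    fix ls v assume ls: "valid ls" and v: "v \<in> G"
    have "LE ls (\<lambda>st. ?f (settle st v)) \<le> ennreal (4 * \<Phi> (1 / 2) 4 ls)"
    proof (cases "topU ls")
      case True
      then obtain t' A w' ls' where e: "ls = (Untested, t', A, w') # ls'" unfolding topU_def by (cases ls) auto
      have "LE ls (\<lambda>st. ?f (settle st v)) \<le> ennreal (5 / 4 * 1 * (1 / 2) ^ nf ls)"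
        unfolding e by (rule settle_bound_untested[OF weights_half _ f]) (use ls v e in auto)
      also have "\<dots> \<le> ennreal (4 * \<Phi> (1 / 2) 4 ls)" by (intro ennreal_leI) (simp add: \<Phi>_def)
      finally show ?thesis .
    next
      case False
      then have s: "settled ls" using ls by (cases ls rule: valid.cases) (auto simp: topU_def split: if_splits)
      have "LE ls (\<lambda>st. ?f (settle st v)) \<le> ennreal (4 * 1 * (1 / 2) ^ nf ls)"
        by (rule settle_bound[OF weights_half _ f s v]) auto
      also have "\<dots> \<le> ennreal (4 * \<Phi> (1 / 2) 4 ls)" by (intro ennreal_leI) (simp add: \<Phi>_def)
      finally show ?thesis .
    qed
    then show "LE ls (\<lambda>st. ennreal ((1 / 2) ^ length (ft (fst (settle (fst (st, v)) (snd (st, v))))))) \<le> ennreal (4 * \<Phi> (1 / 2) 4 ls)" by simp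
  qed simp
  then show ?thesis by (simp add: final_def)
qed

lemma ft_settle: "\<exists>m. ft (fst (settle st v)) = drop m (ft st)"
proof (induct st v rule: settle.induct)
  case (1 v) show ?case by (simp add: ft_def)
next
  case (2 k t j w st v)
  show ?case
  proof (cases "k \<noteq> Stale \<and> j \<notin> BR v")
    case True
    then have "ft (fst (settle ((k, t, j, w) # st) v)) = drop (if k = Untested then 0 else 1) (ft ((k, t, j, w) # st))"
      by (cases k) (auto simp: ft_def)
    then show ?thesis by blast
  next
    case False
    then obtain m where "ft (fst (settle st (w \<circ> ss j \<circ> v))) = drop m (ft st)" using 2 by blast
    then have "ft (fst (settle ((k, t, j, w) # st) v)) = drop (if k = Stale then m else Suc m) (ft ((k, t, j, w) # st))"
      using False by (auto simp: ft_def)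
    then show ?thesis by blast
  qed
qed

lemma ft_step: "\<exists>m. ft (fst (step t c a)) = drop m (ft (fst c)) \<or> ft (fst (step t c a)) = t # drop m (ft (fst c))"
proof (cases "fst a")
  case None then show ?thesis by (auto simp: step_def intro!: exI[of _ 0])
next
  case (Some j)
  obtain m where "ft (fst (settle (fst c) (snd c))) = drop m (ft (fst c))" using ft_settle by blast
  then show ?thesis using Some by (intro exI[of _ m]) (auto simp: step_def push_def ft_def)
qed

lemma run_take_Suc: "t < length l \<Longrightarrow> run 0 st0 (take (Suc t) l) = step t (run 0 st0 (take t l)) (l ! t)"
  by (simp add: take_Suc_conv_app_nth run_append)

text \<open>At time \<open>a + h\<close> the list consists of times pushed in the window on top of a
  remainder \<open>Y\<close> of the list at time \<open>a\<close>. Entries leave from the top only,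
  so removing the lowest time \<open>\<tau>\<close> of the window would bring the height down to
  that of \<open>Y\<close>, which the height conditions exclude from then on.\<close>

lemma window_deterministic:
  assumes n: "a + h \<le> length l"
    and big: "\<And>t. a + h \<le> t \<Longrightarrow> t \<le> length l \<Longrightarrow> length (ft (fst (run 0 st0 (take a l)))) < length (ft (fst (run 0 st0 (take t l)))) - 1"
    and fin: "length (ft (fst (run 0 st0 (take a l)))) < length (ft (fst (final l)))"
  shows "\<exists>\<tau>\<in>set (ft (fst (final l))). a \<le> \<tau> \<and> \<tau> < a + h"
proof -
  define L where "L t = ft (fst (run 0 st0 (take t l)))" for t
  have S: "\<exists>m. L (Suc t) = drop m (L t) \<or> L (Suc t) = t # drop m (L t)" if "t < length l" for t
    unfolding L_def run_take_Suc[OF that] by (rule ft_step)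
  have 1: "s \<le> h \<Longrightarrow> \<exists>X Y. L (a + s) = X @ Y \<and> length Y \<le> length (L a) \<and> (\<forall>\<tau>\<in>set X. a \<le> \<tau> \<and> \<tau> < a + s)" for s
  proof (induct s)
    case 0 show ?case by (intro exI[of _ "[]"] exI[of _ "L a"]) simp
  next
    case (Suc s)
    then obtain X Y where XY: "L (a + s) = X @ Y" "length Y \<le> length (L a)" "\<forall>\<tau>\<in>set X. a \<le> \<tau> \<and> \<tau> < a + s" by auto
    obtain m where m: "L (Suc (a + s)) = drop m (L (a + s)) \<or> L (Suc (a + s)) = (a + s) # drop m (L (a + s))"
      using S[of "a + s"] Suc(2) n by auto
    have d: "drop m (L (a + s)) = drop m X @ drop (m - length X) Y" using XY by simp
    have X': "\<forall>\<tau>\<in>set (drop m X). a \<le> \<tau> \<and> \<tau> < a + Suc s" using XY(3) set_drop_subset[of m X] by fastforce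
    show ?case using m
    proof
      assume "L (Suc (a + s)) = drop m (L (a + s))"
      then show ?thesis using d X' XY(2) by (intro exI[of _ "drop m X"] exI[of _ "drop (m - length X) Y"]) auto
    next
      assume "L (Suc (a + s)) = (a + s) # drop m (L (a + s))"
      then show ?thesis using d X' XY(2) by (intro exI[of _ "(a + s) # drop m X"] exI[of _ "drop (m - length X) Y"]) auto
    qed
  qed
  obtain X Y where XY: "L (a + h) = X @ Y" "length Y \<le> length (L a)" "\<forall>\<tau>\<in>set X. a \<le> \<tau> \<and> \<tau> < a + h" using 1[of h] by auto
  have "X \<noteq> []" using XY big[of "a + h"] n by (auto simp: L_def)
  then obtain X' \<tau> where X: "X = X' @ [\<tau>]" by (metis rev_exhaust)
  have \<tau>: "a \<le> \<tau>" "\<tau> < a + h" using XY(3) X by auto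
  have keep: "\<exists>Z. drop m W = Z @ \<tau> # Y" if W: "\<exists>Z. W = Z @ \<tau> # Y" "length Y < length (drop m W)" for m W
  proof -
    obtain Z where Z: "W = Z @ \<tau> # Y" using W(1) by blast
    then have "m \<le> length Z" using W(2) by simp
    then show ?thesis using Z by simp
  qed
  have 2: "\<exists>Z. L (a + h + s) = Z @ \<tau> # Y" if "a + h + s \<le> length l" for s
    using that
  proof (induct s)
    case 0 show ?case using XY X by simp
  next
    case (Suc s)
    then obtain m where m: "L (Suc (a + h + s)) = drop m (L (a + h + s)) \<or> L (Suc (a + h + s)) = (a + h + s) # drop m (L (a + h + s))"
      using S[of "a + h + s"] by auto
    have Z: "\<exists>Z. L (a + h + s) = Z @ \<tau> # Y" using Suc by simp
    have len: "length Y < length (L (Suc (a + h + s)))" using big[of "Suc (a + h + s)"] Suc(2) XY(2) by (simp add: L_def)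
    show ?case using m
    proof
      assume e: "L (Suc (a + h + s)) = drop m (L (a + h + s))"
      then show ?thesis using keep[OF Z, of m] len by simp
    next
      assume e: "L (Suc (a + h + s)) = (a + h + s) # drop m (L (a + h + s))"
      then have "length Y < length (drop m (L (a + h + s)))" using big[of "Suc (a + h + s)"] Suc(2) XY(2) by (simp add: L_def)
      then obtain Z' where "drop m (L (a + h + s)) = Z' @ \<tau> # Y" using keep[OF Z] by blast
      then show ?thesis using e by (intro exI[of _ "(a + h + s) # Z'"]) simp
    qed
  qed
  have "\<exists>Z. L (length l) = Z @ \<tau> # Y" using 2[of "length l - (a + h)"] n by simp
  moreover obtain m where "ft (fst (final l)) = drop m (L (length l))" using ft_settle unfolding final_def L_def by force
  ultimately have "\<exists>Z. ft (fst (final l)) = Z @ \<tau> # Y" using keep fin XY(2) by (metis L_def le_less_trans)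
  then show ?thesis using \<tau> by auto
qed

lemma window_probability:
  assumes n: "a + h \<le> n" and \<alpha>0: "0 < \<alpha>"
  shows "measure_pmf.prob (replicate_pmf n \<beta>) {l. \<not> (\<exists>\<tau>\<in>set (ft (fst (final l))). a \<le> \<tau> \<and> \<tau> < a + h)} \<le> 24 * \<kappa> ^ h / (1 - \<kappa>)"
proof -
  let ?P = "replicate_pmf n \<beta>"
  let ?u = "\<lambda>l t. length (ft (fst (run 0 st0 (take t l))))"
  have \<kappa>1: "\<kappa> < 1" using \<alpha>0 by (simp add: \<kappa>_def)
  define B where "B t = {l. ?u l t - 1 \<le> ?u l a}" for t
  define Bf where "Bf = {l. length (ft (fst (final l))) \<le> ?u l a}"
  have "measure_pmf.prob ?P {l. \<not> (\<exists>\<tau>\<in>set (ft (fst (final l))). a \<le> \<tau> \<and> \<tau> < a + h)} \<le> measure_pmf.prob ?P ((\<Union>t\<in>{a + h..n}. B t) \<union> Bf)"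
  proof (rule measure_pmf.finite_measure_mono_AE)
    show "AE l in ?P. l \<in> {l. \<not> (\<exists>\<tau>\<in>set (ft (fst (final l))). a \<le> \<tau> \<and> \<tau> < a + h)} \<longrightarrow> l \<in> (\<Union>t\<in>{a + h..n}. B t) \<union> Bf"
      unfolding AE_measure_pmf_iff
    proof (intro ballI impI, rule ccontr)
      fix l assume l: "l \<in> set_pmf ?P" "l \<in> {l. \<not> (\<exists>\<tau>\<in>set (ft (fst (final l))). a \<le> \<tau> \<and> \<tau> < a + h)}" "l \<notin> (\<Union>t\<in>{a + h..n}. B t) \<union> Bf"
      have len: "length l = n" using l(1) by (simp add: set_replicate_pmf)
      have "\<exists>\<tau>\<in>set (ft (fst (final l))). a \<le> \<tau> \<and> \<tau> < a + h"
        by (rule window_deterministic) (use l(3) n len in \<open>auto simp: B_def Bf_def not_le\<close>)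
      then show False using l(2) by blast
    qed
  qed simp
  also have "\<dots> \<le> measure_pmf.prob ?P (\<Union>t\<in>{a + h..n}. B t) + measure_pmf.prob ?P Bf"
    by (rule measure_Un_le) auto
  also have "\<dots> \<le> (\<Sum>t\<in>{a + h..n}. measure_pmf.prob ?P (B t)) + measure_pmf.prob ?P Bf"
    by (intro add_right_mono measure_pmf.finite_measure_subadditive_finite) auto
  also have "\<dots> \<le> (\<Sum>t\<in>{a + h..n}. 8 * \<kappa> ^ (t - a)) + 16 * \<kappa> ^ (n - a)"
  proof (intro add_mono sum_mono)
    fix t assume t: "t \<in> {a + h..n}"
    have "measure_pmf.prob ?P (B t) = measure_pmf.prob (map_pmf (take t) ?P) {l. length (ft (fst (run 0 st0 l))) - 1 \<le> length (ft (fst (run 0 st0 (take a l))))}"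
      using t by (simp add: B_def vimage_def min_absorb1)
    also have "\<dots> \<le> 8 * \<kappa> ^ (t - a)"
      using prob_run_height_le[of a "t - a"] t by (simp add: replicate_pmf_take)
    finally show "measure_pmf.prob ?P (B t) \<le> 8 * \<kappa> ^ (t - a)" .
  next
    show "measure_pmf.prob ?P Bf \<le> 16 * \<kappa> ^ (n - a)"
      using prob_final_height_le[of a "n - a"] n by (simp add: Bf_def)
  qed
  also have "(\<Sum>t\<in>{a + h..n}. 8 * \<kappa> ^ (t - a)) \<le> 8 * \<kappa> ^ h / (1 - \<kappa>)"
  proof -
    have "(\<Sum>t\<in>{a + h..n}. 8 * \<kappa> ^ (t - a)) = (\<Sum>s\<in>{..n - (a + h)}. 8 * \<kappa> ^ (h + s))"
      using n by (intro sum.reindex_bij_witness[of _ "\<lambda>s. a + h + s" "\<lambda>t. t - (a + h)"]) auto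
    also have "\<dots> = 8 * \<kappa> ^ h * (\<Sum>s\<in>{..n - (a + h)}. \<kappa> ^ s)" by (simp add: power_add sum_distrib_left mult.assoc)
    also have "(\<Sum>s\<in>{..n - (a + h)}. \<kappa> ^ s) \<le> 1 / (1 - \<kappa>)"
      using \<kappa>_bounds \<kappa>1 by (simp add: sum_gp0 divide_right_mono)
    finally show ?thesis using \<kappa>_bounds by (simp add: mult_left_mono)
  qed
  also have "8 * \<kappa> ^ h / (1 - \<kappa>) + 16 * \<kappa> ^ (n - a) \<le> 24 * \<kappa> ^ h / (1 - \<kappa>)"
  proof -
    have "\<kappa> ^ (n - a) \<le> \<kappa> ^ h" using \<kappa>_bounds n by (intro power_decreasing) auto
    also have "\<dots> \<le> \<kappa> ^ h / (1 - \<kappa>)" using \<kappa>_bounds \<kappa>1 by (simp add: field_simps)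
    finally show ?thesis by simp
  qed
  finally show ?thesis by simp
qed

end

section \<open>Recovering the trajectory from its endpoint\<close>

lemma inj_into_initial_segment:
  assumes "finite S" shows "\<exists>f :: 'a \<Rightarrow> nat. inj_on f S \<and> f ` S \<subseteq> {..<card S}"
proof -
  obtain f where "bij_betw f S {0..<card S}" using ex_bij_betw_finite_nat[OF assms] by blast
  then show ?thesis by (intro exI[of _ f]) (auto simp: bij_betw_def)
qed

text \<open>The numbering is a function of the set, so it can be inverted by a decoder that has
  reconstructed the set.\<close>

definition encode :: "'a set \<Rightarrow> 'a \<Rightarrow> nat" where
  "encode S = (SOME f. inj_on f S \<and> f ` S \<subseteq> {..<card S})"

lemma encode: assumes "finite S" "z \<in> S" shows "inv_into S (encode S) (encode S z) = z" "encode S z < card S"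
proof -
  have "inj_on (encode S) S \<and> encode S ` S \<subseteq> {..<card S}"
    using someI_ex[OF inj_into_initial_segment[OF assms(1)]] unfolding encode_def .
  then show "inv_into S (encode S) (encode S z) = z" "encode S z < card S" using assms(2) by auto
qed

context pivoting
begin

section \<open>Invariants of the stack and geometry of the surviving pivots\<close>

definition strip :: "'x entry list \<Rightarrow> (nat \<times> ('x \<Rightarrow> 'x)) list" where
  "strip st = map (\<lambda>e. snd (snd e)) st"

definition tm :: "'x entry \<Rightarrow> nat" where "tm e = fst (snd e)"

definition Zw :: "(nat option \<times> ('x \<Rightarrow> 'x)) list \<Rightarrow> nat \<Rightarrow> 'x \<Rightarrow> 'x" where
  "Zw l t = wprod (map snd (take t l))"

fun ok :: "(nat \<Rightarrow> 'x \<Rightarrow> 'x) \<Rightarrow> 'x entry list \<Rightarrow> bool" where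
  "ok Z [] \<longleftrightarrow> True"
| "ok Z (e # st) \<longleftrightarrow> base (strip (e # st)) = Z (tm e) \<and> (\<forall>e'\<in>set st. tm e' < tm e) \<and> ok Z st"

lemma ok_append: "ok Z (st1 @ st2) \<Longrightarrow> ok Z st2 \<and> (\<forall>e\<in>set st1. \<forall>e'\<in>set st2. tm e' < tm e)"
  by (induct st1) auto

lemma strip_simps [simp]: "strip [] = []" "strip ((k, t, j, w) # st) = (j, w) # strip st" "strip (st1 @ st2) = strip st1 @ strip st2"
  by (simp_all add: strip_def)

lemma strip_eq_Nil [simp]: "strip st = [] \<longleftrightarrow> st = []" by (simp add: strip_def)

text \<open>A pop merges the Schottky element with the words on both sides, so the product is
  unchanged. The last clause aligns the remaining word with the top entry; it is what puts the
  endpoint beyond all surviving pivots.\<close>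

lemma settle_invariant:
  "chain (strip st) \<Longrightarrow> v \<in> G \<Longrightarrow> ok Z st \<Longrightarrow> settle st v = (st', v') \<Longrightarrow>
     chain (strip st') \<and> v' \<in> G \<and> ok Z st' \<and> pos (strip st') \<circ> v' = pos (strip st) \<circ> v \<and> tm ` set st' \<subseteq> tm ` set st \<and>
     (st' \<noteq> [] \<longrightarrow> fst (hd (strip st')) \<notin> BR v')"
proof (induct st v arbitrary: st' v' rule: settle.induct)
  case (1 v) then show ?case by simp
next
  case (2 k t j w st v)
  show ?case
  proof (cases "k \<noteq> Stale \<and> j \<notin> BR v")
    case True
    then have e: "st' = (if k = Untested then Fresh else Stale, t, j, w) # st" "v' = v" using 2(5) by auto
    then show ?thesis using 2(2-4) True by (auto simp: tm_def)
  next
    case False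
    have w: "w \<in> G" using chain_hd[of j w "strip st"] 2(2) by simp
    have c: "chain (strip st)" using 2(2) chain_tl by auto
    have s: "settle st (w \<circ> ss j \<circ> v) = (st', v')" using 2(5) False by auto
    have o: "ok Z st" using 2(4) by simp
    have IH: "chain (strip st') \<and> v' \<in> G \<and> ok Z st' \<and> pos (strip st') \<circ> v' = pos (strip st) \<circ> (w \<circ> ss j \<circ> v) \<and> tm ` set st' \<subseteq> tm ` set st \<and>
     (st' \<noteq> [] \<longrightarrow> fst (hd (strip st')) \<notin> BR v')"
      by (rule 2(1)[OF False c Gword[OF w 2(3)] o s])
    moreover have "pos (strip st) \<circ> (w \<circ> ss j \<circ> v) = pos (strip ((k, t, j, w) # st)) \<circ> v" by (simp only: strip_simps pos.simps comp_assoc)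
    moreover have "tm ` set st \<subseteq> tm ` set ((k, t, j, w) # st)" by auto
    ultimately show ?thesis by auto
  qed
qed

definition legit :: "(nat option \<times> ('x \<Rightarrow> 'x)) list \<Rightarrow> bool" where
  "legit l \<longleftrightarrow> (\<forall>a\<in>set l. (\<exists>j<M. a = (Some j, ss j)) \<or> (\<exists>z\<in>G. a = (None, z)))"

lemma legit_support: assumes "l \<in> set_pmf (replicate_pmf n \<beta>)" shows "legit l" "length l = n"
proof -
  have "0 \<in> {..<M}" using M by simp
  then have ne: "set_pmf (pmf_of_set {..<M}) = {..<M}" by (intro set_pmf_of_set) blast+
  have "set_pmf \<beta> \<subseteq> {a. (\<exists>j<M. a = (Some j, ss j)) \<or> (\<exists>z\<in>G. a = (None, z))}"
  proof
    fix a assume "a \<in> set_pmf \<beta>"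
    then consider j where "j \<in> set_pmf (pmf_of_set {..<M})" "a = (Some j, ss j)" | z where "z \<in> set_pmf \<nu>" "a = (None, z)"
      unfolding \<beta>_def by (auto split: if_splits)
    then show "a \<in> {a. (\<exists>j<M. a = (Some j, ss j)) \<or> (\<exists>z\<in>G. a = (None, z))}"
      using \<nu>G unfolding ne by cases auto
  qed
  then show "legit l" "length l = n" using assms by (auto simp: legit_def set_replicate_pmf)
qed

lemma legit_nth: "legit l \<Longrightarrow> i < length l \<Longrightarrow> snd (l ! i) \<in> G"
  unfolding legit_def by (metis inG(3) nth_mem snd_conv)

lemma Zw_Suc: "t < length l \<Longrightarrow> Zw l (Suc t) = Zw l t \<circ> snd (l ! t)"
  by (simp add: Zw_def take_Suc_conv_app_nth wprod_append)

lemma Zw_0 [simp]: "Zw l 0 = id" by (simp add: Zw_def)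

lemma wprod_G: "set xs \<subseteq> G \<Longrightarrow> wprod xs \<in> G"
proof (induct xs)
  case Nil show ?case unfolding wprod_Nil by (rule G_id)
next
  case (Cons a xs) then show ?case unfolding wprod_Cons by (intro G_comp) auto
qed

lemma legit_set: "legit l \<Longrightarrow> snd ` set l \<subseteq> G"
  by (auto simp: legit_def)

lemma Zw_G: "legit l \<Longrightarrow> Zw l t \<in> G"
proof -
  assume "legit l"
  then have "set (map snd (take t l)) \<subseteq> G" using legit_set[of l] set_take_subset[of t l] by (simp, blast)
  then show ?thesis unfolding Zw_def by (rule wprod_G)
qed

lemma run_invariant:
  assumes l: "legit l"
  shows "t \<le> length l \<Longrightarrow> chain (strip (fst (run 0 st0 (take t l)))) \<and> snd (run 0 st0 (take t l)) \<in> G \<and> ok (Zw l) (fst (run 0 st0 (take t l))) \<and>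
    pos (strip (fst (run 0 st0 (take t l)))) \<circ> snd (run 0 st0 (take t l)) = Zw l t \<and> (\<forall>e\<in>set (fst (run 0 st0 (take t l))). tm e < t)"
proof (induct t)
  case 0 show ?case using G_id[unfolded id_def] by (simp add: Zw_def id_def)
next
  case (Suc t)
  obtain st v where c: "run 0 st0 (take t l) = (st, v)" by (metis surj_pair)
  have IH: "chain (strip st)" "v \<in> G" "ok (Zw l) st" "pos (strip st) \<circ> v = Zw l t" "\<forall>e\<in>set st. tm e < t" using Suc(1)[OF Suc_leD[OF Suc(2)]] unfolding c fst_conv snd_conv by blast+
  have t: "t < length l" using Suc by simp
  have R: "run 0 st0 (take (Suc t) l) = step t (st, v) (l ! t)" using run_take_Suc[OF t] c by simp
  have "(\<exists>j<M. l ! t = (Some j, ss j)) \<or> (\<exists>z\<in>G. l ! t = (None, z))" using l t by (auto simp: legit_def)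
  then show ?case
  proof
    assume "\<exists>z\<in>G. l ! t = (None, z)"
    then obtain z where z: "z \<in> G" "l ! t = (None, z)" by blast
    then have R': "run 0 st0 (take (Suc t) l) = (st, v \<circ> z)" using R by (simp add: step_def)
    have "pos (strip st) \<circ> (v \<circ> z) = Zw l (Suc t)" using IH(4) z by (simp only: Zw_Suc[OF t] comp_assoc[symmetric]) simp
    moreover have "\<forall>e\<in>set st. tm e < Suc t" using IH(5) by auto
    ultimately show ?thesis unfolding R' fst_conv snd_conv using IH(1,3) G_comp[OF IH(2) z(1)] by blast
  next
    assume "\<exists>j<M. l ! t = (Some j, ss j)"
    then obtain j where j: "j < M" "l ! t = (Some j, ss j)" by blast
    obtain st' v' where s: "settle st v = (st', v')" by (metis surj_pair)
    note S = settle_invariant[OF IH(1-3) s]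
    have S1: "chain (strip st')" and S2: "v' \<in> G" and S3: "st' \<noteq> [] \<longrightarrow> fst (hd (strip st')) \<notin> BR v'"
      and S4: "ok (Zw l) st'" and S5: "tm ` set st' \<subseteq> tm ` set st" and S6: "pos (strip st') \<circ> v' = pos (strip st) \<circ> v"
      using S by blast+
    have tms: "\<forall>e\<in>set st'. tm e < t" using S5 IH(5) by fastforce
    have Z: "Zw l (Suc t) = pos (strip st') \<circ> v' \<circ> ss j" unfolding Zw_Suc[OF t] S6 IH(4) using j by simp
    show ?thesis
    proof (cases "j \<notin> BL v'")
      case True
      then have R': "run 0 st0 (take (Suc t) l) = ((Untested, t, j, v') # st', id)" using R j s by (simp add: step_def push_def)
      have "chain (strip ((Untested, t, j, v') # st'))"
      proof (cases st')
        case Nil then show ?thesis using j(1) S2 True by simp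
      next
        case (Cons e st2)
        obtain k' t' i w where e: "e = (k', t', i, w)" by (metis surj_pair)
        show ?thesis using S1 S2 S3 Cons e j(1) True by simp
      qed
      moreover have "base (strip ((Untested, t, j, v') # st')) = Zw l t" using S6 IH(4) by simp
      moreover have "pos (strip ((Untested, t, j, v') # st')) \<circ> id = Zw l (Suc t)" using Z by (simp only: strip_simps pos.simps comp_id)
      moreover have "ok (Zw l) ((Untested, t, j, v') # st')" using calculation(2) S4 tms by (simp add: tm_def)
      moreover have "\<forall>e\<in>set ((Untested, t, j, v') # st'). tm e < Suc t" using tms by (auto simp: tm_def)
      ultimately show ?thesis unfolding R' fst_conv snd_conv using G_id by blast
    next
      case False
      then have R': "run 0 st0 (take (Suc t) l) = (st', v' \<circ> ss j)" using R j s by (simp add: step_def push_def)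
      have "\<forall>e\<in>set st'. tm e < Suc t" using tms by auto
      moreover have "pos (strip st') \<circ> (v' \<circ> ss j) = Zw l (Suc t)" using Z by (simp only: comp_assoc)
      ultimately show ?thesis unfolding R' fst_conv snd_conv using S1 S4 G_comp[OF S2 inG(3)] by blast
    qed
  qed
qed

lemma final_invariant:
  assumes l: "legit l"
  shows "chain (strip (fst (final l)))" "snd (final l) \<in> G" "ok (Zw l) (fst (final l))"
    "pos (strip (fst (final l))) \<circ> snd (final l) = Zw l (length l)" "\<And>e. e \<in> set (fst (final l)) \<Longrightarrow> tm e < length l"
    "fst (final l) \<noteq> [] \<Longrightarrow> fst (hd (strip (fst (final l)))) \<notin> BR (snd (final l))"
proof -
  have I: "chain (strip (fst (run 0 st0 l)))" "snd (run 0 st0 l) \<in> G" "ok (Zw l) (fst (run 0 st0 l))"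
    "pos (strip (fst (run 0 st0 l))) \<circ> snd (run 0 st0 l) = Zw l (length l)" "\<forall>e\<in>set (fst (run 0 st0 l)). tm e < length l"
    using run_invariant[OF l, of "length l"] by auto
  have "settle (fst (run 0 st0 l)) (snd (run 0 st0 l)) = (fst (final l), snd (final l))" by (simp add: final_def)
  from settle_invariant[OF I(1-3) this]
  show "chain (strip (fst (final l)))" "snd (final l) \<in> G" "ok (Zw l) (fst (final l))"
    "pos (strip (fst (final l))) \<circ> snd (final l) = Zw l (length l)" "\<And>e. e \<in> set (fst (final l)) \<Longrightarrow> tm e < length l"
    "fst (final l) \<noteq> [] \<Longrightarrow> fst (hd (strip (fst (final l)))) \<notin> BR (snd (final l))"
    using I(4,5) by fastforce+
qed

definition PT :: "(nat option \<times> ('x \<Rightarrow> 'x)) list \<Rightarrow> nat set" where "PT l = set (ft (fst (final l)))"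

lemma PT_entry: assumes "\<tau> \<in> PT l" obtains st1 e st2 where "fst (final l) = st1 @ e # st2" "tm e = \<tau>"
proof -
  obtain e where "e \<in> set (fst (final l))" "tm e = \<tau>" using assms by (auto simp: PT_def ft_def tm_def)
  then show ?thesis using that split_list by metis
qed

lemma PT_less: "legit l \<Longrightarrow> \<tau> \<in> PT l \<Longrightarrow> \<tau> < length l"
  using final_invariant(5) PT_entry by (metis in_set_conv_decomp)

lemma Cadd_pos: "0 \<le> Cadd"
  using C1_pos by (simp add: Cadd_def ca_def sum_nonneg)

text \<open>Times decrease down the stack, so the earlier pivot is the lower entry. The basepoint
  lies before its segment and the base of the later pivot beyond it.\<close>

lemma pivot_additive:
  assumes l: "legit l" and p: "\<tau> \<in> PT l" "\<tau>' \<in> PT l" "\<tau> < \<tau>'"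
  shows "dist b (Zw l \<tau> b) + dist (Zw l \<tau> b) (Zw l \<tau>' b) \<le> dist b (Zw l \<tau>' b) + Cadd"
proof -
  obtain st1 e' st2 where s: "fst (final l) = st1 @ e' # st2" "tm e' = \<tau>'" using PT_entry[OF p(2)] .
  obtain r1 e r2 where r: "fst (final l) = r1 @ e # r2" "tm e = \<tau>" using PT_entry[OF p(1)] .
  note F = final_invariant[OF l]
  have "e \<in> set (st1 @ e' # st2)" unfolding s(1)[symmetric] r(1) by simp
  moreover have "e \<notin> set st1" using ok_append[of "Zw l" st1 "e' # st2"] F(3) s p(3) r(2) by fastforce
  moreover have "e \<noteq> e'" using s(2) r(2) p(3) by auto
  ultimately have "e \<in> set st2" by auto
  then obtain st3 st4 where st2: "st2 = st3 @ e # st4" by (metis split_list)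
  let ?s2 = "strip (e # st4)" and ?T = "strip (e' # st3)"
  have full: "fst (final l) = st1 @ (e' # st3) @ (e # st4)" using s(1) st2 by simp
  have cT: "chain (?T @ ?s2)" using F(1) chain_append[of "strip st1" "?T @ ?s2"] by (simp only: full strip_simps(3))
  have c2: "chain ?s2" using cT chain_append by blast
  have ok: "ok (Zw l) ((e' # st3) @ (e # st4))" using ok_append[of "Zw l" st1 "(e' # st3) @ (e # st4)"] F(3) unfolding full by blast
  have b2: "base ?s2 = Zw l \<tau>" using ok_append[OF ok] r(2) by simp
  have bT: "base (?T @ ?s2) = Zw l \<tau>'" using ok s(2) by (simp add: strip_def)
  have "nearstart ?s2 b" by (rule nearstart_b[OF c2]) simp
  moreover have "nearend ?s2 (base (?T @ ?s2) b)" by (rule nearend_base[OF cT]) simp_all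
  ultimately show ?thesis using chain_pass_near[OF c2 _ , of b "base (?T @ ?s2) b"] unfolding b2 bT by simp
qed

lemma pivot_Cand:
  assumes l: "legit l" and p: "\<tau> \<in> PT l"
  shows "\<exists>\<rho> e j. j < M \<and> \<bar>\<rho> - dist b (Zw l \<tau> b)\<bar> \<le> Cadd \<and> (\<forall>D. \<bar>D - \<rho>\<bar> \<le> 1 \<longrightarrow> Zw l \<tau> \<in> Cand (Zw l (length l) b) D e j)"
proof -
  obtain st1 e st2 where s: "fst (final l) = st1 @ e # st2" "tm e = \<tau>" using PT_entry[OF p] .
  note F = final_invariant[OF l]
  let ?s2 = "strip (e # st2)"
  have cc: "chain (strip st1 @ ?s2)" using F(1) by (simp only: s(1) strip_simps(3))
  then have c2: "chain ?s2" using chain_append by blast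
  have b2: "base ?s2 = Zw l \<tau>" using ok_append[of "Zw l" st1 "e # st2"] F(3) s by simp
  have "nearend ?s2 (pos (strip st1 @ ?s2) (snd (final l) b))"
    by (rule nearend_final[OF cc _ F(2)]) (use F(6) s(1) in \<open>auto simp: strip_def\<close>)
  moreover have "pos (strip st1 @ ?s2) (snd (final l) b) = Zw l (length l) b"
    using fun_cong[OF F(4), of b] by (simp only: s(1) strip_simps(3)) simp
  ultimately have ne: "nearend ?s2 (Zw l (length l) b)" by simp
  obtain \<rho> e' where "\<bar>\<rho> - dist b (base ?s2 b)\<bar> \<le> Cadd \<and> (\<forall>D. \<bar>D - \<rho>\<bar> \<le> 1 \<longrightarrow> base ?s2 \<in> Cand (Zw l (length l) b) D e' (fst (hd ?s2)))"
    using chain_Cand[OF c2 _ ne] by auto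
  moreover have "fst (hd ?s2) < M" using c2 chain_hd[of "fst (snd (snd e))" "snd (snd (snd e))" "strip st2"] by (simp add: strip_def)
  ultimately show ?thesis unfolding b2 by blast
qed

section \<open>Gaps between consecutive pivots and the distance estimate\<close>

definition Pv :: "(nat option \<times> ('x \<Rightarrow> 'x)) list \<Rightarrow> nat set" where "Pv l = insert 0 (PT l)"
text \<open>Time 0, with known position, is counted as a pivot, and the length of the walk replaces
  a missing next pivot; so every time before the end belongs to exactly one gap.\<close>

definition lo :: "(nat option \<times> ('x \<Rightarrow> 'x)) list \<Rightarrow> nat \<Rightarrow> nat" where "lo l i = Max {\<tau>\<in>Pv l. \<tau> \<le> i}"
definition hi :: "(nat option \<times> ('x \<Rightarrow> 'x)) list \<Rightarrow> nat \<Rightarrow> nat" where "hi l i = Min (insert (length l) {\<tau>\<in>Pv l. i < \<tau>})"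
definition letters :: "(nat option \<times> ('x \<Rightarrow> 'x)) list \<Rightarrow> nat \<Rightarrow> nat \<Rightarrow> 'x \<Rightarrow> 'x" where
  "letters l s t = wprod (map (\<lambda>q. snd (l ! q)) [s..<t])"
text \<open>This depends only on the gap containing \<open>i\<close>. Recorded letters therefore
  form complete gaps, from which displacements can be computed.\<close>

definition badl :: "nat \<Rightarrow> ('x \<Rightarrow> 'x) set \<Rightarrow> (nat option \<times> ('x \<Rightarrow> 'x)) list \<Rightarrow> nat \<Rightarrow> bool" where
  "badl k F1 l i \<longleftrightarrow> hi l i - lo l i > k \<or> (\<exists>q\<in>{lo l i..<hi l i}. snd (l ! q) \<notin> F1)"

lemma finite_Pv [simp]: "finite (Pv l)" by (simp add: Pv_def PT_def)
lemma zero_Pv [simp]: "0 \<in> Pv l" by (simp add: Pv_def)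

lemma lo: "lo l i \<in> Pv l" "lo l i \<le> i" "\<And>\<tau>. \<tau> \<in> Pv l \<Longrightarrow> \<tau> \<le> i \<Longrightarrow> \<tau> \<le> lo l i"
proof -
  have f: "finite {\<tau>\<in>Pv l. \<tau> \<le> i}" by simp
  have "0 \<in> {\<tau>\<in>Pv l. \<tau> \<le> i}" by simp
  then have ne: "{\<tau>\<in>Pv l. \<tau> \<le> i} \<noteq> {}" by blast
  show "lo l i \<in> Pv l" "lo l i \<le> i" using Max_in[OF f ne] by (auto simp: lo_def)
  show "\<And>\<tau>. \<tau> \<in> Pv l \<Longrightarrow> \<tau> \<le> i \<Longrightarrow> \<tau> \<le> lo l i" unfolding lo_def using f by (intro Max_ge) auto
qed

lemma hi: "hi l i = length l \<or> hi l i \<in> Pv l \<and> i < hi l i" "hi l i \<le> length l" "\<And>\<tau>. \<tau> \<in> Pv l \<Longrightarrow> i < \<tau> \<Longrightarrow> hi l i \<le> \<tau>"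
proof -
  have f: "finite (insert (length l) {\<tau>\<in>Pv l. i < \<tau>})" by simp
  show "hi l i = length l \<or> hi l i \<in> Pv l \<and> i < hi l i" using Min_in[OF f] by (auto simp: hi_def)
  show "hi l i \<le> length l" "\<And>\<tau>. \<tau> \<in> Pv l \<Longrightarrow> i < \<tau> \<Longrightarrow> hi l i \<le> \<tau>" unfolding hi_def using f by (auto intro!: Min_le)
qed

lemma hi_gt: "i < length l \<Longrightarrow> i < hi l i" using hi(1)[of l i] by auto

lemma same_piece: assumes "lo l i \<le> q" "q < hi l i" shows "lo l q = lo l i" "hi l q = hi l i"
proof -
  show a: "lo l q = lo l i"
  proof (rule antisym)
    show "lo l q \<le> lo l i" using lo(1,2)[of l q] lo(3)[of "lo l q" l i] hi(3)[of "lo l q" l i] assms by (cases "lo l q \<le> i") auto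
    show "lo l i \<le> lo l q" using lo(1)[of l i] assms by (intro lo(3))
  qed
  show "hi l q = hi l i"
  proof (rule antisym)
    show "hi l q \<le> hi l i" using hi(1,2)[of l i] assms hi(2)[of l q] hi(3)[of "hi l i" l q] by auto
    show "hi l i \<le> hi l q"
    proof -
      consider "hi l q = length l" | "hi l q \<in> Pv l" "q < hi l q" using hi(1)[of l q] by auto
      then show ?thesis
      proof cases
        case 1 then show ?thesis using hi(2)[of l i] by simp
      next
        case 2
        have "i < hi l q"
        proof (rule ccontr)
          assume "\<not> i < hi l q"
          then have "hi l q \<le> lo l i" using 2 by (intro lo(3)) auto
          then show False using 2 assms by linarith
        qed
        then show ?thesis using hi(3)[of "hi l q" l i] 2 by simp
      qed
    qed
  qed
qed

lemma lo_Pv: "\<tau> \<in> Pv l \<Longrightarrow> lo l \<tau> = \<tau>" using lo(2)[of l \<tau>] lo(3)[of \<tau> l \<tau>] by simp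

lemma badl_same: assumes "lo l i \<le> q" "q < hi l i" shows "badl k F1 l q = badl k F1 l i"
  unfolding badl_def same_piece[OF assms] ..

lemma Zw_letters: assumes "s \<le> t" "t \<le> length l" shows "Zw l t = Zw l s \<circ> letters l s t"
proof -
  have "t \<le> length l \<Longrightarrow> Zw l t = Zw l s \<circ> letters l s t"
    using assms(1)
  proof (induct t rule: dec_induct)
    case base show ?case by (simp add: letters_def)
  next
    case (step t)
    then show ?case by (simp add: Zw_Suc letters_def wprod_append comp_assoc)
  qed
  then show ?thesis using assms by simp
qed

lemma dist_wprod_le:
  assumes "\<And>z. z \<in> set xs \<Longrightarrow> z \<in> G \<and> dist b (z b) \<le> L"
  shows "dist b (wprod xs b) \<le> L * real (length xs)"
  using assms
proof (induct xs)
  case (Cons z xs)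
  have "dist b (wprod (z # xs) b) \<le> dist b (z b) + dist (z b) (z (wprod xs b))" using dist_triangle by simp
  also have "dist (z b) (z (wprod xs b)) = dist b (wprod xs b)" using Cons by (intro isometry_dist G_iso) auto
  finally have "dist b (wprod (z # xs) b) \<le> dist b (z b) + dist b (wprod xs b)" .
  moreover have "dist b (z b) \<le> L" "dist b (wprod xs b) \<le> L * real (length xs)" using Cons by auto
  ultimately show ?case by (simp add: algebra_simps)
qed simp

definition Bsum :: "nat \<Rightarrow> ('x \<Rightarrow> 'x) set \<Rightarrow> (nat option \<times> ('x \<Rightarrow> 'x)) list \<Rightarrow> nat \<Rightarrow> real" where
  "Bsum k F1 l T = (\<Sum>\<tau>\<in>{\<tau>. \<tau> < T \<and> \<tau> \<in> Pv l \<and> badl k F1 l \<tau>}. dist b (letters l \<tau> (hi l \<tau>) b))"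

lemma Pv_additive:
  assumes l: "legit l" and p: "\<tau> \<in> Pv l" "\<tau>' \<in> Pv l" "\<tau> < \<tau>'"
  shows "dist b (Zw l \<tau> b) + dist (Zw l \<tau> b) (Zw l \<tau>' b) \<le> dist b (Zw l \<tau>' b) + Cadd"
proof (cases "\<tau> = 0")
  case True then show ?thesis using Cadd_pos by simp
next
  case False then show ?thesis using pivot_additive[OF l] p by (simp add: Pv_def)
qed

text \<open>Each gap adds its displacement up to \<open>Cadd\<close>. Bad gaps enter exactly,
  through \<open>Bsum\<close>, however long their displacement; a good gap contributes at most
  \<open>L\<close> per letter. Since distinct pivots have distinct times, the total error is linear
  in \<open>T\<close>.\<close>

lemma distance_estimate:
  assumes l: "legit l" and L: "0 \<le> L" "\<And>z. z \<in> F1 \<Longrightarrow> dist b (z b) \<le> L"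
  shows "T \<in> Pv l \<Longrightarrow> \<bar>dist b (Zw l T b) - Bsum k F1 l T\<bar> \<le> (L + Cadd) * real T"
proof (induct T rule: less_induct)
  case (less T)
  show ?case
  proof (cases "T = 0")
    case True then show ?thesis by (simp add: Bsum_def)
  next
    case False
    define S where "S = lo l (T - 1)"
    have TP: "T \<in> PT l" using less(2) False by (simp add: Pv_def)
    have TL: "T < length l" using PT_less[OF l TP] .
    have S: "S \<in> Pv l" "S < T" using lo(1,2)[of l "T - 1"] False by (auto simp: S_def)
    have none: "\<tau> \<notin> Pv l" if "S < \<tau>" "\<tau> < T" for \<tau> using lo(3)[of \<tau> l "T - 1"] that unfolding S_def by linarith
    have hS: "hi l S = T"
    proof (rule antisym)
      show "hi l S \<le> T" using hi(3)[OF less(2) S(2)] .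
      show "T \<le> hi l S" using hi(1)[of l S] none[of "hi l S"] TL by force
    qed
    have IH: "\<bar>dist b (Zw l S b) - Bsum k F1 l S\<bar> \<le> (L + Cadd) * real S" using less(1)[OF S(2,1)] .
    define d where "d = dist b (letters l S T b)"
    have dd: "dist (Zw l S b) (Zw l T b) = d"
      unfolding d_def Zw_letters[OF less_imp_le[OF S(2)] less_imp_le[OF TL]] using isometry_dist[OF G_iso[OF Zw_G[OF l]]] by simp
    have D: "\<bar>dist b (Zw l T b) - (dist b (Zw l S b) + d)\<bar> \<le> Cadd"
      using Pv_additive[OF l S(1) less(2) S(2)] dist_triangle[of b "Zw l T b" "Zw l S b"] Cadd_pos unfolding dd by linarith
    have one: "1 \<le> real T - real S" using S(2) by linarith
    have C1': "Cadd \<le> Cadd * (real T - real S)" using mult_left_mono[OF one Cadd_pos] by simp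
    have L1': "0 \<le> L * (real T - real S)" using L one by simp
    have "{\<tau>. \<tau> < T \<and> \<tau> \<in> Pv l \<and> badl k F1 l \<tau>} = {\<tau>. \<tau> < S \<and> \<tau> \<in> Pv l \<and> badl k F1 l \<tau>} \<union> (if badl k F1 l S then {S} else {})"
      using none S by (auto simp: not_less_iff_gr_or_eq) (metis nat_neq_iff)+
    then have Bs: "Bsum k F1 l T = Bsum k F1 l S + (if badl k F1 l S then d else 0)"
      unfolding Bsum_def by (auto simp: sum.insert_if hS d_def)
    show ?thesis
    proof (cases "badl k F1 l S")
      case True
      then have "\<bar>dist b (Zw l T b) - Bsum k F1 l T\<bar> \<le> (L + Cadd) * real S + Cadd" using D IH Bs by auto
      also have "\<dots> \<le> (L + Cadd) * real T" using C1' L1' by (simp add: algebra_simps)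
      finally show ?thesis .
    next
      case False
      then have g: "\<forall>q\<in>{S..<T}. snd (l ! q) \<in> F1" using lo_Pv[OF S(1)] hS by (simp add: badl_def)
      have "d \<le> L * real (length (map (\<lambda>q. snd (l ! q)) [S..<T]))"
        unfolding d_def letters_def using g L(2) legit_nth[OF l] TL by (intro dist_wprod_le) auto
      then have "d \<le> L * (real T - real S)" using S(2) by (simp add: of_nat_diff)
      moreover have "0 \<le> d" by (simp add: d_def)
      ultimately have "\<bar>dist b (Zw l T b) - Bsum k F1 l T\<bar> \<le> (L + Cadd) * real S + Cadd + L * (real T - real S)"
        using D IH Bs False by auto
      also have "\<dots> \<le> (L + Cadd) * real T" using C1' by (simp add: algebra_simps)
      finally show ?thesis .
    qed
  qed
qed

end

section \<open>Almost superadditivity of the entropy\<close>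

lemma sum_list_le_const: "(\<And>i. i \<in> set xs \<Longrightarrow> f i \<le> (c::ennreal)) \<Longrightarrow> (\<Sum>i\<leftarrow>xs. f i) \<le> of_nat (length xs) * c"
  by (induct xs) (auto simp: distrib_right intro!: add_mono)

context pivoting
begin

text \<open>\<open>V\<close> lists the letters in long or atypical gaps between consecutive pivots, and \<open>W\<close> marks the pivots at
  which such a gap starts. Distances add up along pivots up to \<open>Cadd\<close>, hence \<open>Bhat\<close>, which is computed from these
  rare data, is the distance to the last pivot before time \<open>N\<close> up to an integer of linear size. Once that distance is
  known, the pivot is one of boundedly many candidates \<open>Cand\<close> along a geodesic to the endpoint.\<close>

definition nxf :: "('x \<Rightarrow> 'x) option list \<Rightarrow> bool list \<Rightarrow> nat \<Rightarrow> nat \<Rightarrow> nat" where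
  "nxf vs ws T \<tau> = (LEAST q. \<tau> < q \<and> (q = T \<or> ws ! q \<or> vs ! q = None))"

definition Bhat :: "('x \<Rightarrow> 'x) option list \<Rightarrow> bool list \<Rightarrow> nat \<Rightarrow> real" where
  "Bhat vs ws T = (\<Sum>\<tau>\<in>{\<tau>. \<tau> < T \<and> ws ! \<tau>}. dist b (wprod (map (\<lambda>q. the (vs ! q)) [\<tau>..<nxf vs ws T \<tau>]) b))"

definition V :: "nat \<Rightarrow> ('x \<Rightarrow> 'x) set \<Rightarrow> nat \<Rightarrow> (nat option \<times> ('x \<Rightarrow> 'x)) list \<Rightarrow> ('x \<Rightarrow> 'x) option" where
  "V k F1 i l = (if badl k F1 l i then Some (snd (l ! i)) else None)"
definition W :: "nat \<Rightarrow> ('x \<Rightarrow> 'x) set \<Rightarrow> nat \<Rightarrow> (nat option \<times> ('x \<Rightarrow> 'x)) list \<Rightarrow> bool" where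
  "W k F1 i l \<longleftrightarrow> badl k F1 l i \<and> i \<in> Pv l"
definition Vl :: "nat \<Rightarrow> ('x \<Rightarrow> 'x) set \<Rightarrow> nat \<Rightarrow> (nat option \<times> ('x \<Rightarrow> 'x)) list \<Rightarrow> ('x \<Rightarrow> 'x) option list" where
  "Vl k F1 N l = map (\<lambda>i. V k F1 i l) [0..<N]"
definition Wl :: "nat \<Rightarrow> ('x \<Rightarrow> 'x) set \<Rightarrow> nat \<Rightarrow> (nat option \<times> ('x \<Rightarrow> 'x)) list \<Rightarrow> bool list" where
  "Wl k F1 N l = map (\<lambda>i. W k F1 i l) [0..<N]"
definition El :: "nat \<Rightarrow> nat \<Rightarrow> (nat option \<times> ('x \<Rightarrow> 'x)) list \<Rightarrow> ('x \<Rightarrow> 'x) list" where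
  "El k N l = map (\<lambda>i. snd (l ! i)) [N - k..<N]"

text \<open>The end of a bad gap can be read off the recorded data: it is the first later position
  that equals \<open>T\<close>, starts another bad gap, or belongs to a good gap and has no recorded
  letter.\<close>

lemma nxf_hi:
  assumes T: "T \<in> Pv l" "T \<le> N" "T < length l" and \<tau>: "\<tau> < T" "badl k F1 l \<tau>" "\<tau> \<in> Pv l"
  shows "nxf (Vl k F1 N l) (Wl k F1 N l) T \<tau> = hi l \<tau>"
  unfolding nxf_def
proof (rule Least_equality)
  have h: "\<tau> < hi l \<tau>" using hi_gt[of \<tau> l] T \<tau> by linarith
  have hT: "hi l \<tau> \<le> T" by (rule hi(3)[OF T(1) \<tau>(1)])
  show "\<tau> < hi l \<tau> \<and> (hi l \<tau> = T \<or> Wl k F1 N l ! hi l \<tau> \<or> Vl k F1 N l ! hi l \<tau> = None)"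
  proof (cases "hi l \<tau> = T")
    case False
    then have "hi l \<tau> < T" using hT by simp
    then have "hi l \<tau> \<in> Pv l" "hi l \<tau> < N" using hi(1)[of l \<tau>] T by auto
    then show ?thesis using h by (simp add: Wl_def Vl_def V_def W_def)
  qed (use h in simp)
  fix q assume q: "\<tau> < q \<and> (q = T \<or> Wl k F1 N l ! q \<or> Vl k F1 N l ! q = None)"
  show "hi l \<tau> \<le> q"
  proof (rule ccontr)
    assume "\<not> ?thesis"
    then have qh: "q < hi l \<tau>" by simp
    then have qT: "q < T" "q < N" using hT T(2) by auto
    have "badl k F1 l q" using badl_same[of l \<tau> q k F1] lo_Pv[OF \<tau>(3)] q qh \<tau>(2) by simp
    then have "q \<in> Pv l" using q qT by (simp add: Wl_def Vl_def V_def W_def)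
    then show False using hi(3)[of q l \<tau>] q qh by simp
  qed
qed

lemma Bhat_eq:
  assumes T: "T \<in> Pv l" "T \<le> N" "T < length l"
  shows "Bhat (Vl k F1 N l) (Wl k F1 N l) T = Bsum k F1 l T"
  unfolding Bhat_def Bsum_def
proof (rule sum.cong)
  show "{\<tau>. \<tau> < T \<and> Wl k F1 N l ! \<tau>} = {\<tau>. \<tau> < T \<and> \<tau> \<in> Pv l \<and> badl k F1 l \<tau>}" using T by (auto simp: Wl_def W_def)
  fix \<tau> assume "\<tau> \<in> {\<tau>. \<tau> < T \<and> \<tau> \<in> Pv l \<and> badl k F1 l \<tau>}"
  then have \<tau>: "\<tau> < T" "\<tau> \<in> Pv l" "badl k F1 l \<tau>" by auto
  have hT: "hi l \<tau> \<le> T" by (rule hi(3)[OF T(1) \<tau>(1)])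
  have e: "map (\<lambda>q. the (Vl k F1 N l ! q)) [\<tau>..<hi l \<tau>] = map (\<lambda>q. snd (l ! q)) [\<tau>..<hi l \<tau>]"
  proof (rule map_cong)
    fix q assume "q \<in> set [\<tau>..<hi l \<tau>]"
    then have q: "\<tau> \<le> q" "q < hi l \<tau>" by auto
    then have "badl k F1 l q" using badl_same[of l \<tau> q k F1] lo_Pv[OF \<tau>(2)] \<tau>(3) by simp
    then show "the (Vl k F1 N l ! q) = snd (l ! q)" using q hT T by (simp add: Vl_def V_def)
  qed simp
  show "dist b (wprod (map (\<lambda>q. the (Vl k F1 N l ! q)) [\<tau>..<nxf (Vl k F1 N l) (Wl k F1 N l) T \<tau>]) b) = dist b (letters l \<tau> (hi l \<tau>) b)"
    unfolding nxf_hi[OF T \<tau>(1,3,2)] letters_def e ..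
qed

definition dec_base :: "('x \<Rightarrow> 'x) \<Rightarrow> real \<Rightarrow> nat \<Rightarrow> int \<Rightarrow> bool \<Rightarrow> nat \<Rightarrow> nat \<Rightarrow> 'x \<Rightarrow> 'x" where
  "dec_base zn B T Q e j m = (if T = 0 then id else inv_into (Cand (zn b) (B + of_int Q) e j) (encode (Cand (zn b) (B + of_int Q) e j)) m)"

text \<open>The letters from the last pivot \<open>T\<close> up to \<open>N\<close> come from
  \<open>vs\<close> if their gap is bad. If it is good it has length at most \<open>k\<close>, and
  \<open>es\<close>, the last \<open>k\<close> letters before \<open>N\<close>, contains
  them.\<close>

definition dec :: "nat \<Rightarrow> nat \<Rightarrow> ('x \<Rightarrow> 'x) \<times> ('x \<Rightarrow> 'x) option list \<times> bool list \<times> ('x \<Rightarrow> 'x) list \<times> nat \<times> int \<times> bool \<times> nat \<times> nat \<Rightarrow> ('x \<Rightarrow> 'x) \<times> ('x \<Rightarrow> 'x)" where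
  "dec k N = (\<lambda>(zn, vs, ws, es, T, Q, e, j, m).
     (dec_base zn (Bhat vs ws T) T Q e j m \<circ> wprod (map (\<lambda>q. case vs ! q of Some z \<Rightarrow> z | None \<Rightarrow> es ! (q - (N - k))) [T..<N]), zn))"

definition Cn :: "real \<Rightarrow> nat \<Rightarrow> nat" where "Cn L N = nat \<lceil>Cadd + (L + Cadd) * real N\<rceil> + 1"

text \<open>Besides the endpoint, the rare data, the last letters and the pivot time, the decoder
  needs only \<open>r\<close>: the integer correction to the estimated distance, the direction, the
  Schottky index and the number of the right candidate. The range of \<open>r\<close> has size
  linear in \<open>N\<close>.\<close>

lemma decode:
  assumes l: "legit l" and N: "N < length l" "k \<le> N" and L: "0 \<le> L" "\<And>z. z \<in> F1 \<Longrightarrow> dist b (z b) \<le> L"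
  shows "\<exists>r\<in>{- int (Cn L N)..int (Cn L N)} \<times> UNIV \<times> {..<M} \<times> {..<Suc (card wpd_set)}.
    dec k N (Zw l (length l), Vl k F1 N l, Wl k F1 N l, El k N l, lo l N, r) = (Zw l N, Zw l (length l))"
proof -
  define T where "T = lo l N"
  have T: "T \<in> Pv l" "T \<le> N" using lo(1,2)[of l N] by (simp_all add: T_def)
  then have TL: "T < length l" using N by linarith
  have Nh: "N < hi l N" by (rule hi_gt[OF N(1)])
  have mm: "map (\<lambda>q. case Vl k F1 N l ! q of Some z \<Rightarrow> z | None \<Rightarrow> El k N l ! (q - (N - k))) [T..<N] = map (\<lambda>q. snd (l ! q)) [T..<N]"
  proof (rule map_cong)
    fix q assume "q \<in> set [T..<N]"
    then have q: "T \<le> q" "q < N" by auto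
    show "(case Vl k F1 N l ! q of Some z \<Rightarrow> z | None \<Rightarrow> El k N l ! (q - (N - k))) = snd (l ! q)"
    proof (cases "badl k F1 l q")
      case True then show ?thesis using q by (simp add: Vl_def V_def)
    next
      case False
      then have "\<not> badl k F1 l N" using badl_same[of l N q k F1] q Nh by (simp add: T_def)
      then have "hi l N - T \<le> k" by (auto simp: badl_def T_def)
      then have "N - k \<le> q" using Nh q by linarith
      then have "El k N l ! (q - (N - k)) = snd (l ! q)"
        using nth_map[of "q - (N - k)" "[N - k..<N]" "\<lambda>i. snd (l ! i)"] nth_upt[of "N - k" "q - (N - k)" N] q by (simp add: El_def)
      then show ?thesis using False q by (simp add: Vl_def V_def)
    qed
  qed simp
  have w: "wprod (map (\<lambda>q. case Vl k F1 N l ! q of Some z \<Rightarrow> z | None \<Rightarrow> El k N l ! (q - (N - k))) [T..<N]) = letters l T N"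
    unfolding mm letters_def ..
  have ZN: "Zw l N = Zw l T \<circ> letters l T N" using Zw_letters[OF T(2)] N by simp
  have "\<exists>Q e j m. \<bar>Q\<bar> \<le> int (Cn L N) \<and> j < M \<and> m < Suc (card wpd_set) \<and> dec_base (Zw l (length l)) (Bhat (Vl k F1 N l) (Wl k F1 N l) T) T Q e j m = Zw l T"
  proof (cases "T = 0")
    case True then show ?thesis using M0 by (intro exI[of _ 0] exI[of _ True]) (auto simp: dec_base_def id_def)
  next
    case False
    then have TP: "T \<in> PT l" using T(1) by (simp add: Pv_def)
    obtain \<rho> e j where \<rho>: "j < M" "\<bar>\<rho> - dist b (Zw l T b)\<bar> \<le> Cadd" "\<And>D. \<bar>D - \<rho>\<bar> \<le> 1 \<Longrightarrow> Zw l T \<in> Cand (Zw l (length l) b) D e j"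
      using pivot_Cand[OF l TP] by blast
    define B where "B = Bhat (Vl k F1 N l) (Wl k F1 N l) T"
    have B: "B = Bsum k F1 l T" unfolding B_def by (rule Bhat_eq[OF T TL])
    have "\<bar>dist b (Zw l T b) - B\<bar> \<le> (L + Cadd) * real T" unfolding B by (rule distance_estimate[OF l L(1) _ T(1)]) (rule L(2))
    also have "\<dots> \<le> (L + Cadd) * real N" using T(2) L Cadd_pos by (intro mult_left_mono) auto
    finally have \<rho>B: "\<bar>\<rho> - B\<bar> \<le> Cadd + (L + Cadd) * real N" using \<rho>(2) by linarith
    define Q where "Q = \<lfloor>\<rho> - B\<rfloor>"
    have Q: "\<bar>Q\<bar> \<le> int (Cn L N)" using \<rho>B unfolding Q_def Cn_def by linarith
    have "\<bar>(B + of_int Q) - \<rho>\<bar> \<le> 1" unfolding Q_def by linarith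
    from \<rho>(3)[OF this] have in_Cand: "Zw l T \<in> Cand (Zw l (length l) b) (B + of_int Q) e j" .
    let ?S = "Cand (Zw l (length l) b) (B + of_int Q) e j"
    have S: "finite ?S" "card ?S \<le> card wpd_set" using Cand_card by auto
    have "encode ?S (Zw l T) < Suc (card wpd_set)" using encode(2)[OF S(1) in_Cand] S(2) by linarith
    then show ?thesis using Q \<rho>(1) encode(1)[OF S(1) in_Cand] False
      by (intro exI[of _ Q] exI[of _ e] exI[of _ j] exI[of _ "encode ?S (Zw l T)"]) (simp add: dec_base_def B_def)
  qed
  then obtain Q e j m where r: "\<bar>Q\<bar> \<le> int (Cn L N)" "j < M" "m < Suc (card wpd_set)"
    "dec_base (Zw l (length l)) (Bhat (Vl k F1 N l) (Wl k F1 N l) T) T Q e j m = Zw l T" by blast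
  have "dec k N (Zw l (length l), Vl k F1 N l, Wl k F1 N l, El k N l, T, Q, e, j, m) = (Zw l N, Zw l (length l))"
    unfolding dec_def prod.case r(4) w ZN ..
  then show ?thesis using r(1-3) unfolding T_def[symmetric] by (intro bexI[of _ "(Q, e, j, m)"]) auto
qed

section \<open>Probability of bad gaps and the entropy inequality\<close>

abbreviation q where "q \<equiv> map_pmf snd \<beta>"

lemma marginal: "i < n \<Longrightarrow> map_pmf (\<lambda>l. snd (l ! i)) (replicate_pmf n \<beta>) = q"
  using replicate_pmf_nth[of i n \<beta>] map_pmf_comp[of snd "\<lambda>l. l ! i" "replicate_pmf n \<beta>"] by simp

text \<open>A gap around \<open>i\<close> longer than \<open>2 * h\<close> has no pivot in the
  \<open>h\<close> times up to \<open>i\<close> or none in the \<open>h\<close> times after it. A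
  shorter one stays within \<open>2 * h\<close> of \<open>i\<close>, so its atypical letter is one
  of at most \<open>4 * h + 1\<close>.\<close>

lemma prob_bad:
  assumes i: "i < n" and \<alpha>0: "0 < \<alpha>" and \<delta>1: "measure_pmf.prob q (- F1) \<le> \<delta>1"
  shows "measure_pmf.prob (replicate_pmf n \<beta>) {l. badl (2 * h) F1 l i} \<le> 48 * \<kappa> ^ h / (1 - \<kappa>) + (4 * real h + 1) * \<delta>1"
proof -
  let ?P = "replicate_pmf n \<beta>"
  define Wn where "Wn a = {l. \<not> (\<exists>\<tau>\<in>set (ft (fst (final l))). a \<le> \<tau> \<and> \<tau> < a + h)}" for a
  \<comment> \<open>For \<open>i < h\<close> time 0 is a pivot close enough to \<open>i\<close>, and
    near the end the gap stops at \<open>n\<close>; the corresponding events are empty.\<close>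
  define E1 where "E1 = (if h \<le> i then Wn (i + 1 - h) else {})"
  define E2 where "E2 = (if i + 1 + h \<le> n then Wn (i + 1) else {})"
  define Qs where "Qs = {r\<in>{i - 2 * h..i + 2 * h}. r < n}"
  define E3 where "E3 = (\<Union>r\<in>Qs. {l :: (nat option \<times> ('x \<Rightarrow> 'x)) list. snd (l ! r) \<notin> F1})"
  have \<kappa>1: "\<kappa> < 1" using \<alpha>0 by (simp add: \<kappa>_def)
  have nn: "0 \<le> 24 * \<kappa> ^ h / (1 - \<kappa>)" using \<kappa>_bounds \<kappa>1 by simp
  have "measure_pmf.prob ?P {l. badl (2 * h) F1 l i} \<le> measure_pmf.prob ?P (E1 \<union> E2 \<union> E3)"
  proof (rule measure_pmf.finite_measure_mono_AE)
    show "AE l in ?P. l \<in> {l. badl (2 * h) F1 l i} \<longrightarrow> l \<in> E1 \<union> E2 \<union> E3"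
      unfolding AE_measure_pmf_iff
    proof (intro ballI impI)
      fix l assume l: "l \<in> set_pmf ?P" "l \<in> {l. badl (2 * h) F1 l i}"
      have len: "length l = n" using legit_support[OF l(1)] by simp
      have ih: "i < hi l i" "lo l i \<le> i" "hi l i \<le> n" using hi_gt[of i l] i len lo(2)[of l i] hi(2)[of l i] by auto
      consider "h \<le> i - lo l i" | "h + 1 \<le> hi l i - i" | "hi l i - lo l i \<le> 2 * h" using ih by linarith
      then show "l \<in> E1 \<union> E2 \<union> E3"
      proof cases
        case 1
        then have "h \<le> i" by simp
        moreover have "\<not> (i + 1 - h \<le> \<tau> \<and> \<tau> < i + 1 - h + h)" if "\<tau> \<in> set (ft (fst (final l)))" for \<tau>
        proof
          assume a: "i + 1 - h \<le> \<tau> \<and> \<tau> < i + 1 - h + h"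
          have "\<tau> \<in> Pv l" using that by (simp add: Pv_def PT_def)
          then have "\<tau> \<le> lo l i" using a \<open>h \<le> i\<close> by (intro lo(3)) auto
          then show False using a 1 ih \<open>h \<le> i\<close> by linarith
        qed
        ultimately have "l \<in> E1" unfolding E1_def Wn_def by auto
        then show ?thesis by blast
      next
        case 2
        then have "i + 1 + h \<le> n" using ih by linarith
        moreover have "\<not> (i + 1 \<le> \<tau> \<and> \<tau> < i + 1 + h)" if "\<tau> \<in> set (ft (fst (final l)))" for \<tau>
        proof
          assume a: "i + 1 \<le> \<tau> \<and> \<tau> < i + 1 + h"
          have "\<tau> \<in> Pv l" using that by (simp add: Pv_def PT_def)
          then have "hi l i \<le> \<tau>" using a by (intro hi(3)) auto
          then show False using a 2 by linarith
        qed
        ultimately have "l \<in> E2" unfolding E2_def Wn_def by auto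
        then show ?thesis by blast
      next
        case 3
        then obtain r where r: "r \<in> {lo l i..<hi l i}" "snd (l ! r) \<notin> F1" using l(2) by (auto simp: badl_def)
        have "r \<in> Qs" unfolding Qs_def using r(1) 3 ih by auto
        then show ?thesis using r(2) unfolding E3_def by blast
      qed
    qed
  qed simp
  also have "\<dots> \<le> measure_pmf.prob ?P (E1 \<union> E2) + measure_pmf.prob ?P E3" by (rule measure_Un_le) auto
  also have "\<dots> \<le> measure_pmf.prob ?P E1 + measure_pmf.prob ?P E2 + measure_pmf.prob ?P E3"
    by (intro add_right_mono measure_Un_le) auto
  also have "measure_pmf.prob ?P E1 \<le> 24 * \<kappa> ^ h / (1 - \<kappa>)"
    using window_probability[of "i + 1 - h" h n, OF _ \<alpha>0] i nn by (auto simp: E1_def Wn_def)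
  also have "measure_pmf.prob ?P E2 \<le> 24 * \<kappa> ^ h / (1 - \<kappa>)"
    using window_probability[of "i + 1" h n, OF _ \<alpha>0] nn by (auto simp: E2_def Wn_def)
  also have "measure_pmf.prob ?P E3 \<le> (4 * real h + 1) * \<delta>1"
  proof -
    have fQ: "finite Qs" by (simp add: Qs_def)
    have \<delta>0: "0 \<le> \<delta>1" using \<delta>1 measure_nonneg order_trans by blast
    have "measure_pmf.prob ?P E3 \<le> (\<Sum>r\<in>Qs. measure_pmf.prob ?P {l. snd (l ! r) \<notin> F1})"
      unfolding E3_def using fQ by (intro measure_pmf.finite_measure_subadditive_finite) auto
    also have "\<dots> \<le> (\<Sum>r\<in>Qs. \<delta>1)"
    proof (rule sum_mono)
      fix r assume "r \<in> Qs"
      then have "measure_pmf.prob (map_pmf (\<lambda>l. snd (l ! r)) ?P) (- F1) \<le> \<delta>1" using marginal[of r n] \<delta>1 by (simp only: Qs_def mem_Collect_eq)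
      moreover have "(\<lambda>l. snd (l ! r)) -` (- F1) = {l :: (nat option \<times> ('x \<Rightarrow> 'x)) list. snd (l ! r) \<notin> F1}" by auto
      ultimately show "measure_pmf.prob ?P {l. snd (l ! r) \<notin> F1} \<le> \<delta>1" by simp
    qed
    also have "\<dots> = real (card Qs) * \<delta>1" by simp
    also have "\<dots> \<le> (4 * real h + 1) * \<delta>1"
    proof (rule mult_right_mono[OF _ \<delta>0])
      have "card Qs \<le> card {i - 2 * h..i + 2 * h}" unfolding Qs_def by (intro card_mono) auto
      then show "real (card Qs) \<le> 4 * real h + 1" by simp
    qed
    finally show ?thesis .
  qed
  finally show ?thesis by simp
qed

text \<open>The position at time \<open>N\<close> and the increment up to time \<open>n\<close> are
  independent, so their joint entropy is the left side. It is bounded by the entropy of the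
  decoder's input, estimated separately for each component: small costs per step for rare letters
  and marks, a boundary term for the last \<open>2 * h\<close> letters, and logarithms.\<close>

theorem near_superadditive:
  assumes \<alpha>0: "0 < \<alpha>" and N: "2 * h \<le> N" "N < n"
    and F: "finite F" "tail F q \<le> ennreal \<eta>" "0 \<le> \<eta>" "measure_pmf.prob q (- F) \<le> exp (-1)"
    and F1: "0 \<le> L" "\<And>z. z \<in> F1 \<Longrightarrow> dist b (z b) \<le> L" "measure_pmf.prob q (- F1) \<le> \<delta>1"
    and \<delta>: "48 * \<kappa> ^ h / (1 - \<kappa>) + (4 * real h + 1) * \<delta>1 \<le> \<delta>" "\<delta> < 1"
  shows "Hp (rw q N) + Hp (rw q (n - N)) \<le> Hp (rw q n) + of_nat N * ennreal (2 * \<delta> + (2 * real (card F) + 2) * sqrt \<delta> + \<eta>)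
     + of_nat (2 * h) * Hp q + ennreal (ln (real (N + 1))) + ennreal (ln (real ((2 * Cn L N + 1) * (2 * (M * Suc (card wpd_set))))))"
proof -
  let ?P = "replicate_pmf n \<beta>"
  let ?k = "2 * h"
  have leg: "legit l" "length l = n" if "l \<in> set_pmf ?P" for l using legit_support[OF that] by auto
  define R where "R = {- int (Cn L N)..int (Cn L N)} \<times> (UNIV :: bool set) \<times> {..<M} \<times> {..<Suc (card wpd_set)}"
  have "\<exists>r\<in>R. dec ?k N (Zw l n, Vl ?k F1 N l, Wl ?k F1 N l, El ?k N l, lo l N, r) = (Zw l N, Zw l n)" if "l \<in> set_pmf ?P" for l
    using decode[OF leg(1)[OF that], of N ?k L F1] leg(2)[OF that] N F1 unfolding R_def by simp
  then obtain cd where cd: "\<And>l. l \<in> set_pmf ?P \<Longrightarrow> cd l \<in> R"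
    "\<And>l. l \<in> set_pmf ?P \<Longrightarrow> dec ?k N (Zw l n, Vl ?k F1 N l, Wl ?k F1 N l, El ?k N l, lo l N, cd l) = (Zw l N, Zw l n)" by metis
  have lawn: "map_pmf (\<lambda>l. Zw l n) ?P = rw q n"
  proof -
    have "map_pmf (\<lambda>l. Zw l n) ?P = map_pmf (\<lambda>l. wprod (map snd l)) ?P"
      by (rule map_pmf_cong) (auto simp: Zw_def dest: leg(2))
    then show ?thesis unfolding rw_def replicate_pmf_map[symmetric] map_pmf_comp .
  qed
  have \<delta>0: "0 \<le> \<delta>"
  proof -
    have "0 \<le> \<delta>1" using F1(3) measure_nonneg order_trans by blast
    moreover have "0 \<le> 48 * \<kappa> ^ h / (1 - \<kappa>)" using \<kappa>_bounds by simp
    ultimately have "0 \<le> 48 * \<kappa> ^ h / (1 - \<kappa>) + (4 * real h + 1) * \<delta>1" by simp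
    then show ?thesis using \<delta>(1) by linarith
  qed
  have pb: "measure_pmf.prob ?P {l. badl ?k F1 l i} \<le> \<delta>" if "i < N" for i
    using prob_bad[of i n F1 \<delta>1 h] that N \<alpha>0 F1(3) \<delta>(1) by linarith
  have HV: "Hp (map_pmf (Vl ?k F1 N) ?P) \<le> of_nat N * ennreal (\<delta> + 2 * real (card F) * sqrt \<delta> + \<eta>)"
  proof -
    have "Hp (map_pmf (Vl ?k F1 N) ?P) \<le> (\<Sum>i\<leftarrow>[0..<N]. Hp (map_pmf (V ?k F1 i) ?P))"
      using Hp_list_le[of "V ?k F1" "[0..<N]" ?P] by (simp add: Vl_def[abs_def])
    also have "\<dots> \<le> of_nat (length [0..<N]) * ennreal (\<delta> + 2 * real (card F) * sqrt \<delta> + \<eta>)"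
    proof (rule sum_list_le_const)
      fix i assume "i \<in> set [0..<N]"
      then have i: "i < N" "i < n" using N by auto
      show "Hp (map_pmf (V ?k F1 i) ?P) \<le> ennreal (\<delta> + 2 * real (card F) * sqrt \<delta> + \<eta>)"
        unfolding V_def[abs_def]
        by (rule Hp_rare[OF F(1) _ F(3) _ pb[OF i(1)] \<delta>(2)]) (simp_all only: marginal[OF i(2)] F)
    qed
    finally show ?thesis by simp
  qed
  have HW: "Hp (map_pmf (Wl ?k F1 N) ?P) \<le> of_nat N * ennreal (\<delta> + 2 * sqrt \<delta>)"
  proof -
    have "Hp (map_pmf (Wl ?k F1 N) ?P) \<le> (\<Sum>i\<leftarrow>[0..<N]. Hp (map_pmf (W ?k F1 i) ?P))"
      using Hp_list_le[of "W ?k F1" "[0..<N]" ?P] by (simp add: Wl_def[abs_def])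
    also have "\<dots> \<le> of_nat (length [0..<N]) * ennreal (\<delta> + 2 * sqrt \<delta>)"
    proof (rule sum_list_le_const)
      fix i assume "i \<in> set [0..<N]"
      then have i: "i < N" by auto
      have "measure_pmf.prob ?P {l. W ?k F1 i l} \<le> measure_pmf.prob ?P {l. badl ?k F1 l i}"
        by (intro measure_pmf.finite_measure_mono) (auto simp: W_def)
      then show "Hp (map_pmf (W ?k F1 i) ?P) \<le> ennreal (\<delta> + 2 * sqrt \<delta>)"
        using pb[OF i] \<delta>(2) by (intro Hp_rare_bool) auto
    qed
    finally show ?thesis by simp
  qed
  have HE: "Hp (map_pmf (El ?k N) ?P) \<le> of_nat ?k * Hp q"
  proof -
    have "Hp (map_pmf (El ?k N) ?P) \<le> (\<Sum>i\<leftarrow>[N - ?k..<N]. Hp (map_pmf (\<lambda>l. snd (l ! i)) ?P))"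
      using Hp_list_le[of "\<lambda>i l. snd (l ! i)" "[N - ?k..<N]" ?P] by (simp add: El_def[abs_def])
    also have "\<dots> \<le> of_nat (length [N - ?k..<N]) * Hp q"
    proof (rule sum_list_le_const)
      fix i assume "i \<in> set [N - ?k..<N]"
      then have "i < n" using N by auto
      then show "Hp (map_pmf (\<lambda>l. snd (l ! i)) ?P) \<le> Hp q" by (simp only: marginal order_refl)
    qed
    finally show ?thesis using N by simp
  qed
  have HT: "Hp (map_pmf (\<lambda>l. lo l N) ?P) \<le> ennreal (ln (real (N + 1)))"
    by (rule Hp_finite_range_map[where A = "{..N}"]) (use lo(2) in auto)
  have HR: "Hp (map_pmf cd ?P) \<le> ennreal (ln (real ((2 * Cn L N + 1) * (2 * (M * Suc (card wpd_set))))))"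
  proof (rule Hp_finite_range_map[where A = R])
    show "finite R" by (simp add: R_def)
    have "card R = nat (2 * int (Cn L N) + 1) * (2 * (M * Suc (card wpd_set)))" unfolding R_def card_cartesian_product by simp
    also have "nat (2 * int (Cn L N) + 1) = 2 * Cn L N + 1" by simp
    finally show "card R \<le> (2 * Cn L N + 1) * (2 * (M * Suc (card wpd_set)))" by simp
  qed (rule cd(1))
  have "Hp (rw q N) + Hp (rw q (n - N)) = Hp (pair_pmf (rw q N) (rw q (n - N)))" by (simp only: Hp_pair_pmf)
  also have "pair_pmf (rw q N) (rw q (n - N)) = map_pmf (\<lambda>l. (Zw l N, inv (Zw l N) \<circ> Zw l n)) ?P"
  proof -
    have e: "?P = map_pmf (\<lambda>(xs, ys). xs @ ys) (pair_pmf (replicate_pmf N \<beta>) (replicate_pmf (n - N) \<beta>))"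
      using replicate_pmf_pair[of N "n - N" \<beta>] N by simp
    have "map_pmf (\<lambda>l. (Zw l N, inv (Zw l N) \<circ> Zw l n)) ?P
       = map_pmf (\<lambda>(xs, ys). (Zw (xs @ ys) N, inv (Zw (xs @ ys) N) \<circ> Zw (xs @ ys) n)) (pair_pmf (replicate_pmf N \<beta>) (replicate_pmf (n - N) \<beta>))"
      unfolding e map_pmf_comp by (rule map_pmf_cong) auto
    also have "\<dots> = map_pmf (\<lambda>(xs, ys). (wprod (map snd xs), wprod (map snd ys))) (pair_pmf (replicate_pmf N \<beta>) (replicate_pmf (n - N) \<beta>))"
    proof (rule map_pmf_cong)
      fix z assume "z \<in> set_pmf (pair_pmf (replicate_pmf N \<beta>) (replicate_pmf (n - N) \<beta>))"
      then obtain xs ys where z: "z = (xs, ys)" "xs \<in> set_pmf (replicate_pmf N \<beta>)" "ys \<in> set_pmf (replicate_pmf (n - N) \<beta>)" by auto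
      have len: "length xs = N" "length ys = n - N" using legit_support z by auto
      have g: "wprod (map snd xs) \<in> G" using Zw_G[OF legit_support(1)[OF z(2)], of N] len by (simp add: Zw_def)
      have "inv (wprod (map snd xs)) \<circ> (wprod (map snd xs) \<circ> wprod (map snd ys)) = wprod (map snd ys)" using g by (simp add: fun_eq_iff)
      then show "(case z of (xs, ys) \<Rightarrow> (Zw (xs @ ys) N, inv (Zw (xs @ ys) N) \<circ> Zw (xs @ ys) n)) = (case z of (xs, ys) \<Rightarrow> (wprod (map snd xs), wprod (map snd ys)))"
        using len N by (simp only: z prod.case) (simp add: Zw_def wprod_append)
    qed simp
    also have "\<dots> = pair_pmf (rw q N) (rw q (n - N))"
      unfolding rw_def replicate_pmf_map[symmetric] map_pmf_comp pair_map_pmf1 pair_map_pmf2 by (intro map_pmf_cong) auto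
    finally show ?thesis ..
  qed
  also have "Hp (map_pmf (\<lambda>l. (Zw l N, inv (Zw l N) \<circ> Zw l n)) ?P) \<le> Hp (map_pmf (\<lambda>l. (Zw l N, Zw l n)) ?P)"
    by (rule Hp_function_le[where f = "\<lambda>(a, c). (a, inv a \<circ> c)"]) simp
  also have "\<dots> \<le> Hp (map_pmf (\<lambda>l. (Zw l n, Vl ?k F1 N l, Wl ?k F1 N l, El ?k N l, lo l N, cd l)) ?P)"
    by (rule Hp_function_le[where f = "dec ?k N"]) (use cd(2) in simp)
  also have "\<dots> \<le> Hp (map_pmf (\<lambda>l. Zw l n) ?P) + (Hp (map_pmf (Vl ?k F1 N) ?P) + (Hp (map_pmf (Wl ?k F1 N) ?P)
      + (Hp (map_pmf (El ?k N) ?P) + (Hp (map_pmf (\<lambda>l. lo l N) ?P) + Hp (map_pmf cd ?P)))))"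
    by (intro order_trans[OF Hp_Pair_le] add_left_mono order_refl)
  also have "\<dots> \<le> Hp (rw q n) + (of_nat N * ennreal (\<delta> + 2 * real (card F) * sqrt \<delta> + \<eta>) + (of_nat N * ennreal (\<delta> + 2 * sqrt \<delta>)
      + (of_nat ?k * Hp q + (ennreal (ln (real (N + 1))) + ennreal (ln (real ((2 * Cn L N + 1) * (2 * (M * Suc (card wpd_set)))))))))) "
    unfolding lawn by (intro add_mono order_refl HV HW HE HT HR)
  also have "\<dots> = Hp (rw q n) + of_nat N * (ennreal (\<delta> + 2 * real (card F) * sqrt \<delta> + \<eta>) + ennreal (\<delta> + 2 * sqrt \<delta>))
     + of_nat (2 * h) * Hp q + ennreal (ln (real (N + 1))) + ennreal (ln (real ((2 * Cn L N + 1) * (2 * (M * Suc (card wpd_set))))))"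
    by (simp only: distrib_left add.assoc)
  also have "ennreal (\<delta> + 2 * real (card F) * sqrt \<delta> + \<eta>) + ennreal (\<delta> + 2 * sqrt \<delta>) = ennreal (2 * \<delta> + (2 * real (card F) + 2) * sqrt \<delta> + \<eta>)"
    using \<delta>0 F(3) by (subst ennreal_plus[symmetric]) (auto simp: algebra_simps)
  finally show ?thesis .
qed

end

section \<open>Continuity of the entropy of convolution powers\<close>

lemma nn_integral_infsum:
  fixes f :: "'a \<Rightarrow> real"
  assumes f: "\<And>x. x \<in> A \<Longrightarrow> 0 \<le> f x" and s: "f summable_on A"
  shows "(\<integral>\<^sup>+ x. ennreal (f x) \<partial>count_space A) = ennreal (infsum f A)"
proof -
  have a: "Infinite_Set_Sum.abs_summable_on f A"
    using s summable_on_iff_abs_summable_on_real[of f A] abs_summable_equivalent[of f A] by blast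
  then have i: "integrable (count_space A) f" by (simp add: Infinite_Set_Sum.abs_summable_on_def)
  have "(\<integral>\<^sup>+ x. ennreal (f x) \<partial>count_space A) = ennreal (integral\<^sup>L (count_space A) f)"
    using f by (intro nn_integral_eq_integral[OF i]) (simp add: AE_count_space)
  then show ?thesis using infsetsum_infsum[OF a] by (simp add: infsetsum_def)
qed

lemma summable_on_nn_integral:
  fixes f :: "'a \<Rightarrow> real"
  assumes f: "\<And>x. x \<in> A \<Longrightarrow> 0 \<le> f x" and s: "(\<integral>\<^sup>+ x. ennreal (f x) \<partial>count_space A) < \<infinity>"
  shows "f summable_on A"
proof -
  have "(\<integral>\<^sup>+ x. ennreal (norm (f x)) \<partial>count_space A) = (\<integral>\<^sup>+ x. ennreal (f x) \<partial>count_space A)"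
    by (intro nn_integral_cong) (use f in auto)
  then have "integrable (count_space A) f" using s by (intro integrableI_bounded) auto
  then show ?thesis
    using summable_on_iff_abs_summable_on_real[of f A] abs_summable_equivalent[of f A] by (simp add: Infinite_Set_Sum.abs_summable_on_def)
qed

lemma nn_integral_count_space_restrict:
  assumes "\<And>x. x \<notin> A \<Longrightarrow> f x = 0"
  shows "(\<integral>\<^sup>+ x. f x \<partial>count_space UNIV) = (\<integral>\<^sup>+ x. f x \<partial>count_space A)"
  by (subst nn_integral_count_space_indicator[of A]) (auto intro!: nn_integral_cong simp: indicator_def assms)

section \<open>The given measures as probability mass functions\<close>

definition law :: "('x \<Rightarrow> 'x) set \<Rightarrow> (('x \<Rightarrow> 'x) \<Rightarrow> real) \<Rightarrow> ('x \<Rightarrow> 'x) pmf" where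
  "law G \<mu> = embed_pmf (\<lambda>x. if x \<in> G then \<mu> x else 0)"

lemma pmf_law:
  assumes "prob_on G \<mu>"
  shows "pmf (law G \<mu>) x = (if x \<in> G then \<mu> x else 0)"
proof -
  have n: "\<And>x. x \<in> G \<Longrightarrow> 0 \<le> \<mu> x" and s: "(\<mu> has_sum 1) G" using assms by (auto simp: prob_on_def)
  have "(\<integral>\<^sup>+ x. ennreal (if x \<in> G then \<mu> x else 0) \<partial>count_space UNIV) = (\<integral>\<^sup>+ x. ennreal (if x \<in> G then \<mu> x else 0) \<partial>count_space G)"
    by (rule nn_integral_count_space_restrict) simp
  also have "\<dots> = (\<integral>\<^sup>+ x. ennreal (\<mu> x) \<partial>count_space G)" by (rule nn_integral_cong) simp
  also have "\<dots> = ennreal (infsum \<mu> G)" using n s by (intro nn_integral_infsum) (auto simp: summable_on_def)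
  also have "\<dots> = 1" using infsumI[OF s] by simp
  finally show ?thesis unfolding law_def using n by (subst pmf_embed_pmf) auto
qed

lemma set_law: "prob_on G \<mu> \<Longrightarrow> set_pmf (law G \<mu>) \<subseteq> G"
  by (auto simp: set_pmf_iff pmf_law split: if_splits)

lemma wprod_closed:
  assumes "id \<in> G" "\<And>f h. f \<in> G \<Longrightarrow> h \<in> G \<Longrightarrow> f \<circ> h \<in> G" "set xs \<subseteq> G"
  shows "wprod xs \<in> G"
  using assms(3)
proof (induct xs)
  case Nil show ?case unfolding wprod_Nil by (rule assms(1))
next
  case (Cons a xs) then show ?case unfolding wprod_Cons by (intro assms(2)) auto
qed

lemma set_rw:
  assumes "isometry_group G" "set_pmf p \<subseteq> G" shows "set_pmf (rw p n) \<subseteq> G"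
proof
  fix z assume "z \<in> set_pmf (rw p n)"
  then obtain xs where xs: "z = wprod xs" "xs \<in> set_pmf (replicate_pmf n p)" by (auto simp: rw_def)
  then have "set xs \<subseteq> G" using assms(2) by (auto simp: set_replicate_pmf)
  then show "z \<in> G" unfolding xs(1) using assms(1) by (intro wprod_closed) (auto simp: isometry_group_def)
qed

lemma conv_pow_rw:
  assumes G: "isometry_group G" and \<mu>: "prob_on G \<mu>"
  shows "x \<in> G \<Longrightarrow> conv_pow G \<mu> n x = pmf (rw (law G \<mu>) n) x"
proof (induct n arbitrary: x)
  case 0 then show ?case by (simp add: rw_0 indicator_def)
next
  case (Suc n)
  let ?P = "law G \<mu>"
  have GG: "\<And>f. f \<in> G \<Longrightarrow> bij f" "\<And>f h. f \<in> G \<Longrightarrow> h \<in> G \<Longrightarrow> f \<circ> h \<in> G" "\<And>f. f \<in> G \<Longrightarrow> inv f \<in> G"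
    using G by (auto simp: isometry_group_def isometry_def)
  let ?f = "\<lambda>y. pmf (rw ?P n) y * pmf ?P (inv y \<circ> x)"
  have "ennreal (pmf (rw ?P (Suc n)) x) = (\<integral>\<^sup>+ z. indicator ((\<lambda>(x, y). x \<circ> y) -` {x}) z \<partial>pair_pmf (rw ?P n) ?P)"
    unfolding rw_Suc by (rule ennreal_pmf_map)
  also have "\<dots> = (\<integral>\<^sup>+ y. \<integral>\<^sup>+ z. indicator ((\<lambda>(x, y). x \<circ> y) -` {x}) (y, z) \<partial>?P \<partial>rw ?P n)"
    by (rule nn_integral_pair_pmf')
  also have "\<dots> = (\<integral>\<^sup>+ y. ennreal (pmf ?P (inv y \<circ> x)) \<partial>rw ?P n)"
  proof (rule nn_integral_pmf_cong)
    fix y assume "y \<in> set_pmf (rw ?P n)"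
    then have y: "y \<in> G" using set_rw[OF G set_law[OF \<mu>]] by blast
    have "y \<circ> z = x \<longleftrightarrow> z = inv y \<circ> x" for z
    proof
      assume "y \<circ> z = x"
      moreover have "inv y \<circ> (y \<circ> z) = z" using GG(1)[OF y] by (simp add: fun_eq_iff bij_is_inj)
      ultimately show "z = inv y \<circ> x" by simp
    next
      assume "z = inv y \<circ> x"
      then show "y \<circ> z = x" using GG(1)[OF y] by (auto simp: fun_eq_iff bij_is_surj surj_f_inv_f)
    qed
    then have "(\<integral>\<^sup>+ z. indicator ((\<lambda>(x, y). x \<circ> y) -` {x}) (y, z) \<partial>?P) = (\<integral>\<^sup>+ z. indicator {inv y \<circ> x} z \<partial>?P)"
      by (intro nn_integral_cong) (auto simp: indicator_def)
    also have "\<dots> = ennreal (pmf ?P (inv y \<circ> x))" by (simp add: emeasure_pmf_single)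
    finally show "(\<integral>\<^sup>+ z. indicator ((\<lambda>(x, y). x \<circ> y) -` {x}) (y, z) \<partial>?P) = ennreal (pmf ?P (inv y \<circ> x))" .
  qed
  also have "\<dots> = (\<integral>\<^sup>+ y. ennreal (pmf (rw ?P n) y) * ennreal (pmf ?P (inv y \<circ> x)) \<partial>count_space UNIV)"
    by (rule nn_integral_measure_pmf)
  also have "\<dots> = (\<integral>\<^sup>+ y. ennreal (?f y) \<partial>count_space UNIV)" by (simp add: ennreal_mult)
  also have "\<dots> = (\<integral>\<^sup>+ y. ennreal (?f y) \<partial>count_space G)"
  proof (rule nn_integral_count_space_restrict)
    fix y assume "y \<notin> G"
    then have "pmf (rw ?P n) y = 0" using set_rw[OF G set_law[OF \<mu>], of n] by (auto simp: set_pmf_iff)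
    then show "ennreal (?f y) = 0" by simp
  qed
  finally have I: "ennreal (pmf (rw ?P (Suc n)) x) = (\<integral>\<^sup>+ y. ennreal (?f y) \<partial>count_space G)" .
  have "(\<integral>\<^sup>+ y. ennreal (?f y) \<partial>count_space G) < \<infinity>" unfolding I[symmetric] by simp
  then have s: "?f summable_on G" by (intro summable_on_nn_integral) auto
  have "ennreal (pmf (rw ?P (Suc n)) x) = ennreal (infsum ?f G)" unfolding I using s by (intro nn_integral_infsum) auto
  then have "pmf (rw ?P (Suc n)) x = infsum ?f G" by (subst (asm) ennreal_inj) (auto intro!: infsum_nonneg)
  also have "\<dots> = infsum (\<lambda>y. conv_pow G \<mu> n y * \<mu> (inv y \<circ> x)) G"
  proof (rule infsum_cong)
    fix y assume y: "y \<in> G"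
    then have "inv y \<circ> x \<in> G" using GG Suc(2) by blast
    then show "?f y = conv_pow G \<mu> n y * \<mu> (inv y \<circ> x)" using Suc(1)[OF y] pmf_law[OF \<mu>] by simp
  qed
  finally show ?case by (simp add: conv_def)
qed

lemma entropy_term_nonneg: "0 \<le> - pmf p x * ln (pmf p x)"
proof -
  have "ln (pmf p x) \<le> 0" using pmf_le_1[of p x] pmf_nonneg[of p x] by (cases "pmf p x = 0") auto
  then have "pmf p x * ln (pmf p x) \<le> 0" by (rule mult_nonneg_nonpos[OF pmf_nonneg])
  then show ?thesis by simp
qed

lemma entropy_eq_Hp:
  assumes p: "set_pmf p \<subseteq> G" "Hp p < \<infinity>" and f: "\<And>x. x \<in> G \<Longrightarrow> f x = pmf p x"
  shows "entropy G f = enn2real (Hp p)"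
proof -
  have H: "Hp p = (\<integral>\<^sup>+ x. ennreal (- pmf p x * ln (pmf p x)) \<partial>count_space G)"
    unfolding Hp_count_space
  proof (rule nn_integral_count_space_restrict)
    fix x assume "x \<notin> G"
    then have "x \<notin> set_pmf p" using p(1) by blast
    then show "ennreal (- pmf p x * ln (pmf p x)) = 0" by (simp add: set_pmf_iff)
  qed
  have s: "(\<lambda>x. - pmf p x * ln (pmf p x)) summable_on G"
    using p(2) unfolding H by (intro summable_on_nn_integral entropy_term_nonneg)
  have "Hp p = ennreal (infsum (\<lambda>x. - pmf p x * ln (pmf p x)) G)"
    unfolding H using s by (intro nn_integral_infsum entropy_term_nonneg)
  moreover have "entropy G f = infsum (\<lambda>x. - pmf p x * ln (pmf p x)) G"
    unfolding entropy_def by (rule infsum_cong) (simp add: f)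
  moreover have "0 \<le> infsum (\<lambda>x. - pmf p x * ln (pmf p x)) G" by (intro infsum_nonneg entropy_term_nonneg)
  ultimately show ?thesis by simp
qed

lemma Hp_law_finite:
  assumes \<mu>: "prob_on G \<mu>" and fe: "finite_entropy G \<mu>" shows "Hp (law G \<mu>) < \<infinity>"
proof -
  let ?p = "law G \<mu>"
  have H: "Hp ?p = (\<integral>\<^sup>+ x. ennreal (- pmf ?p x * ln (pmf ?p x)) \<partial>count_space G)"
    unfolding Hp_count_space by (rule nn_integral_count_space_restrict) (use pmf_law[OF \<mu>] in auto)
  have "(\<lambda>x. - pmf ?p x * ln (pmf ?p x)) summable_on G"
    using fe unfolding finite_entropy_def by (rule summable_on_cong[THEN iffD1, rotated]) (simp add: pmf_law[OF \<mu>])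
  then show ?thesis unfolding H using entropy_term_nonneg[of ?p] by (subst nn_integral_infsum) auto
qed

lemma tendsto_entropy_fun:
  fixes a :: "nat \<Rightarrow> real"
  assumes a: "a \<longlonglongrightarrow> l" and b: "\<And>n. 0 \<le> a n" "\<And>n. a n \<le> 1"
  shows "(\<lambda>n. - a n * ln (a n)) \<longlonglongrightarrow> - l * ln l"
proof (cases "l = 0")
  case False
  then show ?thesis using a by (intro tendsto_intros)
next
  case True
  have up: "\<And>n. - a n * ln (a n) \<le> 2 * sqrt (a n)" using b by (rule entropy_fun_le_sqrt)
  have lo: "\<And>n. 0 \<le> - a n * ln (a n)"
  proof -
    fix n show "0 \<le> - a n * ln (a n)" using b[of n] by (cases "a n = 0") (auto intro!: mult_nonneg_nonpos)
  qed
  have "(\<lambda>n. 2 * sqrt (a n)) \<longlonglongrightarrow> 2 * sqrt 0" using a True by (intro tendsto_intros) auto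
  then have "(\<lambda>n. 2 * sqrt (a n)) \<longlonglongrightarrow> 0" by simp
  then have "(\<lambda>n. - a n * ln (a n)) \<longlonglongrightarrow> 0"
    by (rule tendsto_sandwich[OF always_eventually always_eventually tendsto_const, rotated 2]) (use lo up in auto)
  then show ?thesis using True by simp
qed

lemma nn_integral_lsc:
  fixes u :: "nat \<Rightarrow> 'a \<Rightarrow> ennreal"
  assumes "\<And>x. v x \<le> liminf (\<lambda>i. u i x)"
  shows "(\<integral>\<^sup>+ x. v x \<partial>count_space A) \<le> liminf (\<lambda>i. \<integral>\<^sup>+ x. u i x \<partial>count_space A)"
proof -
  have "(\<integral>\<^sup>+ x. v x \<partial>count_space A) \<le> (\<integral>\<^sup>+ x. liminf (\<lambda>i. u i x) \<partial>count_space A)" by (intro nn_integral_mono assms)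
  also have "\<dots> \<le> liminf (\<lambda>i. \<integral>\<^sup>+ x. u i x \<partial>count_space A)" by (rule nn_integral_liminf) simp
  finally show ?thesis .
qed

lemma liminf_ennreal_tendsto: "a \<longlonglongrightarrow> l \<Longrightarrow> ennreal l \<le> liminf (\<lambda>i. ennreal (a i))"
  using lim_imp_Liminf[OF trivial_limit_sequentially tendsto_ennrealI] by (metis order_refl)

lemma lsc_eventually:
  assumes "ennreal c \<le> liminf (\<lambda>i. ennreal (a i))" "0 < \<epsilon>" "\<And>i. 0 \<le> a i"
  shows "\<forall>\<^sub>F i in sequentially. c - \<epsilon> < a i"
proof (cases "c - \<epsilon> < 0")
  case True
  then show ?thesis using assms(3) by (intro always_eventually allI) (meson less_le_trans)
next
  case False
  then have "ennreal (c - \<epsilon>) < ennreal c" using assms(2) by (simp add: ennreal_less_iff)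
  then have "\<forall>\<^sub>F i in sequentially. ennreal (c - \<epsilon>) < ennreal (a i)" using assms(1) unfolding le_Liminf_iff by blast
  then show ?thesis by eventually_elim (use False in \<open>simp add: ennreal_less_iff\<close>)
qed

text \<open>Fatou's lemma bounds the lower limit for \<open>A\<close> and for its complement; as the
  total mass is 1, the second bound is an upper bound for \<open>A\<close>.\<close>

lemma pmf_tendsto_prob:
  assumes P: "\<And>x. (\<lambda>i. pmf (P i) x) \<longlonglongrightarrow> pmf Q x"
  shows "(\<lambda>i. measure_pmf.prob (P i) A) \<longlonglongrightarrow> measure_pmf.prob Q A"
proof -
  have lsc: "\<forall>\<^sub>F i in sequentially. measure_pmf.prob Q A - \<epsilon> < measure_pmf.prob (P i) A" if "0 < \<epsilon>" for A \<epsilon>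
  proof (rule lsc_eventually[OF _ that])
    have "(\<integral>\<^sup>+ x. ennreal (pmf Q x) \<partial>count_space A) \<le> liminf (\<lambda>i. \<integral>\<^sup>+ x. ennreal (pmf (P i) x) \<partial>count_space A)"
      by (intro nn_integral_lsc liminf_ennreal_tendsto P)
    then show "ennreal (measure_pmf.prob Q A) \<le> liminf (\<lambda>i. ennreal (measure_pmf.prob (P i) A))"
      unfolding nn_integral_pmf measure_pmf.emeasure_eq_measure .
  qed simp
  show ?thesis
  proof (rule LIMSEQ_I)
    fix r :: real assume r: "0 < r"
    have c: "measure_pmf.prob p (- A) = 1 - measure_pmf.prob p A" for p :: "'a pmf"
      using measure_pmf.prob_compl[of A p] by (simp add: Compl_eq_Diff_UNIV)
    have "\<forall>\<^sub>F i in sequentially. norm (measure_pmf.prob (P i) A - measure_pmf.prob Q A) < r"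
      using lsc[OF r, of A] lsc[OF r, of "- A"] by eventually_elim (simp add: c abs_less_iff)
    then show "\<exists>no. \<forall>n\<ge>no. norm (measure_pmf.prob (P n) A - measure_pmf.prob Q A) < r" by (simp add: eventually_sequentially)
  qed
qed

lemma pmf_tendsto_map:
  assumes "\<And>x. (\<lambda>i. pmf (P i) x) \<longlonglongrightarrow> pmf Q x"
  shows "(\<lambda>i. pmf (map_pmf f (P i)) y) \<longlonglongrightarrow> pmf (map_pmf f Q) y"
  unfolding pmf_map by (rule pmf_tendsto_prob[OF assms])

text \<open>The entropy lost by passing to \<open>map_pmf f p\<close>; both it and the entropy of the image are lower
  semicontinuous, so continuity of their sum forces continuity of each.\<close>

definition Hcond :: "('a \<Rightarrow> 'b) \<Rightarrow> 'a pmf \<Rightarrow> ennreal" where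
  "Hcond f p = (\<integral>\<^sup>+ x. ennreal (pmf p x * (ln (pmf (map_pmf f p) (f x)) - ln (pmf p x))) \<partial>count_space UNIV)"

lemma Hp_chain: "Hp p = Hp (map_pmf f p) + Hcond f p"
proof -
  have "Hcond f p = (\<integral>\<^sup>+ x. ennreal (ln (pmf (map_pmf f p) (f x)) - ln (pmf p x)) \<partial>p)"
    unfolding Hcond_def nn_integral_measure_pmf by (simp add: ennreal_mult')
  moreover have "Hp (map_pmf f p) = (\<integral>\<^sup>+ x. ennreal (- ln (pmf (map_pmf f p) (f x))) \<partial>p)" by (simp add: Hp_def)
  ultimately have "Hp (map_pmf f p) + Hcond f p = (\<integral>\<^sup>+ x. (ennreal (- ln (pmf (map_pmf f p) (f x))) + ennreal (ln (pmf (map_pmf f p) (f x)) - ln (pmf p x))) \<partial>p)"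
    by (simp add: nn_integral_add)
  also have "\<dots> = Hp p" unfolding Hp_def
  proof (rule nn_integral_pmf_cong)
    fix x assume "x \<in> set_pmf p"
    then have p: "0 < pmf p x" by (simp add: pmf_positive)
    then have r: "0 < pmf (map_pmf f p) (f x)" "pmf p x \<le> pmf (map_pmf f p) (f x)" using pmf_le_pmf_map[of p x f] by linarith+
    then have "0 \<le> - ln (pmf (map_pmf f p) (f x))" "0 \<le> ln (pmf (map_pmf f p) (f x)) - ln (pmf p x)" using p by (auto simp: pmf_le_1)
    from ennreal_plus[OF this] show "ennreal (- ln (pmf (map_pmf f p) (f x))) + ennreal (ln (pmf (map_pmf f p) (f x)) - ln (pmf p x)) = ennreal (- ln (pmf p x))"
      by simp
  qed
  finally show ?thesis ..
qed

lemma Hp_lsc: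
  assumes "\<And>x. (\<lambda>i. pmf (P i) x) \<longlonglongrightarrow> pmf Q x" shows "Hp Q \<le> liminf (\<lambda>i. Hp (P i))"
  unfolding Hp_count_space by (intro nn_integral_lsc liminf_ennreal_tendsto tendsto_entropy_fun assms) (auto simp: pmf_le_1)

lemma Hcond_lsc:
  assumes P: "\<And>x. (\<lambda>i. pmf (P i) x) \<longlonglongrightarrow> pmf Q x" shows "Hcond f Q \<le> liminf (\<lambda>i. Hcond f (P i))"
  unfolding Hcond_def
proof (rule nn_integral_lsc)
  fix x
  show "ennreal (pmf Q x * (ln (pmf (map_pmf f Q) (f x)) - ln (pmf Q x))) \<le> liminf (\<lambda>i. ennreal (pmf (P i) x * (ln (pmf (map_pmf f (P i)) (f x)) - ln (pmf (P i) x))))"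
  proof (cases "pmf Q x = 0")
    case False
    then have "0 < pmf Q x" using pmf_nonneg[of Q x] by linarith
    then have "0 < pmf (map_pmf f Q) (f x)" using pmf_le_pmf_map[of Q x f] by linarith
    then show ?thesis using False by (intro liminf_ennreal_tendsto tendsto_intros P pmf_tendsto_map[OF P]) auto
  qed simp
qed

lemma Hp_map_tendsto:
  assumes P: "\<And>x. (\<lambda>i. pmf (P i) x) \<longlonglongrightarrow> pmf Q x"
    and fin: "\<And>i. Hp (P i) < \<infinity>" "Hp Q < \<infinity>"
    and H: "(\<lambda>i. enn2real (Hp (P i))) \<longlonglongrightarrow> enn2real (Hp Q)"
  shows "(\<lambda>i. enn2real (Hp (map_pmf f (P i)))) \<longlonglongrightarrow> enn2real (Hp (map_pmf f Q))"
proof -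
  have fin2: "Hp (map_pmf f p) < \<infinity>" "Hcond f p < \<infinity>" if "Hp p < \<infinity>" for p
    using that unfolding Hp_chain[of p f] by auto
  have r: "enn2real (Hp p) = enn2real (Hp (map_pmf f p)) + enn2real (Hcond f p)" if "Hp p < \<infinity>" for p
    unfolding Hp_chain[of p f] using fin2[OF that] by (intro enn2real_plus) auto
  have e: "ennreal (enn2real (Hp (map_pmf f (P i)))) = Hp (map_pmf f (P i))" "ennreal (enn2real (Hp (map_pmf f Q))) = Hp (map_pmf f Q)"
    "ennreal (enn2real (Hcond f (P i))) = Hcond f (P i)" "ennreal (enn2real (Hcond f Q)) = Hcond f Q" for i
    using fin2[OF fin(1)[of i]] fin2[OF fin(2)] by simp_all
  show ?thesis
  proof (rule LIMSEQ_I)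
    fix s :: real assume s: "0 < s"
    have 1: "\<forall>\<^sub>F i in sequentially. enn2real (Hp (map_pmf f Q)) - s < enn2real (Hp (map_pmf f (P i)))"
      by (rule lsc_eventually[OF _ s]) (use Hp_lsc[OF pmf_tendsto_map[OF P], of f] in \<open>simp_all only: e enn2real_nonneg\<close>)
    have 2: "\<forall>\<^sub>F i in sequentially. enn2real (Hcond f Q) - s / 2 < enn2real (Hcond f (P i))"
      by (rule lsc_eventually) (use s Hcond_lsc[OF P, of f] in \<open>simp_all only: e enn2real_nonneg half_gt_zero\<close>)
    have "\<forall>\<^sub>F i in sequentially. dist (enn2real (Hp (P i))) (enn2real (Hp Q)) < s / 2" using tendstoD[OF H, of "s / 2"] s by simp
    with 1 2 have "\<forall>\<^sub>F i in sequentially. norm (enn2real (Hp (map_pmf f (P i))) - enn2real (Hp (map_pmf f Q))) < s"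
    proof eventually_elim
      case (elim i)
      then show ?case using r[OF fin(1), of i] r[OF fin(2)] by (simp add: dist_real_def abs_less_iff) argo
    qed
    then show "\<exists>no. \<forall>n\<ge>no. norm (enn2real (Hp (map_pmf f (P n))) - enn2real (Hp (map_pmf f Q))) < s" by (simp add: eventually_sequentially)
  qed
qed

lemma Hp_rw_finite: "Hp p < \<infinity> \<Longrightarrow> Hp (rw p n) < \<infinity>"
  using Hp_rw_le[of p n] by (simp add: ennreal_mult_less_top order.strict_trans1 ennreal_of_nat_eq_real_of_nat)

text \<open>Entropy is additive on products, so it converges for the pair formed by the walk and its
  next step, and \<open>Hp_map_tendsto\<close> passes to the composition. Pointwise convergence has
  to be carried along in the induction.\<close>

lemma rw_tendsto:
  assumes P: "\<And>x. (\<lambda>i. pmf (P i) x) \<longlonglongrightarrow> pmf Q x"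
    and fin: "\<And>i. Hp (P i) < \<infinity>" "Hp Q < \<infinity>"
    and H: "(\<lambda>i. enn2real (Hp (P i))) \<longlonglongrightarrow> enn2real (Hp Q)"
  shows "(\<forall>x. (\<lambda>i. pmf (rw (P i) n) x) \<longlonglongrightarrow> pmf (rw Q n) x) \<and> (\<lambda>i. enn2real (Hp (rw (P i) n))) \<longlonglongrightarrow> enn2real (Hp (rw Q n))"
proof (induct n)
  case 0 show ?case by (simp add: rw_0)
next
  case (Suc n)
  have pp: "(\<lambda>i. pmf (pair_pmf (rw (P i) n) (P i)) z) \<longlonglongrightarrow> pmf (pair_pmf (rw Q n) Q) z" for z
    using Suc P by (cases z) (auto simp: pmf_pair intro!: tendsto_intros)
  have er: "enn2real (Hp (pair_pmf (rw p n) p)) = enn2real (Hp (rw p n)) + enn2real (Hp p)" if "Hp p < \<infinity>" for p :: "('a \<Rightarrow> 'a) pmf"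
    unfolding Hp_pair_pmf using that Hp_rw_finite[OF that, of n] by (intro enn2real_plus) auto
  have "(\<lambda>i. enn2real (Hp (pair_pmf (rw (P i) n) (P i)))) \<longlonglongrightarrow> enn2real (Hp (pair_pmf (rw Q n) Q))"
    unfolding er[OF fin(1)] er[OF fin(2)] using Suc H by (intro tendsto_add) auto
  then have "(\<lambda>i. enn2real (Hp (rw (P i) (Suc n)))) \<longlonglongrightarrow> enn2real (Hp (rw Q (Suc n)))"
    unfolding rw_Suc using fin Hp_rw_finite by (intro Hp_map_tendsto pp) (auto simp: Hp_pair_pmf)
  moreover have "\<forall>x. (\<lambda>i. pmf (rw (P i) (Suc n)) x) \<longlonglongrightarrow> pmf (rw Q (Suc n)) x"
    unfolding rw_Suc by (intro allI pmf_tendsto_map pp)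
  ultimately show ?case by blast
qed

text \<open>One finite set must serve both the entropy and the mass, hence the approximation of the
  sum \<open>g\<close> of the two summands.\<close>

lemma finite_tail:
  assumes p: "Hp p < \<infinity>" and \<eta>: "0 < \<eta>"
  shows "\<exists>F. finite F \<and> tail F p < ennreal \<eta> \<and> measure_pmf.prob p (- F) < \<eta>"
proof -
  let ?f = "\<lambda>x. - pmf p x * ln (pmf p x)"
  have sf: "?f summable_on UNIV" using p unfolding Hp_count_space by (intro summable_on_nn_integral entropy_term_nonneg)
  have sp: "pmf p summable_on UNIV"
    by (rule summable_on_nn_integral) (auto simp: nn_integral_pmf measure_pmf.emeasure_eq_measure)
  define g where "g x = ?f x + pmf p x" for x
  have g0: "0 \<le> g x" for x unfolding g_def using entropy_term_nonneg[of p x] pmf_nonneg[of p x] by linarith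
  have sg: "g summable_on UNIV" unfolding g_def using sf sp by (rule summable_on_add)
  obtain F where F: "finite F" "dist (sum g F) (infsum g UNIV) \<le> \<eta> / 2" using infsum_finite_approximation[OF sg, of "\<eta> / 2"] \<eta> by auto
  have "infsum g UNIV = infsum g F + infsum g (- F)"
    using sg F(1) by (subst infsum_Un_disjoint[symmetric]) (auto intro: summable_on_subset)
  then have "infsum g (- F) \<le> \<eta> / 2" using F by (simp add: dist_real_def abs_le_iff)
  moreover have "infsum ?f (- F) \<le> infsum g (- F)" "infsum (pmf p) (- F) \<le> infsum g (- F)"
    using summable_on_subset[OF sg, of "- F"] summable_on_subset[OF sf, of "- F"] summable_on_subset[OF sp, of "- F"] entropy_term_nonneg[of p] pmf_nonneg[of p]
    by (auto intro!: infsum_mono simp: g_def)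
  moreover have "tail F p = ennreal (infsum ?f (- F))"
    unfolding tail_def using summable_on_subset[OF sf, of "- F"] by (intro nn_integral_infsum entropy_term_nonneg) auto
  moreover have "ennreal (measure_pmf.prob p (- F)) = ennreal (infsum (pmf p) (- F))"
    unfolding measure_pmf.emeasure_eq_measure[symmetric] nn_integral_pmf[symmetric]
    using summable_on_subset[OF sp, of "- F"] by (intro nn_integral_infsum) auto
  then have "measure_pmf.prob p (- F) = infsum (pmf p) (- F)" by (subst (asm) ennreal_inj) (auto intro!: infsum_nonneg)
  ultimately have "tail F p < ennreal \<eta>" "measure_pmf.prob p (- F) < \<eta>" using \<eta> by (auto intro!: ennreal_lessI)
  then show ?thesis using F(1) by blast
qed

lemma Hp_split: assumes "finite F" shows "Hp p = ennreal (\<Sum>x\<in>F. - pmf p x * ln (pmf p x)) + tail F p"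
proof -
  let ?f = "\<lambda>x. ennreal (- pmf p x * ln (pmf p x))"
  have "Hp p = (\<integral>\<^sup>+ x. ?f x * indicator F x + ?f x * indicator (- F) x \<partial>count_space UNIV)"
    unfolding Hp_count_space by (rule nn_integral_cong) (simp add: indicator_def)
  also have "\<dots> = (\<integral>\<^sup>+ x. ?f x * indicator F x \<partial>count_space UNIV) + (\<integral>\<^sup>+ x. ?f x * indicator (- F) x \<partial>count_space UNIV)"
    by (rule nn_integral_add) auto
  also have "(\<integral>\<^sup>+ x. ?f x * indicator F x \<partial>count_space UNIV) = (\<integral>\<^sup>+ x. ?f x \<partial>count_space F)"
    by (simp add: nn_integral_count_space_indicator)
  also have "\<dots> = ennreal (\<Sum>x\<in>F. - pmf p x * ln (pmf p x))"
    using assms entropy_term_nonneg[of p] by (simp add: nn_integral_count_space_finite sum_ennreal)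
  also have "(\<integral>\<^sup>+ x. ?f x * indicator (- F) x \<partial>count_space UNIV) = tail F p"
    unfolding tail_def by (simp add: nn_integral_count_space_indicator)
  finally show ?thesis .
qed

text \<open>The part over \<open>F\<close> converges by pointwise convergence and the total entropy
  by hypothesis, so the tail converges too. This is the uniform control on the sequence that
  convergence of entropies adds to simple convergence.\<close>

lemma tail_eventually:
  assumes P: "\<And>x. (\<lambda>i. pmf (P i) x) \<longlonglongrightarrow> pmf Q x"
    and fin: "\<And>i. Hp (P i) < \<infinity>" "Hp Q < \<infinity>"
    and H: "(\<lambda>i. enn2real (Hp (P i))) \<longlonglongrightarrow> enn2real (Hp Q)"
    and F: "finite F" "tail F Q < ennreal \<eta>" "measure_pmf.prob Q (- F) < \<eta>"
  shows "\<forall>\<^sub>F i in sequentially. tail F (P i) \<le> ennreal \<eta> \<and> measure_pmf.prob (P i) (- F) \<le> \<eta>"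
proof -
  let ?S = "\<lambda>p. \<Sum>x\<in>F. - pmf p x * ln (pmf p x)"
  have S0: "0 \<le> ?S p" for p :: "'a pmf" by (intro sum_nonneg entropy_term_nonneg)
  have t: "tail F p < \<infinity>" "enn2real (tail F p) = enn2real (Hp p) - ?S p" if "Hp p < \<infinity>" for p :: "'a pmf"
  proof -
    show "tail F p < \<infinity>" using that unfolding Hp_split[OF F(1), of p] by auto
    then show "enn2real (tail F p) = enn2real (Hp p) - ?S p" unfolding Hp_split[OF F(1), of p] using S0[of p] by (subst enn2real_plus) auto
  qed
  have "(\<lambda>i. enn2real (tail F (P i))) \<longlonglongrightarrow> enn2real (tail F Q)"
    unfolding t(2)[OF fin(1)] t(2)[OF fin(2)] by (intro tendsto_intros H tendsto_entropy_fun P) (auto simp: pmf_le_1)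
  moreover have "enn2real (tail F Q) < \<eta>" using F(2) t(1)[OF fin(2)] by (cases "tail F Q") (auto simp: ennreal_less_iff)
  ultimately have "\<forall>\<^sub>F i in sequentially. enn2real (tail F (P i)) < \<eta>" by (rule order_tendstoD(2))
  moreover have "\<forall>\<^sub>F i in sequentially. measure_pmf.prob (P i) (- F) < \<eta>" using pmf_tendsto_prob[OF P] F(3) by (rule order_tendstoD(2))
  ultimately show ?thesis
  proof eventually_elim
    case (elim i)
    have "tail F (P i) = ennreal (enn2real (tail F (P i)))" using t(1)[OF fin(1), of i] by simp
    also have "\<dots> \<le> ennreal \<eta>" using elim(1) by (intro ennreal_leI) simp
    finally show ?case using elim(2) by simp
  qed
qed

lemma fekete:
  fixes a :: "nat \<Rightarrow> real"
  assumes nn: "\<And>n. 0 \<le> a n" and sub: "\<And>m n. a (m + n) \<le> a m + a n"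
  shows "\<exists>L. (\<lambda>n. a n / real n) \<longlonglongrightarrow> L \<and> (\<forall>n>0. L \<le> a n / real n)"
proof -
  define L where "L = Inf ((\<lambda>n. a n / real n) ` {1..})"
  have bdd: "bdd_below ((\<lambda>n. a n / real n) ` {1..})" using nn by (intro bdd_belowI[of _ 0]) auto
  have L: "L \<le> a n / real n" if "0 < n" for n unfolding L_def using that by (intro cInf_lower bdd) auto
  have mult: "a (q * m + r) \<le> real q * a m + a r" for q m r
  proof (induct q)
    case (Suc q)
    have "a (Suc q * m + r) \<le> a m + a (q * m + r)" using sub[of m "q * m + r"] by (simp add: add.assoc)
    then show ?case using Suc by (simp add: algebra_simps)
  qed simp
  have "(\<lambda>n. a n / real n) \<longlonglongrightarrow> L"
  proof (rule LIMSEQ_I)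
    fix \<epsilon> :: real assume \<epsilon>: "0 < \<epsilon>"
    have "\<exists>y\<in>(\<lambda>n. a n / real n) ` {1..}. y < L + \<epsilon> / 2" unfolding L_def using \<epsilon> by (intro cInf_lessD) (auto simp: L_def)
    then obtain m where m: "1 \<le> m" "a m / real m < L + \<epsilon> / 2" by auto
    define C where "C = (\<Sum>r<m. a r)"
    define n0 where "n0 = nat \<lceil>2 * C / \<epsilon>\<rceil> + 1"
    have "norm (a n / real n - L) < \<epsilon>" if "n \<ge> n0" for n
    proof -
      have n: "0 < n" "real n > 2 * C / \<epsilon>" using that unfolding n0_def by (simp, linarith)
      define q r where "q = n div m" and "r = n mod m"
      have r: "r < m" "n = q * m + r" using m by (auto simp: q_def r_def)
      have "a r \<le> C" unfolding C_def using nn r(1) by (intro member_le_sum) auto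
      then have "a n \<le> real q * a m + C" using mult[of q m r] r(2) by simp
      also have "real q * a m = (real q * real m) * (a m / real m)" using m by simp
      also have "\<dots> \<le> real n * (a m / real m)" using nn[of m] r(2) by (intro mult_right_mono) auto
      finally have "a n / real n \<le> a m / real m + C / real n" using n by (simp add: field_simps)
      moreover have "C / real n < \<epsilon> / 2" using n \<epsilon> by (simp add: field_simps)
      ultimately have "a n / real n < L + \<epsilon>" using m(2) by linarith
      then show ?thesis using L[OF n(1)] by simp
    qed
    then show "\<exists>no. \<forall>n\<ge>no. norm (a n / real n - L) < \<epsilon>" by blast
  qed
  then show ?thesis using L by blast
qed

section \<open>Walks in the elementary closure\<close>

lemma ln_affine_small:
  fixes A B \<epsilon> :: real
  assumes "0 \<le> A" "0 < B" "0 < \<epsilon>"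
  shows "\<exists>N0. \<forall>N\<ge>N0. ln (A * real N + B) \<le> \<epsilon> * real N"
proof -
  define c where "c = 2 * sqrt (A + B) / \<epsilon>"
  define N0 where "N0 = nat \<lceil>c\<^sup>2\<rceil> + 1"
  have "ln (A * real N + B) \<le> \<epsilon> * real N" if "N0 \<le> N" for N
  proof -
    have N: "1 \<le> real N" "c\<^sup>2 \<le> real N" using that unfolding N0_def by linarith+
    have c0: "0 \<le> c" using assms by (simp add: c_def)
    define y where "y = A * real N + B"
    have y0: "0 < y" using assms by (simp add: y_def add_nonneg_pos)
    have yle: "y \<le> (A + B) * real N" using N(1) assms mult_left_mono[of 1 "real N" B] by (simp add: y_def algebra_simps)
    have "ln (sqrt y) \<le> sqrt y - 1" using y0 by (intro ln_le_minus_one) simp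
    then have "ln y \<le> 2 * sqrt y" using y0 by (simp add: ln_sqrt)
    also have "\<dots> \<le> 2 * sqrt ((A + B) * real N)" using yle by simp
    also have "\<dots> = \<epsilon> * (c * sqrt (real N))" using assms by (simp add: c_def real_sqrt_mult)
    also have "\<dots> \<le> \<epsilon> * real N"
    proof (rule mult_left_mono)
      have "c \<le> sqrt (real N)" using N(2) c0 by (metis real_le_rsqrt)
      then have "c * sqrt (real N) \<le> sqrt (real N) * sqrt (real N)" by (intro mult_right_mono) auto
      then show "c * sqrt (real N) \<le> real N" by simp
    qed (use assms in simp)
    finally show ?thesis by (simp add: y_def)
  qed
  then show ?thesis by blast
qed

context wpd_orbit
begin

definition p1 :: int where "p1 = (SOME p. p > 0 \<and> (\<forall>y\<in>E. commutes_upto_sign p y))"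

lemma p1: "p1 > 0" "\<And>y. y \<in> E \<Longrightarrow> commutes_upto_sign p1 y"
proof -
  have "\<exists>p. p > 0 \<and> (\<forall>y\<in>E. commutes_upto_sign p y)" using uniform_exponent by blast
  from someI_ex[OF this, folded p1_def] show "p1 > 0" "\<And>y. y \<in> E \<Longrightarrow> commutes_upto_sign p1 y" by auto
qed

text \<open>Coset representatives of \<open>E\<close> modulo the powers of \<open>ipow g p1\<close>:
  those in \<open>\<Psi>\<close> modulo the powers of \<open>g\<close>, combined with the residues
  of exponents modulo \<open>p1\<close>.\<close>

definition reps :: "('x \<Rightarrow> 'x) set" where "reps = (\<lambda>(\<psi>, r). \<psi> \<circ> ipow g r) ` ((\<Psi> \<inter> E) \<times> {0..<p1})"

lemma finite_reps: "finite reps" unfolding reps_def using finite_\<Psi> by simp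

lemma reps_E: "f \<in> reps \<Longrightarrow> f \<in> E"
  unfolding reps_def using E_comp E_ipow by auto

lemma E_decompose: assumes "y \<in> E" shows "\<exists>f\<in>reps. \<exists>k. y = f \<circ> ipow g (p1 * k)"
proof -
  obtain j where j: "y \<circ> ipow g j \<in> \<Psi>" using E_coset[OF assms] by blast
  have jE: "y \<circ> ipow g j \<in> E" by (rule E_comp[OF assms E_ipow])
  define r k where "r = (- j) mod p1" and "k = (- j) div p1"
  have rk: "r + p1 * k = - j" "0 \<le> r" "r < p1" using p1(1) by (auto simp: r_def k_def)
  have "(y \<circ> ipow g j) \<circ> ipow g r \<circ> ipow g (p1 * k) = y \<circ> (ipow g j \<circ> (ipow g r \<circ> ipow g (p1 * k)))" by (simp only: comp_assoc)
  also have "\<dots> = y \<circ> ipow g (j + (r + p1 * k))" by (simp only: ipow_add[OF bij_g])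
  also have "\<dots> = y" using rk(1) by simp
  finally have "y = ((y \<circ> ipow g j) \<circ> ipow g r) \<circ> ipow g (p1 * k)" ..
  moreover have "(y \<circ> ipow g j) \<circ> ipow g r \<in> reps"
    unfolding reps_def using j jE rk by (intro image_eqI[of _ _ "(y \<circ> ipow g j, r)"]) auto
  ultimately show ?thesis by blast
qed

definition fp :: "('x \<Rightarrow> 'x) \<Rightarrow> 'x \<Rightarrow> 'x" where "fp y = (SOME f. f \<in> reps \<and> (\<exists>k. y = f \<circ> ipow g (p1 * k)))"
definition kp :: "('x \<Rightarrow> 'x) \<Rightarrow> int" where "kp y = (SOME k. y = fp y \<circ> ipow g (p1 * k))"
definition sg :: "('x \<Rightarrow> 'x) \<Rightarrow> int" where "sg y = (SOME \<sigma>. (\<sigma> = 1 \<or> \<sigma> = -1) \<and> (\<forall>k. y \<circ> ipow g (p1 * k) = ipow g (\<sigma> * p1 * k) \<circ> y))"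

lemma fp_kp: assumes "y \<in> E" shows "fp y \<in> reps" "y = fp y \<circ> ipow g (p1 * kp y)"
proof -
  have "\<exists>f. f \<in> reps \<and> (\<exists>k. y = f \<circ> ipow g (p1 * k))" using E_decompose[OF assms] by blast
  from someI_ex[OF this, folded fp_def] show "fp y \<in> reps" and "y = fp y \<circ> ipow g (p1 * kp y)"
    unfolding kp_def by (blast, metis (mono_tags, lifting) someI_ex)
qed

lemma sg: assumes "y \<in> E" shows "sg y = 1 \<or> sg y = -1" "y \<circ> ipow g (p1 * k) = ipow g (sg y * p1 * k) \<circ> y"
proof -
  have "\<exists>\<sigma>. (\<sigma> = 1 \<or> \<sigma> = -1) \<and> (\<forall>k. y \<circ> ipow g (p1 * k) = ipow g (\<sigma> * p1 * k) \<circ> y)"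
    using p1(2)[OF assms] unfolding commutes_upto_sign_def .
  from someI_ex[OF this, folded sg_def] show "sg y = 1 \<or> sg y = -1" "y \<circ> ipow g (p1 * k) = ipow g (sg y * p1 * k) \<circ> y" by auto
qed

lemma sg_left: assumes "y \<in> E" shows "ipow g (p1 * k) \<circ> y = y \<circ> ipow g (p1 * (sg y * k))"
proof -
  have "sg y * p1 * (sg y * k) = p1 * k" using sg(1)[OF assms] by auto
  then show ?thesis using sg(2)[OF assms, of "sg y * k"] by metis
qed

definition Ck :: int where "Ck = (\<Sum>(f, f')\<in>reps \<times> reps. \<bar>kp (f \<circ> f')\<bar>) + \<bar>kp id\<bar>"

lemma Ck: "f \<in> reps \<Longrightarrow> f' \<in> reps \<Longrightarrow> \<bar>kp (f \<circ> f')\<bar> \<le> Ck" "\<bar>kp id\<bar> \<le> Ck" "0 \<le> Ck"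
proof -
  have 0: "0 \<le> (\<Sum>(f, f')\<in>reps \<times> reps. \<bar>kp (f \<circ> f')\<bar>)" by (intro sum_nonneg) auto
  then show "\<bar>kp id\<bar> \<le> Ck" "0 \<le> Ck" by (simp_all add: Ck_def)
  assume "f \<in> reps" "f' \<in> reps"
  then have "(case (f, f') of (f, f') \<Rightarrow> \<bar>kp (f \<circ> f')\<bar>) \<le> (\<Sum>(f, f')\<in>reps \<times> reps. \<bar>kp (f \<circ> f')\<bar>)"
    using finite_reps by (intro member_le_sum) auto
  then show "\<bar>kp (f \<circ> f')\<bar> \<le> Ck" by (simp add: Ck_def)
qed

lemma id_E: "id \<in> E" using E_ipow[of 0] unfolding ipow_0 .

lemma wprod_E: "set xs \<subseteq> E \<Longrightarrow> wprod xs \<in> E"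
  using wprod_closed[of E xs] id_E E_comp by blast

text \<open>Powers of \<open>ipow g p1\<close> are collected on the right: passing a suffix of the
  word multiplies the exponent by the sign of that suffix, and replacing a product of two
  representatives by a representative changes it by at most \<open>Ck\<close>.\<close>

lemma wprod_exponent:
  "set xs \<subseteq> E \<Longrightarrow> \<exists>f\<in>reps. \<exists>k. wprod xs = f \<circ> ipow g (p1 * k) \<and>
     \<bar>k - (\<Sum>i<length xs. sg (wprod (drop (Suc i) xs)) * kp (xs ! i))\<bar> \<le> Ck * (int (length xs) + 1)"
proof (induct xs)
  case Nil
  show ?case using fp_kp[OF id_E] Ck(2) unfolding wprod_Nil by (intro bexI[of _ "fp id"] exI[of _ "kp id"]) auto
next
  case (Cons y xs)
  then have yE: "y \<in> E" and xsE: "set xs \<subseteq> E" by auto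
  let ?S = "\<Sum>i<length xs. sg (wprod (drop (Suc i) xs)) * kp (xs ! i)"
  obtain f k where f: "f \<in> reps" "wprod xs = f \<circ> ipow g (p1 * k)" "\<bar>k - ?S\<bar> \<le> Ck * (int (length xs) + 1)"
    using Cons(1)[OF xsE] by blast
  have wE: "wprod xs \<in> E" by (rule wprod_E[OF xsE])
  let ?c = "kp (fp y \<circ> f)"
  let ?s = "sg (wprod xs)"
  have fE: "fp y \<circ> f \<in> E" using E_comp reps_E fp_kp(1)[OF yE] f(1) by blast
  have "wprod (y # xs) = (fp y \<circ> ipow g (p1 * kp y)) \<circ> wprod xs" unfolding wprod_Cons using fp_kp(2)[OF yE] by simp
  also have "\<dots> = fp y \<circ> (wprod xs \<circ> ipow g (p1 * (?s * kp y)))" unfolding comp_assoc sg_left[OF wE] ..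
  also have "\<dots> = (fp y \<circ> f) \<circ> (ipow g (p1 * k) \<circ> ipow g (p1 * (?s * kp y)))" unfolding f(2)[symmetric] by (simp only: f(2) comp_assoc)
  also have "\<dots> = (fp (fp y \<circ> f) \<circ> ipow g (p1 * ?c)) \<circ> (ipow g (p1 * k) \<circ> ipow g (p1 * (?s * kp y)))"
    using fp_kp(2)[OF fE] by simp
  also have "\<dots> = fp (fp y \<circ> f) \<circ> ipow g (p1 * (?c + (k + ?s * kp y)))"
    unfolding distrib_left ipow_add[OF bij_g] comp_assoc ..
  finally have e: "wprod (y # xs) = fp (fp y \<circ> f) \<circ> ipow g (p1 * (?c + (k + ?s * kp y)))" .
  have S: "(\<Sum>i<length (y # xs). sg (wprod (drop (Suc i) (y # xs))) * kp ((y # xs) ! i)) = ?s * kp y + ?S"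
    by (simp add: sum.lessThan_Suc_shift del: sum.lessThan_Suc)
  have "\<bar>?c\<bar> \<le> Ck" using Ck(1) fp_kp(1)[OF yE] f(1) by blast
  then have "\<bar>(?c + (k + ?s * kp y)) - (?s * kp y + ?S)\<bar> \<le> Ck * (int (length (y # xs)) + 1)"
    using f(3) by (simp add: algebra_simps abs_le_iff)
  then show ?case unfolding S using e fp_kp(1)[OF fE] by blast
qed

text \<open>Up to a linear error the exponent is a signed sum over the letters. Letters outside a
  finite set \<open>F'\<close> are rare and are recorded with their signs; every other letter
  contributes at most \<open>L\<close>, so what remains is an integer of linear size and logarithmic
  entropy.\<close>

lemma elementary_entropy:
  assumes pE: "set_pmf p \<subseteq> E" and Hf: "Hp p < \<infinity>" and \<epsilon>: "0 < \<epsilon>"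
  shows "\<exists>N>0. Hp (rw p N) \<le> ennreal (\<epsilon> * real N)"
proof -
  define \<eta> where "\<eta> = min (\<epsilon> / 4) (exp (-1))"
  have \<eta>: "0 < \<eta>" "\<eta> \<le> \<epsilon> / 4" "\<eta> \<le> exp (-1)" using \<epsilon> by (auto simp: \<eta>_def)
  obtain F where F: "finite F" "tail F p < ennreal \<eta>" "measure_pmf.prob p (- F) < \<eta>" using finite_tail[OF Hf \<eta>(1)] by blast
  define c where "c = 2 * real (card F) + 2"
  define s where "s = min (1 / 2) (\<epsilon> / (4 * (c + 2)))"
  have c: "2 \<le> c" by (simp add: c_def)
  have s: "0 < s" "s \<le> 1 / 2" "s \<le> \<epsilon> / (4 * (c + 2))"
    subgoal using \<epsilon> c by (simp add: s_def)
    subgoal unfolding s_def by (rule min.cobounded1)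
    subgoal unfolding s_def by (rule min.cobounded2)
    done
  define \<delta> where "\<delta> = s\<^sup>2"
  have \<delta>: "0 < \<delta>" "\<delta> < 1" "sqrt \<delta> = s" "\<delta> \<le> s"
  proof -
    have "s * s \<le> 1 * s" using s by (intro mult_right_mono) auto
    then show "\<delta> \<le> s" by (simp add: \<delta>_def power2_eq_square)
    then show "\<delta> < 1" using s by linarith
  qed (use s in \<open>auto simp: \<delta>_def\<close>)
  have \<delta>c: "2 * \<delta> + c * sqrt \<delta> \<le> \<epsilon> / 4"
  proof -
    have "2 * \<delta> + c * sqrt \<delta> \<le> (c + 2) * s" using \<delta> by (simp add: algebra_simps)
    also have "\<dots> \<le> (c + 2) * (\<epsilon> / (4 * (c + 2)))" using s c by (intro mult_left_mono) auto
    also have "\<dots> = \<epsilon> / 4" using c by (simp add: field_simps)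
    finally show ?thesis .
  qed
  obtain F' where F': "finite F'" "measure_pmf.prob p (- F') < \<delta>" using finite_tail[OF Hf \<delta>(1)] by blast
  define L where "L = (\<Sum>z\<in>F'. \<bar>kp z\<bar>)"
  have L: "z \<in> F' \<Longrightarrow> \<bar>kp z\<bar> \<le> L" for z unfolding L_def using F'(1) by (intro member_le_sum) auto
  have L0: "0 \<le> L" unfolding L_def by (intro sum_nonneg) auto
  define Cq where "Cq N = nat (Ck * (int N + 1) + int N * L)" for N
  have ne: "reps \<noteq> {}" using fp_kp(1)[OF id_E] by blast
  then have cr: "0 < card reps" using finite_reps by (simp add: card_gt_0_iff)
  have bound: "Hp (rw p N) \<le> of_nat N * ennreal (2 * \<delta> + c * sqrt \<delta> + \<eta>) + ennreal (ln (real ((2 * Cq N + 1) * card reps)))" for N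
  proof -
    let ?P = "replicate_pmf N p"
    let ?V = "\<lambda>i l. if l ! i \<notin> F' then Some (l ! i) else None"
    let ?W = "\<lambda>i l. l ! i \<notin> F' \<and> sg (wprod (drop (Suc i) l)) = 1"
    let ?vs = "\<lambda>l. map (\<lambda>i. ?V i l) [0..<N]"
    let ?ws = "\<lambda>l. map (\<lambda>i. ?W i l) [0..<N]"
    define dec where "dec = (\<lambda>(vs, ws, Q, f :: 'x \<Rightarrow> 'x). f \<circ> ipow g (p1 * (Q + (\<Sum>i<N. case vs ! i of None \<Rightarrow> 0 | Some z \<Rightarrow> if ws ! i then kp z else - kp z))))"
    define R where "R = {- int (Cq N)..int (Cq N)} \<times> reps"
    have "\<exists>r\<in>R. dec (?vs l, ?ws l, r) = wprod l" if l: "l \<in> set_pmf ?P" for l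
    proof -
      have len: "length l = N" and lE: "set l \<subseteq> E" using l pE by (auto simp: set_replicate_pmf)
      let ?S = "\<Sum>i<N. sg (wprod (drop (Suc i) l)) * kp (l ! i)"
      obtain f k where f: "f \<in> reps" "wprod l = f \<circ> ipow g (p1 * k)" "\<bar>k - ?S\<bar> \<le> Ck * (int N + 1)"
        using wprod_exponent[OF lE] unfolding len by blast
      let ?B = "\<Sum>i<N. case ?vs l ! i of None \<Rightarrow> 0 | Some z \<Rightarrow> if ?ws l ! i then kp z else - kp z"
      have sgE: "sg (wprod (drop (Suc i) l)) = 1 \<or> sg (wprod (drop (Suc i) l)) = -1" for i
        using lE set_drop_subset[of "Suc i" l] by (intro sg(1) wprod_E) blast
      have "\<bar>?S - ?B\<bar> \<le> (\<Sum>i<N. L)"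
        unfolding sum_subtractf[symmetric]
      proof (rule order_trans[OF sum_abs sum_mono])
        fix i assume i: "i \<in> {..<N}"
        show "\<bar>sg (wprod (drop (Suc i) l)) * kp (l ! i) - (case ?vs l ! i of None \<Rightarrow> 0 | Some z \<Rightarrow> if ?ws l ! i then kp z else - kp z)\<bar> \<le> L"
          using i sgE[of i] L[of "l ! i"] L0 by (auto simp: abs_mult)
      qed
      then have "\<bar>?S - ?B\<bar> \<le> int N * L" by simp
      then have "\<bar>k - ?B\<bar> \<le> Ck * (int N + 1) + int N * L" using f(3) by linarith
      then have "(k - ?B, f) \<in> R" unfolding R_def Cq_def using f(1) by auto
      moreover have "dec (?vs l, ?ws l, k - ?B, f) = wprod l" unfolding dec_def prod.case f(2) by simp
      ultimately show ?thesis by blast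
    qed
    then have "\<forall>l\<in>set_pmf ?P. \<exists>r. r \<in> R \<and> dec (?vs l, ?ws l, r) = wprod l" by blast
    from bchoice[OF this] obtain cd where "\<forall>l\<in>set_pmf ?P. cd l \<in> R \<and> dec (?vs l, ?ws l, cd l) = wprod l" by blast
    then have cd: "\<And>l. l \<in> set_pmf ?P \<Longrightarrow> cd l \<in> R" "\<And>l. l \<in> set_pmf ?P \<Longrightarrow> dec (?vs l, ?ws l, cd l) = wprod l" by blast+
    have HV: "Hp (map_pmf ?vs ?P) \<le> of_nat N * ennreal (\<delta> + 2 * real (card F) * sqrt \<delta> + \<eta>)"
    proof -
      have "Hp (map_pmf ?vs ?P) \<le> (\<Sum>i\<leftarrow>[0..<N]. Hp (map_pmf (?V i) ?P))" by (rule Hp_list_le)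
      also have "\<dots> \<le> of_nat (length [0..<N]) * ennreal (\<delta> + 2 * real (card F) * sqrt \<delta> + \<eta>)"
      proof (rule sum_list_le_const)
        fix i assume "i \<in> set [0..<N]"
        then have m: "map_pmf (\<lambda>l. l ! i) ?P = p" by (intro replicate_pmf_nth) simp
        have "measure_pmf.prob (map_pmf (\<lambda>l. l ! i) ?P) (- F') \<le> \<delta>" unfolding m using F'(2) by simp
        then have pr: "measure_pmf.prob ?P {l. l ! i \<notin> F'} \<le> \<delta>" by (simp add: vimage_def)
        show "Hp (map_pmf (?V i) ?P) \<le> ennreal (\<delta> + 2 * real (card F) * sqrt \<delta> + \<eta>)"
          by (rule Hp_rare[OF F(1) _ _ _ pr \<delta>(2)]) (use F \<eta> in \<open>simp_all add: m\<close>)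
      qed
      finally show ?thesis by simp
    qed
    have HW: "Hp (map_pmf ?ws ?P) \<le> of_nat N * ennreal (\<delta> + 2 * sqrt \<delta>)"
    proof -
      have "Hp (map_pmf ?ws ?P) \<le> (\<Sum>i\<leftarrow>[0..<N]. Hp (map_pmf (?W i) ?P))" by (rule Hp_list_le)
      also have "\<dots> \<le> of_nat (length [0..<N]) * ennreal (\<delta> + 2 * sqrt \<delta>)"
      proof (rule sum_list_le_const)
        fix i assume "i \<in> set [0..<N]"
        then have m: "map_pmf (\<lambda>l. l ! i) ?P = p" by (intro replicate_pmf_nth) simp
        have "measure_pmf.prob (map_pmf (\<lambda>l. l ! i) ?P) (- F') \<le> \<delta>" unfolding m using F'(2) by simp
        then have pr: "measure_pmf.prob ?P {l. l ! i \<notin> F'} \<le> \<delta>" by (simp add: vimage_def)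
        have "measure_pmf.prob ?P {l. ?W i l} \<le> measure_pmf.prob ?P {l. l ! i \<notin> F'}"
          by (intro measure_pmf.finite_measure_mono) auto
        then show "Hp (map_pmf (?W i) ?P) \<le> ennreal (\<delta> + 2 * sqrt \<delta>)"
          using pr \<delta>(2) by (intro Hp_rare_bool) auto
      qed
      finally show ?thesis by simp
    qed
    have HR: "Hp (map_pmf cd ?P) \<le> ennreal (ln (real ((2 * Cq N + 1) * card reps)))"
    proof (rule Hp_finite_range_map[where A = R])
      show "finite R" by (simp add: R_def finite_reps)
      have "card R = nat (2 * int (Cq N) + 1) * card reps" unfolding R_def card_cartesian_product by simp
      also have "nat (2 * int (Cq N) + 1) = 2 * Cq N + 1" by simp
      finally show "card R \<le> (2 * Cq N + 1) * card reps" by simp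
    qed (rule cd(1))
    have "Hp (rw p N) \<le> Hp (map_pmf (\<lambda>l. (?vs l, ?ws l, cd l)) ?P)"
      unfolding rw_def by (rule Hp_function_le[where f = dec]) (use cd(2) in simp)
    also have "\<dots> \<le> Hp (map_pmf ?vs ?P) + (Hp (map_pmf ?ws ?P) + Hp (map_pmf cd ?P))"
      by (intro order_trans[OF Hp_Pair_le] add_left_mono order_refl)
    also have "\<dots> \<le> of_nat N * ennreal (\<delta> + 2 * real (card F) * sqrt \<delta> + \<eta>) + (of_nat N * ennreal (\<delta> + 2 * sqrt \<delta>) + ennreal (ln (real ((2 * Cq N + 1) * card reps))))"
      by (intro add_mono HV HW HR)
    also have "\<dots> = of_nat N * (ennreal (\<delta> + 2 * real (card F) * sqrt \<delta> + \<eta>) + ennreal (\<delta> + 2 * sqrt \<delta>)) + ennreal (ln (real ((2 * Cq N + 1) * card reps)))"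
      by (simp only: distrib_left add.assoc)
    also have "ennreal (\<delta> + 2 * real (card F) * sqrt \<delta> + \<eta>) + ennreal (\<delta> + 2 * sqrt \<delta>) = ennreal (2 * \<delta> + c * sqrt \<delta> + \<eta>)"
      using \<delta> \<eta> by (subst ennreal_plus[symmetric]) (auto simp: c_def algebra_simps)
    finally show ?thesis .
  qed
  define A where "A = 2 * real_of_int (Ck + L) * real (card reps)"
  define B where "B = (2 * real_of_int Ck + 1) * real (card reps)"
  have AB: "0 \<le> A" "0 < B" using Ck(3) L0 cr by (auto simp: A_def B_def)
  obtain N0 where N0: "\<And>N. N \<ge> N0 \<Longrightarrow> ln (A * real N + B) \<le> (\<epsilon> / 4) * real N" using ln_affine_small[OF AB, of "\<epsilon> / 4"] \<epsilon> by auto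
  define N where "N = Suc N0"
  have "real ((2 * Cq N + 1) * card reps) = A * real N + B"
  proof -
    have "0 \<le> Ck * (int N + 1) + int N * L" using Ck(3) L0 by simp
    then have "real (Cq N) = real_of_int (Ck * (int N + 1) + int N * L)" unfolding Cq_def by simp
    then show ?thesis by (simp add: A_def B_def algebra_simps)
  qed
  then have ln: "ln (real ((2 * Cq N + 1) * card reps)) \<le> (\<epsilon> / 4) * real N" using N0[of N] by (simp add: N_def)
  have "Hp (rw p N) \<le> ennreal (real N * (2 * \<delta> + c * sqrt \<delta> + \<eta>)) + ennreal ((\<epsilon> / 4) * real N)"
    using order_trans[OF bound[of N] add_left_mono[OF ennreal_leI[OF ln]]] \<delta> c \<eta>
    by (simp add: ennreal_mult ennreal_of_nat_eq_real_of_nat)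
  also have "\<dots> = ennreal (real N * (2 * \<delta> + c * sqrt \<delta> + \<eta>) + (\<epsilon> / 4) * real N)"
    using \<delta> c \<eta> \<epsilon> by (intro ennreal_plus[symmetric]) auto
  also have "\<dots> \<le> ennreal (\<epsilon> * real N)"
  proof (rule ennreal_leI)
    have "real N * (2 * \<delta> + c * sqrt \<delta> + \<eta>) \<le> real N * (\<epsilon> / 2)" using \<delta>c \<eta> by (intro mult_left_mono) auto
    moreover have "0 \<le> \<epsilon> * real N" using \<epsilon> by simp
    ultimately show "real N * (2 * \<delta> + c * sqrt \<delta> + \<eta>) + (\<epsilon> / 4) * real N \<le> \<epsilon> * real N" by (simp add: algebra_simps)
  qed
  finally show ?thesis by (intro exI[of _ N]) (simp add: N_def)
qed

end

section \<open>Convergence of the asymptotic entropy\<close>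

text \<open>The residual density \<open>(p - \<alpha> u) / (1 - \<alpha>)\<close> is nonnegative:
  where the law \<open>u\<close> of the chosen \<open>s j\<close> is positive, it is at most 1 while
  \<open>p\<close> is at least \<open>\<alpha>\<close>.\<close>

lemma mixture_exists:
  fixes s :: "nat \<Rightarrow> 'a" and p :: "'a pmf"
  assumes M: "0 < M" and \<alpha>: "0 < \<alpha>" "\<alpha> < 1" and s: "\<And>j. j < M \<Longrightarrow> \<alpha> \<le> pmf p (s j)"
  shows "\<exists>\<nu>. set_pmf \<nu> \<subseteq> set_pmf p \<and>
    map_pmf snd (bind_pmf (bernoulli_pmf \<alpha>) (\<lambda>c. if c then map_pmf (\<lambda>j. (Some j, s j)) (pmf_of_set {..<M}) else map_pmf (Pair None) \<nu>)) = p"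
proof -
  define u where "u = map_pmf s (pmf_of_set {..<M})"
  have "0 \<in> {..<M}" using M by simp
  then have "set_pmf (pmf_of_set {..<M}) = {..<M}" by (intro set_pmf_of_set) blast+
  then have su: "set_pmf u = s ` {..<M}" by (simp add: u_def)
  have le: "\<alpha> * pmf u x \<le> pmf p x" for x
  proof (cases "x \<in> set_pmf u")
    case True
    then obtain j where "j < M" "x = s j" using su by auto
    moreover have "\<alpha> * pmf u x \<le> \<alpha> * 1" using \<alpha> pmf_le_1[of u x] by (intro mult_left_mono) auto
    ultimately show ?thesis using s[of j] by simp
  next
    case False then show ?thesis by (simp add: set_pmf_iff)
  qed
  define f where "f x = (pmf p x - \<alpha> * pmf u x) / (1 - \<alpha>)" for x
  have f0: "0 \<le> f x" for x using le[of x] \<alpha> by (simp add: f_def)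
  have fp: "pmf p x = \<alpha> * pmf u x + (1 - \<alpha>) * f x" for x using \<alpha> by (simp add: f_def)
  have tot: "(\<integral>\<^sup>+ x. ennreal (pmf q x) \<partial>count_space UNIV) = 1" for q :: "'a pmf"
    by (simp add: nn_integral_pmf measure_pmf.emeasure_eq_measure)
  have "1 = (\<integral>\<^sup>+ x. (ennreal \<alpha> * ennreal (pmf u x) + ennreal (1 - \<alpha>) * ennreal (f x)) \<partial>count_space UNIV)"
    unfolding tot[of p, symmetric]
    by (rule nn_integral_cong) (use \<alpha> f0 in \<open>simp add: fp ennreal_mult ennreal_plus\<close>)
  also have "\<dots> = ennreal \<alpha> * 1 + ennreal (1 - \<alpha>) * (\<integral>\<^sup>+ x. ennreal (f x) \<partial>count_space UNIV)"
    by (simp add: nn_integral_add nn_integral_cmult tot)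
  finally have e: "ennreal \<alpha> * 1 + ennreal (1 - \<alpha>) * (\<integral>\<^sup>+ x. ennreal (f x) \<partial>count_space UNIV) = 1" ..
  have "(\<integral>\<^sup>+ x. ennreal (f x) \<partial>count_space UNIV) = 1"
  proof (cases "\<integral>\<^sup>+ x. ennreal (f x) \<partial>count_space UNIV")
    case (real r)
    then have "ennreal (\<alpha> + (1 - \<alpha>) * r) = ennreal 1" using e \<alpha> by (simp add: ennreal_mult ennreal_plus)
    then have "\<alpha> + (1 - \<alpha>) * r = 1" using \<alpha> real(1) by (subst (asm) ennreal_inj) auto
    then have "(1 - \<alpha>) * r = (1 - \<alpha>) * 1" by argo
    then have "r = 1" using \<alpha> by (subst (asm) mult_left_cancel) auto
    then show ?thesis using real by simp
  next
    case top then show ?thesis using e \<alpha> by (simp add: ennreal_mult_top)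
  qed
  then have fe: "pmf (embed_pmf f) x = f x" for x using f0 by (intro pmf_embed_pmf)
  have "set_pmf (embed_pmf f) \<subseteq> set_pmf p"
  proof
    fix x assume "x \<in> set_pmf (embed_pmf f)"
    then have "0 < f x" using f0[of x] fe[of x] by (auto simp: set_pmf_iff)
    then have "0 < pmf p x" unfolding fp[of x] using \<alpha> by (intro add_nonneg_pos) auto
    then show "x \<in> set_pmf p" by (simp add: set_pmf_iff)
  qed
  moreover have "map_pmf snd (bind_pmf (bernoulli_pmf \<alpha>) (\<lambda>c. if c then map_pmf (\<lambda>j. (Some j, s j)) (pmf_of_set {..<M}) else map_pmf (Pair None) (embed_pmf f))) = p"
  proof (rule pmf_eqI)
    fix x
    have "map_pmf snd (bind_pmf (bernoulli_pmf \<alpha>) (\<lambda>c. if c then map_pmf (\<lambda>j. (Some j, s j)) (pmf_of_set {..<M}) else map_pmf (Pair None) (embed_pmf f)))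
       = bind_pmf (bernoulli_pmf \<alpha>) (\<lambda>c. if c then u else embed_pmf f)"
      unfolding map_bind_pmf by (rule bind_pmf_cong) (auto simp: map_pmf_comp u_def)
    moreover have "pmf (bind_pmf (bernoulli_pmf \<alpha>) (\<lambda>c. if c then u else embed_pmf f)) x = \<alpha> * pmf u x + (1 - \<alpha>) * f x"
      using \<alpha> by (simp add: pmf_bind fe)
    ultimately show "pmf (map_pmf snd (bind_pmf (bernoulli_pmf \<alpha>) (\<lambda>c. if c then map_pmf (\<lambda>j. (Some j, s j)) (pmf_of_set {..<M}) else map_pmf (Pair None) (embed_pmf f)))) x = pmf p x"
      using fp[of x] by simp
  qed
  ultimately show ?thesis by blast
qed

definition aH :: "('x \<Rightarrow> 'x) pmf \<Rightarrow> nat \<Rightarrow> real" where "aH p n = enn2real (Hp (rw p n))"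
definition hh :: "('x \<Rightarrow> 'x) pmf \<Rightarrow> real" where "hh p = lim (\<lambda>n. aH p n / real n)"

lemma aH_ennreal: "Hp p < \<infinity> \<Longrightarrow> ennreal (aH p n) = Hp (rw p n)"
  unfolding aH_def using Hp_rw_finite[of p n] by simp

lemma aH_nonneg: "0 \<le> aH p n" by (simp add: aH_def)

lemma hh: assumes "Hp p < \<infinity>" shows "(\<lambda>n. aH p n / real n) \<longlonglongrightarrow> hh p" "\<And>n. 0 < n \<Longrightarrow> hh p \<le> aH p n / real n" "0 \<le> hh p"
proof -
  have sub: "aH p (m + n) \<le> aH p m + aH p n" for m n
  proof -
    have "ennreal (aH p (m + n)) \<le> ennreal (aH p m + aH p n)"
      using Hp_rw_subadditive[of p m n] by (simp add: aH_ennreal[OF assms] ennreal_plus aH_nonneg)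
    then show ?thesis by (subst (asm) ennreal_le_iff) (auto simp: aH_nonneg)
  qed
  obtain L where L: "(\<lambda>n. aH p n / real n) \<longlonglongrightarrow> L" "\<forall>n>0. L \<le> aH p n / real n" using fekete[of "aH p", OF aH_nonneg sub] by blast
  then have h: "hh p = L" unfolding hh_def by (intro limI)
  then show "(\<lambda>n. aH p n / real n) \<longlonglongrightarrow> hh p" "\<And>n. 0 < n \<Longrightarrow> hh p \<le> aH p n / real n" using L by auto
  then show "0 \<le> hh p" by (intro LIMSEQ_le_const) (auto simp: aH_nonneg)
qed

lemma hh_rw: assumes "Hp p < \<infinity>" "0 < m" shows "hh (rw p m) = real m * hh p"
proof -
  have "(\<lambda>n. aH p (m * n) / real (m * n)) \<longlonglongrightarrow> hh p"
    using LIMSEQ_subseq_LIMSEQ[OF hh(1)[OF assms(1)], of "\<lambda>n. m * n"] assms(2) by (simp add: strict_mono_def o_def)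
  then have "(\<lambda>n. real m * (aH p (m * n) / real (m * n))) \<longlonglongrightarrow> real m * hh p" by (intro tendsto_intros)
  moreover have "real m * (aH p (m * n) / real (m * n)) = aH (rw p m) n / real n" for n
    using assms(2) by (simp add: aH_def rw_mult)
  ultimately have "(\<lambda>n. aH (rw p m) n / real n) \<longlonglongrightarrow> real m * hh p" by simp
  then show ?thesis unfolding hh_def by (intro limI)
qed

lemma superadditive_lower_bound:
  assumes fin: "Hp p < \<infinity>" and N: "0 < N" and \<epsilon>: "0 \<le> \<epsilon>"
    and sup: "\<And>n. N < n \<Longrightarrow> Hp (rw p N) + Hp (rw p (n - N)) \<le> Hp (rw p n) + ennreal (\<epsilon> * real N)"
  shows "aH p N / real N - \<epsilon> \<le> hh p"
proof -
  have s: "aH p N + aH p (n - N) \<le> aH p n + \<epsilon> * real N" if "N < n" for n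
  proof -
    have "ennreal (aH p N + aH p (n - N)) \<le> ennreal (aH p n + \<epsilon> * real N)"
      using sup[OF that] \<epsilon> by (simp add: aH_ennreal[OF fin] ennreal_plus aH_nonneg)
    then show ?thesis using \<epsilon> by (subst (asm) ennreal_le_iff) (auto simp: aH_nonneg)
  qed
  have j: "real (Suc j) * (aH p N - \<epsilon> * real N) \<le> aH p (N * Suc j)" for j
  proof (induct j)
    case 0 show ?case using \<epsilon> by simp
  next
    case (Suc j)
    have "N < N * Suc (Suc j)" using N by simp
    from s[OF this] have "aH p N + aH p (N * Suc j) \<le> aH p (N * Suc (Suc j)) + \<epsilon> * real N" by simp
    then show ?case using Suc by (simp add: algebra_simps)
  qed
  have sub: "(\<lambda>j. aH p (N * Suc j) / real (N * Suc j)) \<longlonglongrightarrow> hh p"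
    using LIMSEQ_subseq_LIMSEQ[OF hh(1)[OF fin], of "\<lambda>j. N * Suc j"] N by (simp add: strict_mono_def o_def)
  show ?thesis
  proof (rule LIMSEQ_le_const[OF sub], intro exI allI impI)
    fix j :: nat
    have "(aH p N / real N - \<epsilon>) * real (N * Suc j) = real (Suc j) * (aH p N - \<epsilon> * real N)" using N by (simp add: field_simps)
    also have "\<dots> \<le> aH p (N * Suc j)" by (rule j)
    finally show "aH p N / real N - \<epsilon> \<le> aH p (N * Suc j) / real (N * Suc j)" using N by (subst pos_le_divide_eq) (simp_all only: of_nat_0_less_iff mult_pos_pos zero_less_Suc)
  qed
qed

context schottky
begin

text \<open>The order of choices matters: \<open>F\<close> for the entropy tail,
  \<open>\<delta>\<close> small against \<open>card F\<close>, the window \<open>h\<close> from the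
  decay rate, a typical set \<open>F1\<close> with exceptional mass small against
  \<open>1 / h\<close>, and \<open>N\<close> large against all of these. Every choice is made from
  \<open>Q\<close>, and the conditions pass to \<open>P i\<close> eventually.\<close>

lemma uniform_superadditivity:
  fixes P :: "nat \<Rightarrow> ('x \<Rightarrow> 'x) pmf"
  assumes M: "102 \<le> M" and G: "\<And>i. set_pmf (P i) \<subseteq> G" and Qs: "\<And>j. j < M \<Longrightarrow> ss j \<in> set_pmf Q"
    and P: "\<And>z. (\<lambda>i. pmf (P i) z) \<longlonglongrightarrow> pmf Q z"
    and fin: "\<And>i. Hp (P i) < \<infinity>" "Hp Q < \<infinity>"
    and H: "(\<lambda>i. enn2real (Hp (P i))) \<longlonglongrightarrow> enn2real (Hp Q)"
    and \<epsilon>: "0 < \<epsilon>"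
  shows "\<exists>N>0. \<forall>\<^sub>F i in sequentially. \<forall>n>N. Hp (rw (P i) N) + Hp (rw (P i) (n - N)) \<le> Hp (rw (P i) n) + ennreal (\<epsilon> * real N)"
proof -
  \<comment> \<open>At most half the smallest Schottky mass under \<open>Q\<close>, so that the
    strict inequality persists for \<open>P i\<close> eventually, and at most 1/2, which leaves mass
    for the residual law.\<close>
  define \<alpha> where "\<alpha> = min (Min ((\<lambda>j. pmf Q (ss j)) ` {..<M})) 1 / 2"
  have ne: "(\<lambda>j. pmf Q (ss j)) ` {..<M} \<noteq> {}" using M0 by auto
  have pj: "0 < pmf Q (ss j)" if "j < M" for j using Qs[OF that] by (simp add: pmf_positive)
  then have mp: "0 < Min ((\<lambda>j. pmf Q (ss j)) ` {..<M})" using ne by (subst Min_gr_iff) auto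
  then have \<alpha>: "0 < \<alpha>" "\<alpha> < 1" by (auto simp: \<alpha>_def)
  have \<alpha>Q: "\<alpha> < pmf Q (ss j)" if "j < M" for j
  proof -
    have "Min ((\<lambda>j. pmf Q (ss j)) ` {..<M}) \<le> pmf Q (ss j)" using that by (intro Min_le) auto
    then show ?thesis using mp by (auto simp: \<alpha>_def min_def)
  qed
  note \<alpha>01 = \<alpha>
  define k0 where "k0 = \<alpha> * (25 / 32) + (1 - \<alpha>)"
  have k0: "0 < k0" "k0 < 1" using \<alpha> by (auto simp: k0_def)
  define \<eta> where "\<eta> = min (\<epsilon> / 8) (exp (-1))"
  have \<eta>: "0 < \<eta>" "\<eta> \<le> \<epsilon> / 8" "\<eta> \<le> exp (-1)" using \<epsilon> by (auto simp: \<eta>_def)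
  obtain F where F: "finite F" "tail F Q < ennreal \<eta>" "measure_pmf.prob Q (- F) < \<eta>" using finite_tail[OF fin(2) \<eta>(1)] by blast
  define c where "c = 2 * real (card F) + 2"
  define s where "s = min (1 / 2) (\<epsilon> / (8 * (c + 2)))"
  have c: "2 \<le> c" by (simp add: c_def)
  have s: "0 < s" "s \<le> 1 / 2" "s \<le> \<epsilon> / (8 * (c + 2))"
    subgoal using \<epsilon> c by (simp add: s_def)
    subgoal unfolding s_def by (rule min.cobounded1)
    subgoal unfolding s_def by (rule min.cobounded2)
    done
  define \<delta> where "\<delta> = s\<^sup>2"
  have \<delta>: "0 < \<delta>" "\<delta> < 1" "sqrt \<delta> = s" "\<delta> \<le> s"
  proof -
    have "s * s \<le> 1 * s" using s by (intro mult_right_mono) auto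
    then show "\<delta> \<le> s" by (simp add: \<delta>_def power2_eq_square)
    then show "\<delta> < 1" using s by linarith
  qed (use s in \<open>auto simp: \<delta>_def\<close>)
  have \<delta>c: "2 * \<delta> + c * sqrt \<delta> \<le> \<epsilon> / 8"
  proof -
    have "2 * \<delta> + c * sqrt \<delta> \<le> (c + 2) * s" using \<delta> by (simp add: algebra_simps)
    also have "\<dots> \<le> (c + 2) * (\<epsilon> / (8 * (c + 2)))" using s c by (intro mult_left_mono) auto
    also have "\<dots> = \<epsilon> / 8" using c by (simp add: field_simps)
    finally show ?thesis .
  qed
  have "(\<lambda>h. 48 / (1 - k0) * k0 ^ h) \<longlonglongrightarrow> 48 / (1 - k0) * 0" using k0 by (intro tendsto_intros LIMSEQ_power_zero) auto
  then have "\<forall>\<^sub>F h in sequentially. 48 / (1 - k0) * k0 ^ h < \<delta> / 2" using \<delta> by (intro order_tendstoD(2)) auto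
  then obtain h where h: "48 * k0 ^ h / (1 - k0) < \<delta> / 2" by (auto simp: eventually_sequentially)
  define \<delta>1 where "\<delta>1 = \<delta> / (2 * (4 * real h + 1))"
  have \<delta>1: "0 < \<delta>1" "(4 * real h + 1) * \<delta>1 = \<delta> / 2"
  proof -
    have "0 < 4 * real h + 1" by simp
    then show "0 < \<delta>1" "(4 * real h + 1) * \<delta>1 = \<delta> / 2" using \<delta> unfolding \<delta>1_def by (auto simp: field_simps)
  qed
  obtain F1 where F1: "finite F1" "tail F1 Q < ennreal \<delta>1" "measure_pmf.prob Q (- F1) < \<delta>1" using finite_tail[OF fin(2) \<delta>1(1)] by blast
  define L where "L = (\<Sum>z\<in>F1. dist b (z b))"
  have L: "0 \<le> L" "\<And>z. z \<in> F1 \<Longrightarrow> dist b (z b) \<le> L" unfolding L_def using F1(1) by (auto intro!: sum_nonneg member_le_sum)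
  have Ca: "0 \<le> Cadd" using C1_pos by (simp add: Cadd_def ca_def sum_nonneg)
  define T where "T = enn2real (Hp Q) + 1"
  have T0: "0 \<le> T" by (simp add: T_def)
  define w where "w = real (2 * (M * Suc (card wpd_set)))"
  have w: "1 \<le> w"
  proof -
    have "0 < 2 * (M * Suc (card wpd_set))" using M0 by simp
    then show ?thesis unfolding w_def by linarith
  qed
  obtain N1 where N1: "\<And>N. N \<ge> N1 \<Longrightarrow> ln (1 * real N + 1) \<le> (\<epsilon> / 8) * real N" using ln_affine_small[of 1 1 "\<epsilon> / 8"] \<epsilon> by auto
  define A B where "A = 2 * (L + Cadd) * w" and "B = (2 * (Cadd + 2) + 1) * w"
  have AB: "0 \<le> A" "0 < B" using L Ca w by (auto simp: A_def B_def)
  obtain N2 where N2: "\<And>N. N \<ge> N2 \<Longrightarrow> ln (A * real N + B) \<le> (\<epsilon> / 8) * real N" using ln_affine_small[OF AB, of "\<epsilon> / 8"] \<epsilon> by auto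
  \<comment> \<open>The last summand makes the cost of \<open>2 * h\<close> explicitly stored
    letters, at entropy at most \<open>T\<close> each, small against \<open>N\<close>.\<close>
  define N where "N = 2 * h + 1 + N1 + N2 + nat \<lceil>2 * real h * T * 8 / \<epsilon>\<rceil>"
  have N: "2 * h \<le> N" "0 < N" "N1 \<le> N" "N2 \<le> N" by (auto simp: N_def)
  have NT: "2 * real h * T \<le> (\<epsilon> / 8) * real N"
  proof -
    have "2 * real h * T * 8 / \<epsilon> \<le> real N" unfolding N_def by linarith
    then show ?thesis using \<epsilon> by (simp add: field_simps)
  qed
  have "\<forall>\<^sub>F i in sequentially. enn2real (Hp (P i)) < T" using H by (rule order_tendstoD(2)) (simp add: T_def)
  moreover have "\<forall>\<^sub>F i in sequentially. \<forall>j\<in>{..<M}. \<alpha> < pmf (P i) (ss j)"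
    using order_tendstoD(1)[OF P \<alpha>Q] by (intro eventually_ball_finite) auto
  moreover note tail_eventually[OF P fin H F] tail_eventually[OF P fin H F1]
  ultimately have "\<forall>\<^sub>F i in sequentially. \<forall>n>N. Hp (rw (P i) N) + Hp (rw (P i) (n - N)) \<le> Hp (rw (P i) n) + ennreal (\<epsilon> * real N)"
  proof eventually_elim
    case (elim i)
    have "\<exists>\<nu>. set_pmf \<nu> \<subseteq> set_pmf (P i) \<and>
      map_pmf snd (bind_pmf (bernoulli_pmf \<alpha>) (\<lambda>c. if c then map_pmf (\<lambda>j. (Some j, ss j)) (pmf_of_set {..<M}) else map_pmf (Pair None) \<nu>)) = P i"
      using elim(2) by (intro mixture_exists M0 \<alpha> less_imp_le) auto
    then obtain \<nu> where \<nu>: "set_pmf \<nu> \<subseteq> set_pmf (P i)"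
      "map_pmf snd (bind_pmf (bernoulli_pmf \<alpha>) (\<lambda>c. if c then map_pmf (\<lambda>j. (Some j, ss j)) (pmf_of_set {..<M}) else map_pmf (Pair None) \<nu>)) = P i" by blast
    interpret pivoting b g K G x p U Rt M \<nu> \<alpha>
      by unfold_locales (use \<nu>(1) G \<alpha> M in auto)
    have q: "map_pmf snd \<beta> = P i" unfolding \<beta>_def by (rule \<nu>(2))
    have kk: "\<kappa> = k0" unfolding \<kappa>_def k0_def ..
    show ?case
    proof (intro allI impI)
      fix n assume n: "N < n"
      have "Hp (rw (P i) N) + Hp (rw (P i) (n - N)) \<le> Hp (rw (P i) n) + of_nat N * ennreal (2 * \<delta> + c * sqrt \<delta> + \<eta>)
         + of_nat (2 * h) * Hp (P i) + ennreal (ln (real (N + 1))) + ennreal (ln (real ((2 * Cn L N + 1) * (2 * (M * Suc (card wpd_set))))))"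
        unfolding c_def
      proof (rule near_superadditive[unfolded q kk, where F = F and L = L and ?F1.0 = F1 and ?\<delta>1.0 = \<delta>1])
        show "tail F (P i) \<le> ennreal \<eta>" using elim(3) by blast
        show "measure_pmf.prob (P i) (- F) \<le> exp (- 1)" using elim(3) \<eta>(3) by linarith
        show "measure_pmf.prob (P i) (- F1) \<le> \<delta>1" using elim(4) by blast
        show "48 * k0 ^ h / (1 - k0) + (4 * real h + 1) * \<delta>1 \<le> \<delta>" using h \<delta>1(2) by linarith
        show "0 \<le> \<eta>" using \<eta>(1) by simp
      qed (use \<alpha>01 N n F L \<delta> in auto)
      also have "\<dots> \<le> Hp (rw (P i) n) + ennreal (real N * (\<epsilon> / 4)) + ennreal ((\<epsilon> / 8) * real N) + ennreal ((\<epsilon> / 8) * real N) + ennreal ((\<epsilon> / 8) * real N)"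
      proof (intro add_mono order_refl)
        have "of_nat N * ennreal (2 * \<delta> + c * sqrt \<delta> + \<eta>) = ennreal (real N * (2 * \<delta> + c * sqrt \<delta> + \<eta>))"
          by (simp add: ennreal_of_nat_eq_real_of_nat ennreal_mult')
        also have "\<dots> \<le> ennreal (real N * (\<epsilon> / 4))" using \<delta>c \<eta>(2) by (intro ennreal_leI mult_left_mono) auto
        finally show "of_nat N * ennreal (2 * \<delta> + c * sqrt \<delta> + \<eta>) \<le> ennreal (real N * (\<epsilon> / 4))" .
        have "Hp (P i) = ennreal (enn2real (Hp (P i)))" using fin(1)[of i] by simp
        also have "\<dots> \<le> ennreal T" using elim(1) by (intro ennreal_leI) simp
        finally have "of_nat (2 * h) * Hp (P i) \<le> ennreal (real (2 * h)) * ennreal T"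
          unfolding ennreal_of_nat_eq_real_of_nat by (intro mult_left_mono) auto
        also have "\<dots> = ennreal (2 * real h * T)" using T0 by (simp add: ennreal_mult')
        also have "\<dots> \<le> ennreal ((\<epsilon> / 8) * real N)" by (rule ennreal_leI[OF NT])
        finally show "of_nat (2 * h) * Hp (P i) \<le> ennreal ((\<epsilon> / 8) * real N)" .
        show "ennreal (ln (real (N + 1))) \<le> ennreal ((\<epsilon> / 8) * real N)"
          using N1[OF N(3)] by (intro ennreal_leI) (simp add: add.commute)
        have "real (Cn L N) \<le> Cadd + (L + Cadd) * real N + 2"
          unfolding Cn_def using Ca L(1) by (simp add: nat_le_real_less) linarith
        then have "real (2 * Cn L N + 1) \<le> 2 * (L + Cadd) * real N + (2 * (Cadd + 2) + 1)" by (simp add: algebra_simps)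
        then have "real (2 * Cn L N + 1) * w \<le> (2 * (L + Cadd) * real N + (2 * (Cadd + 2) + 1)) * w" using w by (intro mult_right_mono) auto
        then have le: "real ((2 * Cn L N + 1) * (2 * (M * Suc (card wpd_set)))) \<le> A * real N + B"
          unfolding A_def B_def w_def of_nat_mult by (simp only: algebra_simps)
        have pos: "0 < real ((2 * Cn L N + 1) * (2 * (M * Suc (card wpd_set))))" using M0 by (simp only: of_nat_0_less_iff) simp
        have "ln (real ((2 * Cn L N + 1) * (2 * (M * Suc (card wpd_set))))) \<le> ln (A * real N + B)" by (rule ln_mono[OF le pos])
        then show "ennreal (ln (real ((2 * Cn L N + 1) * (2 * (M * Suc (card wpd_set)))))) \<le> ennreal ((\<epsilon> / 8) * real N)"
          using N2[OF N(4)] by (intro ennreal_leI) linarith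
      qed
      also have "\<dots> = Hp (rw (P i) n) + ennreal (real N * (\<epsilon> / 4) + (\<epsilon> / 8) * real N + (\<epsilon> / 8) * real N + (\<epsilon> / 8) * real N)"
        using \<epsilon> by (simp only: ennreal_plus add.assoc mult_nonneg_nonneg divide_nonneg_nonneg add_nonneg_nonneg less_imp_le of_nat_0_le_iff zero_le_numeral)
      also have "\<dots> \<le> Hp (rw (P i) n) + ennreal (\<epsilon> * real N)"
        using \<epsilon> by (intro add_left_mono ennreal_leI) (simp add: algebra_simps)
      finally show "Hp (rw (P i) N) + Hp (rw (P i) (n - N)) \<le> Hp (rw (P i) n) + ennreal (\<epsilon> * real N)" .
    qed
  qed
  then show ?thesis using N(2) by blast
qed

end

lemma set_rw_comp: "y \<in> set_pmf (rw q m) \<Longrightarrow> z \<in> set_pmf (rw q n) \<Longrightarrow> y \<circ> z \<in> set_pmf (rw q (m + n))"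
  unfolding rw_add set_map_pmf set_pair_pmf by (rule image_eqI[of _ _ "(y, z)"]) auto

lemma set_rw_funpow: "y \<in> set_pmf (rw q n) \<Longrightarrow> y ^^ a \<in> set_pmf (rw q (n * a))"
proof (induct a)
  case 0 then show ?case by (simp add: rw_0 id_def)
next
  case (Suc a)
  have "y \<circ> y ^^ a \<in> set_pmf (rw q (n + n * a))" using Suc by (intro set_rw_comp) auto
  then show ?case unfolding funpow.simps mult_Suc_right .
qed

context wpd_orbit
begin

text \<open>All Schottky elements must lie in the support of one convolution power, while among the
  powers of \<open>g\<close> only \<open>g ^^ m0\<close> is known to be reached, in
  \<open>n0\<close> steps. Taking all exponents to be multiples of \<open>m0\<close> with the same
  total \<open>m0 * t\<close> produces every \<open>ss j\<close> in \<open>n0 * t + 2\<close> steps,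
  two of them for the two letters \<open>x\<close>.\<close>

lemma nonelementary_lower_bound:
  fixes P :: "nat \<Rightarrow> ('x \<Rightarrow> 'x) pmf"
  assumes m0: "0 < m0" and gQ: "g ^^ m0 \<in> set_pmf (rw Q n0)" and x: "x \<in> set_pmf Q" "x \<notin> E"
    and QG: "set_pmf Q \<subseteq> G" and PG: "\<And>i. set_pmf (P i) \<subseteq> G"
    and P: "\<And>z. (\<lambda>i. pmf (P i) z) \<longlonglongrightarrow> pmf Q z"
    and fin: "\<And>i. Hp (P i) < \<infinity>" "Hp Q < \<infinity>"
    and H: "(\<lambda>i. enn2real (Hp (P i))) \<longlonglongrightarrow> enn2real (Hp Q)"
    and \<epsilon>: "0 < \<epsilon>"
  shows "\<forall>\<^sub>F i in sequentially. hh Q - \<epsilon> < hh (P i)"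
proof -
  obtain p where p: "0 < p" "\<And>y. y \<in> E \<Longrightarrow> commutes_upto_sign p y" using uniform_exponent by blast
  define c where "c = nat \<lceil>2 * \<Theta>\<rceil> + 1"
  define M :: nat where "M = 102"
  \<comment> \<open>\<open>p\<close> gives commutation with \<open>E\<close>, \<open>m0\<close>
    makes the exponents reachable, and \<open>c\<close> gives the separation beyond
    \<open>2 * \<Theta>\<close>.\<close>
  define U where "U = p * int m0 * int c"
  have c: "real c > 2 * \<Theta>" "0 < c" unfolding c_def by linarith+
  have pm: "1 \<le> p * int m0" using p(1) m0 by (metis int_one_le_iff_zero_less of_nat_0_less_iff mult_pos_pos)
  have "1 * int c \<le> U" unfolding U_def using pm by (intro mult_right_mono) auto
  then have U: "real_of_int U > 2 * \<Theta>" "0 \<le> U" using c by linarith+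
  note U0 = U(2)
  define B where "B = 2 * real_of_int U * real M * real M + \<bar>real_of_int (pr (x b))\<bar> + \<bar>real_of_int (pr (inv x b))\<bar> + 4 * \<theta>2 + real Nw + 2 * K\<^sup>2 + 2"
  define t where "t = nat \<lceil>B\<rceil> + nat (2 * U * int M * int M)"
  define Rt where "Rt = int m0 * int t"
  have "1 * int t \<le> Rt" unfolding Rt_def using m0 by (intro mult_right_mono) auto
  moreover have tB: "B \<le> real t" "2 * U * int M * int M \<le> int t" unfolding t_def by linarith+
  ultimately have Rt: "B \<le> real_of_int Rt" "2 * U * int M * int M \<le> Rt" by linarith+
  interpret schottky b g K G x p U Rt M
    by unfold_locales (use x QG p U Rt(1) in \<open>auto simp: U_def M_def B_def\<close>)
  have gp: "ipow g (int m0 * int a) \<in> set_pmf (rw Q (n0 * a))" for a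
    using set_rw_funpow[OF gQ, of a] by (simp add: ipow_of_nat funpow_mult flip: of_nat_mult)
  define m where "m = n0 * t + 2"
  have "ss j \<in> set_pmf (rw Q m)" if j: "j < M" for j
  proof -
    have "\<exists>a. lx j = int m0 * int a" by (rule exI[of _ "nat p * c * j"]) (use p(1) in \<open>simp add: lx_def, simp add: U_def ac_simps\<close>)
    then obtain a1 where a1: "lx j = int m0 * int a1" by blast
    have "\<exists>a. ex j = int m0 * int a" by (rule exI[of _ "nat p * c * M * j"]) (use p(1) in \<open>simp add: ex_def, simp add: U_def ac_simps\<close>)
    then obtain a3 where a3: "ex j = int m0 * int a3" by blast
    have "U * int j \<le> U * int M * int M"
    proof -
      have "U * int j \<le> U * int M" using U0 j by (intro mult_left_mono) auto
      moreover have "U * int M * 1 \<le> U * int M * int M" using U0 by (intro mult_left_mono) (auto simp: M_def)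
      ultimately show ?thesis by linarith
    qed
    moreover have "U * int M * int j \<le> U * int M * int M" using U0 j by (intro mult_left_mono) auto
    ultimately have "lx j + ex j \<le> int t" using tB(2) unfolding lx_def ex_def by linarith
    then have "int m0 * int (a1 + a3) \<le> int t" using a1 a3 by (simp add: distrib_left)
    moreover have "1 * int (a1 + a3) \<le> int m0 * int (a1 + a3)" using m0 by (intro mult_right_mono) auto
    ultimately have "int (a1 + a3) \<le> int t" unfolding mult_1 by (rule order_trans[rotated])
    then have at: "a1 + a3 \<le> t" unfolding of_nat_le_iff .
    define a2 where "a2 = t - (a1 + a3)"
    have t: "t = a1 + a2 + a3" using at by (simp add: a2_def)
    have a2: "Rx j = int m0 * int a2" unfolding Rx_def a1 a3 unfolding Rt_def t by (simp add: algebra_simps)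
    have x1: "x \<in> set_pmf (rw Q 1)" unfolding rw_1 by (rule x(1))
    have "((ipow g (lx j) \<circ> x) \<circ> ipow g (Rx j)) \<circ> (x \<circ> ipow g (ex j)) \<in> set_pmf (rw Q (((n0 * a1 + 1) + n0 * a2) + (1 + n0 * a3)))"
      unfolding a1 a2 a3 by (intro set_rw_comp gp x1)
    moreover have "((n0 * a1 + 1) + n0 * a2) + (1 + n0 * a3) = m" unfolding m_def t by (simp add: algebra_simps)
    ultimately show ?thesis unfolding ss_def sa_def sb_def by (simp only:)
  qed
  note ssm = this
  have m: "0 < m" by (simp add: m_def)
  note T = rw_tendsto[OF P fin H]
  have fin': "\<And>i. Hp (rw (P i) m) < \<infinity>" "Hp (rw Q m) < \<infinity>" using Hp_rw_finite fin by blast+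
  define \<epsilon>' where "\<epsilon>' = \<epsilon> * real m / 2"
  have \<epsilon>': "0 < \<epsilon>'" using \<epsilon> m by (simp add: \<epsilon>'_def)
  have M: "102 \<le> M" by (simp add: M_def)
  obtain N where N: "0 < N" "\<forall>\<^sub>F i in sequentially. \<forall>n>N. Hp (rw (rw (P i) m) N) + Hp (rw (rw (P i) m) (n - N)) \<le> Hp (rw (rw (P i) m) n) + ennreal (\<epsilon>' * real N)"
    using uniform_superadditivity[where P = "\<lambda>i. rw (P i) m" and Q = "rw Q m", OF M set_rw[OF Ggrp PG] ssm _ fin' _ \<epsilon>'] T by blast
  have "(\<lambda>i. aH (rw (P i) m) N / real N) \<longlonglongrightarrow> aH (rw Q m) N / real N"
    unfolding aH_def rw_mult using T by (intro tendsto_divide tendsto_const) (use N in auto)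
  moreover have "hh (rw Q m) - \<epsilon>' < aH (rw Q m) N / real N" using hh(2)[OF fin'(2) N(1)] \<epsilon>' by linarith
  ultimately have "\<forall>\<^sub>F i in sequentially. hh (rw Q m) - \<epsilon>' < aH (rw (P i) m) N / real N" by (rule order_tendstoD(1))
  with N(2) show ?thesis
  proof eventually_elim
    case (elim i)
    have "aH (rw (P i) m) N / real N - \<epsilon>' \<le> hh (rw (P i) m)"
      by (rule superadditive_lower_bound[OF fin'(1) N(1)]) (use \<epsilon>' elim(1) in auto)
    then have "real m * hh Q - 2 * \<epsilon>' < real m * hh (P i)"
      using elim(2) unfolding hh_rw[OF fin(1) m] hh_rw[OF fin(2) m] by linarith
    then have "real m * (hh Q - \<epsilon>) < real m * hh (P i)" by (simp add: \<epsilon>'_def algebra_simps)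
    then show ?case using m by simp
  qed
qed

lemma hh_lower_bound:
  fixes P :: "nat \<Rightarrow> ('x \<Rightarrow> 'x) pmf"
  assumes m0: "0 < m0" and gQ: "g ^^ m0 \<in> set_pmf (rw Q n0)"
    and QG: "set_pmf Q \<subseteq> G" and PG: "\<And>i. set_pmf (P i) \<subseteq> G"
    and P: "\<And>z. (\<lambda>i. pmf (P i) z) \<longlonglongrightarrow> pmf Q z"
    and fin: "\<And>i. Hp (P i) < \<infinity>" "Hp Q < \<infinity>"
    and H: "(\<lambda>i. enn2real (Hp (P i))) \<longlonglongrightarrow> enn2real (Hp Q)"
    and \<epsilon>: "0 < \<epsilon>"
  shows "\<forall>\<^sub>F i in sequentially. hh Q - \<epsilon> < hh (P i)"
proof (cases "set_pmf Q \<subseteq> E")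
  case False
  then obtain x where "x \<in> set_pmf Q" "x \<notin> E" by blast
  then show ?thesis by (rule nonelementary_lower_bound[OF m0 gQ _ _ QG PG P fin H \<epsilon>])
next
  case True
  have "hh Q \<le> \<epsilon> / 2"
  proof -
    obtain N where N: "0 < N" "Hp (rw Q N) \<le> ennreal (\<epsilon> / 2 * real N)"
      using elementary_entropy[OF True fin(2), of "\<epsilon> / 2"] \<epsilon> by auto
    have "ennreal (aH Q N) \<le> ennreal (\<epsilon> / 2 * real N)" unfolding aH_ennreal[OF fin(2)] by (rule N(2))
    then have "aH Q N \<le> \<epsilon> / 2 * real N" using \<epsilon> by (subst (asm) ennreal_le_iff) auto
    then have "aH Q N / real N \<le> \<epsilon> / 2" using N(1) by (subst pos_divide_le_eq) auto
    then show ?thesis using hh(2)[OF fin(2) N(1)] by linarith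
  qed
  then have "hh Q - \<epsilon> < hh (P i)" for i using hh(3)[OF fin(1)[of i]] \<epsilon> by linarith
  then show ?thesis by simp
qed

end

lemma hh_upper_bound:
  assumes P: "\<And>z. (\<lambda>i. pmf (P i) z) \<longlonglongrightarrow> pmf Q z"
    and fin: "\<And>i. Hp (P i) < \<infinity>" "Hp Q < \<infinity>"
    and H: "(\<lambda>i. enn2real (Hp (P i))) \<longlonglongrightarrow> enn2real (Hp Q)"
    and h: "hh Q < h"
  shows "\<forall>\<^sub>F i in sequentially. hh (P i) < h"
proof -
  have "\<forall>\<^sub>F n in sequentially. aH Q n / real n < h" by (rule order_tendstoD(2)[OF hh(1)[OF fin(2)] h])
  then have "\<forall>\<^sub>F n in sequentially. 0 < n \<and> aH Q n / real n < h" using eventually_gt_at_top[of 0] by eventually_elim simp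
  then obtain n where n: "0 < n" "aH Q n / real n < h" by (auto simp: eventually_sequentially)
  have "(\<lambda>i. aH (P i) n / real n) \<longlonglongrightarrow> aH Q n / real n"
    unfolding aH_def using rw_tendsto[OF P fin H] n by (intro tendsto_divide tendsto_const) auto
  from order_tendstoD(2)[OF this n(2)] show ?thesis
    by eventually_elim (use hh(2)[OF fin(1) n(1)] in \<open>blast intro: le_less_trans\<close>)
qed

lemma asymp_entropy_eq_hh:
  assumes G: "isometry_group G" and \<mu>: "prob_on G \<mu>" "finite_entropy G \<mu>"
  shows "asymp_entropy G \<mu> = hh (law G \<mu>)"
proof -
  have "entropy G (conv_pow G \<mu> n) = aH (law G \<mu>) n" for n
    unfolding aH_def
    by (intro entropy_eq_Hp set_rw G set_law \<mu> Hp_rw_finite Hp_law_finite conv_pow_rw)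
  then show ?thesis by (simp add: asymp_entropy_def hh_def)
qed

section \<open>Normalization of the contraction constant\<close>

lemma contracting_axis_mono:
  assumes "contracting_axis K \<gamma>" "0 < K" "K \<le> K'" shows "contracting_axis K' \<gamma>"
proof -
  have q: "quasigeodesic K' \<gamma>"
    unfolding quasigeodesic_def
  proof (intro allI conjI)
    fix i j
    have "\<bar>real_of_int (i - j)\<bar> / K' \<le> \<bar>real_of_int (i - j)\<bar> / K" using assms by (intro divide_left_mono) auto
    moreover have "\<bar>real_of_int (i - j)\<bar> / K - K \<le> dist (\<gamma> i) (\<gamma> j)" "dist (\<gamma> i) (\<gamma> j) \<le> K * \<bar>real_of_int (i - j)\<bar> + K"
      using assms(1) by (auto simp: contracting_axis_def quasigeodesic_def)
    moreover have "K * \<bar>real_of_int (i - j)\<bar> \<le> K' * \<bar>real_of_int (i - j)\<bar>" using assms(3) by (intro mult_right_mono) auto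
    ultimately show "\<bar>real_of_int (i - j)\<bar> / K' - K' \<le> dist (\<gamma> i) (\<gamma> j)" "dist (\<gamma> i) (\<gamma> j) \<le> K' * \<bar>real_of_int (i - j)\<bar> + K'"
      using assms(3) by linarith+
  qed
  have "bounded (\<Union>x\<in>S. proj (range \<gamma>) x) \<and> diameter (\<Union>x\<in>S. proj (range \<gamma>) x) < K'"
    if S: "geodesic_segment S" "\<forall>x\<in>S. infdist x (range \<gamma>) > K'" for S
  proof -
    have "\<forall>x\<in>S. infdist x (range \<gamma>) > K" using S(2) assms(3) by force
    then have "bounded (\<Union>x\<in>S. proj (range \<gamma>) x) \<and> diameter (\<Union>x\<in>S. proj (range \<gamma>) x) < K"
      using assms(1) S(1) unfolding contracting_axis_def Let_def by blast
    then show ?thesis using assms(3) by auto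
  qed
  then show ?thesis using q unfolding contracting_axis_def Let_def by blast
qed

lemma contracting_axis_nonneg: "contracting_axis K \<gamma> \<Longrightarrow> 0 \<le> K"
  unfolding contracting_axis_def quasigeodesic_def by (metis abs_zero add_0 diff_self dist_self mult_zero_right of_int_0)

text \<open>Since \<open>x / 0 = 0\<close>, the constant \<open>K = 0\<close> is not excluded by the definition of a contracting axis.\<close>

lemma contracting_axis_0_trivial:
  fixes \<gamma> :: "int \<Rightarrow> 'x::metric_space"
  assumes "contracting_axis 0 \<gamma>" shows "x = \<gamma> 0"
proof (rule ccontr)
  assume x: "x \<noteq> \<gamma> 0"
  have "dist (\<gamma> i) (\<gamma> 0) \<le> 0" for i
    using assms unfolding contracting_axis_def quasigeodesic_def by (metis add_0_right mult_zero_left)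
  then have r: "range \<gamma> = {\<gamma> 0}" by auto
  have "geodesic_segment {x}" unfolding geodesic_segment_def
    by (rule exI[of _ "\<lambda>_. x"], rule exI[of _ 0], rule exI[of _ 0]) auto
  moreover have "\<forall>y\<in>{x}. infdist y (range \<gamma>) > 0" unfolding r using x by (simp add: infdist_singleton)
  ultimately have "bounded (proj (range \<gamma>) x) \<and> diameter (proj (range \<gamma>) x) < 0"
    using assms unfolding contracting_axis_def Let_def by (auto dest!: spec[of _ "{x}"])
  then show False using diameter_ge_0 by force
qed

lemma contracting_positive:
  assumes "contracting b g" "x \<noteq> (y :: 'x::metric_space)"
  shows "\<exists>K\<ge>1. contracting_axis K (\<lambda>i. ipow g i (b :: 'x))"
proof -
  obtain K where K: "contracting_axis K (\<lambda>i. ipow g i b)" using assms(1) by (auto simp: contracting_def)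
  have "K \<noteq> 0" using contracting_axis_0_trivial[of "\<lambda>i. ipow g i b" x] contracting_axis_0_trivial[of "\<lambda>i. ipow g i b" y] K assms(2) by auto
  then have "0 < K" using contracting_axis_nonneg[OF K] by simp
  then show ?thesis using contracting_axis_mono[OF K, of "max K 1"] by (intro exI[of _ "max K 1"]) auto
qed

theorem theorem1p7:
  fixes G :: "('x::metric_space \<Rightarrow> 'x) set" and b :: 'x and g :: "'x \<Rightarrow> 'x"
    and \<mu> :: "('x \<Rightarrow> 'x) \<Rightarrow> real" and \<mu>s :: "nat \<Rightarrow> ('x \<Rightarrow> 'x) \<Rightarrow> real"
  assumes "geodesic_space TYPE('x)"
    and "isometry_group G" and "countable G"
    and "g \<in> G" and "contracting b g" and "WPD G b g"
    and "prob_on G \<mu>" and "finite_entropy G \<mu>"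
    and "\<exists>n m. n > 0 \<and> m > 0 \<and> conv_pow G \<mu> n (g ^^ m) > 0"
    and "\<And>i. prob_on G (\<mu>s i)" and "\<And>i. finite_entropy G (\<mu>s i)"
    and "\<And>x. x \<in> G \<Longrightarrow> (\<lambda>i. \<mu>s i x) \<longlonglongrightarrow> \<mu> x"
    and "(\<lambda>i. entropy G (\<mu>s i)) \<longlonglongrightarrow> entropy G \<mu>"
  shows "(\<lambda>i. asymp_entropy G (\<mu>s i)) \<longlonglongrightarrow> asymp_entropy G \<mu>"
proof -
  let ?P = "\<lambda>i. law G (\<mu>s i)" and ?Q = "law G \<mu>"
  note G = assms(2) and \<mu> = assms(7,8) and \<mu>s = assms(10,11)
  have a: "asymp_entropy G (\<mu>s i) = hh (?P i)" "asymp_entropy G \<mu> = hh ?Q" for i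
    by (rule asymp_entropy_eq_hh[OF G \<mu>s], rule asymp_entropy_eq_hh[OF G \<mu>])
  show ?thesis
  proof (cases "\<exists>x y :: 'x. x \<noteq> y")
    case False
    \<comment> \<open>A one-point space carries a single map, so all laws coincide. It is treated
      apart because a contraction constant of at least 1 is obtained from two distinct
      points.\<close>
    then have "f = h" for f h :: "'x \<Rightarrow> 'x" by (auto simp: fun_eq_iff)
    then have "set_pmf p \<subseteq> {id}" for p :: "('x \<Rightarrow> 'x) pmf" by auto
    then have "p = return_pmf id" for p :: "('x \<Rightarrow> 'x) pmf" unfolding set_pmf_subset_singleton .
    then have "law G (\<mu>s i) = ?Q" for i by metis
    then show ?thesis unfolding a by simp
  next
    case True
    then obtain K where K: "1 \<le> K" "contracting_axis K (\<lambda>i. ipow g i b)" using contracting_positive[OF assms(5)] by blast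
    have "isometry g" using G assms(4) by (simp add: isometry_group_def)
    then interpret wpd_orbit b g K G using assms(1,2,4,6) K by unfold_locales auto
    obtain n0 m0 where nm: "0 < n0" "0 < m0" "conv_pow G \<mu> n0 (g ^^ m0) > 0" using assms(9) by blast
    have "g ^^ m0 \<in> G" using G_ipow[of "int m0"] by (simp add: ipow_of_nat)
    then have gQ: "g ^^ m0 \<in> set_pmf (rw ?Q n0)" using nm(3) conv_pow_rw[OF G \<mu>(1)] by (simp add: set_pmf_iff)
    have fin: "\<And>i. Hp (?P i) < \<infinity>" "Hp ?Q < \<infinity>" by (rule Hp_law_finite[OF \<mu>s], rule Hp_law_finite[OF \<mu>])
    have P: "(\<lambda>i. pmf (?P i) z) \<longlonglongrightarrow> pmf ?Q z" for z
      unfolding pmf_law[OF \<mu>(1)] pmf_law[OF \<mu>s(1)] using assms(12) by (cases "z \<in> G") auto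
    have sG: "set_pmf ?Q \<subseteq> G" "\<And>i. set_pmf (?P i) \<subseteq> G" by (rule set_law[OF \<mu>(1)], rule set_law[OF \<mu>s(1)])
    have e: "entropy G \<mu> = enn2real (Hp ?Q)" "\<And>i. entropy G (\<mu>s i) = enn2real (Hp (?P i))"
      subgoal by (rule entropy_eq_Hp[OF sG(1) fin(2)]) (simp add: pmf_law[OF \<mu>(1)])
      subgoal by (rule entropy_eq_Hp[OF sG(2) fin(1)]) (simp add: pmf_law[OF \<mu>s(1)])
      done
    have H: "(\<lambda>i. enn2real (Hp (?P i))) \<longlonglongrightarrow> enn2real (Hp ?Q)" using assms(13) unfolding e .
    show ?thesis unfolding a
    proof (rule order_tendstoI)
      fix h assume "h < hh ?Q"
      then show "\<forall>\<^sub>F i in sequentially. h < hh (?P i)"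
        using hh_lower_bound[OF nm(2) gQ sG P fin H, of "hh ?Q - h"] by simp
    next
      fix h assume "hh ?Q < h"
      then show "\<forall>\<^sub>F i in sequentially. hh (?P i) < h" by (rule hh_upper_bound[OF P fin H])
    qed
  qed
qed

end
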